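(* Let $\alpha$ be a simple root, let $s_\alpha \in W$ be the simple reflection corresponding to $\alpha$, and let $\mu \in \mathfrak{h}^*$ be such that $\mu(h_\alpha) \neq 0$. Then the categories $\mathcal{O}_\epsilon^\mu(\mathfrak{g})$ and $\mathcal{O}_\epsilon^{s_\alpha(\mu)}(\mathfrak{g})$ are equivalent.
   Context: Everything is over $\mathbb{C}$. $\mathfrak{g}$ is the Lie algebra of a connected reductive algebraic group; $\mathfrak{h}$ is a fixed maximal toral subalgebra, $\Phi\subseteq\mathfrak h^*$ the root system, $\Delta$ a system of simple roots, $\Phi^+$ the positive roots, $\mathfrak{g}_\alpha$ the root spaces, $W$ the Weyl group acting on $\mathfrak h^*$. For $\alpha\in\Phi^+$ choose $e_\alpha\in\mathfrak g_\alpha$, $f_\alpha\in\mathfrak g_{-\alpha}$ with $h_\alpha=[e_\alpha,f_\alpha]\in\mathfrak h$ satisfying $\alpha(h_\alpha)=2$. Let $\mathfrak n=\bigoplus_{\alpha\in\Phi^+}\mathfrak g_\alpha$. The Takiff algebra is $\mathfrak{g}_\epsilon=\mathfrak{g}\otimes\mathbb{C}[\epsilon]/(\epsilon^2)$; write $x=x\otimes 1$, $\overline{x}=x\otimes\epsilon$, and for a subspace $\mathfrak a\subseteq\mathfrak g$ write $\overline{\mathfrak a}=\mathfrak a\otimes\epsilon$, $\mathfrak a_\epsilon=\mathfrak a\oplus\overline{\mathfrak a}$. The category $\mathcal O_\epsilon(\mathfrak g)$ is the full subcategory of $U(\mathfrak g_\epsilon)$-modules $M$ that are finitely generated, on which $\mathfrak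 h$ acts semisimply, and on which $\mathfrak n_\epsilon$ and $\overline{\mathfrak h}$ act locally finitely. For $\mu\in\mathfrak h^*$, $\mathcal O_\epsilon^\mu(\mathfrak g)$ is the full subcategory of $\mathcal O_\epsilon(\mathfrak g)$ consisting of the modules $M$ such that for every $h\in\mathfrak h$ the action of $\overline h-\mu(h)$ on $M$ is locally nilpotent. *)

theory Defs
  imports "HOL-Analysis.Analysis" "HOL-Algebra.Coset" "HOL-Algebra.Ideal" "HOL-Algebra.QuotRing"
    "HOL-Algebra.Module"
begin

section \<open>Linear algebraic groups over the complex numbers\<close>

type_synonym 'n cmat = "complex ^ 'n ^ 'n"

definition mscale :: "complex \<Rightarrow> 'n::finite cmat \<Rightarrow> 'n cmat" where
  "mscale c A = (\<chi> i j. c * A $ i $ j)"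

inductive poly_fun :: "('n::finite cmat \<Rightarrow> complex) \<Rightarrow> bool" where
  const: "poly_fun (\<lambda>_. c)"
| coord: "poly_fun (\<lambda>A. A $ i $ j)"
| add: "poly_fun p \<Longrightarrow> poly_fun q \<Longrightarrow> poly_fun (\<lambda>A. p A + q A)"
| mult: "poly_fun p \<Longrightarrow> poly_fun q \<Longrightarrow> poly_fun (\<lambda>A. p A * q A)"

definition zariski_open :: "'n::finite cmat set \<Rightarrow> bool" where
  "zariski_open U \<longleftrightarrow> (\<exists>F. (\<forall>p\<in>F. poly_fun p) \<and> U = {A. \<exists>p\<in>F. p A \<noteq> 0})"

lemma istopology_zariski_open: "istopology zariski_open"
  unfolding istopology_def
proof (intro conjI allI impI)
  fix S T :: "'n::finite cmat set"
  assume "zariski_open S" "zariski_open T"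
  then obtain F G where F: "\<forall>p\<in>F. poly_fun p" "S = {A. \<exists>p\<in>F. p A \<noteq> 0}"
    and G: "\<forall>p\<in>G. poly_fun p" "T = {A. \<exists>p\<in>G. p A \<noteq> 0}"
    unfolding zariski_open_def by auto
  let ?H = "{\<lambda>A. p A * q A | p q. p \<in> F \<and> q \<in> G}"
  have "\<forall>p\<in>?H. poly_fun p" using F G by (auto intro: poly_fun.mult)
  moreover have "S \<inter> T = {A. \<exists>p\<in>?H. p A \<noteq> 0}"
    unfolding F G by (auto; force)
  ultimately show "zariski_open (S \<inter> T)" unfolding zariski_open_def by blast
next
  fix K :: "'n::finite cmat set set"
  assume "\<forall>U\<in>K. zariski_open U"
  then have "\<forall>U\<in>K. \<exists>F. (\<forall>p\<in>F. poly_fun p) \<and> U = {A. \<exists>p\<in>F. p A \<noteq> 0}"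
    unfolding zariski_open_def .
  from bchoice[OF this] obtain F
    where F: "\<forall>U\<in>K. (\<forall>p\<in>F U. poly_fun p) \<and> U = {A. \<exists>p\<in>F U. p A \<noteq> 0}"
    by blast
  have "A \<in> \<Union>K \<longleftrightarrow> (\<exists>p\<in>(\<Union>U\<in>K. F U). p A \<noteq> 0)" for A
  proof -
    have "A \<in> U \<longleftrightarrow> (\<exists>p\<in>F U. p A \<noteq> 0)" if "U \<in> K" for U
    proof -
      have "U = {A. \<exists>p\<in>F U. p A \<noteq> 0}" using F that by simp
      from arg_cong[OF this, of "\<lambda>S. A \<in> S"] show ?thesis by simp
    qed
    then show ?thesis by auto
  qed
  then have "\<Union>K = {A. \<exists>p\<in>(\<Union>U\<in>K. F U). p A \<noteq> 0}" by (subst set_eq_iff, subst mem_Collect_eq) (rule allI)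
  moreover have "\<forall>p\<in>(\<Union>U\<in>K. F U). poly_fun p" using F by simp
  ultimately show "zariski_open (\<Union>K)"
    unfolding zariski_open_def by (intro exI[of _ "\<Union>U\<in>K. F U"]) (rule conjI)
qed

definition zariski :: "'n::finite cmat topology" where
  "zariski = topology zariski_open"

definition GL :: "'n::finite cmat monoid" where
  "GL = \<lparr>carrier = {A. invertible A}, mult = (**), one = mat 1\<rparr>"

definition linear_algebraic_group :: "'n::finite cmat set \<Rightarrow> bool" where
  "linear_algebraic_group G \<longleftrightarrow>
     subgroup G GL \<and> closedin (subtopology zariski (carrier GL)) G"

definition nilpotent_mat :: "'n::finite cmat \<Rightarrow> bool" where
  "nilpotent_mat A \<longleftrightarrow> (\<exists>k. \<forall>v. (((*v) A) ^^ k) v = 0)"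

definition unipotent_group :: "'n::finite cmat set \<Rightarrow> bool" where
  "unipotent_group N \<longleftrightarrow> (\<forall>A\<in>N. nilpotent_mat (A - mat 1))"

text \<open>Trivial unipotent radical.\<close>

definition reductive_group :: "'n::finite cmat set \<Rightarrow> bool" where
  "reductive_group G \<longleftrightarrow> linear_algebraic_group G \<and>
     (\<forall>N. linear_algebraic_group N \<and> connectedin zariski N \<and> N \<lhd> (GL\<lparr>carrier := G\<rparr>)
          \<and> unipotent_group N \<longrightarrow> N = {mat 1})"

text \<open>The Lie algebra of \<open>G\<close> is the tangent space at the identity, as a subspace of
  \<open>gl\<^sub>n\<close>: all matrices \<open>X\<close> such that the differential at \<open>1\<close> of every polynomial vanishing on
  \<open>G\<close> vanishes at \<open>X\<close>.  The bracket is the commutator.\<close>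

definition lie_algebra_of :: "'n::finite cmat set \<Rightarrow> 'n cmat set" where
  "lie_algebra_of G = {X. \<forall>p. poly_fun p \<and> (\<forall>A\<in>G. p A = 0) \<longrightarrow>
     ((\<lambda>t::complex. p (mat 1 + mscale t X)) has_field_derivative 0) (at 0)}"

definition mbracket :: "'n::finite cmat \<Rightarrow> 'n cmat \<Rightarrow> 'n cmat" where
  "mbracket X Y = X ** Y - Y ** X"


section \<open>Root data\<close>

definition lie_subalgebra :: "'n::finite cmat set \<Rightarrow> 'n cmat set \<Rightarrow> bool" where
  "lie_subalgebra T g \<longleftrightarrow> T \<subseteq> g \<and> 0 \<in> T \<and> (\<forall>x\<in>T. \<forall>y\<in>T. x + y \<in> T)
     \<and> (\<forall>c. \<forall>x\<in>T. mscale c x \<in> T) \<and> (\<forall>x\<in>T. \<forall>y\<in>T. mbracket x y \<in> T)"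

definition semisimple_mat :: "'n::finite cmat \<Rightarrow> bool" where
  "semisimple_mat A \<longleftrightarrow> (\<exists>P D :: 'n cmat. invertible P \<and> (\<forall>i j. i \<noteq> j \<longrightarrow> D $ i $ j = 0)
      \<and> A ** P = P ** D)"

definition toral_subalgebra :: "'n::finite cmat set \<Rightarrow> 'n cmat set \<Rightarrow> bool" where
  "toral_subalgebra T g \<longleftrightarrow> lie_subalgebra T g \<and> (\<forall>x\<in>T. semisimple_mat x)"

definition maximal_toral :: "'n::finite cmat set \<Rightarrow> 'n cmat set \<Rightarrow> bool" where
  "maximal_toral T g \<longleftrightarrow> toral_subalgebra T g
     \<and> (\<forall>T'. toral_subalgebra T' g \<and> T \<subseteq> T' \<longrightarrow> T' = T)"

text \<open>Elements of \<open>h\<^sup>*\<close> are linear functions on \<open>h\<close>, made extensional (i.e.\ \<open>undefined\<close>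
  outside \<open>h\<close>) so that each functional has exactly one representative.\<close>

definition dual :: "'n::finite cmat set \<Rightarrow> ('n cmat \<Rightarrow> complex) set" where
  "dual h = {\<phi> \<in> extensional h. (\<forall>x\<in>h. \<forall>y\<in>h. \<phi> (x + y) = \<phi> x + \<phi> y)
                \<and> (\<forall>c. \<forall>x\<in>h. \<phi> (mscale c x) = c * \<phi> x)}"

definition root_space ::
    "'n::finite cmat set \<Rightarrow> 'n cmat set \<Rightarrow> ('n cmat \<Rightarrow> complex) \<Rightarrow> 'n cmat set" where
  "root_space g h \<alpha> = {x \<in> g. \<forall>t\<in>h. mbracket t x = mscale (\<alpha> t) x}"

definition roots :: "'n::finite cmat set \<Rightarrow> 'n cmat set \<Rightarrow> ('n cmat \<Rightarrow> complex) set" where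
  "roots g h = {\<alpha> \<in> dual h. (\<exists>t\<in>h. \<alpha> t \<noteq> 0) \<and> root_space g h \<alpha> \<noteq> {0}}"

definition nonneg_comb ::
    "'n::finite cmat set \<Rightarrow> ('n cmat \<Rightarrow> complex) set \<Rightarrow> ('n cmat \<Rightarrow> complex) \<Rightarrow> bool" where
  "nonneg_comb h \<Delta> \<beta> \<longleftrightarrow>
     (\<exists>k :: ('n cmat \<Rightarrow> complex) \<Rightarrow> nat. \<forall>t\<in>h. \<beta> t = (\<Sum>\<alpha>\<in>\<Delta>. of_nat (k \<alpha>) * \<alpha> t))"

definition simple_system ::
    "'n::finite cmat set \<Rightarrow> 'n cmat set \<Rightarrow> ('n cmat \<Rightarrow> complex) set \<Rightarrow> bool" where
  "simple_system g h \<Delta> \<longleftrightarrow> \<Delta> \<subseteq> roots g h \<and> finite \<Delta>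
     \<and> (\<forall>c :: ('n cmat \<Rightarrow> complex) \<Rightarrow> complex.
           (\<forall>t\<in>h. (\<Sum>\<alpha>\<in>\<Delta>. c \<alpha> * \<alpha> t) = 0) \<longrightarrow> (\<forall>\<alpha>\<in>\<Delta>. c \<alpha> = 0))
     \<and> (\<forall>\<beta>\<in>roots g h. nonneg_comb h \<Delta> \<beta> \<or> nonneg_comb h \<Delta> (\<lambda>t. - \<beta> t))"

definition positive_roots ::
    "'n::finite cmat set \<Rightarrow> 'n cmat set \<Rightarrow> ('n cmat \<Rightarrow> complex) set \<Rightarrow> ('n cmat \<Rightarrow> complex) set"
  where "positive_roots g h \<Delta> = {\<beta> \<in> roots g h. nonneg_comb h \<Delta> \<beta>}"

definition nilradical ::
    "'n::finite cmat set \<Rightarrow> 'n cmat set \<Rightarrow> ('n cmat \<Rightarrow> complex) set \<Rightarrow> 'n cmat set" where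
  "nilradical g h \<Delta> = {(\<Sum>\<alpha>\<in>positive_roots g h \<Delta>. x \<alpha>) | x.
      \<forall>\<alpha>\<in>positive_roots g h \<Delta>. x \<alpha> \<in> root_space g h \<alpha>}"

text \<open>The reflection \<open>s\<^sub>\<alpha>\<close> on \<open>h\<^sup>*\<close>, where the third argument is the coroot \<open>h\<^sub>\<alpha>\<close>.\<close>

definition reflection ::
    "'n::finite cmat set \<Rightarrow> ('n cmat \<Rightarrow> complex) \<Rightarrow> 'n cmat \<Rightarrow> ('n cmat \<Rightarrow> complex)
       \<Rightarrow> ('n cmat \<Rightarrow> complex)" where
  "reflection h \<alpha> h\<^sub>\<alpha> \<mu> = (\<lambda>t\<in>h. \<mu> t - \<mu> h\<^sub>\<alpha> * \<alpha> t)"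


section \<open>Universal enveloping algebras\<close>

text \<open>A complex Lie algebra with underlying set \<open>lset\<close>; its addition is that of the type.\<close>

record 'l lie_alg =
  lset :: "'l set"
  lscale :: "complex \<Rightarrow> 'l \<Rightarrow> 'l"
  lbracket :: "'l \<Rightarrow> 'l \<Rightarrow> 'l"

text \<open>The free associative unital algebra on a set \<open>X\<close>: finitely supported functions on
  words over \<open>X\<close>, the product being convolution with respect to concatenation.\<close>

definition free_algebra :: "'l set \<Rightarrow> ('l list \<Rightarrow> complex) ring" where
  "free_algebra X =
     \<lparr>carrier = {p. finite {w. p w \<noteq> 0} \<and> (\<forall>w. p w \<noteq> 0 \<longrightarrow> set w \<subseteq> X)},
      mult = (\<lambda>p q w. \<Sum>i\<le>length w. p (take i w) * q (drop i w)),
      one = (\<lambda>w. if w = [] then 1 else 0),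
      zero = (\<lambda>w. 0),
      add = (\<lambda>p q w. p w + q w)\<rparr>"

definition word_const :: "complex \<Rightarrow> 'l list \<Rightarrow> complex" where
  "word_const c = (\<lambda>w. if w = [] then c else 0)"

definition word_gen :: "'l \<Rightarrow> 'l list \<Rightarrow> complex" where
  "word_gen x = (\<lambda>w. if w = [x] then 1 else 0)"

definition enveloping_relations :: "('l::plus) lie_alg \<Rightarrow> ('l list \<Rightarrow> complex) set" where
  "enveloping_relations L =
     (let T = free_algebra (lset L) in
       {word_gen (x + y) \<ominus>\<^bsub>T\<^esub> (word_gen x \<oplus>\<^bsub>T\<^esub> word_gen y) | x y. x \<in> lset L \<and> y \<in> lset L}
     \<union> {word_gen (lscale L c x) \<ominus>\<^bsub>T\<^esub> (word_const c \<otimes>\<^bsub>T\<^esub> word_gen x) | c x. x \<in> lset L}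
     \<union> {(word_gen x \<otimes>\<^bsub>T\<^esub> word_gen y \<ominus>\<^bsub>T\<^esub> word_gen y \<otimes>\<^bsub>T\<^esub> word_gen x)
          \<ominus>\<^bsub>T\<^esub> word_gen (lbracket L x y) | x y. x \<in> lset L \<and> y \<in> lset L})"

lemma ring_free_algebra: "ring (free_algebra X)"
proof -
  let ?T = "free_algebra X"
  have supp: "finite {w. (\<Sum>i\<le>length w. p (take i w) * q (drop i w)) \<noteq> 0}
      \<and> (\<forall>w. (\<Sum>i\<le>length w. p (take i w) * q (drop i w)) \<noteq> 0 \<longrightarrow> set w \<subseteq> X)"
    if "p \<in> carrier ?T" "q \<in> carrier ?T" for p q
  proof -
    have p: "finite {w. p w \<noteq> 0}" "\<And>w. p w \<noteq> 0 \<Longrightarrow> set w \<subseteq> X"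
      and q: "finite {w. q w \<noteq> 0}" "\<And>w. q w \<noteq> 0 \<Longrightarrow> set w \<subseteq> X"
      using that by (auto simp: free_algebra_def)
    have nz: "\<exists>u v. w = u @ v \<and> p u \<noteq> 0 \<and> q v \<noteq> 0"
      if "(\<Sum>i\<le>length w. p (take i w) * q (drop i w)) \<noteq> 0" for w
    proof -
      obtain i where "p (take i w) * q (drop i w) \<noteq> 0"
        using \<open>_ \<noteq> 0\<close> by (meson sum.neutral)
      then show ?thesis by (metis append_take_drop_id mult_eq_0_iff)
    qed
    have "{w. (\<Sum>i\<le>length w. p (take i w) * q (drop i w)) \<noteq> 0}
        \<subseteq> (\<lambda>(u, v). u @ v) ` ({w. p w \<noteq> 0} \<times> {w. q w \<noteq> 0})"
      using nz by fastforce
    then have "finite {w. (\<Sum>i\<le>length w. p (take i w) * q (drop i w)) \<noteq> 0}"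
      by (rule finite_subset) (use p(1) q(1) in simp)
    moreover have "set w \<subseteq> X" if "(\<Sum>i\<le>length w. p (take i w) * q (drop i w)) \<noteq> 0" for w
      using nz[OF that] p(2) q(2) by fastforce
    ultimately show ?thesis by blast
  qed
  have assoc: "(\<Sum>i\<le>length w. (\<Sum>j\<le>length (take i w). p (take j (take i w)) * q (drop j (take i w)))
        * r (drop i w))
      = (\<Sum>i\<le>length w. p (take i w)
        * (\<Sum>j\<le>length (drop i w). q (take j (drop i w)) * r (drop j (drop i w))))"
    (is "?l = ?r") for p q r :: "'a list \<Rightarrow> complex" and w
  proof -
    let ?n = "length w"
    let ?t = "\<lambda>(j, k). p (take j w) * q (take k (drop j w)) * r (drop (j + k) w)"
    have "?l = (\<Sum>i\<le>?n. \<Sum>j\<le>i. ?t (j, i - j))"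
      by (auto simp: sum_distrib_right min_def drop_take take_take intro!: sum.cong)
    also have "\<dots> = (\<Sum>x\<in>{(j, k). j + k \<le> ?n}. ?t x)"
      by (subst sum.Sigma, simp, simp, rule sum.reindex_bij_witness
          [of _ "\<lambda>(j, k). (j + k, j)" "\<lambda>(i, j). (j, i - j)"]) auto
    also have "\<dots> = (\<Sum>i\<le>?n. \<Sum>k\<le>?n - i. ?t (i, k))"
      by (subst sum.Sigma, simp, simp, rule sum.cong) auto
    also have "\<dots> = ?r"
      by (auto simp: sum_distrib_left mult.assoc add.commute intro!: sum.cong)
    finally show ?thesis .
  qed
  have fin_add: "finite {w. p w + q w \<noteq> 0}"
    if "finite {w. p w \<noteq> 0}" "finite {w. q w \<noteq> 0}" for p q :: "'a list \<Rightarrow> complex"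
    by (rule finite_subset[of _ "{w. p w \<noteq> 0} \<union> {w. q w \<noteq> 0}"]) (use that in auto)
  have one_l: "(\<Sum>i\<le>length w. (if take i w = [] then 1 else 0) * p (drop i w)) = p w"
    for p :: "'a list \<Rightarrow> complex" and w
    by (subst sum.mono_neutral_right[where S = "{0}"]) auto
  have one_r: "(\<Sum>i\<le>length w. p (take i w) * (if drop i w = [] then 1 else 0)) = p w"
    for p :: "'a list \<Rightarrow> complex" and w
    by (subst sum.mono_neutral_right[where S = "{length w}"]) auto
  show ?thesis
  proof (rule ringI)
    show "abelian_group ?T"
    proof (rule abelian_groupI)
      fix p assume p: "p \<in> carrier ?T"
      show "\<exists>q\<in>carrier ?T. q \<oplus>\<^bsub>?T\<^esub> p = \<zero>\<^bsub>?T\<^esub>"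
        by (rule bexI[of _ "\<lambda>w. - p w"]) (use p in \<open>auto simp: free_algebra_def\<close>)
    next
      fix p q assume "p \<in> carrier ?T" "q \<in> carrier ?T"
      then show "p \<oplus>\<^bsub>?T\<^esub> q \<in> carrier ?T"
        unfolding free_algebra_def by (auto intro!: fin_add) (metis add_0 subsetD)
    qed (auto simp: free_algebra_def add_ac)
    show "monoid ?T"
    proof (rule monoidI)
      fix p q assume "p \<in> carrier ?T" "q \<in> carrier ?T"
      from supp[OF this] show "p \<otimes>\<^bsub>?T\<^esub> q \<in> carrier ?T" by (simp add: free_algebra_def)
    next
      fix p q r
      show "p \<otimes>\<^bsub>?T\<^esub> q \<otimes>\<^bsub>?T\<^esub> r = p \<otimes>\<^bsub>?T\<^esub> (q \<otimes>\<^bsub>?T\<^esub> r)"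
        unfolding free_algebra_def using assoc[where p = p and q = q and r = r] by simp
    next
      show "\<one>\<^bsub>?T\<^esub> \<in> carrier ?T" by (auto simp: free_algebra_def)
    next
      fix p
      show "\<one>\<^bsub>?T\<^esub> \<otimes>\<^bsub>?T\<^esub> p = p" "p \<otimes>\<^bsub>?T\<^esub> \<one>\<^bsub>?T\<^esub> = p"
        unfolding free_algebra_def using one_l[where p = p] one_r[where p = p] by simp_all
    qed
  qed (auto simp: free_algebra_def algebra_simps sum.distrib)
qed

text \<open>The library's \<open>genideal\<close> is the generated two-sided ideal.\<close>

definition enveloping_ideal :: "('l::plus) lie_alg \<Rightarrow> ('l list \<Rightarrow> complex) set" where
  "enveloping_ideal L = Idl\<^bsub>free_algebra (lset L)\<^esub> (enveloping_relations L)"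

definition U :: "('l::plus) lie_alg \<Rightarrow> ('l list \<Rightarrow> complex) set ring" where
  "U L = free_algebra (lset L) Quot enveloping_ideal L"

definition U_const :: "('l::plus) lie_alg \<Rightarrow> complex \<Rightarrow> ('l list \<Rightarrow> complex) set" where
  "U_const L c = enveloping_ideal L +>\<^bsub>free_algebra (lset L)\<^esub> word_const c"

definition U_gen :: "('l::plus) lie_alg \<Rightarrow> 'l \<Rightarrow> ('l list \<Rightarrow> complex) set" where
  "U_gen L x = enveloping_ideal L +>\<^bsub>free_algebra (lset L)\<^esub> word_gen x"


section \<open>Left modules over noncommutative rings\<close>

text \<open>The library's locale \<open>module\<close> without commutativity of the ring.  Of the record
  \<open>M\<close>, only \<open>carrier\<close>, \<open>zero\<close>, \<open>add\<close> and \<open>smult\<close> are relevant.\<close>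

locale left_module = R?: ring R + M?: abelian_group M
  for R :: "('a, 'r) ring_scheme" (structure) and M :: "('a, 'b, 'm) module_scheme" (structure) +
  assumes smult_closed [simp, intro]:
      "\<lbrakk>a \<in> carrier R; x \<in> carrier M\<rbrakk> \<Longrightarrow> a \<odot>\<^bsub>M\<^esub> x \<in> carrier M"
    and smult_l_distr:
      "\<lbrakk>a \<in> carrier R; b \<in> carrier R; x \<in> carrier M\<rbrakk> \<Longrightarrow>
       (a \<oplus> b) \<odot>\<^bsub>M\<^esub> x = a \<odot>\<^bsub>M\<^esub> x \<oplus>\<^bsub>M\<^esub> b \<odot>\<^bsub>M\<^esub> x"
    and smult_r_distr:
      "\<lbrakk>a \<in> carrier R; x \<in> carrier M; y \<in> carrier M\<rbrakk> \<Longrightarrow>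
       a \<odot>\<^bsub>M\<^esub> (x \<oplus>\<^bsub>M\<^esub> y) = a \<odot>\<^bsub>M\<^esub> x \<oplus>\<^bsub>M\<^esub> a \<odot>\<^bsub>M\<^esub> y"
    and smult_assoc1:
      "\<lbrakk>a \<in> carrier R; b \<in> carrier R; x \<in> carrier M\<rbrakk> \<Longrightarrow>
       (a \<otimes> b) \<odot>\<^bsub>M\<^esub> x = a \<odot>\<^bsub>M\<^esub> (b \<odot>\<^bsub>M\<^esub> x)"
    and smult_one [simp]: "x \<in> carrier M \<Longrightarrow> \<one> \<odot>\<^bsub>M\<^esub> x = x"

definition module_hom ::
    "('a, 'r) ring_scheme \<Rightarrow> ('a, 'b) module \<Rightarrow> ('a, 'b) module \<Rightarrow> ('b \<Rightarrow> 'b) set" where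
  "module_hom R M N = {f \<in> carrier M \<rightarrow>\<^sub>E carrier N.
     (\<forall>x\<in>carrier M. \<forall>y\<in>carrier M. f (x \<oplus>\<^bsub>M\<^esub> y) = f x \<oplus>\<^bsub>N\<^esub> f y)
   \<and> (\<forall>a\<in>carrier R. \<forall>x\<in>carrier M. f (a \<odot>\<^bsub>M\<^esub> x) = a \<odot>\<^bsub>N\<^esub> f x)}"

definition finitely_generated :: "('a, 'r) ring_scheme \<Rightarrow> ('a, 'b) module \<Rightarrow> bool" where
  "finitely_generated R M \<longleftrightarrow> (\<exists>S. finite S \<and> S \<subseteq> carrier M
      \<and> (\<forall>N. submodule N R M \<and> S \<subseteq> N \<longrightarrow> N = carrier M))"

text \<open>A \<open>U(L)\<close>-module is in particular a complex vector space and a representation of \<open>L\<close>.\<close>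

type_synonym ('l, 'b) U_module = "(('l list \<Rightarrow> complex) set, 'b) module"

definition scal :: "('l::plus) lie_alg \<Rightarrow> ('l, 'b) U_module \<Rightarrow> complex \<Rightarrow> 'b \<Rightarrow> 'b" where
  "scal L M c v = U_const L c \<odot>\<^bsub>M\<^esub> v"

definition act :: "('l::plus) lie_alg \<Rightarrow> ('l, 'b) U_module \<Rightarrow> 'l \<Rightarrow> 'b \<Rightarrow> 'b" where
  "act L M x v = U_gen L x \<odot>\<^bsub>M\<^esub> v"

definition csubspace :: "('l::plus) lie_alg \<Rightarrow> ('l, 'b) U_module \<Rightarrow> 'b set \<Rightarrow> bool" where
  "csubspace L M V \<longleftrightarrow> V \<subseteq> carrier M \<and> \<zero>\<^bsub>M\<^esub> \<in> V
     \<and> (\<forall>v\<in>V. \<forall>w\<in>V. v \<oplus>\<^bsub>M\<^esub> w \<in> V) \<and> (\<forall>c. \<forall>v\<in>V. scal L M c v \<in> V)"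

definition cspan :: "('l::plus) lie_alg \<Rightarrow> ('l, 'b) U_module \<Rightarrow> 'b set \<Rightarrow> 'b set" where
  "cspan L M S = \<Inter>{V. csubspace L M V \<and> S \<subseteq> V}"

definition locally_finite_on :: "('l::plus) lie_alg \<Rightarrow> ('l, 'b) U_module \<Rightarrow> 'l set \<Rightarrow> bool" where
  "locally_finite_on L M a \<longleftrightarrow> (\<forall>v\<in>carrier M. \<exists>V. csubspace L M V \<and> v \<in> V
      \<and> (\<exists>S. finite S \<and> S \<subseteq> V \<and> V = cspan L M S)
      \<and> (\<forall>x\<in>a. \<forall>w\<in>V. act L M x w \<in> V))"


section \<open>The Takiff algebra and its category O\<close>

text \<open>The pair \<open>(x, y)\<close> stands for \<open>x \<otimes> 1 + y \<otimes> \<epsilon>\<close>.\<close>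

definition takiff :: "'n::finite cmat set \<Rightarrow> ('n cmat \<times> 'n cmat) lie_alg" where
  "takiff g = \<lparr>lset = g \<times> g,
     lscale = (\<lambda>c (x, y). (mscale c x, mscale c y)),
     lbracket = (\<lambda>(x, y) (x', y'). (mbracket x x', mbracket x y' + mbracket y x'))\<rparr>"

type_synonym ('n, 'b) takiff_module = "('n cmat \<times> 'n cmat, 'b) U_module"

definition weight_space ::
    "'n::finite cmat set \<Rightarrow> 'n cmat set \<Rightarrow> ('n, 'b) takiff_module \<Rightarrow> ('n cmat \<Rightarrow> complex) \<Rightarrow> 'b set"
  where "weight_space g h M \<nu> =
     {v \<in> carrier M. \<forall>t\<in>h. act (takiff g) M (t, 0) v = scal (takiff g) M (\<nu> t) v}"

definition in_O :: "'n::finite cmat set \<Rightarrow> 'n cmat set \<Rightarrow> ('n cmat \<Rightarrow> complex) set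
    \<Rightarrow> ('n, 'b) takiff_module \<Rightarrow> bool" where
  "in_O g h \<Delta> M \<longleftrightarrow> left_module (U (takiff g)) M
     \<and> finitely_generated (U (takiff g)) M
     \<and> cspan (takiff g) M (\<Union>\<nu>\<in>dual h. weight_space g h M \<nu>) = carrier M
     \<and> locally_finite_on (takiff g) M (nilradical g h \<Delta> \<times> nilradical g h \<Delta>)
     \<and> locally_finite_on (takiff g) M ({0} \<times> h)"

definition in_O_mu :: "'n::finite cmat set \<Rightarrow> 'n cmat set \<Rightarrow> ('n cmat \<Rightarrow> complex) set
    \<Rightarrow> ('n cmat \<Rightarrow> complex) \<Rightarrow> ('n, 'b) takiff_module \<Rightarrow> bool" where
  "in_O_mu g h \<Delta> \<mu> M \<longleftrightarrow> in_O g h \<Delta> M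
     \<and> (\<forall>t\<in>h. \<forall>v\<in>carrier M. \<exists>k.
          ((\<lambda>w. act (takiff g) M (0, t) w \<ominus>\<^bsub>M\<^esub> scal (takiff g) M (\<mu> t) w) ^^ k) v = \<zero>\<^bsub>M\<^esub>)"


section \<open>Equivalence of categories\<close>

text \<open>\<open>cmp X Y Z g f\<close> is the composite of \<open>f : X \<rightarrow> Y\<close> and \<open>g : Y \<rightarrow> Z\<close>.  Arrows do not
  carry their source and target, so hom-sets may overlap; therefore the arrow part of a functor
  and the composition take the objects as arguments.\<close>

record ('o, 'a) category =
  obj :: "'o set"
  hom :: "'o \<Rightarrow> 'o \<Rightarrow> 'a set"
  ident :: "'o \<Rightarrow> 'a"
  cmp :: "'o \<Rightarrow> 'o \<Rightarrow> 'o \<Rightarrow> 'a \<Rightarrow> 'a \<Rightarrow> 'a"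

definition is_category :: "('o, 'a) category \<Rightarrow> bool" where
  "is_category C \<longleftrightarrow>
     (\<forall>X\<in>obj C. ident C X \<in> hom C X X)
   \<and> (\<forall>X\<in>obj C. \<forall>Y\<in>obj C. \<forall>Z\<in>obj C. \<forall>f\<in>hom C X Y. \<forall>g\<in>hom C Y Z. cmp C X Y Z g f \<in> hom C X Z)
   \<and> (\<forall>X\<in>obj C. \<forall>Y\<in>obj C. \<forall>f\<in>hom C X Y.
        cmp C X X Y f (ident C X) = f \<and> cmp C X Y Y (ident C Y) f = f)
   \<and> (\<forall>W\<in>obj C. \<forall>X\<in>obj C. \<forall>Y\<in>obj C. \<forall>Z\<in>obj C.
        \<forall>f\<in>hom C W X. \<forall>g\<in>hom C X Y. \<forall>k\<in>hom C Y Z.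
          cmp C W X Z (cmp C X Y Z k g) f = cmp C W Y Z k (cmp C W X Y g f))"

definition is_functor :: "('o, 'a) category \<Rightarrow> ('p, 'b) category
    \<Rightarrow> ('o \<Rightarrow> 'p) \<Rightarrow> ('o \<Rightarrow> 'o \<Rightarrow> 'a \<Rightarrow> 'b) \<Rightarrow> bool" where
  "is_functor C D F F' \<longleftrightarrow>
     (\<forall>X\<in>obj C. F X \<in> obj D)
   \<and> (\<forall>X\<in>obj C. \<forall>Y\<in>obj C. \<forall>f\<in>hom C X Y. F' X Y f \<in> hom D (F X) (F Y))
   \<and> (\<forall>X\<in>obj C. F' X X (ident C X) = ident D (F X))
   \<and> (\<forall>X\<in>obj C. \<forall>Y\<in>obj C. \<forall>Z\<in>obj C. \<forall>f\<in>hom C X Y. \<forall>g\<in>hom C Y Z.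
        F' X Z (cmp C X Y Z g f) = cmp D (F X) (F Y) (F Z) (F' Y Z g) (F' X Y f))"

definition iso_arrow :: "('o, 'a) category \<Rightarrow> 'o \<Rightarrow> 'o \<Rightarrow> 'a \<Rightarrow> bool" where
  "iso_arrow C X Y f \<longleftrightarrow> f \<in> hom C X Y
     \<and> (\<exists>g\<in>hom C Y X. cmp C X Y X g f = ident C X \<and> cmp C Y X Y f g = ident C Y)"

definition natural_iso :: "('o, 'a) category \<Rightarrow> ('p, 'b) category
    \<Rightarrow> ('o \<Rightarrow> 'p) \<Rightarrow> ('o \<Rightarrow> 'o \<Rightarrow> 'a \<Rightarrow> 'b)
    \<Rightarrow> ('o \<Rightarrow> 'p) \<Rightarrow> ('o \<Rightarrow> 'o \<Rightarrow> 'a \<Rightarrow> 'b) \<Rightarrow> ('o \<Rightarrow> 'b) \<Rightarrow> bool" where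
  "natural_iso C D F F' G G' \<eta> \<longleftrightarrow>
     (\<forall>X\<in>obj C. iso_arrow D (F X) (G X) (\<eta> X))
   \<and> (\<forall>X\<in>obj C. \<forall>Y\<in>obj C. \<forall>f\<in>hom C X Y.
        cmp D (F X) (F Y) (G Y) (\<eta> Y) (F' X Y f) = cmp D (F X) (G X) (G Y) (G' X Y f) (\<eta> X))"

definition equivalent_categories :: "('o, 'a) category \<Rightarrow> ('p, 'b) category \<Rightarrow> bool" where
  "equivalent_categories C D \<longleftrightarrow> is_category C \<and> is_category D \<and>
     (\<exists>F F' G G' \<eta> \<theta>. is_functor C D F F' \<and> is_functor D C G G'
        \<and> natural_iso C C (\<lambda>X. X) (\<lambda>X Y f. f)
            (\<lambda>X. G (F X)) (\<lambda>X Y f. G' (F X) (F Y) (F' X Y f)) \<eta>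
        \<and> natural_iso D D (\<lambda>X. F (G X)) (\<lambda>X Y f. F' (G X) (G Y) (G' X Y f))
            (\<lambda>X. X) (\<lambda>X Y f. f) \<theta>)"

text \<open>The category \<open>O\<^sub>\<epsilon>\<^sup>\<mu>(g)\<close>, formed with the modules whose elements lie in the type
  \<open>'b\<close>, which serves as universe of sets.  A finitely generated \<open>U(g\<^sub>\<epsilon>)\<close>-module has at most
  the cardinality of the continuum, so any \<open>'b\<close> of at least that cardinality contains a copy of
  every object.\<close>

definition cat_O_mu :: "'n::finite cmat set \<Rightarrow> 'n cmat set \<Rightarrow> ('n cmat \<Rightarrow> complex) set
    \<Rightarrow> ('n cmat \<Rightarrow> complex) \<Rightarrow> (('n, 'b) takiff_module, 'b \<Rightarrow> 'b) category" where
  "cat_O_mu g h \<Delta> \<mu> =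
     \<lparr>obj = {M. in_O_mu g h \<Delta> \<mu> M},
      hom = module_hom (U (takiff g)),
      ident = (\<lambda>M. \<lambda>v\<in>carrier M. v),
      cmp = (\<lambda>M N P g f. compose (carrier M) g f)\<rparr>"

end

theory Submission
  imports Defs "HOL-Complex_Analysis.Complex_Analysis" "HOL-Library.Poly_Mapping"
    "HOL-Computational_Algebra.Computational_Algebra"
begin

text \<open>
  On a module in \<open>O\<^sup>\<mu>\<close> with \<open>\<mu>(h\<^sub>\<alpha>) \<noteq> 0\<close>, write \<open>E, H, F\<close> for the actions of \<open>e \<otimes> \<epsilon>, h\<^sub>\<alpha> \<otimes> \<epsilon>, f \<otimes> \<epsilon>\<close>. These
  operators commute, \<open>E\<close> is locally nilpotent and \<open>H\<close> is invertible, so \<open>E t\<^sup>2 + H t = F\<close> has a unique solution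
  \<open>t\<close> that is a power series in them. Applying \<open>ad e\<close> to this equation gives \<open>[e, t] = 1\<close>. Hence
  \<open>exp(ad t\<^sup>2/2) exp(ad e\<^sup>2/2) exp(ad t\<^sup>2/2)\<close> is defined on the operators by which the Takiff algebra acts, and maps
  \<open>e\<close> to \<open>-t\<close> and \<open>t\<close> to \<open>e\<close>. Twisting the action by this Fourier transform trades the local nilpotency of \<open>e\<close> for
  that of \<open>F\<close>. The resulting condition on \<open>E\<close> and \<open>F\<close> is symmetric, so that twisting by
  \<open>exp(ad e) exp(-ad f) exp(ad e)\<close>, which lifts \<open>s\<^sub>\<alpha>\<close>, exchanges \<open>\<mu>\<close> and \<open>s\<^sub>\<alpha>(\<mu>)\<close>; the inverse Fourier transform
  then leads to \<open>O\<^sup>s\<^sup>\<mu>\<close>. None of these steps changes the underlying vector space, and each is inverted by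
  a twist of the same kind. Reductivity enters through the nondegenerate trace form, which shows that \<open>h\<close> is its
  own centraliser and hence that \<open>e\<close> and \<open>f\<close> normalise the sum of the other positive root spaces.\<close>

text \<open>The equation for \<open>t\<close> says that exp(-t ad e) kills f \<otimes> \<epsilon>:
  formally exp(s ad e)(f \<otimes> \<epsilon>) = F + s H - s^2 E, taken at s = -t. So
  \<open>t\<close> is a coordinate along the one-parameter group of e, which translates it; hence
  [e, t] = 1. The reflection alone leaves category O, because it makes f locally nilpotent in place
  of e; this is what the Fourier transforms repair. Their price is that x in h acquires a multiple
  of te + et. Semisimplicity of h survives because te is diagonalisable with integer eigenvalues
  wherever e or t is locally nilpotent. Local finiteness over the nilradical is traded for
  nilpotency of a filtration by n', which e, f and h normalise. Naturality comes from uniqueness of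
  t: a module map intertwines the triples E, H, F, hence their roots. To compare different modules
  inside one algebra, each is realised in the corner of an idempotent p, and the unit in every
  identity is p. The parameters s of the transform and c of the reflection are signs; the opposite
  sign gives the inverse.\<close>

no_notation fps_nth (infixl "$" 75)

section \<open>Complex vector spaces and locally nilpotent operators\<close>

text \<open>Complex scalars as a type class, so that scalars, vectors, matrices, free spaces and the
  operators on them share one set of lemmas.\<close>

class cvec = ab_group_add +
  fixes cscale :: "complex => 'a => 'a" (infixr "*." 75)
  assumes cscale_add_right: "c *. (x + y) = c *. x + c *. y"
    and cscale_add_left: "(c + d) *. x = c *. x + d *. x"
    and cscale_cscale: "c *. (d *. x) = (c * d) *. x"
    and cscale_one: "1 *. x = x"

global_interpretation cv: vector_space "cscale :: complex => 'a::cvec => 'a"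
  by unfold_locales (auto simp: cscale_add_right cscale_add_left cscale_cscale cscale_one)

lemmas cscale_simps = cscale_add_right cscale_add_left cscale_cscale cv.scale_minus_left cv.scale_minus_right
  cv.scale_right_diff_distrib cv.scale_left_diff_distrib cv.scale_sum_right cv.scale_sum_left
declare cscale_one [simp]
lemmas cv_sub = cv.subspace_0 cv.subspace_add cv.subspace_scale

definition clin :: "('a::cvec => 'b::cvec) => bool" where
  "clin f \<longleftrightarrow> (\<forall>x y. f (x + y) = f x + f y) \<and> (\<forall>c x. f (c *. x) = c *. f x)"

lemma clinI: "(\<And>x y. f (x + y) = f x + f y) ==> (\<And>c x. f (c *. x) = c *. f x) ==> clin f"
  by (simp add: clin_def)

lemma clin_add: "clin f ==> f (x + y) = f x + f y"
  and clin_scale: "clin f ==> f (c *. x) = c *. f x"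
  by (simp_all add: clin_def)

lemma clin_0: "clin f ==> f 0 = 0"
  using clin_scale[of f 0 0] by simp

lemma clin_minus: "clin f ==> f (- x) = - f x"
  using clin_scale[of f "-1" x] by simp

lemma clin_diff: "clin f ==> f (x - y) = f x - f y"
  using clin_add[of f x "- y"] by (simp add: clin_minus)

lemma clin_sum: "clin f ==> f (sum g S) = (\<Sum>i\<in>S. f (g i))"
  by (induction S rule: infinite_finite_induct) (auto simp: clin_0 clin_add)

lemma clin_funpow: fixes f :: "'a::cvec => 'a" shows "clin f ==> clin (f ^^ n)"
  by (induction n) (auto simp: clin_def)

definition lnil :: "('a::cvec => 'a) => 'a => bool" where
  "lnil N v \<longleftrightarrow> (\<exists>k. (N ^^ k) v = 0)"

lemma funpow_zero_ge: fixes N :: "'a::cvec => 'a" shows "clin N ==> (N ^^ k) v = 0 ==> k \<le> l ==> (N ^^ l) v = 0"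
proof -
  assume a: "clin N" "(N ^^ k) v = 0" "k \<le> l"
  then obtain m where "l = m + k" by (metis le_add_diff_inverse2)
  thus ?thesis by (simp add: funpow_add a clin_0[OF clin_funpow[OF a(1)]])
qed

lemma lnil_0: "lnil N 0"
  unfolding lnil_def by (rule exI[of _ 0]) simp

lemma lnil_add: assumes "clin N" "lnil N v" "lnil N w" shows "lnil N (v + w)"
proof -
  obtain k l where "(N ^^ k) v = 0" "(N ^^ l) w = 0" using assms by (auto simp: lnil_def)
  hence "(N ^^ (max k l)) v = 0" "(N ^^ (max k l)) w = 0"
    using funpow_zero_ge[OF assms(1)] by (meson max.cobounded1 max.cobounded2)+
  hence "(N ^^ (max k l)) (v + w) = 0" using clin_add[OF clin_funpow[OF assms(1)]] by simp
  thus ?thesis by (auto simp: lnil_def)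
qed

lemma lnil_scale: "clin N ==> lnil N v ==> lnil N (c *. v)"
  unfolding lnil_def by (metis clin_scale clin_funpow cv.scale_zero_right)

lemma lnil_subspace: "clin N ==> cv.subspace {v. lnil N v}"
  by (auto simp: cv.subspace_def lnil_0 lnil_add lnil_scale)

lemma lnil_intertwine:
  assumes f: "clin f" and "\<And>x. f (N x) = N' (f x)" and "lnil N v"
  shows "lnil N' (f v)"
proof -
  have "(N' ^^ k) (f v) = f ((N ^^ k) v)" for k by (induction k) (auto simp: assms(2))
  thus ?thesis using assms(3) clin_0[OF f] by (metis lnil_def)
qed

text \<open>The sum is finite, hence meaningful, only where \<^term>\<open>lnil N v\<close>.\<close>

definition fev :: "complex fps => ('a::cvec => 'a) => 'a => 'a" where
  "fev F N v = (\<Sum>k | (N ^^ k) v \<noteq> 0. fps_nth F k *. (N ^^ k) v)"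

lemma fev_bound:
  assumes "clin N" "(N ^^ K) v = 0"
  shows "fev F N v = (\<Sum>k<K. fps_nth F k *. (N ^^ k) v)"
  unfolding fev_def
proof (rule sum.mono_neutral_left)
  show "{k. (N ^^ k) v \<noteq> 0} \<subseteq> {..<K}"
    using funpow_zero_ge[OF assms] by (auto simp: not_le[symmetric])
qed auto

text \<open>Valid at every vector: where infinitely many powers survive, the sum is 0 by convention,
  and 0 lies in \<open>W\<close>.\<close>

lemma fev_stable:
  assumes "cv.subspace W" "\<And>w. w \<in> W ==> N w \<in> W" "v \<in> W"
  shows "fev F N v \<in> W"
proof -
  have "(N ^^ k) v \<in> W" for k by (induction k) (auto simp: assms)
  thus ?thesis unfolding fev_def by (intro cv.subspace_sum cv.subspace_scale assms(1)) auto
qed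

text \<open>Naturality of the power series calculus. With \<open>N' = N\<close> it gives commutation
  with \<open>f\<close>; between two modules it gives functoriality.\<close>

lemma fev_intertwine:
  assumes f: "clin f" and c: "clin N" "clin N'" and i: "\<And>x. f (N x) = N' (f x)" and "lnil N v"
  shows "fev F N' (f v) = f (fev F N v)"
proof -
  have p: "(N' ^^ k) (f v) = f ((N ^^ k) v)" for k by (induction k) (auto simp: i)
  obtain K where K: "(N ^^ K) v = 0" using assms(5) by (auto simp: lnil_def)
  hence "(N' ^^ K) (f v) = 0" using p clin_0[OF f] by simp
  from fev_bound[OF c(2) this] fev_bound[OF c(1) K] show ?thesis
    by (simp add: p clin_sum[OF f] clin_scale[OF f])
qed

lemma fev_vadd: assumes "clin N" "lnil N v" "lnil N w"
  shows "fev F N (v + w) = fev F N v + fev F N w"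
proof -
  obtain k l where "(N ^^ k) v = 0" "(N ^^ l) w = 0" using assms by (auto simp: lnil_def)
  hence *: "(N ^^ (max k l)) v = 0" "(N ^^ (max k l)) w = 0"
    using funpow_zero_ge[OF assms(1)] by (meson max.cobounded1 max.cobounded2)+
  hence "(N ^^ (max k l)) (v + w) = 0" using clin_add[OF clin_funpow[OF assms(1)]] by simp
  from fev_bound[OF assms(1) this] fev_bound[OF assms(1) *(1)] fev_bound[OF assms(1) *(2)]
  show ?thesis by (simp add: clin_add[OF clin_funpow[OF assms(1)]] cscale_simps sum.distrib)
qed

lemma fev_vscale: assumes "clin N" "lnil N v"
  shows "fev F N (c *. v) = c *. fev F N v"
  by (rule fev_intertwine) (use assms in \<open>auto simp: clin_def cscale_simps mult.commute\<close>)

lemma fev_fmult: assumes c: "clin N" and "lnil N v"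
  shows "fev F N (fev G N v) = fev (F * G) N v"
proof -
  obtain K where K: "(N ^^ K) v = 0" using assms(2) by (auto simp: lnil_def)
  have G: "fev G N v = (\<Sum>j<K. fps_nth G j *. (N ^^ j) v)" by (rule fev_bound[OF c K])
  have p: "(N ^^ i) (fev G N v) = (\<Sum>j<K. fps_nth G j *. (N ^^ (i + j)) v)" for i
    unfolding G by (simp add: clin_sum[OF clin_funpow[OF c]] clin_scale[OF clin_funpow[OF c]] funpow_add)
  have z: "(N ^^ i) v = 0" if "i \<ge> K" for i using funpow_zero_ge[OF c K that] .
  have "(N ^^ K) (fev G N v) = 0" unfolding p by (auto intro!: sum.neutral simp: z)
  from fev_bound[OF c this] have "fev F N (fev G N v) =
      (\<Sum>i<K. \<Sum>j<K. (fps_nth F i * fps_nth G j) *. (N ^^ (i + j)) v)"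
    by (simp add: p cscale_simps)
  also have "\<dots> = (\<Sum>x\<in>{..<K}\<times>{..<K}. (\<lambda>(i,j). (fps_nth F i * fps_nth G j) *. (N ^^ (i + j)) v) x)"
    by (simp add: sum.cartesian_product)
  \<comment> \<open>Terms with i + j >= K vanish, so the square shrinks to the triangle of the
    Cauchy product.\<close>
  also have "\<dots> = (\<Sum>x\<in>{(i,j). i + j < K}. (\<lambda>(i,j). (fps_nth F i * fps_nth G j) *. (N ^^ (i + j)) v) x)"
    by (rule sum.mono_neutral_right) (auto simp: z, use z not_less in blast)
  also have "\<dots> = (\<Sum>k<K. \<Sum>i\<le>k. (fps_nth F i * fps_nth G (k - i)) *. (N ^^ k) v)"
    by (subst sum.triangle_reindex) (auto intro!: sum.cong)
  also have "\<dots> = fev (F * G) N v"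
    by (simp add: fev_bound[OF c K] fps_mult_nth cscale_simps atLeast0AtMost)
  finally show ?thesis .
qed

lemma fev_fadd: assumes "clin N" "lnil N v" shows "fev (F + G) N v = fev F N v + fev G N v"
proof -
  obtain K where K: "(N ^^ K) v = 0" using assms(2) by (auto simp: lnil_def)
  show ?thesis by (simp add: fev_bound[OF assms(1) K] cscale_simps sum.distrib)
qed

lemma fev_const: assumes "clin N" "lnil N v" shows "fev (fps_const c) N v = c *. v"
proof -
  obtain K where K: "(N ^^ K) v = 0" using assms(2) by (auto simp: lnil_def)
  hence "(N ^^ Suc K) v = 0" by (intro funpow_zero_ge[OF assms(1) K]) simp
  from fev_bound[OF assms(1) this] show ?thesis
    by (simp add: sum.lessThan_Suc_shift del: sum.lessThan_Suc)
qed

lemma fev_X: assumes "clin N" "lnil N v" shows "fev fps_X N v = N v"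
proof -
  obtain K where K: "(N ^^ K) v = 0" using assms(2) by (auto simp: lnil_def)
  hence "(N ^^ Suc (Suc K)) v = 0" using funpow_zero_ge[OF assms(1) K] by (meson le_SucI order_refl)
  from fev_bound[OF assms(1) this] show ?thesis
    by (simp add: sum.lessThan_Suc_shift del: sum.lessThan_Suc)
qed

lemma fev_lnil: assumes "clin N" "lnil N v" shows "lnil N (fev F N v)"
proof -
  have "fev F N v \<in> {v. lnil N v}"
    by (rule fev_stable[OF lnil_subspace[OF assms(1)]]) (use assms lnil_intertwine[of N N N] in auto)
  thus ?thesis by simp
qed

section \<open>Complex algebras and exponentials of inner derivations\<close>

class calg = cvec + ring_1 +
  assumes cscale_mult_left [simp]: "(c *. x) * y = c *. (x * y)"
    and cscale_mult_right [simp]: "x * (c *. y) = c *. (x * y)"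

definition ad :: "'a::calg => 'a => 'a" where "ad x y = x * y - y * x"

lemma clin_ad: "clin (ad x)"
  by (rule clinI) (auto simp: ad_def algebra_simps cscale_simps)

lemmas ad_add = clin_add[OF clin_ad] and ad_scale = clin_scale[OF clin_ad]
  and ad_0 [simp] = clin_0[OF clin_ad] and ad_diff = clin_diff[OF clin_ad] and ad_minus = clin_minus[OF clin_ad]
  and ad_sum = clin_sum[OF clin_ad]

lemma ad_mult: "ad x (y * z) = ad x y * z + y * ad x z"
  by (simp add: ad_def algebra_simps)

lemma ad_skew: "ad y x = - ad x y" by (simp add: ad_def)

lemma ad_self [simp]: "ad x x = 0" by (simp add: ad_def)

lemma ad_jacobi: "ad x (ad y z) = ad (ad x y) z + ad y (ad x z)"
  by (simp add: ad_def algebra_simps)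

lemma ad_cscale: "ad (c *. x) y = c *. ad x y"
  by (simp add: ad_def cscale_simps)

lemma ad_cscale_pow: "(ad (c *. x) ^^ n) y = c ^ n *. (ad x ^^ n) y"
  by (induction n) (auto simp: ad_cscale ad_scale cscale_simps mult.commute)

abbreviation adn :: "'a::calg => 'a => bool" where "adn x \<equiv> lnil (ad x)"

lemmas adn_add = lnil_add[OF clin_ad] and adn_scale = lnil_scale[OF clin_ad]

lemma adnI: "(ad x ^^ n) y = 0 ==> adn x y" by (auto simp: lnil_def)

lemma adn_cscale: "adn x y ==> adn (c *. x) y"
  by (auto simp: lnil_def ad_cscale_pow)

text \<open>Divided powers of the derivation: with the factorial absorbed, the Leibniz rule has no
  binomial coefficients.\<close>

definition dpow :: "'a::calg => nat => 'a => 'a" where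
  "dpow x n y = (1 / fact n) *. (ad x ^^ n) y"

lemma dpow_0 [simp]: "dpow x 0 y = y" by (simp add: dpow_def)

lemma ad_dpow: "ad x (dpow x n y) = of_nat (Suc n) *. dpow x (Suc n) y"
  by (simp add: dpow_def ad_scale cscale_simps field_simps del: of_nat_Suc)

text \<open>Applying \<open>ad x\<close> to the rule of order n puts the weights k and n + 1 - k on
  the k-th term of order n + 1. They add up to the factor n + 1 of \<open>ad_dpow\<close>, which is
  then cancelled.\<close>

lemma dpow_mult: "dpow x n (y * z) = (\<Sum>k\<le>n. dpow x k y * dpow x (n - k) z)"
proof (induction n)
  case (Suc n)
  let ?f = "\<lambda>k. dpow x k y * dpow x (Suc n - k) z"
  have "of_nat (Suc n) *. dpow x (Suc n) (y * z) = ad x (dpow x n (y * z))" by (simp only: ad_dpow)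
  also have "\<dots> = (\<Sum>k\<le>n. of_nat (Suc k) *. ?f (Suc k)) + (\<Sum>k\<le>n. of_nat (Suc (n - k)) *. ?f k)"
    unfolding Suc ad_sum by (simp add: ad_mult ad_dpow sum.distrib Suc_diff_le del: of_nat_Suc)
  also have "(\<Sum>k\<le>n. of_nat (Suc k) *. ?f (Suc k)) = (\<Sum>k\<le>Suc n. of_nat k *. ?f k)"
    unfolding sum.atMost_Suc_shift[of _ n] by simp
  also have "(\<Sum>k\<le>n. of_nat (Suc (n - k)) *. ?f k) = (\<Sum>k\<le>Suc n. of_nat (Suc n - k) *. ?f k)"
    by (auto simp: Suc_diff_le simp del: of_nat_Suc of_nat_diff intro!: sum.cong)
  also have "(\<Sum>k\<le>Suc n. of_nat k *. ?f k) + \<dots> = (\<Sum>k\<le>Suc n. of_nat (Suc n) *. ?f k)"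
    unfolding sum.distrib[symmetric] cscale_add_left[symmetric] of_nat_add[symmetric]
    by (intro sum.cong) auto
  also have "\<dots> = of_nat (Suc n) *. (\<Sum>k\<le>Suc n. ?f k)" by (simp only: cv.scale_sum_right)
  finally show ?case by (subst (asm) cv.scale_cancel_left) (auto simp del: of_nat_Suc simp: of_nat_eq_0_iff)
qed simp

lemma dpow_zero_ge: "(ad x ^^ k) y = 0 ==> k \<le> l ==> dpow x l y = 0"
  by (simp add: dpow_def funpow_zero_ge[OF clin_ad])

text \<open>In the Leibniz rule of order k + l, one of the two factors of each term has reached its
  order of nilpotency.\<close>

lemma adn_mult: assumes "adn x y" "adn x z" shows "adn x (y * z)"
proof -
  obtain k l where k: "(ad x ^^ k) y = 0" and l: "(ad x ^^ l) z = 0" using assms by (auto simp: lnil_def)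
  have "dpow x (k + l) (y * z) = 0" unfolding dpow_mult
  proof (rule sum.neutral, safe)
    fix i assume "i \<le> k + l"
    hence "k \<le> i \<or> l \<le> k + l - i" by linarith
    thus "dpow x i y * dpow x (k + l - i) z = 0"
      using dpow_zero_ge[OF k, of i] dpow_zero_ge[OF l, of "k + l - i"] by auto
  qed
  thus ?thesis by (auto simp: dpow_def lnil_def)
qed

definition EXP :: "'a::calg => 'a => 'a" where "EXP x y = fev (fps_exp 1) (ad x) y"

lemma EXP_bound: "(ad x ^^ K) y = 0 ==> EXP x y = (\<Sum>k<K. dpow x k y)"
  by (simp add: EXP_def fev_bound[OF clin_ad] dpow_def)

lemmas EXP_add = fev_vadd[OF clin_ad, of _ _ _ "fps_exp 1", folded EXP_def]
  and EXP_scale = fev_vscale[OF clin_ad, of _ _ "fps_exp 1", folded EXP_def]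

text \<open>The exponential of a derivation is multiplicative; with divided powers this is the
  Cauchy product of the two series.\<close>

lemma EXP_mult: assumes "adn x y" "adn x z" shows "EXP x (y * z) = EXP x y * EXP x z"
proof -
  obtain k l where kl: "(ad x ^^ k) y = 0" "(ad x ^^ l) z = 0" using assms by (auto simp: lnil_def)
  define K where "K = max k l"
  have k: "(ad x ^^ K) y = 0" and l: "(ad x ^^ K) z = 0"
    using kl funpow_zero_ge[OF clin_ad] unfolding K_def by (meson max.cobounded1 max.cobounded2)+
  \<comment> \<open>With the cut-off at 2K, any product of terms of total order at least 2K has a
    factor of order at least K and vanishes.\<close>
  have k': "(ad x ^^ (2 * K)) y = 0" and l': "(ad x ^^ (2 * K)) z = 0"
    using k l funpow_zero_ge[OF clin_ad, of K x _ "2 * K"] by auto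
  have z: "dpow x i y * dpow x j z = 0" if "i + j \<ge> 2 * K" for i j
    using dpow_zero_ge[OF k, of i] dpow_zero_ge[OF l, of j] that by (cases "i \<ge> K") auto
  have n: "(ad x ^^ (2 * K)) (y * z) = 0"
  proof -
    have "dpow x (2 * K) (y * z) = 0" unfolding dpow_mult
      by (rule sum.neutral) (auto intro!: z)
    thus ?thesis by (auto simp: dpow_def)
  qed
  have "EXP x y * EXP x z = (\<Sum>i<2*K. \<Sum>j<2*K. dpow x i y * dpow x j z)"
    by (simp add: EXP_bound[OF k'] EXP_bound[OF l'] sum_product)
  also have "\<dots> = (\<Sum>x'\<in>{..<2*K}\<times>{..<2*K}. (\<lambda>(i,j). dpow x i y * dpow x j z) x')"
    by (simp add: sum.cartesian_product)
  also have "\<dots> = (\<Sum>x'\<in>{(i,j). i + j < 2*K}. (\<lambda>(i,j). dpow x i y * dpow x j z) x')"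
    by (rule sum.mono_neutral_right) (auto simp: z, use z not_less in blast)
  also have "\<dots> = (\<Sum>k<2*K. \<Sum>i\<le>k. dpow x i y * dpow x (k - i) z)"
    by (subst sum.triangle_reindex) auto
  also have "\<dots> = EXP x (y * z)" by (simp add: EXP_bound[OF n] dpow_mult)
  finally show ?thesis by simp
qed

text \<open>Moves the scalar from the operator into the series, so that composing exponentials
  becomes multiplying the series exp(cX) and exp(dX).\<close>

lemma EXP_cscale: assumes "adn x y" shows "EXP (c *. x) y = fev (fps_exp c) (ad x) y"
proof -
  obtain K where K: "(ad x ^^ K) y = 0" using assms by (auto simp: lnil_def)
  hence "(ad (c *. x) ^^ K) y = 0" by (simp add: ad_cscale_pow)
  from EXP_bound[OF this] fev_bound[OF clin_ad K] show ?thesis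
    by (simp add: dpow_def ad_cscale_pow cscale_simps)
qed

lemma EXP_inverse: assumes "adn x y" shows "EXP (c *. x) (EXP (d *. x) y) = EXP ((c + d) *. x) y"
  using assms by (simp add: EXP_cscale fev_lnil[OF clin_ad] fev_fmult[OF clin_ad] fps_exp_add_mult)

lemma EXP_0: "EXP 0 y = y"
  using EXP_bound[where x = 0 and K = 1 and y = y] by (simp add: ad_def)

lemma EXP_fix: "ad x y = 0 ==> EXP x y = y"
  using EXP_bound[where x = x and K = 1 and y = y] by simp

lemma EXP_one: "ad x (ad x y) = 0 ==> EXP x y = y + ad x y"
  using EXP_bound[where x = x and K = 2 and y = y] by (simp add: dpow_def numeral_2_eq_2)

text \<open>Compares exponentials in two representations. There is no linear map carrying
  \<open>y\<close> to \<open>y'\<close> here, only the relation \<open>f * y = y' * f\<close>, and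
  this relation is preserved by applying \<open>ad x\<close> on one side and \<open>ad x'\<close> on
  the other.\<close>

lemma EXP_intertwine:
  assumes "f * x = x' * f" "f * y = y' * f" "adn x y" "adn x' y'"
  shows "f * EXP x y = EXP x' y' * f"
proof -
  have c: "f * (ad x ^^ k) y = (ad x' ^^ k) y' * f" for k
  proof (induction k)
    case (Suc k)
    have "f * ad x z = ad x' z' * f" if "f * z = z' * f" for z z'
      unfolding ad_def right_diff_distrib left_diff_distrib
      by (metis (no_types, lifting) assms(1) mult.assoc that)
    with Suc show ?case by simp
  qed (simp add: assms)
  obtain k l where "(ad x ^^ k) y = 0" "(ad x' ^^ l) y' = 0" using assms by (auto simp: lnil_def)
  hence *: "(ad x ^^ (max k l)) y = 0" "(ad x' ^^ (max k l)) y' = 0"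
    using funpow_zero_ge[OF clin_ad] by (meson max.cobounded1 max.cobounded2)+
  show ?thesis unfolding EXP_bound[OF *(1)] EXP_bound[OF *(2)]
    by (simp add: sum_distrib_left sum_distrib_right dpow_def c)
qed

text \<open>\<open>ad (t * t)\<close> is the composite of \<open>ad t\<close> with left plus right
  multiplication by \<open>t\<close>, and both multiplications commute with
  \<open>ad t\<close>.\<close>

lemma ad_square_pow: "(ad t ^^ n) y = 0 ==> (ad (t * t) ^^ n) y = 0"
proof (induction n arbitrary: y)
  case (Suc n)
  have p: "(ad t ^^ k) (t * w) = t * (ad t ^^ k) w \<and> (ad t ^^ k) (w * t) = (ad t ^^ k) w * t" for k w
    by (induction k) (auto simp: ad_mult)
  have e: "ad (t * t) y = t * ad t y + ad t y * t" by (simp add: ad_def algebra_simps)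
  have "(ad t ^^ n) (ad t y) = 0" using Suc.prems by (simp add: funpow_swap1)
  hence "(ad t ^^ n) (ad (t * t) y) = 0" unfolding e by (simp add: clin_add[OF clin_funpow[OF clin_ad]] p)
  from Suc.IH[OF this] show ?case by (simp add: funpow_swap1)
qed simp

lemma adn_square: "adn t y ==> adn (c *. (t * t)) y"
  by (rule adn_cscale) (auto simp: lnil_def dest: ad_square_pow)

section \<open>The Fourier automorphism attached to a Weyl pair\<close>

text \<open>The Weyl element of SL_2 as a product of three unipotents, acting on the Weyl algebra
  generated by \<open>e\<close> and \<open>t\<close>. \<open>s\<close> will be a sign; as the
  product is a palindrome, changing the sign inverts it.\<close>

definition fourier :: "complex => 'a::calg => 'a => 'a => 'a" where
  "fourier s e t y = EXP ((s/2) *. (t * t)) (EXP ((s/2) *. (e * e)) (EXP ((s/2) *. (t * t)) y))"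

text \<open>The domain on which all exponentials involved are genuine finite sums. For a Weyl pair
  it is a subalgebra stable under them.\<close>

definition nilp_alg :: "'a::calg => 'a => 'a set" where
  "nilp_alg e t = {y. adn e y \<and> adn t y}"

text \<open>The relation holds in the corner with unit \<^term>\<open>p\<close>, which need not be \<^term>\<open>1\<close>.\<close>

locale weyl_pair =
  fixes e t p :: "'a::calg"
  assumes comm: "e * t - t * e = p"
    and corner: "p * e = e" "e * p = e" "p * t = t" "t * p = t"
begin

lemma ad_et: "ad e t = p" and ad_te: "ad t e = - p"
  using comm by (auto simp: ad_def algebra_simps)

lemma ad_p: "ad e p = 0" "ad t p = 0" by (simp_all add: ad_def corner)

lemma nilp_alg_e: "e \<in> nilp_alg e t" and nilp_alg_t: "t \<in> nilp_alg e t" and nilp_alg_p: "p \<in> nilp_alg e t"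
proof -
  have "(ad e ^^ 2) u = 0 \<and> (ad t ^^ 2) u = 0" if "u \<in> {e, t, p}" for u
    using that by (auto simp: numeral_2_eq_2 ad_et ad_te ad_p ad_minus)
  hence "u \<in> nilp_alg e t" if "u \<in> {e, t, p}" for u
    using that unfolding nilp_alg_def lnil_def by blast
  thus "e \<in> nilp_alg e t" "t \<in> nilp_alg e t" "p \<in> nilp_alg e t" by simp_all
qed

lemma nilp_alg_add: "y \<in> nilp_alg e t ==> z \<in> nilp_alg e t ==> y + z \<in> nilp_alg e t"
  and nilp_alg_mult: "y \<in> nilp_alg e t ==> z \<in> nilp_alg e t ==> y * z \<in> nilp_alg e t"
  and nilp_alg_scale: "y \<in> nilp_alg e t ==> c *. y \<in> nilp_alg e t"
  by (auto simp: nilp_alg_def adn_add adn_mult adn_scale)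

lemma nilp_alg_diff: "y \<in> nilp_alg e t ==> z \<in> nilp_alg e t ==> y - z \<in> nilp_alg e t"
  using nilp_alg_add[of y "(-1) *. z"] nilp_alg_scale[of z "-1"] by simp

lemma nilp_alg_fev:
  assumes "x \<in> nilp_alg e t" "y \<in> nilp_alg e t" shows "EXP x y \<in> nilp_alg e t"
  unfolding EXP_def
proof (rule fev_stable)
  show "cv.subspace (nilp_alg e t)"
    by (auto simp: cv.subspace_def nilp_alg_add nilp_alg_scale) (auto simp: nilp_alg_def lnil_0)
  show "ad x w \<in> nilp_alg e t" if "w \<in> nilp_alg e t" for w
    using that assms by (auto simp: ad_def intro!: nilp_alg_diff nilp_alg_mult)
qed fact

lemma sq_mem: "c *. (e * e) \<in> nilp_alg e t" "c *. (t * t) \<in> nilp_alg e t"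
  by (auto intro!: nilp_alg_scale nilp_alg_mult nilp_alg_e nilp_alg_t)

lemma sq_adn: "y \<in> nilp_alg e t ==> adn (c *. (e * e)) y" "y \<in> nilp_alg e t ==> adn (c *. (t * t)) y"
  by (auto simp: nilp_alg_def adn_square)

lemma fourier_add: "y \<in> nilp_alg e t ==> z \<in> nilp_alg e t ==>
    fourier s e t (y + z) = fourier s e t y + fourier s e t z"
  unfolding fourier_def by (simp add: EXP_add sq_adn nilp_alg_fev sq_mem)

lemma fourier_scale: "y \<in> nilp_alg e t ==> fourier s e t (c *. y) = c *. fourier s e t y"
  unfolding fourier_def by (simp add: EXP_scale sq_adn nilp_alg_fev sq_mem)

lemma fourier_mult: "y \<in> nilp_alg e t ==> z \<in> nilp_alg e t ==>
    fourier s e t (y * z) = fourier s e t y * fourier s e t z"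
  unfolding fourier_def by (simp add: EXP_mult sq_adn nilp_alg_fev sq_mem)

lemma fourier_diff: "y \<in> nilp_alg e t ==> z \<in> nilp_alg e t ==>
    fourier s e t (y - z) = fourier s e t y - fourier s e t z"
  using fourier_add[of y "(-1) *. z" s] fourier_scale[of z s "-1"] nilp_alg_scale[of z "-1"] by simp

lemma fourier_ad: "y \<in> nilp_alg e t ==> z \<in> nilp_alg e t ==>
    fourier s e t (ad y z) = ad (fourier s e t y) (fourier s e t z)"
  by (simp add: ad_def fourier_diff fourier_mult nilp_alg_mult)

lemma fourier_fourier: assumes "y \<in> nilp_alg e t" shows "fourier (- s) e t (fourier s e t y) = y"
proof -
  have c: "EXP ((- s/2) *. (u * u)) (EXP ((s/2) *. (u * u)) w) = w"
    if "w \<in> nilp_alg e t" "u = e \<or> u = t" for w u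
    using EXP_inverse[of "u * u" w "-s/2" "s/2"] sq_adn[OF that(1), of 1] that(2) by (auto simp: EXP_0)
  let ?E = "EXP ((s/2) *. (e * e))" and ?T = "EXP ((s/2) *. (t * t))"
  have m: "?T y \<in> nilp_alg e t" "?E (?T y) \<in> nilp_alg e t" by (intro nilp_alg_fev sq_mem assms)+
  have "fourier (- s) e t (fourier s e t y) = EXP ((- s/2) *. (t * t)) (EXP ((- s/2) *. (e * e)) (?E (?T y)))"
    unfolding fourier_def by (subst c) (simp_all add: m)
  also have "\<dots> = EXP ((- s/2) *. (t * t)) (?T y)" by (subst c) (simp_all add: m)
  also have "\<dots> = y" by (subst c) (simp_all add: assms)
  finally show ?thesis .
qed

lemma ad_sq_zero: "ad u y = 0 ==> ad (c *. (u * u)) y = 0" for u y :: 'a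
proof -
  assume "ad u y = 0"
  moreover have "ad (u * u) y = u * ad u y + ad u y * u" by (simp add: ad_def algebra_simps)
  ultimately show ?thesis by (simp add: ad_cscale)
qed

lemma fourier_fix: "ad e y = 0 ==> ad t y = 0 ==> fourier s e t y = y"
  unfolding fourier_def by (simp add: EXP_fix ad_sq_zero)

text \<open>Because \<open>p\<close> acts as a unit on \<open>e\<close> and \<open>t\<close>,
  \<open>ad (t * t) e\<close> is -2t and \<open>ad (e * e) t\<close> is 2e. Each is killed by a
  further application, so the series stop after the linear term.\<close>

lemma EXP_e: "EXP ((s/2) *. (t * t)) e = e - s *. t" "EXP ((s/2) *. (e * e)) e = e"
  and EXP_t: "EXP ((s/2) *. (e * e)) t = t + s *. e" "EXP ((s/2) *. (t * t)) t = t"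
proof -
  have d: "x + x = 2 *. x" for x :: 'a using cscale_add_left[of 1 1 x] by simp
  have "ad (t * t) e = t * ad t e + ad t e * t" "ad (e * e) t = e * ad e t + ad e t * e"
    by (simp_all add: ad_def algebra_simps)
  hence a: "ad (t * t) e = - (2 *. t)" "ad (e * e) t = 2 *. e"
    unfolding ad_et ad_te d[symmetric] by (simp_all add: corner)
  have b: "ad (t * t) t = 0" "ad (e * e) e = 0" by (simp_all add: ad_def mult.assoc)
  show "EXP ((s/2) *. (t * t)) e = e - s *. t"
    by (subst EXP_one) (simp_all add: ad_cscale a b ad_scale ad_minus)
  show "EXP ((s/2) *. (e * e)) t = t + s *. e"
    by (subst EXP_one) (simp_all add: ad_cscale a b ad_scale)
  show "EXP ((s/2) *. (e * e)) e = e" "EXP ((s/2) *. (t * t)) t = t"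
    by (simp_all add: EXP_fix ad_cscale b)
qed

lemma EXP_lincomb:
  assumes "y \<in> nilp_alg e t" "z \<in> nilp_alg e t" "u = e \<or> u = t"
  shows "EXP (b *. (u * u)) (y + c *. z) = EXP (b *. (u * u)) y + c *. EXP (b *. (u * u)) z"
proof -
  have "adn (b *. (u * u)) w" if "w \<in> nilp_alg e t" for w using assms(3) sq_adn[OF that] by blast
  thus ?thesis by (simp add: EXP_add EXP_scale adn_scale assms)
qed

text \<open>After two factors \<open>e\<close> has become (1 - s^2) e - s t, and the sign condition
  removes the first term; \<open>t\<close> is treated likewise.\<close>

lemma fourier_e: "s * s = 1 ==> fourier s e t e = - s *. t"
  and fourier_t: "s * s = 1 ==> fourier s e t t = s *. e"
proof -
  assume s: "s * s = 1"
  let ?E = "EXP ((s/2) *. (e * e))" and ?T = "EXP ((s/2) *. (t * t))"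
  have "?E (?T e) = e + (- s) *. (t + s *. e)"
    unfolding EXP_e(1) using EXP_lincomb[OF nilp_alg_e nilp_alg_t, of e "s/2" "-s"] by (simp add: EXP_e EXP_t)
  also have "\<dots> = 0 + (- s) *. t" by (simp add: cscale_add_right cscale_cscale s)
  finally have *: "?T (?E (?T e)) = ?T (0 + (- s) *. t)" by simp
  have z: "0 \<in> nilp_alg e t" by (simp add: nilp_alg_def lnil_0)
  have "?T (0 + (- s) *. t) = (- s) *. t"
    by (subst EXP_lincomb[OF z nilp_alg_t]) (simp_all add: EXP_t EXP_fix)
  thus "fourier s e t e = - s *. t" unfolding fourier_def * by simp
  have "?T (?E (?T t)) = ?T (t + s *. e)" by (simp add: EXP_t)
  also have "\<dots> = t + s *. (e - s *. t)"
    by (subst EXP_lincomb[OF nilp_alg_t nilp_alg_e]) (simp_all add: EXP_t EXP_e)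
  also have "\<dots> = s *. e" by (simp add: cscale_simps s)
  finally show "fourier s e t t = s *. e" unfolding fourier_def .
qed

text \<open>The Fourier automorphism for the transformed pair is conjugate to the original one by
  itself, hence equal to it.\<close>

lemma EXP_fourier: assumes "x \<in> nilp_alg e t" "y \<in> nilp_alg e t" "adn x y"
  shows "EXP (fourier s e t x) (fourier s e t y) = fourier s e t (EXP x y)"
proof -
  have p: "(ad (fourier s e t x) ^^ k) (fourier s e t y) = fourier s e t ((ad x ^^ k) y) \<and> (ad x ^^ k) y \<in> nilp_alg e t" for k
    proof (induction k)
    case (Suc k)
    thus ?case using assms(1) fourier_ad[of x] by (auto simp: ad_def intro!: nilp_alg_diff nilp_alg_mult)
  qed (simp add: assms)
  have z: "fourier s e t 0 = 0" by (rule fourier_fix) auto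
  have sm: "fourier s e t (\<Sum>k<n. g k) = (\<Sum>k<n. fourier s e t (g k)) \<and> (\<Sum>k<n. g k) \<in> nilp_alg e t"
    if "\<And>k. g k \<in> nilp_alg e t" for g and n :: nat
  proof (induction n)
    case 0 thus ?case by (simp add: z) (simp add: nilp_alg_def lnil_0)
  qed (auto simp: that fourier_add nilp_alg_add)
  obtain K where K: "(ad x ^^ K) y = 0" using assms by (auto simp: lnil_def)
  hence "(ad (fourier s e t x) ^^ K) (fourier s e t y) = 0" by (simp add: p z)
  from EXP_bound[OF this] EXP_bound[OF K] show ?thesis
    by (simp add: dpow_def p fourier_scale sm nilp_alg_scale)
qed

lemma fourier_transformed: assumes s: "s * s = 1" and y: "y \<in> nilp_alg e t"
  shows "fourier r (fourier s e t e) (fourier s e t t) (fourier s e t y) = fourier s e t (fourier r e t y)"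
proof -
  have sq: "c *. (fourier s e t u * fourier s e t u) = fourier s e t (c *. (u * u))" if "u \<in> nilp_alg e t" for u c
    using that by (simp add: fourier_scale fourier_mult nilp_alg_mult)
  have E: "EXP (c *. (fourier s e t u * fourier s e t u)) (fourier s e t w) = fourier s e t (EXP (c *. (u * u)) w)"
    if "u = e \<or> u = t" "w \<in> nilp_alg e t" for u w c
  proof -
    have u: "u \<in> nilp_alg e t" "adn (c *. (u * u)) w"
      using that nilp_alg_e nilp_alg_t by (auto intro: sq_adn)
    show ?thesis unfolding sq[OF u(1)]
      by (intro EXP_fourier nilp_alg_scale nilp_alg_mult u that(2))
  qed
  let ?E = "EXP ((r/2) *. (e * e))" and ?T = "EXP ((r/2) *. (t * t))"
  have m: "?T y \<in> nilp_alg e t" "?E (?T y) \<in> nilp_alg e t" by (intro nilp_alg_fev sq_mem y)+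
  show ?thesis unfolding fourier_def[of r]
    by (subst E, blast, rule y, subst E, blast, rule m, subst E, blast, rule m) simp
qed

end

section \<open>Diagonalisable elements and the Jordan decomposition\<close>

definition peval :: "complex poly => 'a::calg => 'a" where
  "peval p x = fold_coeffs (\<lambda>a b. a *. 1 + x * b) p 0"

lemma peval_0 [simp]: "peval 0 x = 0" by (simp add: peval_def)

lemma peval_pCons [simp]: "peval (pCons a p) x = a *. 1 + x * peval p x"
  by (cases "p = 0 \<and> a = 0") (auto simp: peval_def)

lemma peval_add: "peval (p + q) x = peval p x + peval q x"
  by (induction p q rule: poly_induct2) (auto simp: algebra_simps cscale_simps)

lemma peval_smult: "peval (Polynomial.smult c p) x = c *. peval p x"
  by (induction p) (auto simp: algebra_simps cscale_simps)

lemma peval_mult: "peval (p * q) x = peval p x * peval q x"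
  by (induction p) (auto simp: algebra_simps cscale_simps peval_add peval_smult)

lemma peval_diff: "peval (p - q) x = peval p x - peval q x"
  using peval_add[of p "Polynomial.smult (-1) q" x] by (simp add: peval_smult del: smult_minus_left) simp

lemma peval_power: "peval (p ^ n) x = peval p x ^ n"
  by (induction n) (auto simp: peval_mult one_pCons)

lemma peval_sum: "peval (\<Sum>i\<in>S. f i) x = (\<Sum>i\<in>S. peval (f i) x)"
  by (induction S rule: infinite_finite_induct) (auto simp: peval_add)

lemma peval_monom: "peval (monom c k) x = c *. x ^ k"
  by (induction k) (auto simp: monom_Suc monom_0)

lemma peval_commute: "x * y = y * x ==> peval p x * y = y * peval p x"
proof (induction p)
  case (pCons a p)
  have "x * (peval p x * y) = y * x * peval p x" using pCons by (metis mult.assoc)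
  thus ?case by (simp add: distrib_left distrib_right mult.assoc)
qed simp

lemma peval_pcompose: "peval (pcompose p q) x = peval p (peval q x)"
  by (induction p) (auto simp: pcompose_pCons peval_add peval_mult)

abbreviation root_prod :: "complex set => complex poly" where
  "root_prod \<Lambda> \<equiv> (\<Prod>a\<in>\<Lambda>. [:- a, 1:])"

text \<open>Annihilation by a polynomial with distinct roots makes sense in every algebra and gives
  spectral idempotents that are polynomials in \<open>x\<close>. For matrices it agrees with
  \<open>semisimple_mat\<close>, see \<open>semisimple_mat_iff\<close>.\<close>

definition diagonalisable :: "'a::calg => bool" where
  "diagonalisable x \<longleftrightarrow> (\<exists>\<Lambda>. finite \<Lambda> \<and> peval (root_prod \<Lambda>) x = 0)"

text \<open>Lagrange interpolation. With P the product over the smaller set, 1 = P' + Q' where P' =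
  P / P(b) and Q' is divisible by X - b. Then P'(x) z is the component for \<open>b\<close>, and
  Q'(x) z is annihilated by P(x), so the induction hypothesis applies to it.\<close>

lemma eigen_split:
  assumes "finite \<Lambda>" "peval (root_prod \<Lambda>) x * z = 0"
  shows "\<exists>q. z = (\<Sum>a\<in>\<Lambda>. peval (q a) x * z) \<and> (\<forall>a\<in>\<Lambda>. x * (peval (q a) x * z) = a *. (peval (q a) x * z))"
  using assms
proof (induction \<Lambda> arbitrary: z)
  case empty
  thus ?case by (simp add: one_pCons)
next
  case (insert b \<Lambda>)
  define P where "P = root_prod \<Lambda>"
  have Pb: "poly P b \<noteq> 0" using insert.hyps by (auto simp: P_def poly_prod)
  have "[:- b, 1:] dvd (P - [:poly P b:])" by (simp add: poly_eq_0_iff_dvd[symmetric])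
  then obtain Q where Q: "P - [:poly P b:] = [:- b, 1:] * Q" by (auto simp: dvd_def)
  define Q' where "Q' = Polynomial.smult (- 1 / poly P b) ([:- b, 1:] * Q)"
  define P' where "P' = Polynomial.smult (1 / poly P b) P"
  have one: "P' + Q' = 1"
  proof -
    have "P' + Q' = Polynomial.smult (1 / poly P b) (P - [:- b, 1:] * Q)"
      by (simp add: P'_def Q'_def smult_diff_right)
    also have "P - [:- b, 1:] * Q = [:poly P b:]" using Q by (simp add: algebra_simps)
    finally show ?thesis using Pb by (simp add: one_pCons)
  qed
  have bP: "peval [:- b, 1:] x * peval P x * z = 0"
    unfolding P_def peval_mult[symmetric] using insert.prems insert.hyps by (simp only: prod.insert not_False_eq_True)
  have "P * Q' = Polynomial.smult (- 1 / poly P b) (Q * ([:- b, 1:] * P))" by (simp add: Q'_def mult_ac del: mult_pCons_left mult_pCons_right)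
  hence "peval P x * (peval Q' x * z) = (- 1 / poly P b) *. (peval Q x * (peval [:- b, 1:] x * peval P x * z))"
    by (metis (no_types, lifting) peval_mult peval_smult cscale_mult_left mult.assoc)
  hence "peval (root_prod \<Lambda>) x * (peval Q' x * z) = 0" unfolding bP P_def[symmetric] by simp
  from insert.IH[OF this] obtain q where q: "peval Q' x * z = (\<Sum>a\<in>\<Lambda>. peval (q a) x * (peval Q' x * z))"
    "\<And>a. a \<in> \<Lambda> ==> x * (peval (q a) x * (peval Q' x * z)) = a *. (peval (q a) x * (peval Q' x * z))" by blast
  define r where "r = (\<lambda>a. if a = b then P' else q a * Q')"
  have z: "z = peval P' x * z + peval Q' x * z"
    using one by (metis distrib_right peval_add peval_pCons peval_0 one_pCons mult_zero_right add_0_right cscale_one mult_1_left)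
  have 1: "z = (\<Sum>a\<in>insert b \<Lambda>. peval (r a) x * z)"
  proof -
    have "(\<Sum>a\<in>insert b \<Lambda>. peval (r a) x * z) = peval P' x * z + (\<Sum>a\<in>\<Lambda>. peval (q a) x * (peval Q' x * z))"
      using insert.hyps by (auto simp: r_def peval_mult mult.assoc intro!: sum.cong)
    thus ?thesis using z q(1) by simp
  qed
  have "peval [:- b, 1:] x * (peval P' x * z) = (1 / poly P b) *. (peval [:- b, 1:] x * peval P x * z)"
    by (simp only: P'_def peval_smult cscale_mult_left cscale_mult_right mult.assoc)
  hence "(x - b *. 1) * (peval P' x * z) = 0" unfolding bP by simp
  hence 2: "x * (peval P' x * z) = b *. (peval P' x * z)" by (simp add: left_diff_distrib)
  show ?case
  proof (intro exI[of _ r] conjI ballI 1)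
    fix a assume "a \<in> insert b \<Lambda>"
    thus "x * (peval (r a) x * z) = a *. (peval (r a) x * z)"
      using 2 q(2)[of a] insert.hyps by (auto simp: r_def peval_mult mult.assoc)
  qed
qed

lemma diagonalisable_idem:
  assumes "diagonalisable x"
  obtains \<Lambda> L where "finite \<Lambda>" "1 = (\<Sum>a\<in>\<Lambda>. peval (L a) x)"
    "\<And>a. a \<in> \<Lambda> ==> x * peval (L a) x = a *. peval (L a) x"
proof -
  obtain \<Lambda> where L: "finite \<Lambda>" "peval (root_prod \<Lambda>) x * 1 = 0" using assms by (auto simp: diagonalisable_def)
  from eigen_split[OF L] that[OF L(1)] show ?thesis by auto
qed

text \<open>Subtracting b times the sum from its image under \<open>T\<close> removes the component
  for \<open>b\<close> and multiplies the others by c - b, which is nonzero.\<close>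

lemma eigen_component_mem:
  assumes T: "clin T" and W: "cv.subspace W" "\<And>w. w \<in> W ==> T w \<in> W"
    and "finite C" "\<And>c. c \<in> C ==> T (x c) = c *. x c" "(\<Sum>c\<in>C. x c) \<in> W"
  shows "\<forall>c\<in>C. x c \<in> W"
  using assms(4-6)
proof (induction C arbitrary: x)
  case (insert b C)
  let ?s = "\<Sum>c\<in>insert b C. x c"
  have "T ?s - b *. ?s \<in> W" using insert.prems W by (simp add: cv.subspace_diff cv.subspace_scale)
  also have "T ?s - b *. ?s = (\<Sum>c\<in>C. (c - b) *. x c)"
    using insert.hyps insert.prems(1)
    by (simp add: clin_sum[OF T] clin_add[OF T] cscale_simps sum_subtractf)
  finally have *: "(\<Sum>c\<in>C. (c - b) *. x c) \<in> W" .
  have "\<forall>c\<in>C. (c - b) *. x c \<in> W"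
    by (rule insert.IH) (use * insert.prems in \<open>auto simp: clin_scale[OF T] cscale_cscale mult.commute\<close>)
  hence C: "x c \<in> W" if "c \<in> C" for c
  proof -
    have "(1 / (c - b)) *. ((c - b) *. x c) \<in> W" using \<open>\<forall>c\<in>C. _\<close> that W cv.subspace_scale by blast
    moreover have "c - b \<noteq> 0" using that insert.hyps by auto
    ultimately show ?thesis by (simp add: cscale_cscale)
  qed
  have "?s - (\<Sum>c\<in>C. x c) \<in> W" by (intro cv.subspace_diff W cv.subspace_sum insert.prems C)
  thus ?case using C insert.hyps by simp
qed simp

lemma power_mult_commute: fixes x y :: "'a::calg"
  assumes "x * y = y * x" shows "(x * y) ^ n = x ^ n * y ^ n"
proof (induction n)
  case (Suc n)
  have "y * x ^ n = x ^ n * y" by (induction n) (simp_all add: assms[symmetric] mult.assoc[symmetric], metis assms mult.assoc)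
  with Suc show ?case by (simp add: mult.assoc) (metis mult.assoc)
qed simp

text \<open>The Chinese remainder theorem for the values prescribed by the Jordan decomposition:
  near each root \<open>a\<close> the polynomial is to be congruent to the constant
  \<open>a\<close>.\<close>

lemma poly_crt:
  assumes "finite R"
  shows "\<exists>s::complex poly. \<forall>a\<in>R. [:- a, 1:] ^ k a dvd s - [:a:]"
  using assms
proof (induction R)
  case (insert b R)
  then obtain s where s: "\<And>a. a \<in> R ==> [:- a, 1:] ^ k a dvd s - [:a:]" by blast
  define M where "M = (\<Prod>a\<in>R. [:- a, 1:] ^ k a)"
  have Mb: "poly M b \<noteq> 0" using insert.hyps by (auto simp: M_def poly_prod)
  \<comment> \<open>An inverse of \<open>M\<close> modulo powers of X - b, lifted one power at a
    time; the constant \<open>c\<close> cancels the value of the error term at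
    \<open>b\<close>.\<close>
  have "\<exists>v. [:- b, 1:] ^ n dvd 1 - v * M" for n
  proof (induction n)
    case (Suc n)
    then obtain v w where w: "1 - v * M = [:- b, 1:] ^ n * w" by (auto simp: dvd_def)
    define c where "c = poly w b / poly M b"
    have "poly (w - [:c:] * M) b = 0" using Mb by (simp add: c_def)
    then obtain u where u: "w - [:c:] * M = [:- b, 1:] * u" unfolding poly_eq_0_iff_dvd dvd_def by blast
    have "1 - (v + [:c:] * [:- b, 1:] ^ n) * M = [:- b, 1:] ^ n * (w - [:c:] * M)"
      using w by (simp add: algebra_simps del: mult_pCons_left mult_pCons_right)
    also have "\<dots> = [:- b, 1:] ^ Suc n * u" unfolding u by (simp only: power_Suc2 mult.assoc)
    finally show ?case by (metis dvd_triv_left)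
  qed auto
  then obtain v where v: "[:- b, 1:] ^ k b dvd 1 - v * M" by blast
  \<comment> \<open>Congruent to \<open>s\<close> modulo \<open>M\<close>, hence unchanged at the
    old roots, and congruent to \<open>b\<close> where \<open>v * M\<close> is congruent to
    1.\<close>
  define s' where "s' = s + v * M * ([:b:] - s)"
  have "s' - [:b:] = (1 - v * M) * (s - [:b:])" by (simp add: s'_def algebra_simps del: mult_pCons_left mult_pCons_right)
  hence "[:- b, 1:] ^ k b dvd s' - [:b:]" using v by simp
  moreover have "[:- a, 1:] ^ k a dvd s' - [:a:]" if "a \<in> R" for a
  proof -
    have "[:- a, 1:] ^ k a dvd M" unfolding M_def by (rule dvd_prodI) (use insert.hyps that in auto)
    moreover have "s' - [:a:] = (s - [:a:]) + v * ([:b:] - s) * M" by (simp add: s'_def algebra_simps del: mult_pCons_left mult_pCons_right)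
    ultimately show ?thesis using s[OF that] by (metis dvd_add dvd_mult)
  qed
  ultimately show ?case by auto
qed simp

text \<open>Take \<open>s\<close> congruent to a modulo (X - a)^(order of a). Then the product of
  all s - a, and a power of X - s, are divisible by the annihilating polynomial. Both parts are
  polynomials in \<open>x\<close>, so they commute with whatever commutes with
  \<open>x\<close>.\<close>

lemma jordan_decomposition:
  fixes x :: "'a::calg"
  assumes p: "p \<noteq> 0" "peval p x = 0"
  obtains s m where "diagonalisable (peval s x)" "(x - peval s x) ^ m = 0"
proof -
  define R where "R = {z. poly p z = 0}"
  have fR: "finite R" unfolding R_def using p(1) by (rule poly_roots_finite)
  define M where "M = (\<Prod>z\<in>R. [:- z, 1:] ^ Polynomial.order z p)"
  have "p = Polynomial.smult (lead_coeff p) M" unfolding M_def R_def using complex_poly_decompose[of p] by simp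
  hence "lead_coeff p *. peval M x = 0" using p(2) peval_smult by metis
  hence M: "peval M x = 0" using p(1) by simp
  have dv: "peval q x = 0" if "M dvd q" for q using that M by (auto simp: dvd_def peval_mult)
  obtain s where s: "\<And>a. a \<in> R ==> [:- a, 1:] ^ Polynomial.order a p dvd s - [:a:]" using poly_crt[OF fR, of "\<lambda>a. Polynomial.order a p"] by blast
  have "peval (root_prod R) (peval s x) = peval (pcompose (root_prod R) s) x" by (simp add: peval_pcompose)
  also have "pcompose (root_prod R) s = (\<Prod>a\<in>R. s - [:a:])"
    by (simp add: pcompose_prod pcompose_pCons) (metis (no_types) uminus_add_conv_diff minus_pCons minus_zero)
  also have "peval \<dots> x = 0" by (rule dv) (unfold M_def, rule prod_dvd_prod, rule s)
  finally have 1: "diagonalisable (peval s x)" using fR by (auto simp: diagonalisable_def)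
  define m where "m = Suc (\<Sum>a\<in>R. Polynomial.order a p)"
  have "M dvd (\<Prod>a\<in>R. ([:0, 1:] - s) ^ Polynomial.order a p)" unfolding M_def
  proof (rule prod_dvd_prod)
    fix a assume a: "a \<in> R"
    hence "Polynomial.order a p \<noteq> 0" using p(1) by (simp add: R_def order_root)
    hence "[:- a, 1:] dvd [:- a, 1:] ^ Polynomial.order a p" by (simp add: dvd_power)
    hence "[:- a, 1:] dvd s - [:a:]" using s[OF a] by (rule dvd_trans)
    hence "[:- a, 1:] dvd [:- a, 1:] - (s - [:a:])" by (rule dvd_diff[OF dvd_refl])
    also have "[:- a, 1:] - (s - [:a:]) = [:0, 1:] - s" by (simp add: poly_eq_iff coeff_pCons split: nat.splits)
    finally show "[:- a, 1:] ^ Polynomial.order a p dvd ([:0, 1:] - s) ^ Polynomial.order a p" by (rule dvd_power_same)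
  qed
  also have "\<dots> dvd ([:0, 1:] - s) ^ m" by (simp add: m_def power_sum[symmetric])
  finally have "peval (([:0, 1:] - s) ^ m) x = 0" by (rule dv)
  hence 2: "(x - peval s x) ^ m = 0" by (simp add: peval_power peval_diff)
  from that[OF 1 2] show ?thesis .
qed

section \<open>The algebra of complex matrices\<close>

instantiation complex :: cvec begin
definition "cscale_complex = ((*) :: complex => complex => complex)"
instance by standard (auto simp: cscale_complex_def algebra_simps)
end

instantiation vec :: (cvec, finite) cvec begin
definition "cscale_vec c v = (\<chi> i. c *. (v $ i))"
instance by standard (auto simp: cscale_vec_def vec_eq_iff cscale_simps)
end

lemma cscale_eq_smult: "c *. (v :: complex ^ 'n) = c *s v"
  by (simp add: vec_eq_iff cscale_vec_def cscale_complex_def)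

lemma mscale_eq_cscale: "mscale c A = c *. A"
  by (simp add: mscale_def cscale_vec_def cscale_complex_def vec_eq_iff)

text \<open>A copy of the matrix type on which \<open>*\<close> can be the matrix product; on nested
  vectors \<open>*\<close> is the entrywise product.\<close>

typedef (overloaded) 'n mx = "UNIV :: (complex ^ 'n::finite ^ 'n) set" morphisms mat_of mx_of ..
setup_lifting type_definition_mx

lemma mat_of_mx_of [simp]: "mat_of (mx_of A) = A" by (simp add: mx_of_inverse)

instantiation mx :: (finite) calg begin
lift_definition zero_mx :: "'a mx" is 0 .
lift_definition one_mx :: "'a mx" is "mat 1" .
lift_definition plus_mx :: "'a mx => 'a mx => 'a mx" is "(+)" .
lift_definition minus_mx :: "'a mx => 'a mx => 'a mx" is "(-)" .
lift_definition uminus_mx :: "'a mx => 'a mx" is uminus .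
lift_definition times_mx :: "'a mx => 'a mx => 'a mx" is "(**)" .
lift_definition cscale_mx :: "complex => 'a mx => 'a mx" is cscale .
instance
proof
  show "(0 :: 'a mx) \<noteq> 1"
    by transfer (auto simp: vec_eq_iff mat_def)
  fix x y z :: "'a mx" and c d :: complex
  show "x * y * z = x * (y * z)" by transfer (simp add: matrix_mul_assoc)
  show "(x + y) * z = x * z + y * z" by transfer (simp add: matrix_matrix_mult_def vec_eq_iff sum.distrib algebra_simps)
  show "x * (y + z) = x * y + x * z" by transfer (simp add: matrix_matrix_mult_def vec_eq_iff sum.distrib algebra_simps)
  show "c *. x * y = c *. (x * y)" "x * c *. y = c *. (x * y)"
    by (transfer, simp add: matrix_matrix_mult_def cscale_vec_def cscale_complex_def vec_eq_iff sum_distrib_left mult_ac)+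
  show "1 * x = x" "x * 1 = x" by (transfer, simp)+
qed (transfer; simp add: cscale_simps)+
end

lemma mat_of_simps [simp]:
  "mat_of 0 = 0" "mat_of 1 = mat 1" "mat_of (x + y) = mat_of x + mat_of y" "mat_of (x - y) = mat_of x - mat_of y"
  "mat_of (- x) = - mat_of x" "mat_of (x * y) = mat_of x ** mat_of y" "mat_of (c *. x) = c *. mat_of x"
  by (transfer, simp)+

definition app :: "'n::finite mx => complex ^ 'n => complex ^ 'n" (infixr "*>" 76) where
  "x *> v = mat_of x *v v"

lemma app_simps [simp]: "0 *> v = 0" "1 *> v = v" "(x * y) *> v = x *> (y *> v)" "x *> 0 = 0"
  "(x + y) *> v = x *> v + y *> v" "(x - y) *> v = x *> v - y *> v"
  "x *> (v + w) = x *> v + x *> w" "x *> (v - w) = x *> v - x *> w" 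
  "(c *. x) *> v = c *. (x *> v)" "x *> (c *. v) = c *. (x *> v)"
  by (simp_all add: app_def matrix_vector_mul_assoc matrix_vector_mult_add_rdistrib matrix_vector_mult_diff_rdistrib
    matrix_vector_right_distrib matrix_vector_mult_diff_distrib)
   (simp_all add: matrix_vector_mult_def vec_eq_iff cscale_vec_def cscale_complex_def sum_distrib_left mult_ac)

lemma app_sum: "(\<Sum>i\<in>S. x i) *> v = (\<Sum>i\<in>S. x i *> v)"
  by (induction S rule: infinite_finite_induct) auto

lemma mx_eqI: "(\<And>v. x *> v = y *> v) ==> x = y"
  by (metis app_def mat_of_inject matrix_eq)

definition tr :: "'n::finite mx => complex" where "tr x = trace (mat_of x)"

lemma tr_add: "tr (x + y) = tr x + tr y" and tr_diff: "tr (x - y) = tr x - tr y"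
  and tr_scale: "tr (c *. x) = c * tr x" and tr_comm: "tr (x * y) = tr (y * x)"
  by (auto simp: tr_def trace_add trace_sub intro: trace_mul_sym)
    (simp add: trace_def cscale_vec_def cscale_complex_def sum_distrib_left)

lemma tr_ad: "tr (ad x y * z) = tr (x * ad y z)"
proof -
  have "tr (y * x * z) = tr (x * z * y)" using tr_comm[of y "x * z"] by (simp add: mult.assoc)
  thus ?thesis by (simp add: ad_def left_diff_distrib right_diff_distrib tr_diff mult.assoc)
qed

lemma app_sum_right: "x *> (\<Sum>i\<in>S. f i) = (\<Sum>i\<in>S. x *> f i)"
  by (induction S rule: infinite_finite_induct) auto

lemma cv_projection:
  fixes K :: "'a::cvec set" assumes "cv.subspace K"
  obtains P where "clin P" "\<And>v. P v \<in> K" "\<And>v. v \<in> K ==> P v = v"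
proof -
  interpret vp: vector_space_pair "cscale :: complex => 'a => 'a" "cscale :: complex => 'a => 'a" ..
  obtain g where g: "range g \<subseteq> K" "Vector_Spaces.linear cscale cscale g" "\<forall>v\<in>K. g (id v) = v"
    using vp.linear_exists_left_inverse_on[OF cv.linear_id assms] by auto
  hence "clin g" unfolding clin_def by (metis Vector_Spaces.linear.axioms(3) module_hom.add module_hom.scale Vector_Spaces.linear_iff_module_hom)
  thus ?thesis using that g by auto
qed

lemma mx_of_clin: assumes "clin f" obtains x :: "'n::finite mx" where "\<And>v. x *> v = f v"
proof -
  have "Vector_Spaces.linear (*s) (*s) f"
    by unfold_locales (use assms in \<open>auto simp: clin_def cscale_eq_smult\<close>)
  hence "mx_of (matrix f) *> v = f v" for v by (simp add: app_def matrix_works)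
  thus ?thesis using that by blast
qed

text \<open>A projection onto the kernel of \<open>x\<close>. The second property says that it acts
  as the identity on matrices with image in that kernel.\<close>

lemma mx_kernel_idempotent:
  fixes x :: "'n::finite mx"
  obtains p where "x * p = 0" "\<And>z. x * z = 0 ==> p * z = z"
proof -
  have "cv.subspace {v. x *> v = 0}" by (auto simp: cv.subspace_def)
  then obtain P where P: "clin P" "\<And>v. P v \<in> {v. x *> v = 0}" "\<And>v. v \<in> {v. x *> v = 0} ==> P v = v"
    by (rule cv_projection) blast
  obtain p where p: "\<And>v. p *> v = P v" using mx_of_clin[OF P(1)] by blast
  have "x * p = 0" by (rule mx_eqI) (use P(2) in \<open>auto simp: p\<close>)
  moreover have "p * z = z" if "x * z = 0" for z :: "'n mx"
  proof (rule mx_eqI)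
    fix v
    have "x *> (z *> v) = 0" using that by (metis app_simps(1) app_simps(3))
    thus "(p * z) *> v = z *> v" using P(3) by (simp add: p)
  qed
  ultimately show ?thesis using that by blast
qed

text \<open>No eigenvalues enter. With \<open>p\<close> the projection onto the kernel of
  \<open>x\<close>, the matrix y = (1 - p) x has the trace of \<open>x\<close>, since tr (p x) = tr
  (x p) = 0. From x y = x^2 one gets y^m = (1 - p) x^m, which is 0 because x^m maps into the
  kernel.\<close>

lemma tr_nilpotent: "(x :: 'n::finite mx) ^ m = 0 ==> tr x = 0"
proof (induction m arbitrary: x)
  case 0
  hence "x = 0" by (metis mult_1_left mult_zero_left power_0)
  thus ?case using tr_scale[of 0 x] by simp
next
  case (Suc m)
  obtain p where p: "x * p = 0" "\<And>z. x * z = 0 ==> p * z = z" using mx_kernel_idempotent by blast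
  define y where "y = (1 - p) * x"
  have xpow: "x * y ^ k = x ^ Suc k" for k
  proof (induction k)
    case (Suc k)
    have "x * y ^ Suc k = x * y * y ^ k" by (simp add: mult.assoc)
    also have "x * y = x * x" by (simp add: y_def left_diff_distrib right_diff_distrib mult.assoc[symmetric] p)
    finally show ?case using Suc by (simp add: mult.assoc)
  qed simp
  show ?case
  proof (cases m)
    case 0
    thus ?thesis using Suc.prems tr_scale[of 0 x] by simp
  next
    case k: (Suc k)
    have "y ^ m = (1 - p) * (x * y ^ k)" by (simp add: k y_def mult.assoc)
    also have "\<dots> = (1 - p) * x ^ m" by (simp only: xpow k)
    also have "\<dots> = 0" using p(2)[of "x ^ m"] Suc.prems by (simp add: left_diff_distrib)
    finally have "tr y = 0" by (rule Suc.IH)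
    moreover have "tr (p * x) = 0" using tr_comm[of p x] p(1) tr_scale[of 0 x] by simp
    ultimately show ?thesis by (simp add: y_def left_diff_distrib tr_diff)
  qed
qed

text \<open>Among the powers up to the real dimension D of the matrix space, either two coincide or
  there is a real linear dependence.\<close>

lemma mx_annihilating: "\<exists>p\<noteq>0. peval p (x::'n::finite mx) = 0"
proof -
  define D where "D = DIM(complex ^ 'n ^ 'n)"
  define f where "f = (\<lambda>k. mat_of (x ^ k))"
  show ?thesis
  proof (cases "inj_on f {..D}")
    case False
    then obtain i j where ij: "i \<noteq> j" "f i = f j" by (auto simp: inj_on_def)
    hence "x ^ i = x ^ j" by (simp add: f_def mat_of_inject)
    hence "peval (monom 1 i - monom 1 j) x = 0" by (simp add: peval_diff peval_monom)
    moreover have "monom 1 i - monom (1::complex) j \<noteq> 0" using ij(1) by (simp add: monom_eq_iff')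
    ultimately show ?thesis by blast
  next
    case True
    hence "card (f ` {..D}) = Suc D" by (simp add: card_image)
    hence "dependent (f ` {..D})" by (intro dependent_biggerset) (simp add: D_def)
    then obtain u where u: "\<exists>v\<in>f ` {..D}. u v \<noteq> 0" "(\<Sum>v\<in>f ` {..D}. u v *\<^sub>R v) = 0"
      by (auto simp: real_vector.dependent_finite)
    define p where "p = (\<Sum>k\<le>D. monom (complex_of_real (u (f k))) k)"
    have c: "coeff p k = complex_of_real (u (f k))" if "k \<le> D" for k
      using that by (simp add: p_def coeff_sum)
    have "mat_of (\<Sum>k\<in>S. y k) = (\<Sum>k\<in>S. mat_of (y k :: 'n mx))" for S :: "nat set" and y
      by (induction S rule: infinite_finite_induct) auto
    hence "mat_of (peval p x) = (\<Sum>k\<le>D. complex_of_real (u (f k)) *. f k)"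
      by (simp add: p_def peval_sum peval_monom f_def)
    also have "\<dots> = (\<Sum>k\<le>D. u (f k) *\<^sub>R f k)"
      by (intro sum.cong refl) (simp add: vec_eq_iff cscale_vec_def cscale_complex_def complex_eq_iff)
    also have "\<dots> = (\<Sum>v\<in>f ` {..D}. u v *\<^sub>R v)" using True by (simp add: sum.reindex)
    finally have "peval p x = 0" using u(2) by (metis mat_of_inject mat_of_simps(1))
    moreover have "p \<noteq> 0" using u(1) c by fastforce
    ultimately show ?thesis by blast
  qed
qed

definition dg :: "('n::finite => complex) => 'n mx" where
  "dg d = mx_of (\<chi> i j. if i = j then d i else 0)"

lemma dg_entry: "mat_of (dg d) $ i $ j = (if i = j then d i else 0)" by (simp add: dg_def)

lemma mx_entry_eqI: "(\<And>i j. mat_of x $ i $ j = mat_of y $ i $ j) ==> x = y"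
  by (metis mat_of_inject vec_eq_iff)

lemma dg_mult_left: "mat_of (dg d * x) $ i $ j = d i * mat_of x $ i $ j"
  by (simp add: matrix_matrix_mult_def dg_entry if_distrib[of "\<lambda>x. x * _"] cong: if_cong)

lemma dg_mult_right: "mat_of (x * dg d) $ i $ j = mat_of x $ i $ j * d j"
  by (simp add: matrix_matrix_mult_def dg_entry if_distrib[of "\<lambda>x. _ * x"] cong: if_cong)

lemma dg_add: "dg c + dg d = dg (\<lambda>i. c i + d i)" and dg_scale: "a *. dg d = dg (\<lambda>i. a * d i)"
  and dg_mult: "dg c * dg d = dg (\<lambda>i. c i * d i)" and dg_1: "dg (\<lambda>i. 1) = 1"
proof -
  show "dg c * dg d = dg (\<lambda>i. c i * d i)"
    by (rule mx_entry_eqI) (simp only: dg_mult_left, simp add: dg_entry)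
qed (rule mx_entry_eqI; simp add: dg_entry cscale_vec_def cscale_complex_def mat_def)+

lemma tr_dg: "tr (dg d) = (\<Sum>i\<in>UNIV. d i)" by (simp add: tr_def trace_def dg_entry)

lemma peval_dg: "peval p (dg d) = dg (\<lambda>i. poly p (d i))"
proof (induction p)
  case 0
  show ?case by (rule mx_entry_eqI) (simp add: dg_entry)
next
  case (pCons a p)
  thus ?case by (simp add: dg_mult dg_add dg_scale flip: dg_1)
qed

lemma peval_intertwine: "x * p = p * y ==> peval q x * p = p * peval q y"
proof (induction q)
  case (pCons a q)
  have "x * peval q x * p = p * (y * peval q y)" using pCons by (metis mult.assoc)
  thus ?case by (simp add: distrib_left distrib_right)
qed simp

lemma diagonalisable_dg:
  assumes "x * p = p * dg d" "p * q = 1" shows "diagonalisable x"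
proof -
  have "peval (root_prod (range d)) (dg d) = 0"
    unfolding peval_dg by (rule mx_entry_eqI) (auto simp: dg_entry poly_prod)
  with peval_intertwine[OF assms(1)] have "peval (root_prod (range d)) x * p = 0" by simp
  hence "peval (root_prod (range d)) x * (p * q) = 0" by (simp add: mult.assoc[symmetric])
  hence "peval (root_prod (range d)) x = 0" by (simp add: assms(2))
  thus ?thesis unfolding diagonalisable_def by (intro exI[of _ "range d"] conjI finite_imageI finite)
qed

lemma diagonalisable_eigenspan:
  fixes x :: "'n::finite mx"
  assumes "vec.span {v. \<exists>a. x *> v = a *. v} = UNIV"
  obtains p q d where "p * q = 1" "q * p = 1" "x = p * dg d * q"
proof -
  let ?E = "{v. \<exists>a. x *> v = a *. v}"
  obtain B where B: "B \<subseteq> ?E" "vec.independent B" "?E \<subseteq> vec.span B"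
    using vec.maximal_independent_subset by blast
  have sB: "vec.span B = UNIV" using B(3) assms vec.span_minimal[of ?E "vec.span B"] vec.subspace_span by auto
  have "card B = vec.dim (UNIV :: (complex^'n) set)"
    using B(2) sB by (intro vec.basis_card_eq_dim) auto
  hence "card B = CARD('n)" by (simp add: vec.dim_UNIV card_cart_basis)
  moreover have "finite B" using B(2) by (rule vec.finiteI_independent)
  ultimately obtain b where b: "bij_betw b (UNIV :: 'n set) B"
    by (metis finite_same_card_bij finite)
  define P where "P = (\<chi> i j. b j $ i)"
  have "columns P = B" using b by (auto simp: columns_def column_def P_def bij_betw_def vec_eq_iff image_def)
  then obtain Q where Q: "P ** Q = mat 1" using sB matrix_right_invertible_span_columns[of P] by auto
  hence Q': "Q ** P = mat 1" by (simp add: matrix_left_right_inverse)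
  define p q where "p = mx_of P" and "q = mx_of Q"
  have pq: "p * q = 1" "q * p = 1" using Q Q' by (metis mat_of_inject mat_of_mx_of mat_of_simps(2,6) p_def q_def)+
  have "\<forall>j. \<exists>a. x *> b j = a *. b j" using B(1) b by (auto simp: bij_betw_def)
  then obtain d where d: "\<And>j. x *> b j = d j *. b j" by metis
  have "x * p = p * dg d"
  proof (rule mx_entry_eqI)
    fix i j
    have "mat_of (x * p) $ i $ j = (x *> b j) $ i"
      by (simp add: app_def matrix_matrix_mult_def matrix_vector_mult_def p_def P_def)
    also have "\<dots> = mat_of (p * dg d) $ i $ j"
      unfolding d dg_mult_right by (simp add: p_def P_def cscale_vec_def cscale_complex_def)
    finally show "mat_of (x * p) $ i $ j = mat_of (p * dg d) $ i $ j" .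
  qed
  hence "x * (p * q) = p * dg d * q" by (simp add: mult.assoc[symmetric])
  hence "x = p * dg d * q" by (simp add: pq)
  with pq that show ?thesis by blast
qed

lemma diagonalisable_app_split:
  fixes x :: "'n::finite mx"
  assumes "diagonalisable x"
  obtains \<Lambda> L where "finite \<Lambda>" "1 = (\<Sum>a\<in>\<Lambda>. L a)" "\<And>a v. a \<in> \<Lambda> ==> x *> L a *> v = a *. (L a *> v)"
    "\<And>a y. x * y = y * x ==> L a * y = y * L a"
proof -
  obtain \<Lambda> L where L: "finite \<Lambda>" "1 = (\<Sum>a\<in>\<Lambda>. peval (L a) x)"
    "\<And>a. a \<in> \<Lambda> ==> x * peval (L a) x = a *. peval (L a) x" using diagonalisable_idem[OF assms] by blast
  show ?thesis
  proof (rule that[OF L(1,2)])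
    show "x *> peval (L a) x *> v = a *. (peval (L a) x *> v)" if "a \<in> \<Lambda>" for a v
      using L(3)[OF that] by (metis app_simps(3,9))
  qed (rule peval_commute)
qed

lemma diagonalisable_form:
  fixes x :: "'n::finite mx"
  assumes "diagonalisable x"
  obtains p q d where "p * q = 1" "q * p = 1" "x = p * dg d * q"
proof -
  obtain \<Lambda> L where L: "1 = (\<Sum>a\<in>\<Lambda>. L a)" "\<And>a v. a \<in> \<Lambda> ==> x *> L a *> v = a *. (L a *> v)"
    using diagonalisable_app_split[OF assms] by metis
  have "v \<in> vec.span {v. \<exists>a. x *> v = a *. v}" for v
  proof -
    have "v = (\<Sum>a\<in>\<Lambda>. L a *> v)" using L(1) by (metis app_simps(2) app_sum)
    also have "\<dots> \<in> vec.span {v. \<exists>a. x *> v = a *. v}"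
      by (intro vec.span_sum vec.span_base) (use L(2) in blast)
    finally show ?thesis .
  qed
  thus ?thesis using diagonalisable_eigenspan[of x] that by blast
qed

lemma semisimple_mat_iff: fixes x :: "'n::finite mx" shows "semisimple_mat (mat_of x) \<longleftrightarrow> diagonalisable x"
proof
  assume "semisimple_mat (mat_of x)"
  then obtain P D :: "'n cmat" where PD: "invertible P" "\<And>i j. i \<noteq> j ==> D $ i $ j = 0" "mat_of x ** P = P ** D"
    unfolding semisimple_mat_def by blast
  then obtain Q where Q: "P ** Q = mat 1" unfolding invertible_def by blast
  have "mx_of D = dg (\<lambda>i. D $ i $ i)" by (rule mx_entry_eqI) (auto simp: dg_entry PD(2))
  hence "x * mx_of P = mx_of P * dg (\<lambda>i. D $ i $ i)" using PD(3) by (metis mat_of_inject mat_of_mx_of mat_of_simps(6))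
  moreover have "mx_of P * mx_of Q = 1" using Q by (metis mat_of_inject mat_of_mx_of mat_of_simps(2,6))
  ultimately show "diagonalisable x" by (rule diagonalisable_dg)
next
  assume "diagonalisable x"
  then obtain p q d where pq: "p * q = 1" "q * p = 1" "x = p * dg d * q" by (rule diagonalisable_form)
  hence "x * p = p * dg d" by (simp add: mult.assoc)
  hence "mat_of x ** mat_of p = mat_of p ** mat_of (dg d)" by (metis mat_of_simps(6))
  moreover have "invertible (mat_of p)" using pq(1,2) unfolding invertible_def by (metis mat_of_simps(2,6))
  ultimately show "semisimple_mat (mat_of x)" unfolding semisimple_mat_def
    by (intro exI[of _ "mat_of p"] exI[of _ "mat_of (dg d)"]) (simp add: dg_entry)
qed

text \<open>The spectral components of \<open>x\<close> are polynomials in \<open>x\<close> and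
  commute with \<open>y\<close>, so applying components of both elements splits every vector into
  joint eigenvectors.\<close>

lemma diagonalisable_lincomb:
  fixes x y :: "'n::finite mx"
  assumes "diagonalisable x" "diagonalisable y" "x * y = y * x"
  shows "diagonalisable (x + c *. y)"
proof -
  obtain A L where L: "1 = (\<Sum>a\<in>A. L a)" "\<And>a v. a \<in> A ==> x *> L a *> v = a *. (L a *> v)"
    "\<And>a y. x * y = y * x ==> L a * y = y * L a"
    using diagonalisable_app_split[OF assms(1)] by metis
  obtain B M where M: "1 = (\<Sum>a\<in>B. M a)" "\<And>a v. a \<in> B ==> y *> M a *> v = a *. (M a *> v)"
    "\<And>a x. y * x = x * y ==> M a * x = x * M a"
    using diagonalisable_app_split[OF assms(2)] by metis
  let ?z = "x + c *. y"
  have e: "?z *> L a *> M b *> v = (a + c * b) *. (L a *> M b *> v)" if "a \<in> A" "b \<in> B" for a b v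
  proof -
    have "y *> L a *> M b *> v = b *. (L a *> M b *> v)"
      using L(3)[OF assms(3), of a] M(2)[OF that(2), of v] by (metis app_simps(3,10))
    thus ?thesis using L(2)[OF that(1), of "M b *> v"] by (simp add: cscale_simps)
  qed
  have "v \<in> vec.span {v. \<exists>a. ?z *> v = a *. v}" for v
  proof -
    have "v = (\<Sum>a\<in>A. L a *> (\<Sum>b\<in>B. M b *> v))" using L(1) M(1) by (metis app_simps(2) app_sum)
    also have "\<dots> = (\<Sum>a\<in>A. \<Sum>b\<in>B. L a *> M b *> v)"
      by (simp add: app_sum_right)
    also have "\<dots> \<in> vec.span {v. \<exists>a. ?z *> v = a *. v}"
      by (intro vec.span_sum vec.span_base) (use e in blast)
    finally show ?thesis .
  qed
  then obtain p q d where "p * q = 1" "q * p = 1" "?z = p * dg d * q" using diagonalisable_eigenspan[of ?z] by blast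
  thus ?thesis by (intro diagonalisable_dg[of _ p d q]) (simp_all add: mult.assoc)
qed

text \<open>Sandwiching \<open>y\<close> between the spectral components for a and b gives an
  eigenvector of \<open>ad t\<close> for a - b; the components are then collected by this
  difference.\<close>

lemma ad_eigen_split:
  fixes t y :: "'a::calg"
  assumes "diagonalisable t"
  obtains C x where "finite C" "y = (\<Sum>c\<in>C. x c)" "\<And>c. c \<in> C ==> ad t (x c) = c *. x c"
proof -
  obtain \<Lambda> L where L: "finite \<Lambda>" "1 = (\<Sum>a\<in>\<Lambda>. peval (L a) t)"
    "\<And>a. a \<in> \<Lambda> ==> t * peval (L a) t = a *. peval (L a) t" using diagonalisable_idem[OF assms] by blast
  define z where "z = (\<lambda>(a, b). peval (L a) t * y * peval (L b) t)"
  define S where "S = (\<lambda>c. {(a, b)\<in>\<Lambda> \<times> \<Lambda>. a - b = c})"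
  let ?C = "(\<lambda>(a, b). a - b) ` (\<Lambda> \<times> \<Lambda>)"
  have fS: "finite (S c)" for c by (rule finite_subset[of _ "\<Lambda> \<times> \<Lambda>"]) (auto simp: S_def L(1))
  have "y = (\<Sum>a\<in>\<Lambda>. peval (L a) t) * y * (\<Sum>b\<in>\<Lambda>. peval (L b) t)" using L(2) by simp
  also have "\<dots> = (\<Sum>a\<in>\<Lambda>. peval (L a) t * (y * (\<Sum>b\<in>\<Lambda>. peval (L b) t)))"
    by (simp only: mult.assoc sum_distrib_right)
  also have "\<dots> = (\<Sum>a\<in>\<Lambda>. \<Sum>b\<in>\<Lambda>. z (a, b))"
    by (simp add: z_def sum_distrib_left mult.assoc)
  also have "\<dots> = (\<Sum>p\<in>\<Lambda> \<times> \<Lambda>. z p)" by (simp add: sum.cartesian_product)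
  also have "\<dots> = (\<Sum>c\<in>?C. \<Sum>p\<in>{p\<in>\<Lambda> \<times> \<Lambda>. (\<lambda>(a, b). a - b) p = c}. z p)"
    by (rule sum.image_gen) (simp add: L(1))
  also have "\<dots> = (\<Sum>c\<in>?C. \<Sum>p\<in>S c. z p)" by (intro sum.cong refl) (auto simp: S_def)
  finally have y: "y = (\<Sum>c\<in>?C. \<Sum>p\<in>S c. z p)" .
  have e: "ad t (z p) = c *. z p" if p': "p \<in> S c" for p c
  proof -
    have p: "fst p \<in> \<Lambda>" "snd p \<in> \<Lambda>" "c = fst p - snd p" using p' by (auto simp: S_def)
    have z: "z p = peval (L (fst p)) t * y * peval (L (snd p)) t" by (simp add: z_def case_prod_beta)
    have "peval (L (snd p)) t * t = snd p *. peval (L (snd p)) t" using L(3)[OF p(2)] peval_commute[of t t] by simp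
    hence "z p * t = snd p *. z p" by (simp add: z mult.assoc)
    moreover have "t * z p = fst p *. z p" by (simp add: z mult.assoc[symmetric] L(3)[OF p(1)])
    ultimately show ?thesis by (simp add: ad_def p(3) cscale_simps)
  qed
  define w where "w c = (\<Sum>p\<in>S c. z p)" for c
  have "ad t (w c) = c *. w c" for c using e[of _ c] by (simp add: w_def ad_sum cv.scale_sum_right)
  with y that[of ?C w] L(1) show ?thesis by (simp add: w_def)
qed

text \<open>\<open>ad t\<close> is itself diagonalisable, so a vector killed by one of its powers
  has only a component for 0. The components are separated by \<open>eigen_component_mem\<close>
  with the zero subspace.\<close>

lemma ad_diagonalisable_square:
  fixes t y :: "'a::calg"
  assumes "diagonalisable t" "(ad t ^^ k) y = 0" shows "ad t y = 0"
proof -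
  obtain C x where x: "finite C" "y = (\<Sum>c\<in>C. x c)" "\<And>c. c \<in> C ==> ad t (x c) = c *. x c"
    by (rule ad_eigen_split[OF assms(1), of y]) blast
  have p: "(ad t ^^ k) (x c) = c ^ k *. x c" if "c \<in> C" for k c
    by (induction k) (auto simp: x(3)[OF that] ad_scale cscale_cscale mult.commute)
  have "(\<Sum>c\<in>C. c ^ k *. x c) = 0"
    using assms(2) by (simp add: x(2) clin_sum[OF clin_funpow[OF clin_ad]] p)
  hence "\<forall>c\<in>C. c ^ k *. x c \<in> {0}"
    by (intro eigen_component_mem[OF clin_ad[of t]])
       (auto simp: x(1,3) ad_scale cscale_cscale mult.commute)
  hence "\<forall>c\<in>C. c *. x c = 0" by auto
  hence "(\<Sum>c\<in>C. c *. x c) = 0" by (rule sum.neutral)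
  moreover have "ad t y = (\<Sum>c\<in>C. c *. x c)"
    unfolding x(2) ad_sum by (intro sum.cong refl x(3))
  ultimately show ?thesis by simp
qed

section \<open>Polynomial functions and the Lie algebra of a linear algebraic group\<close>

definition mderiv :: "(complex => 'n::finite mx) => 'n mx => complex => bool" where
  "mderiv \<Phi> D s \<longleftrightarrow> (\<forall>i j. ((\<lambda>t. mat_of (\<Phi> t) $ i $ j) has_field_derivative mat_of D $ i $ j) (at s))"

lemma mderiv_const: "mderiv (\<lambda>t. x) 0 s"
  by (auto simp: mderiv_def)

lemma mderiv_add: "mderiv \<Phi> D s ==> mderiv \<Psi> E s ==> mderiv (\<lambda>t. \<Phi> t + \<Psi> t) (D + E) s"
  by (auto simp: mderiv_def intro!: DERIV_add)

lemma mderiv_sum: "(\<And>k. k \<in> K ==> mderiv (\<Phi> k) (D k) s) ==> mderiv (\<lambda>t. \<Sum>k\<in>K. \<Phi> k t) (\<Sum>k\<in>K. D k) s"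
  by (induction K rule: infinite_finite_induct) (auto intro: mderiv_add mderiv_const)

lemma mderiv_mult: assumes "mderiv \<Phi> D s" "mderiv \<Psi> E s"
  shows "mderiv (\<lambda>t. \<Phi> t * \<Psi> t) (D * \<Psi> s + \<Phi> s * E) s"
proof -
  have "((\<lambda>t. \<Sum>k\<in>UNIV. mat_of (\<Phi> t) $ i $ k * mat_of (\<Psi> t) $ k $ j) has_field_derivative
    (\<Sum>k\<in>UNIV. mat_of D $ i $ k * mat_of (\<Psi> s) $ k $ j + mat_of E $ k $ j * mat_of (\<Phi> s) $ i $ k)) (at s)" for i j
    using assms by (intro DERIV_sum DERIV_mult') (auto simp: mderiv_def add.commute intro: DERIV_mult)
  thus ?thesis by (simp add: mderiv_def matrix_matrix_mult_def sum.distrib mult.commute)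
qed

lemma mderiv_cscale: assumes "(f has_field_derivative c) (at s)" shows "mderiv (\<lambda>t. f t *. x) (c *. x) s"
  using assms by (auto simp: mderiv_def cscale_vec_def cscale_complex_def intro!: DERIV_cmult_right)

lemma mderiv_dg: assumes "\<And>i. ((\<lambda>t. f t i) has_field_derivative c i) (at s)" shows "mderiv (\<lambda>t. dg (f t)) (dg c) s"
  using assms by (auto simp: mderiv_def dg_entry)

definition pd :: "('n::finite cmat => complex) => 'n mx => 'n mx => complex" where
  "pd p a x = deriv (\<lambda>t. p (mat_of (a + t *. x))) 0"

lemma mderiv_line: "mderiv (\<lambda>t. a + t *. x) x s"
  using mderiv_add[OF mderiv_const mderiv_cscale[OF DERIV_ident]] by simp

lemma pd_eqI: "((\<lambda>t. p (mat_of (a + t *. x))) has_field_derivative D) (at 0) ==> pd p a x = D"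
  unfolding pd_def by (rule DERIV_imp_deriv)

lemma pd_chain: "poly_fun p ==> mderiv \<Phi> D s ==> ((\<lambda>t. p (mat_of (\<Phi> t))) has_field_derivative pd p (\<Phi> s) D) (at s)"
proof (induction arbitrary: \<Phi> D s rule: poly_fun.induct)
  case (const c)
  thus ?case by (simp add: pd_def)
next
  case (coord i j)
  have "pd (\<lambda>A. A $ i $ j) (\<Phi> s) D = mat_of D $ i $ j"
    by (rule pd_eqI) (use mderiv_line[of "\<Phi> s" D 0] in \<open>auto simp: mderiv_def\<close>)
  thus ?case using coord by (simp add: mderiv_def)
next
  case (add p q)
  have "pd (\<lambda>A. p A + q A) (\<Phi> s) D = pd p (\<Phi> s) D + pd q (\<Phi> s) D"
    using add.IH[OF mderiv_line[of "\<Phi> s" D 0]] by (intro pd_eqI DERIV_add) simp_all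
  thus ?case using add by (auto intro: DERIV_add)
next
  case (mult p q)
  have "pd (\<lambda>A. p A * q A) (\<Phi> s) D = pd p (\<Phi> s) D * q (mat_of (\<Phi> s)) + pd q (\<Phi> s) D * p (mat_of (\<Phi> s))"
    using mult.IH[OF mderiv_line[of "\<Phi> s" D 0]] by (intro pd_eqI) (auto dest: DERIV_mult)
  thus ?case using DERIV_mult[OF mult.IH(1)[OF mult.prems] mult.IH(2)[OF mult.prems]] by simp
qed

lemma pd_const [simp]: "pd (\<lambda>A. c) a x = 0"
  by (simp add: pd_def)

lemma pd_line: "poly_fun p ==> ((\<lambda>t. p (mat_of (a + t *. x))) has_field_derivative pd p a x) (at 0)"
  using pd_chain[OF _ mderiv_line[of a x 0], of p] by simp

lemma pd_add: "poly_fun p ==> poly_fun q ==> pd (\<lambda>A. p A + q A) a x = pd p a x + pd q a x"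
  by (rule pd_eqI, rule DERIV_add) (rule pd_line, assumption)+

lemma pd_mult: "poly_fun p ==> poly_fun q ==> pd (\<lambda>A. p A * q A) a x = pd p a x * q (mat_of a) + p (mat_of a) * pd q a x"
  using DERIV_mult[OF pd_line[of p a x] pd_line[of q a x]] by (intro pd_eqI) (simp add: mult.commute)

lemma pd_coord: "pd (\<lambda>A. A $ i $ j) a x = mat_of x $ i $ j"
  by (rule pd_eqI) (use mderiv_line[of a x 0] in \<open>auto simp: mderiv_def\<close>)

lemma pd_clin: "poly_fun p ==> clin (pd p a)"
  by (induction rule: poly_fun.induct) 
     (auto simp: clin_def pd_add pd_mult pd_coord cscale_vec_def cscale_complex_def algebra_simps)

lemma poly_fun_sum: "(\<And>k. k \<in> K ==> poly_fun (f k)) ==> poly_fun (\<lambda>A. \<Sum>k\<in>K. f k A)"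
  by (induction K rule: infinite_finite_induct) (auto intro: poly_fun.intros)

lemma poly_fun_mult_const: "poly_fun (\<lambda>A. mat_of (b * mx_of A * c) $ i $ j)"
  by (auto simp: matrix_matrix_mult_def intro!: poly_fun_sum poly_fun.intros)

lemma poly_fun_comp: "poly_fun p ==> poly_fun (\<lambda>A. p (mat_of (b * mx_of A * c)))"
proof (induction rule: poly_fun.induct)
  case (coord i j)
  show ?case by (rule poly_fun_mult_const)
qed (auto intro: poly_fun.intros)

lemma pd_comp: "poly_fun p ==> pd (\<lambda>A. p (mat_of (b * mx_of A * c))) a x = pd p (b * a * c) (b * x * c)"
proof (rule pd_eqI)
  assume p: "poly_fun p"
  have "mderiv (\<lambda>t. b * (a + t *. x) * c) (b * x * c) 0"
    using mderiv_mult[OF mderiv_mult[OF mderiv_const[of b] mderiv_line[of a x]] mderiv_const[of c], of 0] by simp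
  from pd_chain[OF p this] show "((\<lambda>t. p (mat_of (b * mx_of (mat_of (a + t *. x)) * c))) has_field_derivative pd p (b * a * c) (b * x * c)) (at 0)"
    by (simp add: mat_of_inverse)
qed

text \<open>The left-invariant vector field A \<mapsto> A x, as a derivation of the polynomial
  functions.\<close>

definition DX :: "'n::finite mx => ('n cmat => complex) => ('n cmat => complex)" where
  "DX x p = (\<lambda>A. pd p (mx_of A) (mx_of A * x))"

lemma DX_const: "DX x (\<lambda>A. c) = (\<lambda>A. 0)"
  and DX_add: "poly_fun p ==> poly_fun q ==> DX x (\<lambda>A. p A + q A) = (\<lambda>A. DX x p A + DX x q A)"
  and DX_mult: "poly_fun p ==> poly_fun q ==> DX x (\<lambda>A. p A * q A) = (\<lambda>A. DX x p A * q A + p A * DX x q A)"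
  and DX_coord: "DX x (\<lambda>A. A $ i $ j) = (\<lambda>A. mat_of (mx_of A * x) $ i $ j)"
  by (simp_all add: DX_def pd_add pd_mult pd_coord)

lemma poly_fun_DX: "poly_fun p ==> poly_fun (DX x p)"
proof (induction rule: poly_fun.induct)
  case (coord i j)
  thus ?case using poly_fun_mult_const[of 1] by (simp add: DX_coord)
qed (auto simp: DX_const DX_add DX_mult intro: poly_fun.intros)

lemma DX_coord2: "DX y (\<lambda>A. mat_of (mx_of A * x) $ i $ j) = (\<lambda>A. mat_of (mx_of A * (y * x)) $ i $ j)"
  using pd_comp[OF poly_fun.coord[of i j], of 1 x] by (simp add: DX_def pd_coord mat_of_inverse mult.assoc del: mat_of_simps)

text \<open>The commutator of two derivations is a derivation, so the identity is inherited by sums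
  and products from the coordinate functions.\<close>

lemma DX_bracket: "poly_fun p ==> DX x (DX y p) A - DX y (DX x p) A = DX (ad x y) p A"
proof (induction arbitrary: A rule: poly_fun.induct)
  case (coord i j)
  have "DX z (\<lambda>A. A $ i $ j) = (\<lambda>A. mat_of (mx_of A * z) $ i $ j)" for z by (rule DX_coord)
  thus ?case by (simp add: DX_coord2 ad_def right_diff_distrib del: mat_of_simps) (simp add: mat_of_simps)
next
  case (mult p q)
  have e: "DX x (DX y (\<lambda>A. p A * q A)) A = DX x (DX y p) A * q A + DX y p A * DX x q A
      + (DX x p A * DX y q A + p A * DX x (DX y q) A)" for x y
    using mult.hyps by (simp add: DX_mult DX_add poly_fun_DX poly_fun.mult)
  have r: "DX (ad x y) (\<lambda>A. p A * q A) A = (DX x (DX y p) A - DX y (DX x p) A) * q A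
      + p A * (DX x (DX y q) A - DX y (DX x q) A)"
    by (simp only: DX_mult[OF mult.hyps] mult.IH)
  have i: "(a * u + b * c + (d * f + v * h)) - (a' * u + d * f + (b * c + v * h')) = (a - a') * u + v * (h - h')"
    for a a' b c d f h h' u v :: complex by (simp add: algebra_simps)
  show ?case by (simp only: e r i)
next
  case (add p q)
  have e: "DX x (DX y (\<lambda>A. p A + q A)) A = DX x (DX y p) A + DX x (DX y q) A" for x y
    using add.hyps by (simp add: DX_add poly_fun_DX)
  have r: "DX (ad x y) (\<lambda>A. p A + q A) A = (DX x (DX y p) A - DX y (DX x p) A)
      + (DX x (DX y q) A - DX y (DX x q) A)"
    by (simp only: DX_add[OF add.hyps] add.IH)
  have i: "(a + b) - (c + d) = (a - c) + (b - d)" for a b c d :: complex by simp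
  show ?case by (simp only: e r i)
qed (simp add: DX_const)

locale alg_group =
  fixes G :: "'n::finite mx set" and F :: "('n cmat => complex) set"
  assumes F: "p \<in> F ==> poly_fun p"
    and G: "a \<in> G \<longleftrightarrow> (\<exists>b. a * b = 1) \<and> (\<forall>p\<in>F. p (mat_of a) = 0)"
    and one: "1 \<in> G" and mult: "a \<in> G ==> b \<in> G ==> a * b \<in> G"
    and inv: "a \<in> G ==> \<exists>b\<in>G. a * b = 1 \<and> b * a = 1"
begin

definition I :: "('n cmat => complex) set" where
  "I = {p. poly_fun p \<and> (\<forall>a\<in>G. p (mat_of a) = 0)}"

definition lie :: "'n mx set" where "lie = {x. \<forall>p\<in>I. pd p 1 x = 0}"

lemma lie_subspace: "cv.subspace lie"
proof -
  have c: "clin (pd p 1)" if "p \<in> I" for p using that by (intro pd_clin) (simp add: I_def)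
  show ?thesis
    by (rule cv.subspaceI) (simp_all add: lie_def clin_0[OF c] clin_add[OF c] clin_scale[OF c])
qed

lemma I_comp: "p \<in> I ==> b \<in> G ==> c \<in> G ==> (\<lambda>A. p (mat_of (b * mx_of A * c))) \<in> I"
  by (auto simp: I_def poly_fun_comp mat_of_inverse mult simp del: mat_of_simps)

text \<open>Left translation by a group element maps the ideal into itself and carries the
  derivative at 1 to the derivative at that element.\<close>

lemma DX_I: assumes "x \<in> lie" "p \<in> I" shows "DX x p \<in> I"
proof -
  have "DX x p (mat_of a) = 0" if "a \<in> G" for a
  proof -
    have "pd (\<lambda>A. p (mat_of (a * mx_of A * 1))) 1 x = 0"
      using I_comp[OF assms(2) that one] assms(1) by (auto simp: lie_def)
    thus ?thesis using assms(2) pd_comp[of p a 1 1 x] by (simp add: DX_def mat_of_inverse I_def del: mat_of_simps)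
  qed
  thus ?thesis using assms poly_fun_DX by (auto simp: I_def)
qed

lemma lie_DX: "x \<in> lie \<longleftrightarrow> (\<forall>p\<in>I. DX x p (mat_of 1) = 0)"
  by (simp add: lie_def DX_def mat_of_inverse del: mat_of_simps)

lemma lie_ad: assumes "x \<in> lie" "y \<in> lie" shows "ad x y \<in> lie"
  unfolding lie_DX
proof
  fix p assume p: "p \<in> I"
  hence "DX x (DX y p) (mat_of 1) = 0" "DX y (DX x p) (mat_of 1) = 0"
    using DX_I[OF assms(1) DX_I[OF assms(2) p]] DX_I[OF assms(2) DX_I[OF assms(1) p]] one unfolding I_def by blast+
  thus "DX (ad x y) p (mat_of 1) = 0" using DX_bracket[of p x y "mat_of 1"] p by (simp add: I_def)
qed

lemma lie_conj: assumes "x \<in> lie" "a \<in> G" "b \<in> G" "a * b = 1" shows "a * x * b \<in> lie"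
  unfolding lie_def
proof safe
  fix p assume p: "p \<in> I"
  hence "pd (\<lambda>A. p (mat_of (a * mx_of A * b))) 1 x = 0"
    using I_comp[OF p assms(2,3)] assms(1) unfolding lie_def by blast
  thus "pd p 1 (a * x * b) = 0" using pd_comp[of p a b 1 x] p assms(4) by (simp add: I_def)
qed

text \<open>Along a curve with \<Phi>' = \<Phi> x, differentiation is \<open>DX x\<close>, which
  preserves \<open>I\<close>. Hence all derivatives at t = 0 vanish, and the entire function is
  0.\<close>

lemma one_parameter:
  assumes x: "x \<in> lie" and \<Phi>: "\<And>s. mderiv \<Phi> (\<Phi> s * x) s" "\<Phi> 0 = 1" and p: "p \<in> I"
  shows "p (mat_of (\<Phi> t)) = 0"
proof -
  have I: "(DX x ^^ k) p \<in> I" for k using p by (induction k) (auto intro: DX_I x)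
  have d: "((\<lambda>t. q (mat_of (\<Phi> t))) has_field_derivative DX x q (mat_of (\<Phi> s))) (at s)" if "q \<in> I" for q s
    using pd_chain[OF _ \<Phi>(1), of q s] that by (simp add: DX_def I_def mat_of_inverse)
  have dk: "(deriv ^^ k) (\<lambda>t. p (mat_of (\<Phi> t))) = (\<lambda>t. (DX x ^^ k) p (mat_of (\<Phi> t)))" for k
  proof (induction k)
    case (Suc k)
    have "deriv (\<lambda>t. (DX x ^^ k) p (mat_of (\<Phi> t))) = (\<lambda>s. DX x ((DX x ^^ k) p) (mat_of (\<Phi> s)))"
      by (rule ext, rule DERIV_imp_deriv, rule d[OF I])
    thus ?case using Suc by simp
  qed simp
  show ?thesis
  proof (rule holomorphic_fun_eq_0_on_connected[of "\<lambda>t. p (mat_of (\<Phi> t))" UNIV 0])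
    show "(\<lambda>t. p (mat_of (\<Phi> t))) holomorphic_on UNIV"
      using d[OF p] by (auto simp: holomorphic_on_open)
    show "(deriv ^^ n) (\<lambda>t. p (mat_of (\<Phi> t))) 0 = 0" for n
      using I[of n] one unfolding dk \<Phi>(2) I_def by blast
  qed auto
qed

end

section \<open>Exponential polynomials\<close>

text \<open>For additive \<open>f\<close>, an exponential polynomial in \<open>t\<close> is deformed by a parameter \<open>s\<close> that replaces
  \<open>exp (\<kappa> t)\<close> by \<open>exp (\<kappa> t + s f \<kappa>)\<close>. By linear independence of exponentials, an identity at
  \<open>s = 0\<close> persists for all \<open>s\<close>.\<close>

inductive expoly :: "(complex => complex) => (complex => complex => complex) => bool" for f where
  mono: "expoly f (\<lambda>s t. c * exp (\<kappa> * t + s * f \<kappa>) * t ^ k)"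
| add: "expoly f u ==> expoly f v ==> expoly f (\<lambda>s t. u s t + v s t)"

lemma expoly_mult:
  assumes f: "\<And>x y. f (x + y) = f x + f y" and u: "expoly f u" and v: "expoly f v"
  shows "expoly f (\<lambda>s t. u s t * v s t)"
  using u
proof induction
  case (mono c \<kappa> k)
  show ?case using v
  proof induction
    case (mono c' \<kappa>' k')
    have "c * exp (\<kappa> * t + s * f \<kappa>) * t ^ k * (c' * exp (\<kappa>' * t + s * f \<kappa>') * t ^ k') =
      (c * c') * exp ((\<kappa> + \<kappa>') * t + s * f (\<kappa> + \<kappa>')) * t ^ (k + k')" for s t
    proof -
      have "(\<kappa> + \<kappa>') * t + s * f (\<kappa> + \<kappa>') = (\<kappa> * t + s * f \<kappa>) + (\<kappa>' * t + s * f \<kappa>')"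
        by (simp add: f algebra_simps)
      thus ?thesis by (simp only: exp_add power_add) (simp only: mult_ac)
    qed
    thus ?case using expoly.mono[of f "c * c'" "\<kappa> + \<kappa>'" "k + k'"] by (simp only:)
  next
    case (add u v)
    thus ?case using expoly.add[OF add.IH] by (simp add: distrib_left)
  qed
next
  case (add u v)
  thus ?case using expoly.add[OF add.IH] by (simp add: distrib_right)
qed

lemma expoly_const: assumes f: "\<And>x y. f (x + y) = f x + f y" shows "expoly f (\<lambda>s t. c)"
proof -
  have "f 0 = 0" using f[of 0 0] by simp
  thus ?thesis using expoly.mono[of f c 0 0] by simp
qed

lemma expoly_sum: assumes f: "\<And>x y. f (x + y) = f x + f y" and "\<And>k. k \<in> K ==> expoly f (u k)"
  shows "expoly f (\<lambda>s t. \<Sum>k\<in>K. u k s t)"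
  using assms(2) by (induction K rule: infinite_finite_induct) (auto intro: expoly.add expoly_const[OF f])

lemma expoly_form:
  assumes "expoly f u"
  obtains K R where "finite K" "\<And>s t. u s t = (\<Sum>\<kappa>\<in>K. exp (\<kappa> * t + s * f \<kappa>) * poly (R \<kappa>) t)"
proof -
  have "\<exists>K R. finite K \<and> (\<forall>\<kappa>. \<kappa> \<notin> K --> R \<kappa> = 0) \<and> (\<forall>s t. u s t = (\<Sum>\<kappa>\<in>K. exp (\<kappa> * t + s * f \<kappa>) * poly (R \<kappa>) t))"
    using assms
  proof induction
    case (mono c \<kappa> k)
    thus ?case
      by (intro exI[of _ "{\<kappa>}"] exI[of _ "\<lambda>\<psi>. if \<psi> = \<kappa> then monom c k else 0"]) (auto simp: poly_monom)
  next
    case (add u v)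
    from add.IH(1) obtain K R where K: "finite K" "\<And>\<kappa>. \<kappa> \<notin> K ==> R \<kappa> = 0" "\<And>s t. u s t = (\<Sum>\<kappa>\<in>K. exp (\<kappa> * t + s * f \<kappa>) * poly (R \<kappa>) t)"
      by blast
    from add.IH(2) obtain L S where L: "finite L" "\<And>\<kappa>. \<kappa> \<notin> L ==> S \<kappa> = 0" "\<And>s t. v s t = (\<Sum>\<kappa>\<in>L. exp (\<kappa> * t + s * f \<kappa>) * poly (S \<kappa>) t)" by blast
    have "u s t = (\<Sum>\<kappa>\<in>K\<union>L. exp (\<kappa> * t + s * f \<kappa>) * poly (R \<kappa>) t)" for s t
      unfolding K(3) by (rule sum.mono_neutral_left) (auto simp: K L)
    moreover have "v s t = (\<Sum>\<kappa>\<in>K\<union>L. exp (\<kappa> * t + s * f \<kappa>) * poly (S \<kappa>) t)" for s t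
      unfolding L(3) by (rule sum.mono_neutral_left) (auto simp: K L)
    ultimately show ?case
      by (intro exI[of _ "K \<union> L"] exI[of _ "\<lambda>\<kappa>. R \<kappa> + S \<kappa>"]) (auto simp: K L distrib_left sum.distrib)
  qed
  thus ?thesis using that by blast
qed

text \<open>The leading coefficient gets multiplied by \<open>c\<close>, since the derivative has
  smaller degree.\<close>

lemma pderiv_shift_eq_0:
  fixes r :: "complex poly" assumes "c \<noteq> 0" "pderiv r + Polynomial.smult c r = 0" shows "r = 0"
proof (rule ccontr)
  assume "r \<noteq> 0"
  have "coeff (pderiv r) (degree r) = 0" by (simp add: coeff_pderiv coeff_eq_0)
  hence "coeff (pderiv r + Polynomial.smult c r) (degree r) = c * lead_coeff r" by simp
  thus False using assms \<open>r \<noteq> 0\<close> by simp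
qed

text \<open>Divide by exp(c t) and differentiate until the polynomial belonging to \<open>c\<close>
  is gone. The effect on the remaining coefficients is injective, so induction on the set of
  exponents applies.\<close>

lemma exp_poly_independent:
  assumes "finite K" "\<And>t. (\<Sum>\<kappa>\<in>K. exp (\<kappa> * t) * poly (R \<kappa>) t) = (0::complex)"
  shows "\<forall>\<kappa>\<in>K. R \<kappa> = 0"
  using assms
proof (induction K arbitrary: R)
  case (insert c K)
  \<comment> \<open>The derivative of exp((\<kappa> - c) t) r(t) is exp((\<kappa> - c) t) times
    \<open>L \<kappa> r\<close>.\<close>
  define L where "L = (\<lambda>\<kappa> r. pderiv r + Polynomial.smult (\<kappa> - c) r)"
  have step: "((\<lambda>t. poly q t + (\<Sum>\<kappa>\<in>K. exp ((\<kappa> - c) * t) * poly (S \<kappa>) t)) has_field_derivative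
      poly (pderiv q) t + (\<Sum>\<kappa>\<in>K. exp ((\<kappa> - c) * t) * poly (L \<kappa> (S \<kappa>)) t)) (at t)" for q S t
    by (auto intro!: derivative_eq_intros poly_DERIV sum.cong simp: L_def algebra_simps)
  have Z: "poly ((pderiv ^^ n) (R c)) t + (\<Sum>\<kappa>\<in>K. exp ((\<kappa> - c) * t) * poly ((L \<kappa> ^^ n) (R \<kappa>)) t) = 0" for n t
  proof (induction n arbitrary: t)
    case 0
    have "exp (- c * t) * (\<Sum>\<kappa>\<in>insert c K. exp (\<kappa> * t) * poly (R \<kappa>) t) = 0" using insert.prems by simp
    also have "exp (- c * t) * (\<Sum>\<kappa>\<in>insert c K. exp (\<kappa> * t) * poly (R \<kappa>) t) =
      (\<Sum>\<kappa>\<in>insert c K. exp ((\<kappa> - c) * t) * poly (R \<kappa>) t)"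
    proof -
      have "exp (- c * t) * exp (\<kappa> * t) = exp ((\<kappa> - c) * t)" for \<kappa>
        by (simp add: exp_add[symmetric] algebra_simps)
      thus ?thesis unfolding sum_distrib_left mult.assoc[symmetric] by simp
    qed
    finally show ?case using insert.hyps by simp
  next
    case (Suc n)
    have "((\<lambda>t. 0) has_field_derivative
      poly ((pderiv ^^ Suc n) (R c)) t + (\<Sum>\<kappa>\<in>K. exp ((\<kappa> - c) * t) * poly ((L \<kappa> ^^ Suc n) (R \<kappa>)) t)) (at t)"
      using step[of "(pderiv ^^ n) (R c)" "\<lambda>\<kappa>. (L \<kappa> ^^ n) (R \<kappa>)" t] unfolding Suc by simp
    thus ?case by (rule DERIV_unique[OF _ DERIV_const])
  qed
  define n where "n = Suc (degree (R c))"
  have "(pderiv ^^ n) (R c) = 0"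
    using degree_higher_pderiv[of "degree (R c)" "R c"] by (simp add: n_def pderiv_eq_0_iff)
  hence *: "(\<Sum>\<kappa>\<in>K. exp ((\<kappa> - c) * t) * poly ((L \<kappa> ^^ n) (R \<kappa>)) t) = 0" for t using Z[of n t] by simp
  have "(\<Sum>\<kappa>\<in>K. exp (\<kappa> * t) * poly ((L \<kappa> ^^ n) (R \<kappa>)) t) = 0" for t
  proof -
    have "exp (c * t) * exp ((\<kappa> - c) * t) = exp (\<kappa> * t)" for \<kappa>
      by (simp add: exp_add[symmetric] algebra_simps)
    hence "(\<Sum>\<kappa>\<in>K. exp (\<kappa> * t) * poly ((L \<kappa> ^^ n) (R \<kappa>)) t) = exp (c * t) * (\<Sum>\<kappa>\<in>K. exp ((\<kappa> - c) * t) * poly ((L \<kappa> ^^ n) (R \<kappa>)) t)"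
      unfolding sum_distrib_left mult.assoc[symmetric] by simp
    thus ?thesis using * by simp
  qed
  hence L0: "\<forall>\<kappa>\<in>K. (L \<kappa> ^^ n) (R \<kappa>) = 0" by (rule insert.IH)
  have "R \<kappa> = 0" if "\<kappa> \<in> K" for \<kappa>
  proof -
    have "(L \<kappa> ^^ k) (R \<kappa>) = 0 ==> R \<kappa> = 0" for k
      using that insert.hyps by (induction k) (auto simp: L_def dest: pderiv_shift_eq_0[rotated])
    thus ?thesis using L0 that by blast
  qed
  moreover have "R c = 0"
  proof -
    have "poly (R c) t = 0" for t using Z[of 0 t] calculation by simp
    thus ?thesis using poly_all_0_iff_0 by blast
  qed
  ultimately show ?case by blast
qed simp

section \<open>One-parameter groups of nilpotent matrices, and replicas\<close>

definition expN :: "'n::finite mx => nat => complex => 'n mx" where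
  "expN x m t = (\<Sum>k<m. (t ^ k / fact k) *. x ^ k)"

lemma expN_0: "x ^ m = 0 ==> expN x m 0 = 1"
  by (cases m) (auto simp: expN_def sum.lessThan_Suc_shift simp del: sum.lessThan_Suc)

lemma expN_commute: "x * y = y * x ==> expN x m t * y = y * expN x m t"
proof -
  assume "x * y = y * x"
  hence "x ^ k * y = y * x ^ k" for k
    using peval_commute[of x y "monom 1 k"] by (simp add: peval_monom)
  thus ?thesis by (simp add: expN_def sum_distrib_left sum_distrib_right)
qed

lemma mderiv_expN: assumes "x ^ m = 0" shows "mderiv (expN x m) (x * expN x m s) s"
proof (cases m)
  case 0
  hence "(1::'a mx) = 0" using assms by simp
  thus ?thesis by simp
next
  case (Suc n)
  have "((\<lambda>t. t ^ k / fact k) has_field_derivative of_nat k * s ^ (k - 1) / fact k) (at s)" for k :: nat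
    by (auto intro!: derivative_eq_intros)
  hence "mderiv (\<lambda>t. \<Sum>k<m. (t ^ k / fact k) *. x ^ k) (\<Sum>k<m. (of_nat k * s ^ (k - 1) / fact k) *. x ^ k) s"
    by (intro mderiv_sum mderiv_cscale)
  moreover have "(\<Sum>k<m. (of_nat k * s ^ (k - 1) / fact k) *. x ^ k) = (\<Sum>k<n. (s ^ k / fact k) *. x ^ Suc k)"
    unfolding Suc sum.lessThan_Suc_shift by (simp add: field_simps del: of_nat_Suc power_Suc) 
  moreover have "x * expN x m s = (\<Sum>k<n. (s ^ k / fact k) *. x ^ Suc k)"
    using assms by (simp add: expN_def sum_distrib_left distrib_left Suc)
  ultimately show ?thesis by (simp add: expN_def[abs_def])
qed

text \<open>The product has derivative 0 and is 1 at t = 0.\<close>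

lemma expN_add: assumes "x ^ m = 0" shows "expN x m t * expN x m (- t) = 1"
proof -
  define \<Phi> where "\<Phi> = (\<lambda>t. expN x m t * expN x m (- t))"
  have c: "expN x m s * x = x * expN x m s" for s by (rule expN_commute) simp
  have n: "mderiv (\<lambda>t. expN x m (- t)) (- (x * expN x m (- s))) s" for s
    using mderiv_expN[OF assms, of "- s"] unfolding mderiv_def
    by (auto intro!: DERIV_chain2[where g = uminus and Db = "-1", simplified] derivative_eq_intros)
  have "mderiv \<Phi> (x * expN x m s * expN x m (- s) + expN x m s * - (x * expN x m (- s))) s" for s
    unfolding \<Phi>_def by (rule mderiv_mult[OF mderiv_expN[OF assms] n])
  hence "mderiv \<Phi> 0 s" for s by (simp add: c mult.assoc[symmetric])
  hence "\<exists>c. \<forall>t. mat_of (\<Phi> t) $ i $ j = c" for i j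
    using has_field_derivative_zero_constant[of UNIV "\<lambda>t. mat_of (\<Phi> t) $ i $ j"] by (auto simp: mderiv_def)
  hence "mat_of (\<Phi> t) $ i $ j = mat_of (\<Phi> 0) $ i $ j" for i j by metis
  hence "\<Phi> t = \<Phi> 0" by (rule mx_entry_eqI)
  thus ?thesis by (simp add: \<Phi>_def expN_0[OF assms])
qed

lemma expoly_mx_mult:
  assumes f: "\<And>x y. f (x + y) = f x + f y"
    and "\<And>i j. expoly f (\<lambda>s t. mat_of (u s t) $ i $ j)" "\<And>i j. expoly f (\<lambda>s t. mat_of (v s t) $ i $ j)"
  shows "expoly f (\<lambda>s t. mat_of (u s t * v s t) $ i $ j)"
  by (simp add: matrix_matrix_mult_def) (intro expoly_sum[OF f] expoly_mult[OF f] assms)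

lemma expoly_poly_fun:
  assumes f: "\<And>x y. f (x + y) = f x + f y" and "\<And>i j. expoly f (\<lambda>s t. u s t $ i $ j)" and "poly_fun p"
  shows "expoly f (\<lambda>s t. p (u s t))"
  using assms(3) by induction (auto intro: expoly_const[OF f] expoly.add expoly_mult[OF f] assms(2))

context alg_group
begin

text \<open>Chevalley's replicas. The curve t \<mapsto> exp(t S) exp(t N) lies in the zero set of
  \<open>I\<close>, and a polynomial along it is an exponential polynomial in t. The coefficients
  vanish by independence of exponentials, so the deformation by exp(s f(S)) stays in the zero set as
  well; its s-derivative at s = t = 0 is the replica f(S).\<close>

lemma lie_additive_replica:
  assumes x: "p * dg d * q + N \<in> lie" and pq: "p * q = 1" "q * p = 1"
    and SN: "p * dg d * q * N = N * (p * dg d * q)" "N ^ m = 0"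
    and f: "\<And>x y. f (x + y) = f x + f y"
  shows "p * dg (\<lambda>i. f (d i)) * q \<in> lie"
proof -
  define S where "S = p * dg d * q"
  \<comment> \<open>This is exp(t S + s f(S)) in the eigenbasis of S.\<close>
  define T where "T s t = p * dg (\<lambda>i. exp (d i * t + s * f (d i))) * q" for s t
  define \<Psi> where "\<Psi> s t = T s t * expN N m t" for s t
  have T0: "mderiv (T 0) (T 0 t * S) t" for t
  proof -
    have "mderiv (\<lambda>t. dg (\<lambda>i. exp (d i * t + 0 * f (d i)))) (dg (\<lambda>i. exp (d i * t) * d i)) t"
      by (rule mderiv_dg) (auto intro!: derivative_eq_intros)
    from mderiv_mult[OF mderiv_mult[OF mderiv_const[of p] this] mderiv_const[of q]]
    have "mderiv (T 0) (p * dg (\<lambda>i. exp (d i * t) * d i) * q) t" unfolding T_def by simp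
    moreover have "T 0 t * S = p * (dg (\<lambda>i. exp (d i * t)) * (q * p) * dg d) * q"
      by (simp add: T_def S_def mult.assoc)
    ultimately show ?thesis by (simp add: pq dg_mult)
  qed
  have ES: "expN N m t * S = S * expN N m t" and EN: "expN N m t * N = N * expN N m t" for t
    using SN by (auto intro!: expN_commute simp: S_def)
  have d: "mderiv (\<Psi> 0) (\<Psi> 0 t * (S + N)) t" for t
  proof -
    have "mderiv (\<Psi> 0) (T 0 t * S * expN N m t + T 0 t * (N * expN N m t)) t"
      unfolding \<Psi>_def by (rule mderiv_mult[OF T0 mderiv_expN[OF SN(2)]])
    also have "T 0 t * S * expN N m t + T 0 t * (N * expN N m t) = \<Psi> 0 t * (S + N)"
      by (simp add: \<Psi>_def distrib_left mult.assoc ES EN)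
    finally show ?thesis .
  qed
  have 00: "\<Psi> 0 0 = 1" by (simp add: \<Psi>_def T_def expN_0[OF SN(2)] dg_1 pq)
  have ex: "expoly f (\<lambda>s t. mat_of (\<Psi> s t) $ i $ j)" for i j
  proof -
    have D: "expoly f (\<lambda>s t. mat_of (dg (\<lambda>i. exp (d i * t + s * f (d i)))) $ i $ j)" for i j
      using expoly.mono[of f 1 "d i" 0] expoly_const[of f 0, OF f] by (cases "i = j") (simp_all add: dg_entry)
    have P: "expoly f (\<lambda>s t. t ^ k / fact k * c)" for k c
    proof -
      have "f 0 = 0" using f[of 0 0] by simp
      thus ?thesis using expoly.mono[of f "c / fact k" 0 k] by (simp add: field_simps)
    qed
    have "expoly f (\<lambda>s t. mat_of (expN N m t) $ i $ j)" for i j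
    proof -
      have "mat_of (\<Sum>k\<in>K. y k) = (\<Sum>k\<in>K. mat_of (y k :: 'n mx))" for K :: "nat set" and y
        by (induction K rule: infinite_finite_induct) auto
      hence "(\<lambda>(s::complex) t. mat_of (expN N m t) $ i $ j) = (\<lambda>s t. \<Sum>k<m. t ^ k / fact k * mat_of (N ^ k) $ i $ j)"
        by (simp add: expN_def cscale_vec_def cscale_complex_def)
      moreover have "expoly f (\<lambda>s t. \<Sum>k<m. t ^ k / fact k * mat_of (N ^ k) $ i $ j)"
        by (rule expoly_sum[OF f], rule P)
      ultimately show ?thesis by simp
    qed
    thus ?thesis unfolding \<Psi>_def T_def by (intro expoly_mx_mult[OF f] D expoly_const[OF f])
  qed
  have van: "r (mat_of (\<Psi> s t)) = 0" if r: "r \<in> I" for r s t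
  proof -
    have "expoly f (\<lambda>s t. r (mat_of (\<Psi> s t)))"
      using r by (intro expoly_poly_fun[OF f ex]) (simp_all add: I_def)
    then obtain K R where K: "finite K" "\<And>s t. r (mat_of (\<Psi> s t)) = (\<Sum>c\<in>K. exp (c * t + s * f c) * poly (R c) t)"
      by (rule expoly_form) blast
    have "r (mat_of (\<Psi> 0 t)) = 0" for t
      by (rule one_parameter[OF _ _ _ r, of "S + N"]) (use x d 00 in \<open>simp_all add: S_def\<close>)
    hence "(\<Sum>c\<in>K. exp (c * t) * poly (R c) t) = 0" for t using K(2)[of 0 t] by simp
    hence "\<forall>c\<in>K. R c = 0" by (rule exp_poly_independent[OF K(1)])
    thus ?thesis by (simp add: K(2))
  qed
  have "mderiv (\<lambda>s. dg (\<lambda>i. exp (d i * 0 + s * f (d i)))) (dg (\<lambda>i. f (d i))) 0"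
    by (rule mderiv_dg) (auto intro!: derivative_eq_intros)
  from mderiv_mult[OF mderiv_mult[OF mderiv_const[of p] this] mderiv_const[of q]]
  have "mderiv (\<lambda>s. \<Psi> s 0) (p * dg (\<lambda>i. f (d i)) * q) 0"
    unfolding \<Psi>_def T_def expN_0[OF SN(2)] by simp
  from pd_chain[OF _ this] have "pd r 1 (p * dg (\<lambda>i. f (d i)) * q) = 0" if "r \<in> I" for r
    using that van[OF that] DERIV_unique[OF _ DERIV_const] by (fastforce simp: I_def 00)
  thus ?thesis by (simp add: lie_def S_def)
qed

lemma G_closed: "(\<exists>b. a * b = 1) ==> (\<And>p. p \<in> I ==> p (mat_of a) = 0) ==> a \<in> G"
  using F G by (auto simp: I_def)

lemma exp_nilpotent: assumes "x \<in> lie" "x ^ m = 0" shows "expN x m t \<in> G"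
proof (rule G_closed)
  show "\<exists>b. expN x m t * b = 1" using expN_add[OF assms(2)] by blast
  have "mderiv (expN x m) (expN x m s * x) s" for s
    using mderiv_expN[OF assms(2), of s] expN_commute[of x x m s] by simp
  thus "p (mat_of (expN x m t)) = 0" if "p \<in> I" for p
    
    by (intro one_parameter[where \<Phi> = "expN x m" and x = x] assms(1) expN_0[OF assms(2)] that)
qed

end

section \<open>Complex powers of unipotent matrices\<close>

definition uexp :: "'n::finite mx => nat => complex => 'n mx" where
  "uexp x m t = (\<Sum>k<m. (t gchoose k) *. x ^ k)"

lemma uexp_0: "x ^ m = 0 ==> uexp x m 0 = 1"
  by (cases m) (auto simp: uexp_def sum.lessThan_Suc_shift gbinomial_0 simp del: sum.lessThan_Suc)

text \<open>Pascal's rule for the binomial series of (1 + x)^t. It identifies the values at natural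
  numbers with ordinary powers.\<close>

lemma uexp_add_1: assumes "x ^ m = 0" shows "uexp x m (t + 1) = uexp x m t * (1 + x)"
proof (cases m)
  case 0
  hence "(1::'a mx) = 0" using assms by simp
  thus ?thesis by simp
next
  case (Suc n)
  have "uexp x m (t + 1) = 1 + (\<Sum>k<n. ((t gchoose k) + (t gchoose Suc k)) *. x ^ Suc k)"
    unfolding uexp_def Suc sum.lessThan_Suc_shift by (simp add: gbinomial_Suc_Suc del: power_Suc)
  also have "\<dots> = (1 + (\<Sum>k<n. (t gchoose Suc k) *. x ^ Suc k)) + (\<Sum>k<n. (t gchoose k) *. x ^ Suc k)"
    by (simp add: cscale_add_left sum.distrib del: power_Suc)
  also have "1 + (\<Sum>k<n. (t gchoose Suc k) *. x ^ Suc k) = uexp x m t"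
    unfolding uexp_def Suc sum.lessThan_Suc_shift by simp
  also have "(\<Sum>k<n. (t gchoose k) *. x ^ Suc k) = uexp x m t * x"
    using assms by (simp add: uexp_def Suc sum_distrib_right distrib_right power_Suc2[symmetric] del: power_Suc)
  finally show ?thesis by (simp add: distrib_left)
qed

lemma uexp_of_nat: "x ^ m = 0 ==> uexp x m (of_nat n) = (1 + x) ^ n"
proof (induction n)
  case (Suc n)
  thus ?case using uexp_add_1[OF Suc.prems, of "of_nat n"] by (simp add: add.commute power_Suc2 del: power_Suc)
qed (simp add: uexp_0)

lemma gbinomial_poly: "\<exists>P. \<forall>t::complex. t gchoose k = poly P t"
proof -
  have "t gchoose k = poly (Polynomial.smult (1 / fact k) (\<Prod>i<k. [:- of_nat i, 1:])) t" for t :: complex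
    by (simp add: gbinomial_prod_rev poly_prod atLeast0LessThan field_simps)
  thus ?thesis by blast
qed

lemma poly_fun_poly:
  assumes "poly_fun p" "\<And>i j. \<exists>P. \<forall>t. u t $ i $ j = poly P t"
  shows "\<exists>P. \<forall>t. p (u t) = poly P t"
  using assms(1)
proof induction
  case (const c)
  thus ?case by (intro exI[of _ "[:c:]"]) simp
next
  case (coord i j)
  thus ?case by (rule assms(2))
next
  case (add p q)
  thus ?case by (metis poly_add)
next
  case (mult p q)
  thus ?case by (metis poly_mult)
qed

lemma uexp_entry_poly: "\<exists>P. \<forall>t. mat_of (uexp x m t) $ i $ j = poly P t"
proof -
  obtain P where P: "\<And>k (t::complex). t gchoose k = poly (P k) t" using gbinomial_poly by metis
  have "mat_of (\<Sum>k\<in>K. y k) = (\<Sum>k\<in>K. mat_of (y k :: 'a mx))" for K :: "nat set" and y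
    by (induction K rule: infinite_finite_induct) auto
  hence "mat_of (uexp x m t) $ i $ j = poly (\<Sum>k<m. Polynomial.smult (mat_of (x ^ k) $ i $ j) (P k)) t" for t
    by (simp add: uexp_def P poly_sum cscale_vec_def cscale_complex_def mult.commute)
  thus ?thesis by blast
qed

lemma poly_eq_0_of_nat: assumes "\<And>n::nat. poly (P::complex poly) (of_nat n) = 0" shows "P = 0"
proof (rule ccontr)
  assume "P \<noteq> 0"
  hence "finite {x. poly P x = 0}" by (rule poly_roots_finite)
  moreover have "range (of_nat :: nat => complex) \<subseteq> {x. poly P x = 0}" using assms by auto
  ultimately show False using finite_subset infinite_UNIV_nat finite_imageD inj_of_nat by blast
qed

lemma geometric_mx: "(1 - z) * (\<Sum>k<m. z ^ k) = 1 - (z :: 'a::calg) ^ m"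
  by (induction m) (auto simp: distrib_left left_diff_distrib)

lemma uexp_minus_1: "uexp x m t - 1 = x * (\<Sum>k<m. (t gchoose Suc k) *. x ^ k)" if "x ^ m = 0" 
proof (cases m)
  case 0
  hence "(1::'a mx) = 0" using that by simp
  thus ?thesis by simp
next
  case (Suc n)
  have "x * x ^ n = 0" using that unfolding Suc by simp
  thus ?thesis unfolding uexp_def Suc
    by (subst sum.lessThan_Suc_shift) (simp add: sum_distrib_left distrib_left)
qed

text \<open>An equation of the group is a polynomial in t along this curve and vanishes at all
  natural numbers, where the curve takes powers of 1 + x; so it vanishes identically. Invertibility
  comes from the geometric series of a nilpotent matrix.\<close>

lemma (in alg_group) uexp_mem: assumes "1 + x \<in> G" "x ^ m = 0" shows "uexp x m t \<in> G"
proof (rule G_closed)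
  let ?y = "\<Sum>k<m. (t gchoose Suc k) *. x ^ k"
  have xk: "x * x ^ k = x ^ k * x" for k by (simp add: power_commutes)
  have c: "x * ?y = ?y * x" by (simp add: sum_distrib_left sum_distrib_right xk)
  have "(x * ?y) ^ m = 0" using power_mult_commute[OF c] assms(2) by simp
  hence "(- (x * ?y)) ^ m = 0" by (metis mult_zero_right power_minus)
  moreover have "uexp x m t = 1 - (- (x * ?y))" using uexp_minus_1[OF assms(2), of t] by (simp add: algebra_simps)
  ultimately show "\<exists>b. uexp x m t * b = 1" using geometric_mx[of "- (x * ?y)" m] by auto
  fix p assume p: "p \<in> I"
  obtain P where P: "\<And>t. p (mat_of (uexp x m t)) = poly P t"
    using poly_fun_poly[of p "\<lambda>t. mat_of (uexp x m t)"] uexp_entry_poly p unfolding I_def by blast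
  have "(1 + x) ^ n \<in> G" for n by (induction n) (auto simp: one mult assms(1))
  hence "poly P (of_nat n) = 0" for n using p unfolding P[symmetric] uexp_of_nat[OF assms(2)] by (auto simp: I_def)
  hence "P = 0" by (rule poly_eq_0_of_nat)
  thus "p (mat_of (uexp x m t)) = 0" by (simp add: P)
qed

section \<open>Engel's theorem\<close>

text \<open>The n-th step consists of the vectors killed by all products of n operators from
  \<open>X\<close>. The same filtration serves Engel's theorem, the flag of the radical of the trace
  form, and nilpotency of the operators of \<open>n'\<close> on modules.\<close>

primrec wk :: "('x => 'v::cvec => 'v) => 'x set => nat => 'v set" where
  "wk f X 0 = {0}"
| "wk f X (Suc n) = {v. \<forall>x\<in>X. f x v \<in> wk f X n}"

lemma wk_subspace: assumes "\<And>x. x \<in> X ==> clin (f x)" shows "cv.subspace (wk f X n)"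
proof (induction n)
  case 0
  show ?case by (simp add: cv.subspace_def)
next
  case (Suc n)
  thus ?case unfolding cv.subspace_def
    by (auto simp: clin_0[OF assms] clin_add[OF assms] clin_scale[OF assms])
qed

lemma wk_0: "(\<And>x. x \<in> X ==> clin (f x)) ==> 0 \<in> wk f X n"
  using wk_subspace cv.subspace_0 by blast

lemma wk_mono_Suc: assumes "\<And>x. x \<in> X ==> clin (f x)" shows "wk f X n \<subseteq> wk f X (Suc n)"
  by (induction n) (auto simp: clin_0[OF assms])

lemma wk_mono: assumes "\<And>x. x \<in> X ==> clin (f x)" "m \<le> n" shows "wk f X m \<subseteq> wk f X n"
  using lift_Suc_mono_le[of "wk f X" m n, OF wk_mono_Suc[OF assms(1)]] assms(2) by simp

lemma wk_lower: "v \<in> wk f X (Suc n) ==> x \<in> X ==> f x v \<in> wk f X n"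
  by simp

lemma wk_lower': assumes "\<And>x. x \<in> X ==> clin (f x)" "v \<in> wk f X n" "x \<in> X" shows "f x v \<in> wk f X (n - 1)"
  using assms by (cases n) (auto simp: clin_0)

lemma wk_act: assumes "\<And>x. x \<in> X ==> clin (f x)" "v \<in> wk f X n" "x \<in> X" shows "f x v \<in> wk f X n"
  using wk_lower'[OF assms] wk_mono[of X f "n - 1" n, OF assms(1)] by auto

text \<open>\<open>g\<close> normalises the operators from \<open>X\<close>: the correction term is
  another such operator, which lowers the step just as \<open>f x\<close> does.\<close>

lemma wk_normal:
  assumes X: "\<And>x. x \<in> X ==> clin (f x)" and g: "clin g"
    and N: "\<And>x. x \<in> X ==> \<exists>x'\<in>X. \<forall>v. f x (g v) = g (f x v) + f x' v"
  shows "v \<in> wk f X n ==> g v \<in> wk f X n"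
proof (induction n arbitrary: v)
  case 0
  thus ?case by (simp add: clin_0[OF g])
next
  case (Suc n)
  have "f x (g v) \<in> wk f X n" if x: "x \<in> X" for x
  proof -
    obtain x' where x': "x' \<in> X" "f x (g v) = g (f x v) + f x' v" using N[OF x] by blast
    have "g (f x v) \<in> wk f X n" using Suc x by simp
    moreover have "f x' v \<in> wk f X n" using Suc.prems x'(1) by simp
    moreover have "cv.subspace (wk f X n)" by (rule wk_subspace) (rule X)
    ultimately show ?thesis unfolding x'(2) by (simp add: cv.subspace_add)
  qed
  thus ?case by simp
qed

lemma wk_antimono: "X \<subseteq> Y ==> wk f Y n \<subseteq> wk f X n"
  by (induction n) auto

lemma wk_span:
  assumes X: "\<And>x. clin (f x)" and f: "\<And>v. clin (\<lambda>x. f x v)"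
  shows "wk f (cv.span X) n = wk f X n"
proof (induction n)
  case (Suc n)
  have "f x v \<in> wk f X n" if "x \<in> cv.span X" "\<And>x. x \<in> X ==> f x v \<in> wk f X n" for x v
    using that(1)
  proof (induction rule: cv.span_induct)
    case base
    have "clin (f x)" for x by (rule X)
    hence s: "cv.subspace (wk f X n)" by (rule wk_subspace)
    show ?case
      using cv_sub[OF s]
      by (auto intro!: cv.subspaceI simp: clin_0[OF f] clin_add[OF f] clin_scale[OF f])
  qed (rule that(2))
  thus ?case unfolding wk.simps Suc by (auto intro: cv.span_base)
qed simp

lemma clin_app [simp]: "clin (app x)" and clin_app_left: "clin (\<lambda>x. app x v)"
  by (simp_all add: clin_def)

lemma wk_app_nilpotent:
  assumes "\<And>j v. v \<in> wk app X (Suc j) ==> x *> v \<in> wk app X j" "wk app X k = UNIV"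
  shows "x ^ k = 0"
proof (rule mx_eqI)
  fix v
  have "i \<le> k ==> (x ^ i) *> v \<in> wk app X (k - i)" for i
  proof (induction i)
    case (Suc i)
    hence "(x ^ i) *> v \<in> wk app X (Suc (k - Suc i))" by (simp add: Suc_diff_Suc)
    from assms(1)[OF this] show ?case by simp
  qed (simp add: assms(2))
  from this[of k] show "(x ^ k) *> v = 0 *> v" by simp
qed

text \<open>Grade matrices by how far they move the flag. Every matrix raises it by at most k, each
  \<open>ad s\<close> improves this by one, and after 2k improvements the matrix lowers the whole
  space to 0.\<close>

lemma wk_ad_UNIV:
  fixes S :: "'n::finite mx set"
  assumes k: "wk app S k = UNIV"
  shows "wk ad S (2 * k) = UNIV"
proof -
  let ?V = "wk app S"
  have mono: "m \<le> n ==> ?V m \<subseteq> ?V n" for m n by (rule wk_mono) simp_all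
  have sub: "cv.subspace (?V j)" for j by (rule wk_subspace) simp
  have lw: "v \<in> ?V j ==> s \<in> S ==> s *> v \<in> ?V (j - 1)" for s v j by (rule wk_lower') simp_all
  \<comment> \<open>Shift by k - i, which turns negative after i = k; the truncated subtraction then
    means landing in step 0.\<close>
  define P where "P i y \<longleftrightarrow> (\<forall>j. \<forall>v\<in>?V j. y *> v \<in> ?V (j + k - i))" for i and y :: "'n mx"
  have "P i y ==> y \<in> wk ad S (2 * k - i)" if "i \<le> 2 * k" for i y using that
  proof (induction "2 * k - i" arbitrary: i y)
    case 0
    hence "i = 2 * k" by simp
    have "y *> v = 0" for v using 0(2) k unfolding P_def \<open>i = 2 * k\<close> by (auto dest: spec[of _ k])
    hence "y = 0" by (intro mx_eqI) simp
    with 0 show ?case by simp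
  next
    case (Suc n)
    have "ad s y \<in> wk ad S n" if s: "s \<in> S" for s
    proof -
      have "P (Suc i) (ad s y)" unfolding P_def
      proof safe
        fix j v assume v: "v \<in> ?V j"
        have "s *> y *> v \<in> ?V (j + k - i - 1)" using Suc.prems(1) v s by (intro lw) (auto simp: P_def)
        hence 1: "s *> y *> v \<in> ?V (j + k - Suc i)" by simp
        have 2: "y *> s *> v \<in> ?V (j + k - Suc i)"
        proof (cases j)
          case 0
          thus ?thesis using v cv.subspace_0[OF sub] by simp
        next
          case (Suc j')
          have "s *> v \<in> ?V j'" using lw[OF v s] Suc by simp
          hence "y *> s *> v \<in> ?V (j' + k - i)" using Suc.prems(1) by (auto simp: P_def)
          thus ?thesis using Suc by simp
        qed
        show "ad s y *> v \<in> ?V (j + k - Suc i)"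
          using cv.subspace_diff[OF sub 1 2] by (simp add: ad_def)
      qed
      moreover have "n = 2 * k - Suc i" "Suc i \<le> 2 * k" using Suc by linarith+
      ultimately show ?thesis using Suc.hyps(1)[of "Suc i" "ad s y"] by simp
    qed
    thus ?case by (simp flip: Suc.hyps(2))
  qed
  moreover have "P 0 y" for y using mono[of k "j + k" for j] k by (fastforce simp: P_def)
  ultimately show ?thesis by (metis UNIV_eq_I diff_zero le0)
qed

text \<open>As \<open>x\<close> normalises \<open>S\<close>, it preserves each step of the flag of
  \<open>S\<close>. Being nilpotent, it refines each step into \<open>m\<close> smaller
  ones.\<close>

lemma wk_insert_normal:
  fixes S :: "'n::finite mx set"
  assumes k: "wk app S k = UNIV" and x: "\<And>s. s \<in> S ==> ad s x \<in> S" and m: "x ^ m = 0"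
  shows "wk app (insert x S) (m * k) = UNIV"
proof -
  let ?V = "wk app S" and ?W = "wk app (insert x S)"
  have mono: "m \<le> n ==> ?W m \<subseteq> ?W n" for m n by (rule wk_mono) simp_all
  have xV: "v \<in> ?V n ==> x *> v \<in> ?V n" for v n
  proof (rule wk_normal[of S app "app x"])
    fix s assume "s \<in> S"
    thus "\<exists>x'\<in>S. \<forall>v. s *> x *> v = x *> s *> v + x' *> v"
      by (intro bexI[of _ "ad s x"] x) (auto simp: ad_def)
  qed simp_all
  have "?V j \<subseteq> ?W (m * j)" for j
  proof (induction j)
    case (Suc j)
    have "v \<in> ?V (Suc j) ==> (x ^ i) *> v \<in> ?V j ==> v \<in> ?W (i + m * j)" for i v
    proof (induction i arbitrary: v)
      case 0
      thus ?case using Suc.IH by auto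
    next
      case (Suc i)
      have "s *> v \<in> ?W (i + m * j)" if "s \<in> S" for s
        using Suc.prems(1) that \<open>?V j \<subseteq> ?W (m * j)\<close> mono[of "m * j" "i + m * j"] by auto
      moreover have "x *> v \<in> ?W (i + m * j)"
        using Suc.prems xV[of v "Suc j"] by (intro Suc.IH) (simp_all add: power_Suc2 del: wk.simps power_Suc)
      ultimately show ?case by simp
    qed
    moreover have "(x ^ m) *> v \<in> ?V j" for v using m wk_0[of S app j] by simp
    ultimately show ?case by (auto simp del: wk.simps)
  qed (use wk_0[of "insert x S" app] in simp)
  thus ?thesis using k by blast
qed

text \<open>Dimensions are counted over the reals, where nested subspaces of equal dimension
  coincide just as well.\<close>

lemma mx_subspace_real: "cv.subspace S ==> subspace (mat_of ` S)"
proof (rule real_vector.subspaceI)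
  assume S: "cv.subspace S"
  show "0 \<in> mat_of ` S" using cv.subspace_0[OF S] mat_of_simps(1) by (metis imageI)
  show "a + b \<in> mat_of ` S" if "a \<in> mat_of ` S" "b \<in> mat_of ` S" for a b
    using that cv.subspace_add[OF S] by (auto simp flip: mat_of_simps(3))
  show "c *\<^sub>R a \<in> mat_of ` S" if "a \<in> mat_of ` S" for a c
  proof -
    have "c *\<^sub>R a = complex_of_real c *. a"
      by (simp add: vec_eq_iff cscale_vec_def cscale_complex_def complex_eq_iff)
    thus ?thesis using that cv.subspace_scale[OF S] by (auto simp flip: mat_of_simps(7))
  qed
qed

text \<open>A subalgebra with a flag and of greatest dimension is all of \<open>L\<close>: otherwise
  some element outside normalises it, and adjoining that element keeps a flag by
  \<open>wk_insert_normal\<close>.\<close>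

theorem engel:
  fixes L :: "'n::finite mx set"
  assumes L: "cv.subspace L" "\<And>x y. x \<in> L ==> y \<in> L ==> ad x y \<in> L" "\<And>x. x \<in> L ==> \<exists>m. x ^ m = 0"
  shows "\<exists>k. wk app L k = UNIV"
proof -
  define Q where "Q S \<longleftrightarrow> cv.subspace S \<and> S \<subseteq> L \<and> (\<forall>x\<in>S. \<forall>y\<in>S. ad x y \<in> S) \<and> (\<exists>k. wk app S k = UNIV)" for S
  have "\<exists>k. wk app {0::'n mx} k = UNIV" by (rule exI[of _ 1]) auto
  hence "Q {0}" using cv.subspace_0[OF L(1)] unfolding Q_def by (simp add: cv.subspace_def)
  \<comment> \<open>Real dimension bounds the chain, so a greatest one is attained.\<close>
  moreover have "\<forall>S. Q S --> dim (mat_of ` S) < Suc DIM(complex^'n^'n)"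
    by (intro allI impI le_imp_less_Suc dim_subset_UNIV)
  ultimately have "\<exists>S. Q S \<and> (\<forall>T. Q T --> dim (mat_of ` T) \<le> dim (mat_of ` S))"
    by (rule ex_has_greatest_nat)
  then obtain S where S: "Q S" "\<And>T. Q T ==> dim (mat_of ` T) \<le> dim (mat_of ` S)" by blast
  have "S = L"
  proof (rule ccontr)
    assume "S \<noteq> L"
    then obtain y where y: "y \<in> L" "y \<notin> S" using S(1) by (auto simp: Q_def)
    obtain k where k: "wk app S k = UNIV" using S(1) by (auto simp: Q_def)
    \<comment> \<open>An element of L - S at the lowest level for \<open>ad\<close> of
      \<open>S\<close> normalises \<open>S\<close>: its brackets with \<open>S\<close> lie in L on a
      lower level, hence in S.\<close>
    define n where "n = (LEAST n. \<exists>y\<in>L - S. y \<in> wk ad S n)"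
    have "\<exists>n. \<exists>y\<in>L - S. y \<in> wk ad S n" using y wk_ad_UNIV[OF k] by blast
    from LeastI_ex[OF this] obtain x where x: "x \<in> L - S" "x \<in> wk ad S n" unfolding n_def by blast
    have xS: "ad s x \<in> S" if s: "s \<in> S" for s
    proof (cases n)
      case 0
      thus ?thesis using x S(1) cv.subspace_0 by (auto simp: Q_def)
    next
      case (Suc n')
      have "ad s x \<in> wk ad S n'" using x(2) s unfolding Suc by simp
      moreover have "ad s x \<in> L" using S(1) s x(1) L(2) by (auto simp: Q_def)
      ultimately show ?thesis using not_less_Least[of n' "\<lambda>n. \<exists>y\<in>L - S. y \<in> wk ad S n"] Suc unfolding n_def by auto
    qed
    define T where "T = cv.span (insert x S)"
    obtain m where "x ^ m = 0" using L(3) x(1) by blast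
    from wk_insert_normal[OF k xS this] have 1: "wk app T (m * k) = UNIV"
      unfolding T_def using wk_span[of app "insert x S"] clin_app clin_app_left by blast
    have TL: "T \<subseteq> L" unfolding T_def using x(1) S(1) L(1) by (intro cv.span_minimal) (auto simp: Q_def)
    have T: "z \<in> T \<longleftrightarrow> (\<exists>c. \<exists>s\<in>S. z = s + c *. x)" for z
    proof -
      have "cv.span S = S" using S(1) by (simp add: Q_def cv.span_eq_iff)
      hence "z \<in> T \<longleftrightarrow> (\<exists>c. z - c *. x \<in> S)" by (simp only: T_def cv.span_insert mem_Collect_eq)
      moreover have "z - c *. x \<in> S \<longleftrightarrow> (\<exists>s\<in>S. z = s + c *. x)" for c
        by (auto intro!: bexI[of _ "z - c *. x"])
      ultimately show ?thesis by simp
    qed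
    have "ad a b \<in> T" if a: "a \<in> T" and b: "b \<in> T" for a b
    proof -
      obtain c s c' s' where a: "a = s + c *. x" "s \<in> S" and b: "b = s' + c' *. x" "s' \<in> S"
        using a b T by metis
      have "ad a b = (ad s s' + c' *. ad s x) - c *. ad s' x"
        by (simp add: a b ad_def algebra_simps cscale_simps)
      also have "\<dots> \<in> S" using S(1) a b xS unfolding Q_def
        by (intro cv.subspace_diff cv.subspace_add cv.subspace_scale) auto
      finally show ?thesis unfolding T_def by (auto intro: cv.span_base)
    qed
    hence "Q T" using 1 TL by (auto simp: Q_def T_def)
    hence "dim (mat_of ` T) \<le> dim (mat_of ` S)" by (rule S(2))
    moreover have ST: "mat_of ` S \<subseteq> mat_of ` T" by (auto simp: T_def intro: cv.span_base)
    ultimately have "mat_of ` S = mat_of ` T"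
      using S(1) \<open>Q T\<close> by (intro subspace_dim_equal mx_subspace_real) (auto simp: Q_def)
    hence "S = T" by (simp add: inj_image_eq_iff inj_def mat_of_inject)
    moreover have "x \<in> T" by (auto simp: T_def intro: cv.span_base)
    ultimately show False using x by blast
  qed
  thus ?thesis using S(1) by (auto simp: Q_def)
qed

lemma engel_tr:
  assumes k: "wk app L k = UNIV" and "x \<in> L" "y \<in> L" shows "tr (x * y) = 0"
proof -
  have "(x * y) ^ k = 0"
  proof (rule wk_app_nilpotent[OF _ k])
    show "(x * y) *> v \<in> wk app L j" if "v \<in> wk app L (Suc j)" for v j
      using wk_act[of L app "y *> v" j x] that assms by simp
  qed
  thus ?thesis by (rule tr_nilpotent)
qed

section \<open>The trace form of a reductive group\<close>

text \<open>In the eigenbasis, a matrix commuting with \<open>dg d\<close> has nonzero entries only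
  where two values of \<open>d\<close> agree, and there the values of \<open>e\<close> agree
  too.\<close>

lemma dg_function_commute:
  assumes pq: "p * q = 1" "q * p = 1" and c: "p * dg d * q * y = y * (p * dg d * q)" and f: "\<And>i j. d i = d j ==> e i = e j"
  shows "p * dg e * q * y = y * (p * dg e * q)"
proof -
  define z where "z = q * y * p"
  have y: "y = p * z * q"
  proof -
    have "p * z * q = (p * q) * y * (p * q)" by (simp only: z_def mult.assoc)
    thus ?thesis by (simp add: pq)
  qed
  have P: "p * a * q * (p * b * q) = p * (a * b) * q" for a b
  proof -
    have "p * a * q * (p * b * q) = p * a * (q * p) * b * q" by (simp only: mult.assoc)
    thus ?thesis by (simp add: pq mult.assoc)
  qed
  have Q: "q * (p * a * q) * p = a" for a
  proof -
    have "q * (p * a * q) * p = (q * p) * a * (q * p)" by (simp only: mult.assoc)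
    thus ?thesis by (simp add: pq)
  qed
  have c': "p * (dg d * z) * q = p * (z * dg d) * q" using c unfolding y P .
  have "dg d * z = q * (p * (dg d * z) * q) * p" by (simp only: Q)
  also have "\<dots> = z * dg d" unfolding c' by (rule Q)
  finally have "dg d * z = z * dg d" .
  hence "d i * mat_of z $ i $ j = mat_of z $ i $ j * d j" for i j by (simp only: dg_mult_left[symmetric] dg_mult_right[symmetric])
  hence "d i = d j \<or> mat_of z $ i $ j = 0" for i j by (metis mult.commute mult_right_cancel)
  hence "e i * mat_of z $ i $ j = mat_of z $ i $ j * e j" for i j using f[of i j] by (metis mult.commute mult_zero_left mult_zero_right)
  hence "dg e * z = z * dg e" by (intro mx_entry_eqI) (simp only: dg_mult_left dg_mult_right)
  thus ?thesis unfolding y P by simp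
qed

lemma tr_commuting_nilpotent:
  assumes "(x::'n::finite mx) * y = y * x" "x ^ m = 0" shows "tr (x * y) = 0"
  using power_mult_commute[OF assms(1), of m] assms(2) by (intro tr_nilpotent[of _ m]) simp

lemma tr_conj: assumes "q * p = 1" shows "tr (p * x * q) = tr x"
  using tr_comm[of "p * x" q] assms by (simp add: mult.assoc[symmetric])

lemma tr_zero [simp]: "tr 0 = 0" using tr_scale[of 0 0] by simp

lemma openin_zariski: "openin zariski = zariski_open"
  unfolding zariski_def by (rule topology_inverse'[OF istopology_zariski_open])

lemma zariski_open_UNIV: "zariski_open (UNIV :: 'n::finite cmat set)" unfolding zariski_open_def
  by (intro exI[of _ "{\<lambda>_. 1}"]) (auto intro: poly_fun.const)

lemma topspace_zariski: "topspace (zariski :: 'n::finite cmat topology) = UNIV"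
  unfolding topspace_def openin_zariski using zariski_open_UNIV by blast

text \<open>The Zariski topology is coarser than the Euclidean one, because polynomial functions are
  continuous.\<close>

lemma connectedin_zariski: assumes "connected S" shows "connectedin zariski S"
proof -
  have cont: "continuous_on UNIV p" if "poly_fun p" for p :: "'a cmat => complex"
    using that by induction (auto intro!: continuous_intros)
  have "open U" if U: "zariski_open U" for U :: "'a cmat set"
  proof -
    obtain F where F: "(\<forall>p\<in>F. poly_fun p) \<and> U = {A. \<exists>p\<in>F. p A \<noteq> 0}"
      using U unfolding zariski_open_def ..
    hence "U = (\<Union>p\<in>F. {A. p A \<noteq> 0})" by blast
    moreover have "open {A. p A \<noteq> 0}" if "p \<in> F" for p
      using cont[of p] F that by (intro open_Collect_neq) auto
    ultimately show ?thesis by (simp add: open_UN)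
  qed
  hence "continuous_map euclidean zariski (id :: 'a cmat => _)"
    by (auto simp: continuous_map_def openin_zariski topspace_zariski)
  from connectedin_continuous_map_image[OF this] assms show ?thesis by simp
qed

text \<open>Only subgroups connected in the Euclidean topology are tested; by
  \<open>connectedin_zariski\<close> this is a consequence of
  \<open>reductive_group\<close>.\<close>

locale reductive = alg_group +
  assumes red: "\<And>N F'. alg_group N F' ==> N \<subseteq> G ==> connected (mat_of ` N) ==>
    (\<And>a. a \<in> N ==> \<exists>m. (a - 1) ^ m = 0) ==>
    (\<And>a g h. a \<in> N ==> g \<in> G ==> h \<in> G ==> g * h = 1 ==> h * g = 1 ==> g * a * h \<in> N) ==> N = {1}"
begin

text \<open>Besides the semisimple part itself, its complex conjugate in an eigenbasis is a replica
  and lies in the Lie algebra. It is the partner against which the trace form becomes a sum of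
  squares of absolute values.\<close>

lemma lie_jordan:
  assumes "x \<in> lie"
  obtains p q d N m where "p * q = 1" "q * p = 1" "x = p * dg d * q + N" "N ^ m = 0"
    "\<And>y. x * y = y * x ==> p * dg d * q * y = y * (p * dg d * q)"
    "\<And>y. x * y = y * x ==> p * dg (\<lambda>i. cnj (d i)) * q * y = y * (p * dg (\<lambda>i. cnj (d i)) * q)"
    "p * dg d * q \<in> lie" "p * dg (\<lambda>i. cnj (d i)) * q \<in> lie"
proof -
  obtain P where "P \<noteq> 0" "peval P x = 0" using mx_annihilating by blast
  then obtain s m where s: "diagonalisable (peval s x)" "(x - peval s x) ^ m = 0" by (rule jordan_decomposition)
  obtain p q d where pq: "p * q = 1" "q * p = 1" "peval s x = p * dg d * q" using diagonalisable_form[OF s(1)] by metis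
  have c: "p * dg d * q * y = y * (p * dg d * q)" if "x * y = y * x" for y
    using peval_commute[OF that, of s] pq(3) by simp
  have c': "p * dg (\<lambda>i. cnj (d i)) * q * y = y * (p * dg (\<lambda>i. cnj (d i)) * q)" if "x * y = y * x" for y
    by (rule dg_function_commute[OF pq(1,2) c[OF that]]) simp
  define N where "N = x - p * dg d * q"
  have xN: "x = p * dg d * q + N" and N: "N ^ m = 0" using s(2) pq(3) by (simp_all add: N_def)
  have SN: "p * dg d * q * N = N * (p * dg d * q)" using c[of x] by (simp add: N_def left_diff_distrib right_diff_distrib)
  note r = lie_additive_replica[OF _ pq(1,2) SN N, folded xN, OF assms]
  have "p * dg d * q \<in> lie" using r[of "\<lambda>x. x"] by simp
  moreover have "p * dg (\<lambda>i. cnj (d i)) * q \<in> lie" using r[of cnj] by simp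
  ultimately show ?thesis using that[OF pq(1,2) xN N c c'] by blast
qed

text \<open>The nilpotent part contributes no trace because it commutes with the conjugate, so the
  trace is the sum of the |d i|^2.\<close>

lemma tr_cnj_semisimple:
  assumes pq: "p * q = 1" "q * p = 1" and x: "x = p * dg d * q + N" "N ^ m = 0"
    and c: "p * dg (\<lambda>i. cnj (d i)) * q * N = N * (p * dg (\<lambda>i. cnj (d i)) * q)"
    and z: "tr (x * (p * dg (\<lambda>i. cnj (d i)) * q)) = 0"
  shows "x = N"
proof -
  let ?C = "p * dg (\<lambda>i. cnj (d i)) * q"
  have "tr (N * ?C) = 0" by (rule tr_commuting_nilpotent[OF c[symmetric] x(2)])
  hence "tr (p * dg d * q * ?C) = 0" using z by (simp add: x(1) distrib_right tr_add)
  also have "p * dg d * q * ?C = p * (dg d * (q * p) * dg (\<lambda>i. cnj (d i))) * q" by (simp add: mult.assoc)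
  also have "tr \<dots> = (\<Sum>i\<in>UNIV. d i * cnj (d i))" by (simp only: tr_conj[OF pq(2)] pq mult_1_right dg_mult tr_dg)
  finally have "(\<Sum>i\<in>UNIV. d i * cnj (d i)) = 0" .
  moreover have "(\<Sum>i\<in>UNIV. d i * cnj (d i)) = of_real (\<Sum>i\<in>UNIV. (cmod (d i))\<^sup>2)"
    by (simp add: complex_norm_square[symmetric])
  ultimately have "(\<Sum>i\<in>UNIV. (cmod (d i))\<^sup>2) = 0" by (metis of_real_eq_0_iff)
  hence "d i = 0" for i by (subst (asm) sum_nonneg_eq_0_iff) auto
  hence "dg d = 0" by (intro mx_entry_eqI) (simp add: dg_entry)
  thus ?thesis by (simp add: x(1))
qed

definition rad :: "'a mx set" where "rad = {x \<in> lie. \<forall>y\<in>lie. tr (x * y) = 0}"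

lemma rad_subspace: "cv.subspace rad"
  using lie_subspace by (auto simp: cv.subspace_def rad_def distrib_right tr_add tr_scale)

lemma rad_ad: "x \<in> rad ==> y \<in> rad ==> ad x y \<in> rad"
  by (auto simp: rad_def lie_ad tr_ad)

lemma rad_conj: assumes "x \<in> rad" "a \<in> G" "b \<in> G" "a * b = 1" "b * a = 1" shows "a * x * b \<in> rad"
proof -
  have "tr (a * x * b * y) = 0" if "y \<in> lie" for y
  proof -
    have "tr (a * x * b * y) = tr (x * (b * y * a))" using tr_comm[of a "x * b * y"] by (simp add: mult.assoc)
    thus ?thesis using lie_conj[OF that assms(3,2,5)] assms(1) by (simp add: rad_def)
  qed
  thus ?thesis using assms lie_conj by (auto simp: rad_def)
qed

lemma rad_nilpotent: assumes "x \<in> rad" shows "\<exists>m. x ^ m = 0"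
proof -
  have "x \<in> lie" using assms by (simp add: rad_def)
  then obtain p q d N m where J: "p * q = 1" "q * p = 1" "x = p * dg d * q + N" "N ^ m = 0"
    "\<And>y. x * y = y * x ==> p * dg d * q * y = y * (p * dg d * q)"
    "\<And>y. x * y = y * x ==> p * dg (\<lambda>i. cnj (d i)) * q * y = y * (p * dg (\<lambda>i. cnj (d i)) * q)"
    "p * dg d * q \<in> lie" "p * dg (\<lambda>i. cnj (d i)) * q \<in> lie" by (rule lie_jordan) blast
  have "x * N = N * x" using J(5)[of x] by (simp add: J(3) distrib_left distrib_right)
  hence "x = N" using assms J(8) by (intro tr_cnj_semisimple[OF J(1-4) J(6)]) (simp_all add: rad_def)
  thus ?thesis using J(4) by blast
qed

definition rad_flag :: "nat => (complex ^ 'a) set" where "rad_flag = wk app rad"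

text \<open>The elements acting trivially on the quotients of the flag of the radical. This group is
  closed, connected, normal and unipotent, and it contains the exponentials of the radical;
  reductivity will make it trivial.\<close>

definition unip :: "'a mx set" where
  "unip = {a \<in> G. \<forall>i. \<forall>v\<in>rad_flag (Suc i). (a - 1) *> v \<in> rad_flag i}"

lemma rad_flag_subspace: "cv.subspace (rad_flag i)"
  unfolding rad_flag_def by (rule wk_subspace) simp

lemma rad_flag_mono: "rad_flag i \<subseteq> rad_flag (Suc i)"
  unfolding rad_flag_def by (rule wk_mono_Suc) simp

lemma rad_flag_UNIV: obtains k where "rad_flag k = UNIV"
  using engel[OF rad_subspace rad_ad rad_nilpotent] unfolding rad_flag_def by blast

text \<open>Conjugation by the group preserves the radical, hence the flag built from it.\<close>

lemma rad_flag_G: assumes "a \<in> G" shows "v \<in> rad_flag i ==> a *> v \<in> rad_flag i"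
proof (induction i arbitrary: v)
  case 0
  thus ?case by (simp add: rad_flag_def)
next
  case (Suc i)
  obtain b where b: "b \<in> G" "a * b = 1" "b * a = 1" using inv[OF assms] by blast
  have "x *> a *> v \<in> rad_flag i" if x: "x \<in> rad" for x
  proof -
    have "b * x * a \<in> rad" by (rule rad_conj) (use x b assms in auto)
    hence "(b * x * a) *> v \<in> rad_flag i" using Suc.prems by (simp add: rad_flag_def del: app_simps)
    hence "a *> (b * x * a) *> v \<in> rad_flag i" by (rule Suc.IH)
    moreover have "a *> (b * x * a) *> v = (a * b) *> x *> a *> v" by simp
    ultimately show ?thesis by (simp only: b app_simps(2))
  qed
  thus ?case by (simp add: rad_flag_def)
qed

text \<open>Linear equations for the flag turn the conditions defining \<open>unip\<close> into
  polynomial equations.\<close>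

lemma rad_flag_eqns: "\<exists>Z. \<forall>w. w \<in> rad_flag i \<longleftrightarrow> (\<forall>z\<in>Z. z *> w = 0)"
proof (induction i)
  case 0
  show ?case by (rule exI[of _ "{1}"]) (simp add: rad_flag_def)
next
  case (Suc i)
  then obtain Z where Z: "\<And>w. w \<in> rad_flag i \<longleftrightarrow> (\<forall>z\<in>Z. z *> w = 0)" by blast
  show ?case
    by (rule exI[of _ "(\<lambda>(z, x). z * x) ` (Z \<times> rad)"]) (use Z in \<open>auto simp: rad_flag_def\<close>)
qed

lemma poly_fun_app: "poly_fun (\<lambda>A. (z *> (mx_of A - 1) *> v) $ j)"
proof -
  have "(\<lambda>A. (z *> (mx_of A - 1) *> v) $ j) = (\<lambda>A. (\<Sum>k\<in>UNIV. mat_of (z * mx_of A * 1) $ j $ k * v $ k) + - ((z *> v) $ j))"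
    by (auto simp: app_def matrix_vector_mult_diff_rdistrib matrix_vector_mult_diff_distrib matrix_vector_mul_assoc)
      (simp add: matrix_vector_mult_def)
  thus ?thesis
    by (simp only:) (intro poly_fun.add poly_fun.const poly_fun_sum poly_fun.mult poly_fun_mult_const)
qed

lemma unip_alg_group: "\<exists>F'. alg_group unip F'"
proof -
  obtain Z where Z: "\<And>i w. w \<in> rad_flag i \<longleftrightarrow> (\<forall>z\<in>Z i. z *> w = 0)" using rad_flag_eqns by metis
  define F' where "F' = F \<union> (\<Union>i. \<Union>v\<in>rad_flag (Suc i). \<Union>z\<in>Z i. range (\<lambda>j A. (z *> (mx_of A - 1) *> v) $ j))"
  have eqn: "(a - 1) *> v \<in> rad_flag i \<longleftrightarrow> (\<forall>z\<in>Z i. \<forall>j. (z *> (mx_of (mat_of a) - 1) *> v) $ j = 0)" for a v i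
    unfolding Z by (simp add: mat_of_inverse vec_eq_iff del: app_simps)
  have "alg_group unip F'"
  proof
    show "poly_fun p" if "p \<in> F'" for p using that F poly_fun_app unfolding F'_def by auto
    show "a \<in> unip \<longleftrightarrow> (\<exists>b. a * b = 1) \<and> (\<forall>p\<in>F'. p (mat_of a) = 0)" for a
      by (simp only: unip_def mem_Collect_eq G eqn F'_def ball_Un ball_UN ball_simps conj_assoc UNIV_I ball_UNIV)
    show "1 \<in> unip" using one cv.subspace_0[OF rad_flag_subspace] by (auto simp: unip_def)
    show "a * b \<in> unip" if a: "a \<in> unip" and b: "b \<in> unip" for a b
    proof -
      have "(a * b - 1) *> v \<in> rad_flag i" if v: "v \<in> rad_flag (Suc i)" for v i
      proof -
        have "(a * b - 1) *> v = a *> ((b - 1) *> v) + (a - 1) *> v" by simp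
        thus ?thesis using a b v rad_flag_G[of a] unfolding unip_def
          by (metis (mono_tags, lifting) cv.subspace_add[OF rad_flag_subspace] mem_Collect_eq)
      qed
      thus ?thesis using a b mult by (auto simp: unip_def)
    qed
    show "\<exists>b\<in>unip. a * b = 1 \<and> b * a = 1" if a: "a \<in> unip" for a
    proof -
      obtain b where b: "b \<in> G" "a * b = 1" "b * a = 1" using inv[of a] a by (auto simp: unip_def)
      have "(b - 1) *> v \<in> rad_flag i" if v: "v \<in> rad_flag (Suc i)" for v i
      proof -
        have "b - 1 = b * (0 - (a - 1))" using b by (simp add: right_diff_distrib)
        hence "(b - 1) *> v = b *> (0 - (a - 1) *> v)" by (metis app_simps(1,3,6))
        moreover have "0 - (a - 1) *> v \<in> rad_flag i" using a v unfolding unip_def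
          by (intro cv.subspace_diff[OF rad_flag_subspace] cv.subspace_0[OF rad_flag_subspace]) auto
        ultimately show ?thesis using rad_flag_G[OF b(1)] by metis
      qed
      thus ?thesis using b by (auto simp: unip_def)
    qed
  qed
  thus ?thesis by blast
qed

lemma unip_nilpotent: assumes "rad_flag k = UNIV" "a \<in> unip" shows "(a - 1) ^ k = 0"
  by (rule wk_app_nilpotent[of rad _ k]) (use assms in \<open>auto simp: unip_def rad_flag_def simp del: wk.simps app_simps\<close>)

lemma unip_conj: assumes "a \<in> unip" "g \<in> G" "h \<in> G" "g * h = 1" "h * g = 1" shows "g * a * h \<in> unip"
proof -
  have "(g * a * h - 1) *> v \<in> rad_flag i" if v: "v \<in> rad_flag (Suc i)" for v i
  proof -
    have "g * a * h - 1 = g * (a - 1) * h" using assms(4) by (simp add: right_diff_distrib left_diff_distrib)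
    hence "(g * a * h - 1) *> v = g *> (a - 1) *> h *> v" by (metis app_simps(3))
    moreover have "(a - 1) *> h *> v \<in> rad_flag i"
      using rad_flag_G[OF assms(3) v] assms(1) unfolding unip_def by blast
    ultimately show ?thesis using rad_flag_G[OF assms(2)] by metis
  qed
  thus ?thesis using assms mult by (auto simp: unip_def)
qed

lemma unip_lower:
  assumes y: "\<And>i v. v \<in> rad_flag (Suc i) ==> y *> v \<in> rad_flag i" and v: "v \<in> rad_flag (Suc i)"
  shows "(y * (\<Sum>k<m. c k *. y ^ k)) *> v \<in> rad_flag i"
proof -
  have "(y ^ k) *> v \<in> rad_flag (Suc i)" for k
    by (induction k) (use v y rad_flag_mono in auto)
  hence "(\<Sum>k<m. c k *. y ^ k) *> v \<in> rad_flag (Suc i)"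
    by (auto simp: app_sum intro!: cv.subspace_sum cv.subspace_scale rad_flag_subspace)
  thus ?thesis using y by simp
qed

lemma uexp_unip: assumes "rad_flag k = UNIV" "a \<in> unip" shows "uexp (a - 1) k t \<in> unip"
proof -
  have n: "(a - 1) ^ k = 0" by (rule unip_nilpotent[OF assms])
  have "uexp (a - 1) k t \<in> G" by (rule uexp_mem[OF _ n]) (use assms(2) in \<open>simp add: unip_def\<close>)
  moreover have "(uexp (a - 1) k t - 1) *> v \<in> rad_flag i" if "v \<in> rad_flag (Suc i)" for v i
    unfolding uexp_minus_1[OF n] by (rule unip_lower[OF _ that]) (use assms(2) in \<open>auto simp: unip_def simp del: app_simps\<close>)
  ultimately show ?thesis by (simp add: unip_def del: app_simps)
qed

text \<open>Each element a is joined to 1 inside the group by the complex powers a^t, whose entries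
  are polynomials in t.\<close>

lemma connected_unip: "connected (mat_of ` unip)"
proof -
  obtain k where k: "rad_flag k = UNIV" by (rule rad_flag_UNIV)
  define C where "C a = range (\<lambda>t. mat_of (uexp (a - 1) k t))" for a :: "'a mx"
  have "connected (C a)" for a :: "'a mx"
  proof -
    have "continuous_on UNIV (\<lambda>t. mat_of (uexp (a - 1) k t) $ i $ j)" for i j
    proof -
      obtain P where "\<forall>t. mat_of (uexp (a - 1) k t) $ i $ j = poly P t" using uexp_entry_poly by blast
      thus ?thesis by (simp add: continuous_on_poly)
    qed
    hence "continuous_on UNIV (\<lambda>t. \<chi> i j. mat_of (uexp (a - 1) k t) $ i $ j)"
      by (intro continuous_on_vec_lambda)
    hence "continuous_on UNIV (\<lambda>t. mat_of (uexp (a - 1) k t))" by simp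
    thus ?thesis unfolding C_def by (rule connected_continuous_image) (rule connected_UNIV)
  qed
  moreover have "mat_of 1 \<in> C a" if "a \<in> unip" for a
    unfolding C_def using uexp_0[OF unip_nilpotent[OF k that]] by (metis rangeI)
  moreover have "mat_of a \<in> C a" if "a \<in> unip" for a
  proof -
    have "uexp (a - 1) k 1 = a" using uexp_of_nat[OF unip_nilpotent[OF k that], of 1] by simp
    thus ?thesis unfolding C_def by (metis rangeI)
  qed
  moreover have "C a \<subseteq> mat_of ` unip" if "a \<in> unip" for a
    unfolding C_def using uexp_unip[OF k that] by blast
  ultimately have "mat_of ` unip = \<Union>(C ` unip)" "connected (\<Union>(C ` unip))"
    by (blast, intro connected_Union) blast+
  thus ?thesis by simp
qed

text \<open>An element of the radical is nilpotent and lowers the flag, so its exponentials lie in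
  \<open>unip\<close> = {1}. Differentiating the constant curve at t = 0 gives the element back as
  0.\<close>

theorem trace_form_nondegenerate: assumes "x \<in> lie" "\<And>y. y \<in> lie ==> tr (x * y) = 0" shows "x = 0"
proof -
  have x: "x \<in> rad" using assms by (simp add: rad_def)
  obtain k where k: "rad_flag k = UNIV" by (rule rad_flag_UNIV)
  obtain F' where "alg_group unip F'" using unip_alg_group by blast
  hence u: "unip = {1}"
    by (rule red) (use connected_unip unip_nilpotent[OF k] unip_conj in \<open>auto simp: unip_def simp del: app_simps\<close>)
  obtain m where m: "x ^ m = 0" using rad_nilpotent[OF x] by blast
  have lw: "x *> v \<in> rad_flag i" if "v \<in> rad_flag (Suc i)" for v i using that x by (simp add: rad_flag_def)
  have "expN x m t \<in> unip" for t
  proof -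
    have "expN x m t - 1 = x * (\<Sum>k<m. (t ^ Suc k / fact (Suc k)) *. x ^ k)"
    proof (cases m)
      case 0
      hence "(1::'a mx) = 0" using m by simp
      thus ?thesis by (metis mult_1_left mult_zero_left diff_self)
    next
      case (Suc n)
      hence "x * x ^ n = 0" using m by simp
      thus ?thesis unfolding expN_def Suc
        by (subst sum.lessThan_Suc_shift) (simp add: sum_distrib_left distrib_left del: fact_Suc)
    qed
    hence "(expN x m t - 1) *> v \<in> rad_flag i" if "v \<in> rad_flag (Suc i)" for v i
      using unip_lower[OF lw that] by simp
    thus ?thesis using exp_nilpotent[OF assms(1) m] by (simp add: unip_def del: app_simps)
  qed
  hence e: "expN x m = (\<lambda>t. 1)" using u by auto
  have "mderiv (\<lambda>t. 1) (x * 1) 0" using mderiv_expN[OF m, of 0] unfolding e .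
  hence "mat_of x $ i $ j = mat_of 0 $ i $ j" for i j
    using mderiv_const[of "1 :: 'a mx" 0] unfolding mderiv_def by (simp del: mat_of_simps(1)) (metis DERIV_unique)
  thus ?thesis by (rule mx_entry_eqI)
qed

end

section \<open>Toral subalgebras and root spaces\<close>

text \<open>A real basis of the subspace also spans it over the complex numbers.\<close>

lemma mx_finite_span:
  fixes S :: "'n::finite mx set" assumes "cv.subspace S"
  obtains B where "finite B" "B \<subseteq> S" "S \<subseteq> cv.span B"
proof -
  obtain B where B: "B \<subseteq> mat_of ` S" "independent B" "mat_of ` S \<subseteq> span B"
    by (rule maximal_independent_subset[of "mat_of ` S"]) blast
  have "x \<in> cv.span (mx_of ` B)" if "x \<in> S" for x
  proof -
    have "mat_of x \<in> span B" using B(3) that by blast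
    hence "mx_of (mat_of x) \<in> cv.span (mx_of ` B)"
    proof (induction rule: real_vector.span_induct)
      case base
      have 1: "mx_of 0 = (0 :: 'n mx)" "mx_of (a + b) = mx_of a + mx_of b" "mx_of (r *\<^sub>R a) = complex_of_real r *. mx_of a"
        for a b r
        by (simp_all add: mat_of_inject[symmetric]) (simp add: vec_eq_iff cscale_vec_def cscale_complex_def complex_eq_iff)
      show ?case
        by (intro real_vector.subspaceI) (auto simp: 1 cv.span_zero intro: cv.span_add cv.span_scale)
    qed (auto intro: cv.span_base)
    thus ?thesis by (simp add: mat_of_inverse)
  qed
  moreover have "finite (mx_of ` B)" using B(2) by (simp add: finiteI_independent)
  moreover have "mx_of ` B \<subseteq> S" using B(1) by (auto simp: mat_of_inverse)
  ultimately show ?thesis using that by blast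
qed

text \<open>Every eigenvalue is a difference of two spectral values of \<open>t\<close>: otherwise
  all blocks of the eigenvector vanish.\<close>

lemma ad_eigenvalues_finite:
  fixes t :: "'a::calg" assumes "diagonalisable t"
  obtains C where "finite C" "\<And>y c. ad t y = c *. y ==> y \<noteq> 0 ==> c \<in> C"
proof -
  obtain \<Lambda> L where L: "finite \<Lambda>" "1 = (\<Sum>a\<in>\<Lambda>. peval (L a) t)"
    "\<And>a. a \<in> \<Lambda> ==> t * peval (L a) t = a *. peval (L a) t" using diagonalisable_idem[OF assms] by blast
  have "c \<in> (\<lambda>(a, b). a - b) ` (\<Lambda> \<times> \<Lambda>)" if y: "ad t y = c *. y" "y \<noteq> 0" for y c
  proof (rule ccontr)
    assume n: "c \<notin> (\<lambda>(a, b). a - b) ` (\<Lambda> \<times> \<Lambda>)"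
    have "peval (L a) t * y * peval (L b) t = 0" if ab: "a \<in> \<Lambda>" "b \<in> \<Lambda>" for a b
    proof -
      have a: "peval (L a) t * t = a *. peval (L a) t" using L(3)[OF ab(1)] peval_commute[of t t] by simp
      have "peval (L a) t * ad t y * peval (L b) t = (peval (L a) t * t) * y * peval (L b) t - peval (L a) t * y * (t * peval (L b) t)"
        by (simp add: ad_def right_diff_distrib left_diff_distrib mult.assoc)
      also have "\<dots> = (a - b) *. (peval (L a) t * y * peval (L b) t)"
        unfolding a L(3)[OF ab(2)] by (simp add: cscale_simps)
      finally have "(c - (a - b)) *. (peval (L a) t * y * peval (L b) t) = 0"
        unfolding y(1) by (simp add: cscale_simps)
      moreover have "c - (a - b) \<noteq> 0" using n ab by force
      ultimately show ?thesis by (simp only: cv.scale_eq_0_iff) simp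
    qed
    hence "(\<Sum>a\<in>\<Lambda>. peval (L a) t) * y * (\<Sum>b\<in>\<Lambda>. peval (L b) t) = 0"
      by (simp add: sum_distrib_left sum_distrib_right)
    thus False using y(2) L(2) by simp
  qed
  with L(1) that[of "(\<lambda>(a, b). a - b) ` (\<Lambda> \<times> \<Lambda>)"] show ?thesis by blast
qed

section \<open>Maximal toral subalgebras and their centralisers\<close>

locale toral = reductive +
  fixes h :: "'a mx set"
  assumes h_subspace: "cv.subspace h" and h_lie: "h \<subseteq> lie"
    and h_ad: "\<And>x y. x \<in> h ==> y \<in> h ==> ad x y \<in> h"
    and h_diag: "\<And>x. x \<in> h ==> diagonalisable x"
    and h_max: "\<And>T. cv.subspace T ==> T \<subseteq> lie ==> (\<And>x y. x \<in> T ==> y \<in> T ==> ad x y \<in> T) ==>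
      (\<And>x. x \<in> T ==> diagonalisable x) ==> h \<subseteq> T ==> T = h"
begin

text \<open>For an eigenvector w of \<open>ad t\<close> inside \<open>h\<close>, \<open>ad w\<close>
  applied twice to t gives 0. As w is diagonalisable, already \<open>ad w t\<close> is 0, so the
  eigenvalue component vanishes under \<open>ad t\<close>.\<close>

lemma h_abelian: assumes t: "t \<in> h" and x: "x \<in> h" shows "ad t x = 0"
proof -
  obtain C w where w: "finite C" "x = (\<Sum>c\<in>C. w c)" "\<And>c. c \<in> C ==> ad t (w c) = c *. w c"
    using ad_eigen_split[OF h_diag[OF t], of x] by metis
  have wh: "\<forall>c\<in>C. w c \<in> h"
    by (rule eigen_component_mem[OF clin_ad[of t] h_subspace]) (use w t x h_ad in auto)
  have "ad t (w c) = 0" if c: "c \<in> C" for c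
  proof -
    have a: "ad (w c) t = - (c *. w c)" using w(3)[OF c] ad_skew[of "w c" t] by simp
    hence "(ad (w c) ^^ 2) t = 0" by (simp add: numeral_2_eq_2 ad_minus ad_scale)
    hence "ad (w c) t = 0" using ad_diagonalisable_square[OF h_diag] wh c by blast
    thus ?thesis using ad_skew[of t "w c"] by simp
  qed
  thus ?thesis unfolding w(2) ad_sum by (rule sum.neutral[OF ballI])
qed

text \<open>Adjoining the line of \<open>y\<close> to \<open>h\<close> gives another toral
  subalgebra, because commuting diagonalisable elements have diagonalisable combinations; maximality
  then applies.\<close>

lemma commute_h_mem: assumes y: "y \<in> lie" "diagonalisable y" "\<And>t. t \<in> h ==> ad t y = 0" shows "y \<in> h"
proof -
  define T where "T = {t + c *. y | t c. t \<in> h}"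
  have "T = h"
  proof (rule h_max)
    show "cv.subspace T" unfolding T_def
    proof (rule cv.subspaceI)
      show "0 \<in> {t + c *. y | t c. t \<in> h}" using cv.subspace_0[OF h_subspace] by (auto intro!: exI[of _ 0])
      fix a b assume "a \<in> {t + c *. y | t c. t \<in> h}" "b \<in> {t + c *. y | t c. t \<in> h}"
      then obtain t c t' c' where "a = t + c *. y" "t \<in> h" "b = t' + c' *. y" "t' \<in> h" by blast
      thus "a + b \<in> {t + c *. y | t c. t \<in> h}"
        using cv.subspace_add[OF h_subspace, of t t'] by (auto intro!: exI[of _ "t + t'"] exI[of _ "c + c'"] simp: cscale_simps algebra_simps)
    next
      fix a r assume "a \<in> {t + c *. y | t c. t \<in> h}"
      then obtain t c where "a = t + c *. y" "t \<in> h" by blast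
      thus "r *. a \<in> {t + c *. y | t c. t \<in> h}"
        using cv.subspace_scale[OF h_subspace, of t r] by (auto intro!: exI[of _ "r *. t"] exI[of _ "r * c"] simp: cscale_simps)
    qed
    show "T \<subseteq> lie" using y(1) h_lie cv.subspace_add[OF lie_subspace] cv.subspace_scale[OF lie_subspace] by (auto simp: T_def)
    show "h \<subseteq> T"
    proof
      fix t assume "t \<in> h"
      moreover have "t = t + 0 *. y" by simp
      ultimately show "t \<in> T" unfolding T_def by blast
    qed
    show "diagonalisable x" if "x \<in> T" for x
    proof -
      obtain t c where t: "x = t + c *. y" "t \<in> h" using \<open>x \<in> T\<close> unfolding T_def by blast
      hence "t * y = y * t" using y(3)[of t] by (simp add: ad_def)
      thus ?thesis unfolding t(1) by (rule diagonalisable_lincomb[OF h_diag[OF t(2)] y(2)])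
    qed
    show "ad a b \<in> T" if ab: "a \<in> T" "b \<in> T" for a b
    proof -
      obtain t c where a: "a = t + c *. y" "t \<in> h" using ab(1) unfolding T_def by blast
      obtain t' c' where b: "b = t' + c' *. y" "t' \<in> h" using ab(2) unfolding T_def by blast
      have "ad a b = ad t t' + c' *. ad t y - c *. ad t' y"
        by (simp add: a b ad_def algebra_simps cscale_simps)
      hence "ad a b = 0" using h_abelian a b y(3) by simp
      hence "ad a b = 0 + 0 *. y" by simp
      thus ?thesis using cv.subspace_0[OF h_subspace] unfolding T_def by blast
    qed
  qed
  moreover have "y = 0 + 1 *. y" by simp
  hence "y \<in> T" unfolding T_def using cv.subspace_0[OF h_subspace] by blast
  ultimately show ?thesis by simp
qed

definition cent :: "'a mx set" where "cent = {x \<in> lie. \<forall>t\<in>h. ad t x = 0}"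

lemma cent_commute: "x \<in> cent ==> t \<in> h ==> x * t = t * x"
  by (auto simp: cent_def ad_def)

text \<open>The semisimple part and its conjugate commute with everything \<open>x\<close> commutes
  with, in particular with \<open>h\<close>, so both lie in \<open>h\<close>. Testing the trace form
  against the conjugate shows when the semisimple part vanishes.\<close>

lemma cent_jordan:
  assumes x: "x \<in> cent"
  obtains S N m where "x = S + N" "S \<in> h" "N \<in> cent" "N ^ m = 0"
    "(\<And>C. C \<in> h ==> tr (x * C) = 0) ==> x = N"
proof -
  have "x \<in> lie" using x by (simp add: cent_def)
  then obtain p q d N m where J: "p * q = 1" "q * p = 1" "x = p * dg d * q + N" "N ^ m = 0"
    "\<And>y. x * y = y * x ==> p * dg d * q * y = y * (p * dg d * q)"
    "\<And>y. x * y = y * x ==> p * dg (\<lambda>i. cnj (d i)) * q * y = y * (p * dg (\<lambda>i. cnj (d i)) * q)"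
    "p * dg d * q \<in> lie" "p * dg (\<lambda>i. cnj (d i)) * q \<in> lie" by (rule lie_jordan) blast
  have dm: "diagonalisable (p * dg e * q)" for e
  proof (rule diagonalisable_dg[OF _ J(1)])
    show "p * dg e * q * p = p * dg e" by (simp add: mult.assoc J(2))
  qed
  have S: "p * dg d * q \<in> h"
    by (rule commute_h_mem[OF J(7) dm]) (use J(5) cent_commute[OF x] in \<open>simp add: ad_def\<close>)
  have C: "p * dg (\<lambda>i. cnj (d i)) * q \<in> h"
    by (rule commute_h_mem[OF J(8) dm]) (use J(6) cent_commute[OF x] in \<open>simp add: ad_def\<close>)
  have xN: "N = x - p * dg d * q" using J(3) by simp
  have "N \<in> cent" using x S h_lie unfolding xN
    by (auto simp: cent_def ad_diff h_abelian intro!: cv.subspace_diff[OF lie_subspace])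
  moreover have "x * N = N * x" using J(5)[of x] by (simp add: xN left_diff_distrib right_diff_distrib)
  hence "(\<And>C. C \<in> h ==> tr (x * C) = 0) ==> x = N"
    using C by (intro tr_cnj_semisimple[OF J(1-4) J(6)]) auto
  ultimately show ?thesis using that[OF J(3) S _ J(4)] by blast
qed

text \<open>\<open>\<beta>\<close> is any function, of which only the values on \<open>h\<close>
  matter, and 0 is a vector of every weight.\<close>

definition weight_vector :: "('a mx => complex) => 'a mx => bool" where
  "weight_vector \<beta> y \<longleftrightarrow> y \<in> lie \<and> (\<forall>t\<in>h. ad t y = \<beta> t *. y)"

text \<open>A finite spanning set of \<open>h\<close> is used one element at a time: the joint
  eigenspace found so far is stable under the next \<open>ad t\<close>, since \<open>h\<close> is
  abelian, so the \<open>ad t\<close> components of its vectors stay in it.\<close>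

lemma lie_span_weight_vectors: "lie \<subseteq> cv.span {y. \<exists>\<beta>. weight_vector \<beta> y}"
proof -
  obtain B where B: "finite B" "B \<subseteq> h" "h \<subseteq> cv.span B" by (rule mx_finite_span[OF h_subspace])
  define Y where "Y B = {y \<in> lie. \<forall>t\<in>B. \<exists>c. ad t y = c *. y}" for B
  have "lie \<subseteq> cv.span (Y B)" using B(1,2)
  proof (induction B)
    case empty
    thus ?case by (auto simp: Y_def intro: cv.span_base)
  next
    case (insert t B)
    have "y \<in> cv.span (Y (insert t B))" if y: "y \<in> Y B" for y
    proof -
      have "\<forall>s\<in>B. \<exists>c. ad s y = c *. y" using y by (simp add: Y_def)
      from bchoice[OF this] obtain \<gamma> where \<gamma>: "\<forall>s\<in>B. ad s y = \<gamma> s *. y" ..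
      define W where "W = {z \<in> lie. \<forall>s\<in>B. ad s z = \<gamma> s *. z}"
      have W: "cv.subspace W" unfolding W_def
        using cv_sub[OF lie_subspace]
        by (intro cv.subspaceI) (auto simp: ad_add ad_scale cscale_simps mult.commute)
      have tW: "ad t w \<in> W" if w: "w \<in> W" for w
      proof -
        have "ad s (ad t w) = \<gamma> s *. ad t w" if s: "s \<in> B" for s
          using ad_jacobi[of s t w] h_abelian[of s t] insert.prems s w by (auto simp: W_def ad_scale ad_def[of 0])
        thus ?thesis using w insert.prems h_lie by (auto simp: W_def lie_ad)
      qed
      have "y \<in> W" using y \<gamma> by (auto simp: W_def Y_def)
      moreover obtain C w where w: "finite C" "y = (\<Sum>c\<in>C. w c)" "\<And>c. c \<in> C ==> ad t (w c) = c *. w c"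
        using ad_eigen_split[OF h_diag, of t y] insert.prems by (metis insert_subset)
      ultimately have "\<forall>c\<in>C. w c \<in> W"
        by (intro eigen_component_mem[OF clin_ad[of t] W tW]) auto
      hence "\<forall>c\<in>C. w c \<in> Y (insert t B)" using w(3) by (auto simp: W_def Y_def)
      thus ?thesis unfolding w(2) by (intro cv.span_sum cv.span_base) auto
    qed
    hence "cv.span (Y B) \<subseteq> cv.span (Y (insert t B))" by (intro cv.span_minimal) auto
    thus ?case using insert by auto
  qed
  also have "Y B \<subseteq> {y. \<exists>\<beta>. weight_vector \<beta> y}"
  proof safe
    fix y assume y: "y \<in> Y B"
    have "\<exists>c. ad t y = c *. y" if "t \<in> cv.span B" for t using that
    proof (induction rule: cv.span_induct)
      case base
      show ?case
      proof (rule cv.subspaceI)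
        show "0 \<in> {t. \<exists>c. ad t y = c *. y}" by (auto simp: ad_def intro!: exI[of _ 0])
        show "a + b \<in> {t. \<exists>c. ad t y = c *. y}" if ab: "a \<in> {t. \<exists>c. ad t y = c *. y}" "b \<in> {t. \<exists>c. ad t y = c *. y}" for a b
        proof -
          obtain c c' where "ad a y = c *. y" "ad b y = c' *. y" using ab by blast
          hence "ad (a + b) y = (c + c') *. y" by (simp add: ad_def distrib_left distrib_right cscale_simps algebra_simps)
          thus ?thesis by blast
        qed
        show "r *. a \<in> {t. \<exists>c. ad t y = c *. y}" if a: "a \<in> {t. \<exists>c. ad t y = c *. y}" for a r
          using a by (auto simp: ad_cscale cscale_cscale)
      qed
    next
      case (step t)
      thus ?case using y by (auto simp: Y_def)
    qed
    hence "\<forall>t\<in>h. \<exists>c. ad t y = c *. y" using B(3) by blast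
    from bchoice[OF this] obtain \<beta> where "\<forall>t\<in>h. ad t y = \<beta> t *. y" ..
    thus "\<exists>\<beta>. weight_vector \<beta> y" using y by (auto simp: weight_vector_def Y_def)
  qed
  hence "cv.span (Y B) \<subseteq> cv.span {y. \<exists>\<beta>. weight_vector \<beta> y}" by (rule cv.span_mono)
  finally show ?thesis .
qed

text \<open>The nilpotent elements of the centraliser form a subalgebra to which Engel's theorem
  applies. They are trace orthogonal to \<open>h\<close>, hence by Jordan decomposition to the whole
  centraliser, and by invariance to all vectors of nonzero weight. So they are 0, and only
  semisimple parts remain.\<close>

theorem cent_eq: "cent = h"
proof
  show "h \<subseteq> cent" using h_lie h_abelian by (auto simp: cent_def)
  have cs: "cv.subspace cent" unfolding cent_def
    using cv_sub[OF lie_subspace]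
    by (intro cv.subspaceI) (auto simp: ad_add ad_scale)
  \<comment> \<open>These turn out to be the elements of \<open>cent\<close> orthogonal to
    \<open>h\<close>, a description that makes closure under sums visible.\<close>
  define nc where "nc = {x \<in> cent. \<exists>m. x ^ m = 0}"
  have trh: "tr (x * C) = 0" if "x \<in> nc" "C \<in> h" for x C
    using that cent_commute[of x C] tr_commuting_nilpotent[of x C] by (auto simp: nc_def)
  have ncI: "x \<in> nc" if x: "x \<in> cent" "\<And>C. C \<in> h ==> tr (x * C) = 0" for x
  proof -
    obtain N m where "N ^ m = 0" "x = N" using cent_jordan[OF x(1)] x(2) by metis
    thus ?thesis using x(1) by (auto simp: nc_def)
  qed
  have ncs: "cv.subspace nc"
  proof (rule cv.subspaceI)
    show "0 \<in> nc" using cv.subspace_0[OF cs] by (auto simp: nc_def intro!: exI[of _ 1])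
    show "x + y \<in> nc" if "x \<in> nc" "y \<in> nc" for x y
      using that trh[of x] trh[of y] cv.subspace_add[OF cs] by (intro ncI) (auto simp: nc_def distrib_right tr_add)
    show "c *. x \<in> nc" if "x \<in> nc" for c x
      using that trh[of x] cv.subspace_scale[OF cs] by (intro ncI) (auto simp: nc_def tr_scale)
  qed
  have nca: "ad x y \<in> nc" if xy: "x \<in> nc" "y \<in> nc" for x y
  proof (rule ncI)
    have "x \<in> cent" "y \<in> cent" using xy by (auto simp: nc_def)
    thus "ad x y \<in> cent" unfolding cent_def using lie_ad ad_jacobi[of _ x y] by (auto simp: ad_def[of 0])
    show "tr (ad x y * C) = 0" if "C \<in> h" for C
      using that cent_commute[OF \<open>y \<in> cent\<close>, of C] by (simp add: tr_ad) (simp add: ad_def)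
  qed
  have "\<exists>m. x ^ m = 0" if "x \<in> nc" for x using that by (simp add: nc_def)
  then obtain k where k: "wk app nc k = UNIV" using engel[OF ncs nca] by blast
  have z: "x = 0" if x: "x \<in> nc" for x
  proof (rule trace_form_nondegenerate)
    show "x \<in> lie" using x by (simp add: nc_def cent_def)
    have c: "tr (x * y) = 0" if y: "y \<in> cent" for y
    proof -
      obtain S N m where S: "y = S + N" "S \<in> h" "N \<in> cent" "N ^ m = 0" using cent_jordan[OF y] by metis
      thus ?thesis using trh[OF x] engel_tr[OF k x, of N] by (auto simp: distrib_left tr_add nc_def)
    qed
    have w: "tr (x * y) = 0" if y: "weight_vector \<beta> y" for \<beta> y
    proof (cases "\<exists>t\<in>h. \<beta> t \<noteq> 0")
      case True
      then obtain t where t: "t \<in> h" "\<beta> t \<noteq> 0" by blast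
      have "x * t = t * x" using x t cent_commute by (auto simp: nc_def)
      hence "ad x t = 0" by (simp add: ad_def)
      hence "tr (x * ad t y) = 0" using tr_ad[of x t y] by simp
      thus ?thesis using y t by (simp add: weight_vector_def tr_scale)
    next
      case False
      thus ?thesis using y by (intro c) (auto simp: weight_vector_def cent_def)
    qed
    show "tr (x * y) = 0" if "y \<in> lie" for y
    proof -
      have "y \<in> cv.span {y. \<exists>\<beta>. weight_vector \<beta> y}" using that lie_span_weight_vectors by blast
      thus ?thesis
      proof (induction rule: cv.span_induct)
        case base
        show ?case by (rule cv.subspaceI) (auto simp: distrib_left tr_add tr_scale)
      qed (use w in auto)
    qed
  qed
  show "cent \<subseteq> h"
  proof
    fix x assume x: "x \<in> cent"
    obtain S N m where S: "x = S + N" "S \<in> h" "N \<in> cent" "N ^ m = 0" using cent_jordan[OF x] by metis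
    hence "N \<in> nc" unfolding nc_def by blast
    hence "N = 0" by (rule z)
    thus "x \<in> h" using S(1,2) by simp
  qed
qed

end

section \<open>Nilpotent weight vectors and sl_2\<close>

lemma wk_singleton: "v \<in> wk f {x} n \<longleftrightarrow> (f x ^^ n) v = 0"
  by (induction n arbitrary: v) (auto simp: funpow_swap1)

lemma ad_nilpotent: assumes "(e :: 'n::finite mx) ^ k = 0" shows "(ad e ^^ (2 * k)) y = 0"
proof -
  have "(app e ^^ i) v = (e ^ i) *> v" for i v by (induction i) auto
  hence "wk app {e} k = UNIV" using assms by (auto simp: wk_singleton)
  from wk_ad_UNIV[OF this] have "y \<in> wk ad {e} (2 * k)" by blast
  thus ?thesis by (simp add: wk_singleton)
qed

lemma ad_power_eigen: "ad H e = c *. e ==> ad H (e ^ m) = (of_nat m * c) *. e ^ m"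
  by (induction m) (auto simp: ad_mult cscale_simps ad_def[of _ 1] distrib_right)

text \<open>The powers of \<open>e\<close> would otherwise be eigenvectors of \<open>ad H\<close>
  for the infinitely many values m c.\<close>

lemma eigen_nilpotent: assumes "diagonalisable H" "ad H e = c *. e" "c \<noteq> 0" shows "\<exists>m. e ^ m = 0"
proof (rule ccontr)
  assume n: "\<nexists>m. e ^ m = 0"
  obtain C where C: "finite C" "\<And>y c. ad H y = c *. y ==> y \<noteq> 0 ==> c \<in> C" using ad_eigenvalues_finite[OF assms(1)] by metis
  have "range (\<lambda>m. of_nat m * c) \<subseteq> C" using C(2)[OF ad_power_eigen[OF assms(2)]] n by auto
  hence "finite (range (\<lambda>m. of_nat m * c))" using C(1) finite_subset by blast
  moreover have "inj (\<lambda>m. of_nat m * c)" using assms(3) by (auto simp: inj_def)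
  ultimately show False using finite_imageD infinite_UNIV_nat by blast
qed

text \<open>Starting from a nonzero \<open>y\<close> of weight 2k > 0 with e f y = 0, applying f to
  e^(m+1) y returns a nonzero multiple of e^m y. So raising never stops, against the finiteness of
  the eigenvalues of \<open>ad H\<close>.\<close>

lemma sl2_raising:
  assumes H: "diagonalisable H" "ad e f = H" "ad H e = 2 *. e"
    and y: "ad H y = (2 * of_nat k) *. y" "k \<ge> 1" "ad e (ad f y) = 0"
  shows "y = 0"
proof (rule ccontr)
  assume y0: "y \<noteq> 0"
  define u where "u m = (ad e ^^ m) y" for m
  have uS: "u (Suc m) = ad e (u m)" for m by (simp add: u_def)
  have Hu: "ad H (u m) = (2 * of_nat (k + m)) *. u m" for m
  proof (induction m)
    case (Suc m)
    have "ad H (u (Suc m)) = ad (ad H e) (u m) + ad e (ad H (u m))" unfolding uS by (rule ad_jacobi)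
    also have "\<dots> = (2 + 2 * of_nat (k + m)) *. u (Suc m)"
      unfolding H(3) Suc by (simp only: ad_cscale ad_scale uS cscale_add_left)
    also have "2 + 2 * of_nat (k + m) = (2 * of_nat (k + Suc m) :: complex)" by simp
    finally show ?case .
  qed (simp add: u_def y)
  \<comment> \<open>The sum of the weights of y, e y, ..., e^(m-1) y, positive for m > 0 because k
    >= 1.\<close>
  define c where "c m = (\<Sum>i<m. 2 * (k + i))" for m
  have fu: "ad f (u (Suc m)) = - (of_nat (c (Suc m)) *. u m)" for m
  proof (induction m)
    case 0
    have "ad f (ad e y) = ad (ad f e) y + ad e (ad f y)" by (rule ad_jacobi)
    also have "ad f e = - H" using ad_skew[of f e] H(2) by simp
    also have "ad (- H) y = - ad H y" using ad_cscale[of "-1" H y] by simp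
    finally show ?case by (simp add: uS u_def y c_def)
  next
    case (Suc m)
    have "ad f (ad e (u (Suc m))) = ad (ad f e) (u (Suc m)) + ad e (ad f (u (Suc m)))" by (rule ad_jacobi)
    also have "ad f e = - H" using ad_skew[of f e] H(2) by simp
    also have "ad (- H) (u (Suc m)) = - ad H (u (Suc m))" using ad_cscale[of "-1" H] by simp
    also have "ad e (ad f (u (Suc m))) = - (of_nat (c (Suc m)) *. u (Suc m))"
      unfolding Suc by (simp add: ad_minus ad_scale uS)
    also have "- ad H (u (Suc m)) + - (of_nat (c (Suc m)) *. u (Suc m)) = - ((2 * of_nat (k + Suc m) + of_nat (c (Suc m))) *. u (Suc m))"
      unfolding Hu by (simp add: cscale_add_left)
    also have "2 * of_nat (k + Suc m) + of_nat (c (Suc m)) = (of_nat (c (Suc (Suc m))) :: complex)"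
      unfolding c_def sum.lessThan_Suc[of _ "Suc m"] by simp
    finally show ?case unfolding uS[of "Suc m"] .
  qed
  have un0: "u m \<noteq> 0" for m
  proof (induction m)
    case (Suc m)
    have "c (Suc m) \<noteq> 0" using y(2) by (auto simp: c_def sum.lessThan_Suc_shift simp del: sum.lessThan_Suc)
    thus ?case using fu[of m] Suc by (metis ad_0 cv.scale_eq_0_iff neg_equal_0_iff_equal of_nat_eq_0_iff)
  qed (simp add: u_def y0)
  obtain C where C: "finite C" "\<And>y c. ad H y = c *. y ==> y \<noteq> 0 ==> c \<in> C" using ad_eigenvalues_finite[OF H(1)] by metis
  have "range (\<lambda>m. 2 * of_nat (k + m)) \<subseteq> C" using C(2)[OF Hu un0] by auto
  hence "finite (range (\<lambda>m. 2 * of_nat (k + m) :: complex))" using C(1) finite_subset by blast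
  moreover have "inj (\<lambda>m. 2 * of_nat (k + m) :: complex)" by (auto simp: inj_def)
  ultimately show False using finite_imageD infinite_UNIV_nat by blast
qed

text \<open>Induction on the index set: independence yields an element killed by the old functionals
  but not by the new one, and a multiple of it corrects the new value.\<close>

lemma independent_functionals:
  fixes h :: "'a::cvec set" and \<phi> :: "'i => 'a => complex"
  assumes h: "cv.subspace h" and "finite I" and "\<And>i. i \<in> I ==> clin (\<phi> i)"
    and "\<And>c. (\<forall>t\<in>h. (\<Sum>i\<in>I. c i * \<phi> i t) = 0) ==> \<forall>i\<in>I. c i = 0"
  shows "\<exists>t\<in>h. \<forall>i\<in>I. \<phi> i t = v i"
  using assms(2-4)
proof (induction I arbitrary: v)
  case empty
  thus ?case using cv.subspace_0[OF h] by auto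
next
  case (insert b I)
  have ind': "\<forall>i\<in>I. c i = 0" if c: "\<forall>t\<in>h. (\<Sum>i\<in>I. c i * \<phi> i t) = 0" for c
  proof -
    have "(\<Sum>i\<in>insert b I. (c(b := 0)) i * \<phi> i t) = (\<Sum>i\<in>I. c i * \<phi> i t)" for t
    proof -
      have "(\<Sum>i\<in>insert b I. (c(b := 0)) i * \<phi> i t) = (\<Sum>i\<in>I. (c(b := 0)) i * \<phi> i t)"
        using insert.hyps by (subst sum.insert) simp_all
      also have "\<dots> = (\<Sum>i\<in>I. c i * \<phi> i t)" using insert.hyps by (intro sum.cong) auto
      finally show ?thesis .
    qed
    hence "\<forall>i\<in>insert b I. (c(b := 0)) i = 0" using c by (intro insert.prems(2)) simp
    thus ?thesis using insert.hyps(2) by (metis fun_upd_other insertI2)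
  qed
  have IH: "\<exists>t\<in>h. \<forall>i\<in>I. \<phi> i t = v i" for v using insert.prems(1) ind' by (intro insert.IH) auto
  have "\<exists>k\<in>h. (\<forall>i\<in>I. \<phi> i k = 0) \<and> \<phi> b k \<noteq> 0"
  proof (rule ccontr)
    assume n: "\<not> ?thesis"
    have "\<forall>j. \<exists>t. t \<in> h \<and> (\<forall>i\<in>I. \<phi> i t = (if i = j then 1 else 0))"
    proof
      show "\<exists>t. t \<in> h \<and> (\<forall>i\<in>I. \<phi> i t = (if i = j then 1 else 0))" for j
        using IH[of "\<lambda>i. if i = j then 1 else 0"] by blast
    qed
    from choice[OF this] obtain w where w: "w j \<in> h" "i \<in> I ==> \<phi> i (w j) = (if i = j then 1 else 0)" for i j by blast
    \<comment> \<open>If the new functional vanished on the common kernel of the old ones, it would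
      be their combination with coefficients given by the dual family \<open>w\<close>; this is that
      relation, with coefficient 1 at \<open>b\<close>.\<close>
    define c where "c i = (if i = b then 1 else - \<phi> b (w i))" for i
    have b: "clin (\<phi> b)" using insert.prems(1) by simp
    have "(\<Sum>i\<in>insert b I. c i * \<phi> i t) = 0" if t: "t \<in> h" for t
    proof -
      define k where "k = t - (\<Sum>j\<in>I. \<phi> j t *. w j)"
      have kh: "k \<in> h" unfolding k_def by (intro cv.subspace_diff h cv.subspace_sum cv.subspace_scale w(1) t)
      have "\<phi> i k = 0" if i: "i \<in> I" for i
      proof -
        have "clin (\<phi> i)" using insert.prems(1) i by simp
        hence "\<phi> i k = \<phi> i t - (\<Sum>j\<in>I. \<phi> j t * (if i = j then 1 else 0))"
          by (simp add: k_def clin_diff clin_sum clin_scale w(2)[OF i] cscale_complex_def)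
        thus ?thesis using insert.hyps i by (simp add: if_distrib cong: if_cong)
      qed
      hence "\<phi> b k = 0" using n kh by blast
      hence "\<phi> b t = (\<Sum>j\<in>I. \<phi> j t * \<phi> b (w j))"
        by (simp add: k_def clin_diff[OF b] clin_sum[OF b] clin_scale[OF b] cscale_complex_def)
      moreover have "(\<Sum>i\<in>I. c i * \<phi> i t) = - (\<Sum>j\<in>I. \<phi> j t * \<phi> b (w j))"
        unfolding sum_negf[symmetric] using insert.hyps by (intro sum.cong) (auto simp: c_def)
      ultimately show ?thesis using insert.hyps by (simp add: c_def)
    qed
    hence "\<forall>i\<in>insert b I. c i = 0" by (intro insert.prems(2)) blast
    thus False by (simp add: c_def)
  qed
  then obtain k where k: "k \<in> h" "\<And>i. i \<in> I ==> \<phi> i k = 0" "\<phi> b k \<noteq> 0" by blast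
  obtain t where t: "t \<in> h" "\<And>i. i \<in> I ==> \<phi> i t = v i" using IH by blast
  define s where "s = t + ((v b - \<phi> b t) / \<phi> b k) *. k"
  have "s \<in> h" unfolding s_def by (intro cv.subspace_add h cv.subspace_scale t k)
  moreover have "\<phi> i s = v i" if "i \<in> insert b I" for i
  proof -
    have "clin (\<phi> i)" using insert.prems(1) that by simp
    hence "\<phi> i s = \<phi> i t + (v b - \<phi> b t) / \<phi> b k * \<phi> i k" by (simp add: s_def clin_add clin_scale cscale_complex_def)
    thus ?thesis using that k t by auto
  qed
  ultimately show ?case by blast
qed

section \<open>Positive root spaces and the minimal parabolic subalgebra of a simple root\<close>

locale simple_roots = toral +
  fixes \<Delta> :: "'i set" and \<phi> :: "'i => 'a mx => complex" and a :: 'i and \<alpha> :: "'a mx => complex" and e f :: "'a mx"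
  assumes fin: "finite \<Delta>" and lin: "\<And>\<gamma>. \<gamma> \<in> \<Delta> ==> clin (\<phi> \<gamma>)"
    and ind: "\<And>c. (\<forall>t\<in>h. (\<Sum>\<gamma>\<in>\<Delta>. c \<gamma> * \<phi> \<gamma> t) = 0) ==> \<forall>\<gamma>\<in>\<Delta>. c \<gamma> = 0"
    and pos: "\<And>\<beta> y. weight_vector \<beta> y ==> y \<noteq> 0 ==> \<exists>t\<in>h. \<beta> t \<noteq> 0 ==>
      \<exists>k::_ => nat. (\<forall>t\<in>h. \<beta> t = (\<Sum>\<gamma>\<in>\<Delta>. of_nat (k \<gamma>) * \<phi> \<gamma> t)) \<or> (\<forall>t\<in>h. - \<beta> t = (\<Sum>\<gamma>\<in>\<Delta>. of_nat (k \<gamma>) * \<phi> \<gamma> t))"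
    and a: "a \<in> \<Delta>" and \<alpha>: "\<alpha> = \<phi> a" and e: "weight_vector \<alpha> e" and f: "weight_vector (\<lambda>t. - \<alpha> t) f"
    and H: "ad e f \<in> h" "\<alpha> (ad e f) = 2"
begin

lemma sl2_relations: "diagonalisable (ad e f)" "ad (ad e f) e = 2 *. e" "ad (ad e f) f = (-2) *. f"
  using h_diag H e f by (auto simp: weight_vector_def)

lemma e_nilpotent: "\<exists>m. e ^ m = 0" and f_nilpotent: "\<exists>m. f ^ m = 0"
  using eigen_nilpotent[OF sl2_relations(1,2)] eigen_nilpotent[OF sl2_relations(1,3)] by auto

lemma weight_vector_ad:
  assumes "weight_vector \<beta> x" "weight_vector \<gamma> y" shows "weight_vector (\<lambda>t. \<beta> t + \<gamma> t) (ad x y)"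
  using assms lie_ad ad_jacobi[of _ x y]
  by (auto simp: weight_vector_def ad_cscale ad_scale cscale_simps)

text \<open>One-dimensionality of the simple root space, and absence of higher multiples of the
  root. Both come from \<open>sl2_raising\<close>; in the base case this uses that the centraliser
  of \<open>h\<close> is \<open>h\<close>, so \<open>ad f y\<close> lies in \<open>h\<close> and
  acts on \<open>e\<close> by a scalar.\<close>

lemma root_multiple_space: "weight_vector (\<lambda>t. of_nat (Suc k) * \<alpha> t) y ==> (\<exists>c. y = c *. e) \<and> (k \<noteq> 0 --> y = 0)"
proof (induction k arbitrary: y)
  case 0
  have "weight_vector (\<lambda>t. 0) (ad f y)" using weight_vector_ad[OF f 0] by simp
  hence "ad f y \<in> cent" by (simp add: weight_vector_def cent_def)
  hence z: "ad f y \<in> h" using cent_eq by blast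
  \<comment> \<open>Chosen so that \<alpha> vanishes on \<open>ad f (y + c *. e)\<close>, given that
    \<alpha> takes the value 2 on \<open>ad e f\<close>.\<close>
  define c where "c = \<alpha> (ad f y) / 2"
  define y' where "y' = y + c *. e"
  have fy': "ad f y' = ad f y - c *. ad e f"
    using ad_skew[of f e] by (simp add: y'_def ad_add ad_scale)
  have fh: "ad f y' \<in> h" unfolding fy' by (intro cv.subspace_diff h_subspace cv.subspace_scale z H)
  have "\<alpha> (ad f y') = 0"
    unfolding fy' using lin[OF a] H(2) \<alpha> by (simp add: clin_diff clin_scale c_def cscale_complex_def)
  hence "ad (ad f y') e = 0" using fh e by (simp add: weight_vector_def)
  hence A: "ad e (ad f y') = 0" using ad_skew[of e "ad f y'"] by simp
  have B: "ad (ad e f) y' = (2 * of_nat 1) *. y'"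
    using 0 e H by (simp add: y'_def weight_vector_def ad_add ad_scale cscale_simps mult.commute)
  have "y' = 0" by (rule sl2_raising[OF sl2_relations(1) refl sl2_relations(2) B _ A]) simp
  hence "y = (- c) *. e" by (simp add: y'_def add_eq_0_iff)
  thus ?case by blast
next
  case (Suc k)
  have "weight_vector (\<lambda>t. of_nat (Suc k) * \<alpha> t) (ad f y)"
    using weight_vector_ad[OF f Suc.prems] by (simp add: algebra_simps)
  then obtain c where "ad f y = c *. e" using Suc.IH by blast
  hence A: "ad e (ad f y) = 0" by (simp add: ad_scale)
  have B: "ad (ad e f) y = (2 * of_nat (Suc (Suc k))) *. y"
    using Suc.prems H by (simp add: weight_vector_def mult.commute del: of_nat_Suc)
  have "y = 0" by (rule sl2_raising[OF sl2_relations(1) refl sl2_relations(2) B _ A]) simp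
  thus ?case by (auto intro!: exI[of _ 0])
qed

definition pos_weight :: "('a mx => complex) => bool" where
  "pos_weight \<beta> \<longleftrightarrow> (\<exists>t\<in>h. \<beta> t \<noteq> 0) \<and> (\<exists>k::_ => nat. \<forall>t\<in>h. \<beta> t = (\<Sum>\<gamma>\<in>\<Delta>. of_nat (k \<gamma>) * \<phi> \<gamma> t))"

definition pos_vectors :: "'a mx set" where
  "pos_vectors = {y. \<exists>\<beta>. pos_weight \<beta> \<and> weight_vector \<beta> y}"

definition npos :: "'a mx set" where "npos = cv.span pos_vectors"

definition nprime :: "'a mx set" where
  "nprime = cv.span {y. \<exists>\<beta>. pos_weight \<beta> \<and> (\<exists>t\<in>h. \<beta> t \<noteq> \<alpha> t) \<and> weight_vector \<beta> y}"

lemma alpha_sum: "\<alpha> t = (\<Sum>\<gamma>\<in>\<Delta>. (if \<gamma> = a then 1 else 0) * \<phi> \<gamma> t)"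
  using fin a \<alpha> by (simp add: if_distrib[of "\<lambda>x. x * _"] cong: if_cong)

text \<open>A positive weight other than \<alpha> contains a second simple root, since multiples of
  \<alpha> are excluded. Adding or subtracting \<alpha> leaves that coefficient untouched, so the
  new weight is positive and differs from \<alpha>.\<close>

lemma nprime_weight_shift:
  fixes s :: complex
  assumes s: "s = 1 \<or> s = -1" and z: "weight_vector (\<lambda>t. s * \<alpha> t) z"
    and y: "pos_weight \<beta>" "\<exists>t\<in>h. \<beta> t \<noteq> \<alpha> t" "weight_vector \<beta> y"
  shows "ad z y \<in> nprime"
proof (cases "ad z y = 0")
  case True
  thus ?thesis by (simp add: nprime_def cv.span_zero)
next
  case nz: False
  hence "y \<noteq> 0" by auto
  obtain k :: "_ => nat" where k: "\<forall>t\<in>h. \<beta> t = (\<Sum>\<gamma>\<in>\<Delta>. of_nat (k \<gamma>) * \<phi> \<gamma> t)" using y(1) by (auto simp: pos_weight_def)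
  have "\<exists>\<gamma>\<in>\<Delta>. \<gamma> \<noteq> a \<and> k \<gamma> \<noteq> 0"
  proof (rule ccontr)
    assume n: "\<not> ?thesis"
    have b: "\<beta> t = of_nat (k a) * \<alpha> t" if "t \<in> h" for t
    proof -
      have "\<beta> t = (\<Sum>\<gamma>\<in>\<Delta>. if \<gamma> = a then of_nat (k a) * \<alpha> t else 0)"
        unfolding k[rule_format, OF that]
      proof (rule sum.cong[OF refl])
        fix \<gamma> assume "\<gamma> \<in> \<Delta>"
        thus "of_nat (k \<gamma>) * \<phi> \<gamma> t = (if \<gamma> = a then of_nat (k a) * \<alpha> t else 0)"
          using n \<alpha> by (cases "\<gamma> = a") auto
      qed
      thus ?thesis using fin a \<alpha> by simp
    qed
    have "k a \<noteq> 0" using y(1) b by (auto simp: pos_weight_def)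
    then obtain m where m: "k a = Suc m" by (cases "k a") auto
    have "m \<noteq> 0" using y(2) b m by auto
    moreover have "weight_vector (\<lambda>t. of_nat (Suc m) * \<alpha> t) y" using y(3) b m by (simp add: weight_vector_def)
    ultimately show False using root_multiple_space \<open>y \<noteq> 0\<close> by blast
  qed
  then obtain g where g: "g \<in> \<Delta>" "g \<noteq> a" "k g \<noteq> 0" by blast
  let ?b = "\<lambda>t. s * \<alpha> t + \<beta> t"
  have w: "weight_vector ?b (ad z y)" by (rule weight_vector_ad[OF z y(3)])
  \<comment> \<open>By independence every expansion of the shifted weight has coefficient
    \<open>k g\<close> at \<open>g\<close>. This rules out the weight 0, the weight \<alpha>, and a
    nonpositive combination.\<close>
  have key: "\<not> (\<forall>t\<in>h. ?b t = (\<Sum>\<gamma>\<in>\<Delta>. c \<gamma> * \<phi> \<gamma> t))" if "c g \<noteq> of_nat (k g)" for c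
  proof
    assume as: "\<forall>t\<in>h. ?b t = (\<Sum>\<gamma>\<in>\<Delta>. c \<gamma> * \<phi> \<gamma> t)"
    have "\<forall>t\<in>h. (\<Sum>\<gamma>\<in>\<Delta>. (s * (if \<gamma> = a then 1 else 0) + of_nat (k \<gamma>) - c \<gamma>) * \<phi> \<gamma> t) = 0"
    proof
      fix t assume t: "t \<in> h"
      have E: "(\<Sum>\<gamma>\<in>\<Delta>. (s * (if \<gamma> = a then 1 else 0) + of_nat (k \<gamma>) - c \<gamma>) * \<phi> \<gamma> t) =
        s * (\<Sum>\<gamma>\<in>\<Delta>. (if \<gamma> = a then 1 else 0) * \<phi> \<gamma> t) + (\<Sum>\<gamma>\<in>\<Delta>. of_nat (k \<gamma>) * \<phi> \<gamma> t) - (\<Sum>\<gamma>\<in>\<Delta>. c \<gamma> * \<phi> \<gamma> t)"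
        by (simp add: sum_distrib_left sum.distrib[symmetric] sum_subtractf[symmetric] algebra_simps)
      have "\<beta> t = (\<Sum>\<gamma>\<in>\<Delta>. of_nat (k \<gamma>) * \<phi> \<gamma> t)" "s * \<alpha> t + \<beta> t = (\<Sum>\<gamma>\<in>\<Delta>. c \<gamma> * \<phi> \<gamma> t)"
        using as k t by blast+
      thus "(\<Sum>\<gamma>\<in>\<Delta>. (s * (if \<gamma> = a then 1 else 0) + of_nat (k \<gamma>) - c \<gamma>) * \<phi> \<gamma> t) = 0"
        unfolding E alpha_sum[symmetric] by simp
    qed
    from ind[OF this] g that show False by auto
  qed
  have n0: "\<exists>t\<in>h. ?b t \<noteq> 0" using key[of "\<lambda>_. 0"] g(3) by auto
  have na: "\<exists>t\<in>h. ?b t \<noteq> \<alpha> t" using key[of "\<lambda>\<gamma>. if \<gamma> = a then 1 else 0"] g alpha_sum by auto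
  obtain k' :: "_ => nat" where k': "(\<forall>t\<in>h. ?b t = (\<Sum>\<gamma>\<in>\<Delta>. of_nat (k' \<gamma>) * \<phi> \<gamma> t)) \<or> (\<forall>t\<in>h. - ?b t = (\<Sum>\<gamma>\<in>\<Delta>. of_nat (k' \<gamma>) * \<phi> \<gamma> t))"
    using pos[OF w nz n0] by blast
  have "\<not> (\<forall>t\<in>h. - ?b t = (\<Sum>\<gamma>\<in>\<Delta>. of_nat (k' \<gamma>) * \<phi> \<gamma> t))"
  proof
    assume as: "\<forall>t\<in>h. - ?b t = (\<Sum>\<gamma>\<in>\<Delta>. of_nat (k' \<gamma>) * \<phi> \<gamma> t)"
    have "\<forall>t\<in>h. ?b t = (\<Sum>\<gamma>\<in>\<Delta>. - of_nat (k' \<gamma>) * \<phi> \<gamma> t)"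
    proof
      fix t assume "t \<in> h"
      hence "- (- ?b t) = - (\<Sum>\<gamma>\<in>\<Delta>. of_nat (k' \<gamma>) * \<phi> \<gamma> t)" using as by (simp only:)
      thus "?b t = (\<Sum>\<gamma>\<in>\<Delta>. - of_nat (k' \<gamma>) * \<phi> \<gamma> t)"
        by (simp only: minus_minus mult_minus_left sum_negf)
    qed
    moreover have "- of_nat (k' g) \<noteq> (of_nat (k g) :: complex)"
    proof
      assume "- of_nat (k' g) = (of_nat (k g) :: complex)"
      hence "of_nat (k g + k' g) = (0 :: complex)" by (simp flip: \<open>_ = of_nat (k g)\<close>)
      thus False using g(3) by (simp only: of_nat_eq_0_iff)
    qed
    ultimately show False using key[of "\<lambda>\<gamma>. - of_nat (k' \<gamma>)"] by blast
  qed
  hence "pos_weight ?b" using k' n0 unfolding pos_weight_def by blast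
  thus ?thesis unfolding nprime_def using na w by (intro cv.span_base) blast
qed

lemma nprime_ad:
  assumes z: "z \<in> insert e (insert f h)" and y: "y \<in> nprime" shows "ad z y \<in> nprime"
  using y unfolding nprime_def[of]
proof (induction rule: cv.span_induct)
  case base
  show ?case
    by (rule cv.subspaceI) (auto simp: ad_add ad_scale cv.span_zero intro: cv.span_add cv.span_scale)
next
  case (step y)
  then obtain \<beta> where b: "pos_weight \<beta>" "\<exists>t\<in>h. \<beta> t \<noteq> \<alpha> t" "weight_vector \<beta> y" by blast
  consider "z = e" | "z = f" | "z \<in> h" using z by blast
  thus ?case
  proof cases
    case 1
    thus ?thesis using nprime_weight_shift[of 1 z, OF _ _ b] e by (simp add: nprime_def)
  next
    case 2
    thus ?thesis using nprime_weight_shift[of "-1" z, OF _ _ b] f by (simp add: nprime_def)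
  next
    case 3
    hence "ad z y = \<beta> z *. y" using b(3) by (simp add: weight_vector_def)
    thus ?thesis using step by (auto intro: cv.span_scale cv.span_base)
  qed
qed

lemma nprime_lie: "nprime \<subseteq> lie"
  unfolding nprime_def by (rule cv.span_minimal[OF _ lie_subspace]) (auto simp: weight_vector_def)

text \<open>The vectors of weight \<alpha> are the multiples of \<open>e\<close>, so splitting them
  off leaves exactly \<open>nprime\<close>.\<close>

lemma npos_eq: "npos = {c *. e + y | c y. y \<in> nprime}"
proof
  have S: "{c *. e + y | c y. y \<in> nprime} = cv.span (insert e {y. \<exists>\<beta>. pos_weight \<beta> \<and> (\<exists>t\<in>h. \<beta> t \<noteq> \<alpha> t) \<and> weight_vector \<beta> y})"
  proof (rule Set.set_eqI)
    fix x
    have "(\<exists>c y. x = c *. e + y \<and> y \<in> nprime) \<longleftrightarrow> (\<exists>k. x - k *. e \<in> nprime)"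
    proof
      assume "\<exists>c y. x = c *. e + y \<and> y \<in> nprime"
      then obtain c y where "x = c *. e + y" "y \<in> nprime" by blast
      hence "x - c *. e \<in> nprime" by simp
      thus "\<exists>k. x - k *. e \<in> nprime" ..
    next
      assume "\<exists>k. x - k *. e \<in> nprime"
      then obtain k where "x - k *. e \<in> nprime" ..
      moreover have "x = k *. e + (x - k *. e)" by simp
      ultimately show "\<exists>c y. x = c *. e + y \<and> y \<in> nprime" by blast
    qed
    thus "x \<in> {c *. e + y | c y. y \<in> nprime} \<longleftrightarrow> x \<in> cv.span (insert e {y. \<exists>\<beta>. pos_weight \<beta> \<and> (\<exists>t\<in>h. \<beta> t \<noteq> \<alpha> t) \<and> weight_vector \<beta> y})"
      unfolding cv.span_insert nprime_def[symmetric] mem_Collect_eq .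
  qed
  have "\<alpha> (ad e f) \<noteq> 0" using H by simp
  hence pa: "pos_weight \<alpha>" unfolding pos_weight_def using H(1) alpha_sum
    by (auto intro!: exI[of _ "\<lambda>\<gamma>. if \<gamma> = a then 1 else 0"] simp: if_distrib cong: if_cong)
  show "npos \<subseteq> {c *. e + y | c y. y \<in> nprime}" unfolding npos_def
  proof (rule cv.span_minimal)
    show "cv.subspace {c *. e + y | c y. y \<in> nprime}" unfolding S by (rule cv.subspace_span)
    show "pos_vectors \<subseteq> {c *. e + y | c y. y \<in> nprime}"
    proof
      fix y assume "y \<in> pos_vectors"
      then obtain \<beta> where b: "pos_weight \<beta>" "weight_vector \<beta> y" by (auto simp: pos_vectors_def)
      show "y \<in> {c *. e + y | c y. y \<in> nprime}"
      proof (cases "\<exists>t\<in>h. \<beta> t \<noteq> \<alpha> t")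
        case True
        thus ?thesis unfolding S using b by (intro cv.span_base) blast
      next
        case False
        hence "weight_vector (\<lambda>t. of_nat (Suc 0) * \<alpha> t) y" using b(2) by (simp add: weight_vector_def)
        then obtain c where "y = c *. e" using root_multiple_space by blast
        thus ?thesis unfolding S by (simp add: cv.span_scale cv.span_base)
      qed
    qed
  qed
  show "{c *. e + y | c y. y \<in> nprime} \<subseteq> npos" unfolding S npos_def
    using pa e by (intro cv.span_mono) (auto simp: pos_vectors_def)
qed

text \<open>On an element where all simple roots take the value 1, a positive root takes its height,
  a positive integer.\<close>

lemma height_element: "\<exists>\<rho>\<in>h. \<forall>y\<in>pos_vectors. \<exists>j::nat. j \<ge> 1 \<and> ad \<rho> y = of_nat j *. y"
proof -
  have "\<exists>t\<in>h. \<forall>\<gamma>\<in>\<Delta>. \<phi> \<gamma> t = 1"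
  proof (rule independent_functionals[OF h_subspace fin, where \<phi> = \<phi>])
    show "clin (\<phi> \<gamma>)" if "\<gamma> \<in> \<Delta>" for \<gamma> by (rule lin[OF that])
    show "\<forall>\<gamma>\<in>\<Delta>. c \<gamma> = 0" if "\<forall>t\<in>h. (\<Sum>\<gamma>\<in>\<Delta>. c \<gamma> * \<phi> \<gamma> t) = 0" for c by (rule ind[OF that])
  qed
  then obtain \<rho> where r: "\<rho> \<in> h" "\<forall>\<gamma>\<in>\<Delta>. \<phi> \<gamma> \<rho> = 1" by blast
  have "\<exists>j::nat. j \<ge> 1 \<and> ad \<rho> y = of_nat j *. y" if y: "y \<in> pos_vectors" for y
  proof -
    obtain \<beta> where b: "pos_weight \<beta>" "weight_vector \<beta> y" using y by (auto simp: pos_vectors_def)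
    then obtain k :: "_ => nat" where k: "\<forall>t\<in>h. \<beta> t = (\<Sum>\<gamma>\<in>\<Delta>. of_nat (k \<gamma>) * \<phi> \<gamma> t)" by (auto simp: pos_weight_def)
    have "\<beta> \<rho> = of_nat (\<Sum>\<gamma>\<in>\<Delta>. k \<gamma>)" using k r by (auto intro!: sum.cong)
    moreover have "(\<Sum>\<gamma>\<in>\<Delta>. k \<gamma>) \<noteq> 0"
    proof
      assume "(\<Sum>\<gamma>\<in>\<Delta>. k \<gamma>) = 0"
      hence "\<forall>t\<in>h. \<beta> t = 0" using k fin by simp
      thus False using b(1) by (auto simp: pos_weight_def)
    qed
    ultimately show ?thesis using b(2) r(1) unfolding weight_vector_def
      by (intro exI[of _ "\<Sum>\<gamma>\<in>\<Delta>. k \<gamma>"]) auto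
  qed
  thus ?thesis using r(1) by blast
qed

text \<open>A weight is determined by its values on a finite spanning set of \<open>h\<close>, each
  from a finite set of eigenvalues. Finiteness matters because a sum over infinitely many positive
  roots would be 0 by convention in \<open>nilradical\<close>.\<close>

lemma pos_weight_restrict_finite: "finite {restrict \<beta> h | \<beta>. \<exists>y. weight_vector \<beta> y \<and> y \<noteq> 0}"
proof -
  obtain B where B: "finite B" "B \<subseteq> h" "h \<subseteq> cv.span B" by (rule mx_finite_span[OF h_subspace])
  have "\<exists>C. finite C \<and> (\<forall>y c. ad t y = c *. y --> y \<noteq> 0 --> c \<in> C)" if "t \<in> h" for t
    using ad_eigenvalues_finite[OF h_diag[OF that]] by metis
  then obtain C where C: "\<And>t. t \<in> h ==> finite (C t)" "\<And>t y c. t \<in> h ==> ad t y = c *. y ==> y \<noteq> 0 ==> c \<in> C t" by metis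
  let ?W = "{restrict \<beta> h | \<beta>. \<exists>y. weight_vector \<beta> y \<and> y \<noteq> 0}"
  have "finite ((\<lambda>\<beta>. restrict \<beta> B) ` ?W)"
  proof (rule finite_subset)
    show "(\<lambda>\<beta>. restrict \<beta> B) ` ?W \<subseteq> (\<Pi>\<^sub>E t\<in>B. C t)"
    proof
      fix b assume "b \<in> (\<lambda>\<beta>. restrict \<beta> B) ` ?W"
      then obtain \<beta> y where b: "b = restrict (restrict \<beta> h) B" "weight_vector \<beta> y" "y \<noteq> 0" by blast
      have "restrict \<beta> h t \<in> C t" if t: "t \<in> B" for t
      proof -
        have "t \<in> h" using t B(2) by blast
        thus ?thesis using C(2)[of t y "\<beta> t"] b(2,3) by (simp add: weight_vector_def)
      qed
      thus "b \<in> (\<Pi>\<^sub>E t\<in>B. C t)" unfolding b(1) by (intro restrict_PiE_iff[THEN iffD2] ballI)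
    qed
    show "finite (\<Pi>\<^sub>E t\<in>B. C t)" using B C by (intro finite_PiE) auto
  qed
  moreover have "inj_on (\<lambda>\<beta>. restrict \<beta> B) ?W"
  proof (rule inj_onI)
    fix b c assume "b \<in> ?W" "c \<in> ?W" and eq: "restrict b B = restrict c B"
    then obtain \<beta> y \<gamma> z where b: "b = restrict \<beta> h" "weight_vector \<beta> y" "y \<noteq> 0"
      and c: "c = restrict \<gamma> h" "weight_vector \<gamma> z" "z \<noteq> 0" by blast
    have BE: "\<beta> t = \<gamma> t" if "t \<in> B" for t using eq that B(2) b(1) c(1) by (metis restrict_apply subsetD)
    have "t \<in> h --> \<beta> t = \<gamma> t" if "t \<in> cv.span B" for t
    proof -
      have "t \<in> {t. t \<in> h \<and> \<beta> t = \<gamma> t}"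
      proof -
        have add: "\<beta> (s + t) = \<beta> s + \<beta> t" "\<beta> (r *. t) = r * \<beta> t" if "weight_vector \<beta> y" "y \<noteq> 0" "s \<in> h" "t \<in> h" for \<beta> y s t r
        proof -
          have "ad (s + t) y = ad s y + ad t y" "ad (r *. t) y = r *. ad t y"
            by (simp_all add: ad_def algebra_simps cscale_simps)
          hence "(\<beta> (s + t) - (\<beta> s + \<beta> t)) *. y = 0" "(\<beta> (r *. t) - r * \<beta> t) *. y = 0"
            using that cv.subspace_add[OF h_subspace that(3,4)] cv.subspace_scale[OF h_subspace that(4), of r]
            by (simp_all add: weight_vector_def cscale_simps)
          thus "\<beta> (s + t) = \<beta> s + \<beta> t" "\<beta> (r *. t) = r * \<beta> t" using that(2) by simp_all
        qed
        have "\<beta> 0 = 0" "\<gamma> 0 = 0" using add(2)[OF b(2,3) _ cv.subspace_0[OF h_subspace], of 0 0]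
          add(2)[OF c(2,3) _ cv.subspace_0[OF h_subspace], of 0 0] cv.subspace_0[OF h_subspace] by simp_all
        hence "cv.subspace {t. t \<in> h \<and> \<beta> t = \<gamma> t}"
          using cv_sub[OF h_subspace]
          by (intro cv.subspaceI) (auto simp: add[OF b(2,3)] add[OF c(2,3)])
        hence "cv.span B \<subseteq> {t. t \<in> h \<and> \<beta> t = \<gamma> t}"
          by (rule cv.span_minimal[rotated]) (use BE B(2) in auto)
        thus ?thesis using that by blast
      qed
      thus ?thesis by simp
    qed
    thus "b = c" using B(3) b(1) c(1) by (auto simp: fun_eq_iff restrict_def)
  qed
  ultimately show ?thesis by (rule finite_imageD)
qed

end

section \<open>From the group to its root data\<close>

abbreviation mxs :: "'n::finite cmat set => 'n mx set" where "mxs S \<equiv> {x. mat_of x \<in> S}"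

text \<open>All that the equivalence of categories uses about the pair \<open>(g, h)\<close>: \<open>n'\<close> is the nilradical of the
  minimal parabolic subalgebra attached to \<open>\<alpha>\<close>, and \<open>\<rho>\<close> is an element of \<open>h\<close> on which all simple roots are \<open>1\<close>.\<close>

locale root_setup =
  fixes g h n' :: "'n::finite mx set" and \<alpha> :: "'n mx => complex" and e f \<rho> :: "'n mx"
  assumes g_subspace: "cv.subspace g" and g_ad: "\<And>x y. x \<in> g ==> y \<in> g ==> ad x y \<in> g"
    and h_subspace: "cv.subspace h" and h_g: "h \<subseteq> g" and h_ad: "\<And>s t. s \<in> h ==> t \<in> h ==> ad s t = 0"
    and e_g: "e \<in> g" and f_g: "f \<in> g" and H_h: "ad e f \<in> h" and \<alpha>_H: "\<alpha> (ad e f) = 2"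
    and h_e: "\<And>t. t \<in> h ==> ad t e = \<alpha> t *. e" and h_f: "\<And>t. t \<in> h ==> ad t f = - (\<alpha> t *. f)"
    and e_nilp: "\<exists>m. e ^ m = 0" and f_nilp: "\<exists>m. f ^ m = 0"
    and n'_subspace: "cv.subspace n'" and n'_g: "n' \<subseteq> g"
    and n'_ad: "\<And>z y. z \<in> insert e (insert f h) ==> y \<in> n' ==> ad z y \<in> n'"
    and \<rho>_h: "\<rho> \<in> h"
    and \<rho>_n: "{c *. e + y | c y. y \<in> n'} \<subseteq> cv.span {y. y \<in> {c *. e + y | c y. y \<in> n'} \<and> (\<exists>j::nat. j \<ge> 1 \<and> ad \<rho> y = of_nat j *. y)}"

lemma carrier_GL: "carrier GL = {A. invertible A}" by (simp add: GL_def)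

lemma closedin_GL_iff:
  fixes G :: "'n::finite cmat set"
  shows "closedin (subtopology zariski (carrier GL)) G \<longleftrightarrow>
    (\<exists>F. (\<forall>p\<in>F. poly_fun p) \<and> G = {A. invertible A \<and> (\<forall>p\<in>F. p A = 0)})"
proof -
  have c: "closedin zariski T \<longleftrightarrow> (\<exists>F. (\<forall>p\<in>F. poly_fun p) \<and> T = {A. \<forall>p\<in>F. p A = 0})" for T :: "'n cmat set"
  proof -
    have "closedin zariski T \<longleftrightarrow> zariski_open (- T)"
      by (simp add: closedin_def topspace_zariski openin_zariski Compl_eq_Diff_UNIV)
    also have "\<dots> \<longleftrightarrow> (\<exists>F. (\<forall>p\<in>F. poly_fun p) \<and> T = {A. \<forall>p\<in>F. p A = 0})"
    proof -
      have "- T = {A. \<exists>p\<in>F. p A \<noteq> 0} \<longleftrightarrow> T = {A. \<forall>p\<in>F. p A = 0}" for F :: "('n cmat => complex) set" by blast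
      thus ?thesis unfolding zariski_open_def by simp
    qed
    finally show ?thesis .
  qed
  have e: "{A. \<forall>p\<in>F. p A = 0} \<inter> carrier GL = {A. invertible A \<and> (\<forall>p\<in>F. p A = 0)}" for F :: "('n cmat => complex) set"
    unfolding carrier_GL by blast
  have "closedin (subtopology zariski (carrier GL)) G \<longleftrightarrow> (\<exists>T. closedin zariski T \<and> G = T \<inter> carrier GL)"
    by (rule closedin_subtopology)
  also have "\<dots> \<longleftrightarrow> (\<exists>F. (\<forall>p\<in>F. poly_fun p) \<and> G = {A. \<forall>p\<in>F. p A = 0} \<inter> carrier GL)"
    unfolding c
  proof (rule iffI; elim exE conjE)
    fix T F assume "\<forall>p\<in>F. poly_fun p" "T = {A. \<forall>p\<in>F. p A = 0}" "G = T \<inter> carrier GL"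
    thus "\<exists>F. (\<forall>p\<in>F. poly_fun p) \<and> G = {A. \<forall>p\<in>F. p A = 0} \<inter> carrier GL"
      by (intro exI[of _ F] conjI) simp_all
  next
    fix F assume "\<forall>p\<in>F. poly_fun p" "G = {A. \<forall>p\<in>F. p A = 0} \<inter> carrier GL"
    thus "\<exists>T. (\<exists>F. (\<forall>p\<in>F. poly_fun p) \<and> T = {A. \<forall>p\<in>F. p A = 0}) \<and> G = T \<inter> carrier GL"
      by (intro exI[of _ "{A. \<forall>p\<in>F. p A = 0}"] exI[of _ F] conjI) simp_all
  qed
  finally show ?thesis unfolding e .
qed

lemma mat_eq_1: "mat_of x = mat 1 \<longleftrightarrow> x = 1" by (metis mat_of_inject mat_of_simps(2))

lemma invertible_mx: "invertible (mat_of x) \<longleftrightarrow> (\<exists>y. x * y = 1)"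
proof -
  have "invertible (mat_of x) \<longleftrightarrow> (\<exists>B. mat_of x ** B = mat 1)" by (rule invertible_right_inverse)
  also have "\<dots> \<longleftrightarrow> (\<exists>y. mat_of x ** mat_of y = mat 1)" by (metis mat_of_mx_of)
  also have "\<dots> \<longleftrightarrow> (\<exists>y. x * y = 1)" by (simp add: mat_eq_1 flip: mat_of_simps(6))
  finally show ?thesis .
qed

lemma group_GL: "group (GL :: 'n::finite cmat monoid)"
proof (rule groupI)
  show "x \<otimes>\<^bsub>GL\<^esub> y \<in> carrier GL" if "x \<in> carrier GL" "y \<in> carrier GL" for x y :: "'n cmat"
    using that by (simp add: GL_def invertible_mult)
  show "\<exists>y\<in>carrier GL. y \<otimes>\<^bsub>GL\<^esub> x = \<one>\<^bsub>GL\<^esub>" if "x \<in> carrier GL" for x :: "'n cmat"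
    using that by (auto simp: GL_def invertible_def)
qed (auto simp: GL_def matrix_mul_assoc invertible_def intro: exI[of _ "mat 1"])

lemma mx_inverse_comm: "(x :: 'n::finite mx) * y = 1 \<longleftrightarrow> y * x = 1"
  using matrix_left_right_inverse[of "mat_of x" "mat_of y"] by (simp add: mat_eq_1 flip: mat_of_simps(6))

lemma alg_group_of:
  assumes "linear_algebraic_group G" shows "\<exists>F. alg_group (mxs G) F"
proof -
  have G: "subgroup G GL" "closedin (subtopology zariski (carrier GL)) G" using assms by (auto simp: linear_algebraic_group_def)
  obtain F where F: "\<forall>p\<in>F. poly_fun p" "G = {A. invertible A \<and> (\<forall>p\<in>F. p A = 0)}" using G(2) unfolding closedin_GL_iff by blast
  interpret S: subgroup G GL by fact
  have "alg_group (mxs G) F"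
  proof
    show "poly_fun p" if "p \<in> F" for p using F(1) that by blast
    show "a \<in> mxs G \<longleftrightarrow> (\<exists>b. a * b = 1) \<and> (\<forall>p\<in>F. p (mat_of a) = 0)" for a
      by (simp add: F(2) invertible_mx)
    show "1 \<in> mxs G" using S.one_closed by (simp add: GL_def)
    show "a * b \<in> mxs G" if "a \<in> mxs G" "b \<in> mxs G" for a b
      using S.m_closed[of "mat_of a" "mat_of b"] that by (simp add: GL_def)
    show "\<exists>b\<in>mxs G. a * b = 1 \<and> b * a = 1" if a: "a \<in> mxs G" for a
    proof -
      have "mat_of a \<in> carrier GL" using a S.subset by blast
      hence "mat_of a \<otimes>\<^bsub>GL\<^esub> inv\<^bsub>GL\<^esub> mat_of a = \<one>\<^bsub>GL\<^esub>" by (rule group.r_inv[OF group_GL])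
      moreover have "inv\<^bsub>GL\<^esub> mat_of a \<in> G" using a by (intro S.m_inv_closed) simp
      ultimately have "a * mx_of (inv\<^bsub>GL\<^esub> mat_of a) = 1" "mx_of (inv\<^bsub>GL\<^esub> mat_of a) \<in> mxs G"
        by (simp_all add: GL_def flip: mat_eq_1)
      thus ?thesis using mx_inverse_comm by blast
    qed
  qed
  thus ?thesis by blast
qed

lemma linear_algebraic_group_of:
  assumes "alg_group N F" shows "linear_algebraic_group (mat_of ` N)"
proof -
  interpret alg_group N F by fact
  have N: "mat_of ` N = {A. invertible A \<and> (\<forall>p\<in>F. p A = 0)}"
  proof (rule Set.set_eqI)
    fix A
    have "A \<in> mat_of ` N \<longleftrightarrow> mx_of A \<in> N" by (metis image_iff mat_of_inverse mat_of_mx_of)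
    also have "\<dots> \<longleftrightarrow> invertible (mat_of (mx_of A)) \<and> (\<forall>p\<in>F. p (mat_of (mx_of A)) = 0)"
      unfolding G[of "mx_of A"] invertible_mx ..
    finally show "A \<in> mat_of ` N \<longleftrightarrow> A \<in> {A. invertible A \<and> (\<forall>p\<in>F. p A = 0)}" by simp
  qed
  have "subgroup (mat_of ` N) GL"
  proof (rule group.subgroupI[OF group_GL])
    show "mat_of ` N \<subseteq> carrier GL" unfolding N carrier_GL by blast
    show "mat_of ` N \<noteq> {}" using one by blast
    show "inv\<^bsub>GL\<^esub> A \<in> mat_of ` N" if A: "A \<in> mat_of ` N" for A
    proof -
      obtain a where a: "A = mat_of a" "a \<in> N" using A by blast
      obtain b where b: "b \<in> N" "a * b = 1" "b * a = 1" using inv[OF a(2)] by blast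
      have "mat_of b \<otimes>\<^bsub>GL\<^esub> mat_of a = \<one>\<^bsub>GL\<^esub>" using b(3) by (simp add: GL_def flip: mat_of_simps(2,6))
      hence "inv\<^bsub>GL\<^esub> A = mat_of b"
        unfolding a(1) using \<open>mat_of ` N \<subseteq> carrier GL\<close> a(2) b(1) by (intro group.inv_equality[OF group_GL]) auto
      thus ?thesis using b(1) by simp
    qed
    show "A \<otimes>\<^bsub>GL\<^esub> B \<in> mat_of ` N" if "A \<in> mat_of ` N" "B \<in> mat_of ` N" for A B
      using that mult by (auto simp: GL_def simp flip: mat_of_simps(6))
  qed
  moreover have "closedin (subtopology zariski (carrier GL)) (mat_of ` N)"
    unfolding closedin_GL_iff using F N by blast
  ultimately show ?thesis by (simp add: linear_algebraic_group_def)
qed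

lemma nilpotent_mat_of: assumes "x ^ m = 0" shows "nilpotent_mat (mat_of x)"
proof -
  have "(((*v) (mat_of x)) ^^ k) v = (x ^ k) *> v" for k v by (induction k) (auto simp: app_def matrix_vector_mul_assoc)
  thus ?thesis using assms unfolding nilpotent_mat_def by (metis app_simps(1))
qed

lemma reductive_of:
  assumes "reductive_group G" shows "\<exists>F. reductive (mxs G) F"
proof -
  have lag: "linear_algebraic_group G" using assms by (simp add: reductive_group_def)
  obtain F where "alg_group (mxs G) F" using alg_group_of[OF lag] by blast
  then interpret alg_group "mxs G" F .
  have sG: "subgroup G GL" using lag by (simp add: linear_algebraic_group_def)
  have gG: "group (GL\<lparr>carrier := G\<rparr>)" by (rule group.subgroup_imp_group[OF group_GL sG])
  have "reductive (mxs G) F"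
  proof (unfold_locales, rule ccontr)
    fix N F' assume N: "alg_group N F'" "N \<subseteq> mxs G" "connected (mat_of ` N)"
      "\<And>a. a \<in> N ==> \<exists>m. (a - 1) ^ m = 0"
      "\<And>a g h. a \<in> N ==> g \<in> mxs G ==> h \<in> mxs G ==> g * h = 1 ==> h * g = 1 ==> g * a * h \<in> N"
      and n: "N \<noteq> {1}"
    have l: "linear_algebraic_group (mat_of ` N)" by (rule linear_algebraic_group_of[OF N(1)])
    have sub: "subgroup (mat_of ` N) (GL\<lparr>carrier := G\<rparr>)"
      using l N(2) sG by (intro group.subgroup_incl[OF group_GL]) (auto simp: linear_algebraic_group_def)
    have "mat_of ` N \<lhd> GL\<lparr>carrier := G\<rparr>"
    proof (rule group.normal_inv_iff[OF gG, THEN iffD2], intro conjI ballI sub)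
      fix A B assume A: "A \<in> carrier (GL\<lparr>carrier := G\<rparr>)" and B: "B \<in> mat_of ` N"
      obtain b where b: "B = mat_of b" "b \<in> N" using B by blast
      obtain c where c: "mat_of c \<in> G" "mx_of A * c = 1" "c * mx_of A = 1" using inv[of "mx_of A"] A by auto
      have "mat_of c \<otimes>\<^bsub>GL\<lparr>carrier := G\<rparr>\<^esub> A = \<one>\<^bsub>GL\<lparr>carrier := G\<rparr>\<^esub>"
        using arg_cong[OF c(3), of mat_of] by (simp add: GL_def)
      hence i: "inv\<^bsub>GL\<lparr>carrier := G\<rparr>\<^esub> A = mat_of c"
        using A c(1) by (intro group.inv_equality[OF gG]) auto
      have "mx_of A * b * c \<in> N" using A c by (intro N(5) b(2)) auto
      hence "mat_of (mx_of A * b * c) \<in> mat_of ` N" by blast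
      thus "A \<otimes>\<^bsub>GL\<lparr>carrier := G\<rparr>\<^esub> B \<otimes>\<^bsub>GL\<lparr>carrier := G\<rparr>\<^esub> inv\<^bsub>GL\<lparr>carrier := G\<rparr>\<^esub> A \<in> mat_of ` N"
        unfolding i b(1) by (simp add: GL_def)
    qed
    moreover have "unipotent_group (mat_of ` N)" unfolding unipotent_group_def
    proof (clarify)
      fix a assume "a \<in> N"
      then obtain m where "(a - 1) ^ m = 0" using N(4) by blast
      from nilpotent_mat_of[OF this] show "nilpotent_mat (mat_of a - mat 1)" by simp
    qed
    moreover have "connectedin zariski (mat_of ` N)" by (rule connectedin_zariski[OF N(3)])
    ultimately have "mat_of ` N = {mat 1}" using assms l by (auto simp: reductive_group_def)
    hence E: "mat_of ` N = mat_of ` {1}" by simp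
    have i: "inj mat_of" by (simp add: inj_def mat_of_inject)
    have "N = {1}" by (rule inj_image_eq_iff[OF i, THEN iffD1, OF E])
    thus False using n by contradiction
  qed
  thus ?thesis by blast
qed

lemma (in alg_group) lie_of: "x \<in> lie \<longleftrightarrow> mat_of x \<in> lie_algebra_of (mat_of ` G)"
proof -
  have "((\<lambda>t. p (mat 1 + mscale t (mat_of x))) has_field_derivative 0) (at 0) \<longleftrightarrow> pd p 1 x = 0" if "poly_fun p" for p
  proof -
    have "((\<lambda>t. p (mat 1 + mscale t (mat_of x))) has_field_derivative pd p 1 x) (at 0)"
      using pd_line[OF that, of 1 x] by (simp add: mscale_eq_cscale)
    thus ?thesis using DERIV_unique by metis
  qed
  thus ?thesis unfolding lie_def I_def lie_algebra_of_def by auto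
qed

lemma mbracket_mx: "mbracket (mat_of x) (mat_of y) = mat_of (ad x y)"
  by (simp add: mbracket_def ad_def)

lemma subspace_vimage:
  assumes "0 \<in> T" "\<And>x y. x \<in> T ==> y \<in> T ==> x + y \<in> T" "\<And>c x. x \<in> T ==> mscale c x \<in> T"
  shows "cv.subspace (mxs T)"
  by (rule cv.subspaceI) (use assms in \<open>auto simp: mscale_eq_cscale\<close>)

lemma toral_of:
  assumes "reductive_group G" "maximal_toral h (lie_algebra_of G)"
  shows "\<exists>F. toral (mxs G) F (mxs h) \<and> alg_group.lie (mxs G) = {x. mat_of x \<in> lie_algebra_of G}"
proof -
  obtain F where "reductive (mxs G) F" using reductive_of[OF assms(1)] by blast
  then interpret reductive "mxs G" F .
  have "mat_of ` mxs G = G" by (metis (no_types, lifting) image_Collect_subsetI mat_of_mx_of mem_Collect_eq subsetI subset_antisym image_iff)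
  hence lie: "lie = {x. mat_of x \<in> lie_algebra_of G}" using lie_of by auto
  have h: "lie_subalgebra h (lie_algebra_of G)" "\<And>x. x \<in> h ==> semisimple_mat x"
    using assms(2) by (auto simp: maximal_toral_def toral_subalgebra_def)
  have "toral (mxs G) F (mxs h)"
  proof
    show "cv.subspace (mxs h)" using h(1) by (intro subspace_vimage) (auto simp: lie_subalgebra_def)
    show "(mxs h) \<subseteq> lie" using h(1) by (auto simp: lie lie_subalgebra_def)
    show "ad x y \<in> mxs h" if "x \<in> mxs h" "y \<in> mxs h" for x y
      using h(1) that by (auto simp: lie_subalgebra_def simp flip: mbracket_mx)
    show "diagonalisable x" if "x \<in> mxs h" for x
      using h(2)[of "mat_of x"] that by (simp add: semisimple_mat_iff)
    fix T assume T: "cv.subspace T" "T \<subseteq> lie" "\<And>x y. x \<in> T ==> y \<in> T ==> ad x y \<in> T"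
      "\<And>x. x \<in> T ==> diagonalisable x" "(mxs h) \<subseteq> T"
    have "toral_subalgebra (mat_of ` T) (lie_algebra_of G)" unfolding toral_subalgebra_def lie_subalgebra_def
    proof (intro conjI ballI allI)
      show "mat_of ` T \<subseteq> lie_algebra_of G" using T(2) lie by auto
      show "0 \<in> mat_of ` T" using cv.subspace_0[OF T(1)] by (metis imageI mat_of_simps(1))
      show "x + y \<in> mat_of ` T" if "x \<in> mat_of ` T" "y \<in> mat_of ` T" for x y
        using that cv.subspace_add[OF T(1)] by (auto simp flip: mat_of_simps(3))
      show "mscale c x \<in> mat_of ` T" if "x \<in> mat_of ` T" for c x
        using that cv.subspace_scale[OF T(1)] by (auto simp: mscale_eq_cscale simp flip: mat_of_simps(7))
      show "mbracket x y \<in> mat_of ` T" if "x \<in> mat_of ` T" "y \<in> mat_of ` T" for x y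
        using that T(3) by (auto simp: mbracket_mx)
      show "semisimple_mat x" if "x \<in> mat_of ` T" for x using that T(4) by (auto simp: semisimple_mat_iff)
    qed
    moreover have "h \<subseteq> mat_of ` T"
    proof
      fix A assume "A \<in> h"
      hence "mx_of A \<in> T" using T(5) by auto
      thus "A \<in> mat_of ` T" by (metis imageI mat_of_mx_of)
    qed
    ultimately have "mat_of ` T = h" using assms(2) by (auto simp: maximal_toral_def)
    thus "T = mxs h" by (auto simp: mat_of_inject)
  qed
  thus ?thesis using lie by blast
qed

theorem root_setup_exists:
  fixes G g h :: "'n::finite cmat set"
  assumes red: "reductive_group G" and g: "g = lie_algebra_of G" and mt: "maximal_toral h g"
    and ss: "simple_system g h \<Delta>" and \<alpha>\<Delta>: "\<alpha> \<in> \<Delta>"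
    and e: "e \<in> root_space g h \<alpha>" and f: "f \<in> root_space g h (\<lambda>t. - \<alpha> t)"
    and H: "mbracket e f \<in> h" "\<alpha> (mbracket e f) = 2"
  shows "\<exists>n' \<rho>. root_setup (mxs g) (mxs h) n' (\<lambda>x. \<alpha> (mat_of x)) (mx_of e) (mx_of f) \<rho>
    \<and> nilradical g h \<Delta> = mat_of ` {c *. mx_of e + y | c y. y \<in> n'}"
proof -
  let ?h = "mxs h" and ?r = "\<lambda>b. restrict (\<lambda>A. b (mx_of A)) h"
  obtain F where F: "toral (mxs G) F ?h" "alg_group.lie (mxs G) = mxs g"
    using toral_of[OF red] mt g by blast
  interpret T: toral "mxs G" F ?h by (rule F(1))
  have lie: "T.lie = mxs g" by (rule F(2))
  \<comment> \<open>Roots are given on \<open>h\<close> only; composing with a linear projection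
    onto \<open>h\<close> extends them to linear functionals on all matrices.\<close>
  obtain P where P: "clin P" "\<And>v. P v \<in> ?h" "\<And>v. v \<in> ?h ==> P v = v" using cv_projection[OF T.h_subspace] by metis
  define \<phi> where "\<phi> \<gamma> x = \<gamma> (mat_of (P x))" for \<gamma> :: "'n cmat => complex" and x
  have \<phi>h: "\<phi> \<gamma> t = \<gamma> (mat_of t)" if "t \<in> ?h" for \<gamma> t using P(3)[OF that] by (simp add: \<phi>_def)
  have S: "\<Delta> \<subseteq> roots g h" "finite \<Delta>" "\<And>c. \<forall>t\<in>h. (\<Sum>\<gamma>\<in>\<Delta>. c \<gamma> * \<gamma> t) = 0 ==> \<forall>\<gamma>\<in>\<Delta>. c \<gamma> = 0"
    "\<And>\<beta>. \<beta> \<in> roots g h ==> nonneg_comb h \<Delta> \<beta> \<or> nonneg_comb h \<Delta> (\<lambda>t. - \<beta> t)"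
    using ss unfolding simple_system_def by blast+
  have hm: "mx_of A \<in> ?h" if "A \<in> h" for A using that by simp
  have rs: "mat_of y \<in> root_space g h \<beta> \<longleftrightarrow> y \<in> T.lie \<and> (\<forall>t\<in>?h. ad t y = \<beta> (mat_of t) *. y)" for \<beta> y
  proof -
    have "(\<forall>t\<in>h. mbracket t (mat_of y) = mscale (\<beta> t) (mat_of y)) \<longleftrightarrow> (\<forall>t\<in>?h. ad t y = \<beta> (mat_of t) *. y)"
    proof
      assume a: "\<forall>t\<in>h. mbracket t (mat_of y) = mscale (\<beta> t) (mat_of y)"
      show "\<forall>t\<in>?h. ad t y = \<beta> (mat_of t) *. y"
      proof
        fix t assume "t \<in> ?h"
        hence "mat_of (ad t y) = mat_of (\<beta> (mat_of t) *. y)" using a by (simp add: mscale_eq_cscale flip: mbracket_mx)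
        thus "ad t y = \<beta> (mat_of t) *. y" by (simp only: mat_of_inject)
      qed
    next
      assume a: "\<forall>t\<in>?h. ad t y = \<beta> (mat_of t) *. y"
      show "\<forall>t\<in>h. mbracket t (mat_of y) = mscale (\<beta> t) (mat_of y)"
      proof
        fix t assume "t \<in> h"
        hence "ad (mx_of t) y = \<beta> (mat_of (mx_of t)) *. y" using a hm by blast
        hence "mat_of (ad (mx_of t) y) = mat_of (\<beta> t *. y)" by simp
        thus "mbracket t (mat_of y) = mscale (\<beta> t) (mat_of y)"
          using mbracket_mx[of "mx_of t" y] by (simp add: mscale_eq_cscale)
      qed
    qed
    thus ?thesis unfolding root_space_def lie by simp
  qed
  have wv: "T.weight_vector \<beta> y \<longleftrightarrow> mat_of y \<in> root_space g h (?r \<beta>)" for \<beta> y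
    unfolding rs T.weight_vector_def by (simp add: mat_of_inverse)
  have dual: "?r \<beta> \<in> roots g h" if y: "T.weight_vector \<beta> y" "y \<noteq> 0" "\<exists>t\<in>?h. \<beta> t \<noteq> 0" for \<beta> y
  proof -
    have lin: "\<beta> (s + t) = \<beta> s + \<beta> t" "\<beta> (c *. t) = c * \<beta> t" if st: "s \<in> ?h" "t \<in> ?h" for s t c
    proof -
      have "ad (s + t) y = ad s y + ad t y" "ad (c *. t) y = c *. ad t y"
        by (simp_all add: ad_def algebra_simps cscale_simps)
      moreover have "s + t \<in> ?h" "c *. t \<in> ?h" using cv.subspace_add[OF T.h_subspace st] cv.subspace_scale[OF T.h_subspace st(2)] by blast+
      ultimately have "(\<beta> (s + t) - (\<beta> s + \<beta> t)) *. y = 0" "(\<beta> (c *. t) - c * \<beta> t) *. y = 0"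
        using y(1) st unfolding T.weight_vector_def by (simp_all add: cscale_simps)
      thus "\<beta> (s + t) = \<beta> s + \<beta> t" "\<beta> (c *. t) = c * \<beta> t" using y(2) by simp_all
    qed
    have "?r \<beta> \<in> dual h"
    proof -
      have hs: "A + B \<in> h" "mscale c A \<in> h" if "A \<in> h" "B \<in> h" for A B c
        using cv.subspace_add[OF T.h_subspace hm[OF that(1)] hm[OF that(2)]] cv.subspace_scale[OF T.h_subspace hm[OF that(1)], of c]
        by (simp_all add: mscale_eq_cscale)
      have "mx_of (A + B) = mx_of A + mx_of B" "mx_of (mscale c A) = c *. mx_of A" for A B :: "'n cmat" and c
        by (simp_all add: mat_of_inject[symmetric] mscale_eq_cscale)
      thus ?thesis unfolding dual_def using lin[OF hm hm] hs by auto
    qed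
    moreover have "\<exists>t\<in>h. ?r \<beta> t \<noteq> 0"
    proof -
      obtain t where "t \<in> ?h" "\<beta> t \<noteq> 0" using y(3) by blast
      thus ?thesis by (intro bexI[of _ "mat_of t"]) (auto simp: mat_of_inverse)
    qed
    moreover have "root_space g h (?r \<beta>) \<noteq> {0}"
    proof
      assume a: "root_space g h (?r \<beta>) = {0}"
      have "mat_of y = mat_of 0" using y(1) unfolding wv a by simp
      thus False using y(2) by (simp only: mat_of_inject)
    qed
    ultimately show ?thesis unfolding roots_def by blast
  qed
  have adef: "ad (mx_of e) (mx_of f) = mx_of (mbracket e f)" by (simp add: mat_of_inject[symmetric] flip: mbracket_mx)
  have sumh: "(\<Sum>\<gamma>\<in>\<Delta>. c \<gamma> * \<phi> \<gamma> (mx_of A)) = (\<Sum>\<gamma>\<in>\<Delta>. c \<gamma> * \<gamma> A)" if "A \<in> h" for A c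
    using \<phi>h[OF hm[OF that]] by simp
  have "simple_roots (mxs G) F ?h \<Delta> \<phi> \<alpha> (\<phi> \<alpha>) (mx_of e) (mx_of f)"
  proof
    show "clin (\<phi> \<gamma>)" if "\<gamma> \<in> \<Delta>" for \<gamma>
    proof -
      have d: "\<gamma> (x + y) = \<gamma> x + \<gamma> y" "\<gamma> (mscale c x) = c * \<gamma> x" if "x \<in> h" "y \<in> h" for x y c
        using S(1) \<open>\<gamma> \<in> \<Delta>\<close> that by (auto simp: roots_def dual_def)
      have Ph: "mat_of (P v) \<in> h" for v using P(2)[of v] by simp
      show ?thesis
        by (rule clinI) (simp_all add: \<phi>_def clin_add[OF P(1)] clin_scale[OF P(1)] d[OF Ph Ph] cscale_complex_def flip: mscale_eq_cscale)
    qed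
    show "\<forall>\<gamma>\<in>\<Delta>. c \<gamma> = 0" if c: "\<forall>t\<in>?h. (\<Sum>\<gamma>\<in>\<Delta>. c \<gamma> * \<phi> \<gamma> t) = 0" for c
    proof (rule S(3), rule ballI)
      fix A assume A: "A \<in> h"
      show "(\<Sum>\<gamma>\<in>\<Delta>. c \<gamma> * \<gamma> A) = 0" using c[rule_format, OF hm[OF A]] unfolding sumh[OF A] .
    qed
    show "\<exists>k::_ => nat. (\<forall>t\<in>?h. \<beta> t = (\<Sum>\<gamma>\<in>\<Delta>. of_nat (k \<gamma>) * \<phi> \<gamma> t)) \<or> (\<forall>t\<in>?h. - \<beta> t = (\<Sum>\<gamma>\<in>\<Delta>. of_nat (k \<gamma>) * \<phi> \<gamma> t))"
      if y: "T.weight_vector \<beta> y" "y \<noteq> 0" "\<exists>t\<in>?h. \<beta> t \<noteq> 0" for \<beta> y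
    proof -
      let ?b = "?r \<beta>"
      have b: "?b (mat_of t) = \<beta> t" if "t \<in> ?h" for t using that by (simp add: mat_of_inverse)
      consider k where "\<forall>t\<in>h. ?b t = (\<Sum>\<gamma>\<in>\<Delta>. of_nat (k \<gamma> :: nat) * \<gamma> t)"
        | k where "\<forall>t\<in>h. - ?b t = (\<Sum>\<gamma>\<in>\<Delta>. of_nat (k \<gamma> :: nat) * \<gamma> t)"
        using S(4)[OF dual[OF y]] unfolding nonneg_comb_def by blast
      thus ?thesis
      proof cases
        case 1
        have "\<beta> t = (\<Sum>\<gamma>\<in>\<Delta>. of_nat (k \<gamma>) * \<phi> \<gamma> t)" if t: "t \<in> ?h" for t
          using 1[rule_format, of "mat_of t"] b[OF t] \<phi>h[OF t] t by simp
        thus ?thesis by blast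
      next
        case 2
        have "- \<beta> t = (\<Sum>\<gamma>\<in>\<Delta>. of_nat (k \<gamma>) * \<phi> \<gamma> t)" if t: "t \<in> ?h" for t
          using 2[rule_format, of "mat_of t"] b[OF t] \<phi>h[OF t] t by simp
        thus ?thesis by blast
      qed
    qed
    show "T.weight_vector (\<phi> \<alpha>) (mx_of e)" unfolding T.weight_vector_def using e rs[of "mx_of e" \<alpha>] \<phi>h by simp
    show "T.weight_vector (\<lambda>t. - \<phi> \<alpha> t) (mx_of f)" unfolding T.weight_vector_def using f rs[of "mx_of f" "\<lambda>t. - \<alpha> t"] \<phi>h by simp
    show "ad (mx_of e) (mx_of f) \<in> ?h" using H(1) adef by simp
    thus "\<phi> \<alpha> (ad (mx_of e) (mx_of f)) = 2" using \<phi>h H(2) adef by simp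
  qed (use S(2) \<alpha>\<Delta> in auto)
  then interpret R: simple_roots "mxs G" F ?h \<Delta> \<phi> \<alpha> "\<phi> \<alpha>" "mx_of e" "mx_of f" .
  obtain \<rho> where \<rho>: "\<rho> \<in> ?h" "\<forall>y\<in>R.pos_vectors. \<exists>j::nat. j \<ge> 1 \<and> ad \<rho> y = of_nat j *. y" using R.height_element by blast
  have "root_setup (mxs g) ?h R.nprime (\<lambda>x. \<alpha> (mat_of x)) (mx_of e) (mx_of f) \<rho>"
  proof
    show "ad t (mx_of e) = \<alpha> (mat_of t) *. mx_of e" "ad t (mx_of f) = - (\<alpha> (mat_of t) *. mx_of f)" if "t \<in> ?h" for t
      using R.e R.f \<phi>h[OF that] that unfolding T.weight_vector_def by (metis cv.scale_minus_left)+
    show "{c *. mx_of e + y |c y. y \<in> R.nprime} \<subseteq> cv.span {y \<in> {c *. mx_of e + y |c y. y \<in> R.nprime}. \<exists>j::nat. j \<ge> 1 \<and> ad \<rho> y = of_nat j *. y}"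
      unfolding R.npos_eq[symmetric]
    proof -
      have "R.pos_vectors \<subseteq> {y \<in> R.npos. \<exists>j::nat. j \<ge> 1 \<and> ad \<rho> y = of_nat j *. y}"
        using \<rho>(2) by (auto simp: R.npos_def intro: cv.span_base)
      thus "R.npos \<subseteq> cv.span {y \<in> R.npos. \<exists>j::nat. j \<ge> 1 \<and> ad \<rho> y = of_nat j *. y}"
        unfolding R.npos_def by (rule cv.span_mono)
    qed
    show "ad s t = 0" if "s \<in> ?h" "t \<in> ?h" for s t using T.h_abelian[OF that] .
    show "\<alpha> (mat_of (ad (mx_of e) (mx_of f))) = 2" using H adef by simp
    show "ad z y \<in> R.nprime" if "z \<in> insert (mx_of e) (insert (mx_of f) ?h)" "y \<in> R.nprime" for z y by (rule R.nprime_ad[OF that])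
    show "cv.subspace R.nprime" unfolding R.nprime_def by (rule cv.subspace_span)
    show "\<rho> \<in> ?h" by (rule \<rho>(1))
    show "ad (mx_of e) (mx_of f) \<in> ?h" by (rule R.H(1))
  qed (use T.lie_subspace T.lie_ad T.h_subspace T.h_lie R.nprime_lie R.e_nilpotent R.f_nilpotent R.e R.f in \<open>simp_all add: lie T.weight_vector_def\<close>)
  moreover have "nilradical g h \<Delta> = mat_of ` R.npos"
  proof -
    let ?P = "positive_roots g h \<Delta>" and ?W = "{restrict \<beta> ?h | \<beta>. \<exists>y. T.weight_vector \<beta> y \<and> y \<noteq> 0}"
    have Pw: "mx_of z \<in> R.pos_vectors" if b: "b \<in> ?P" and z: "z \<in> root_space g h b" for b z
    proof -
      have "T.weight_vector (\<lambda>t. b (mat_of t)) (mx_of z)" using z rs[of "mx_of z" b] unfolding T.weight_vector_def by simp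
      moreover have "R.pos_weight (\<lambda>t. b (mat_of t))" unfolding R.pos_weight_def
      proof
        show "\<exists>t\<in>?h. b (mat_of t) \<noteq> 0" 
        proof -
          obtain t where t: "t \<in> h" "b t \<noteq> 0" using b unfolding positive_roots_def roots_def by blast
          show ?thesis by (rule bexI[of _ "mx_of t"]) (use t in simp_all)
        qed
        obtain k :: "_ => nat" where k: "\<forall>t\<in>h. b t = (\<Sum>\<gamma>\<in>\<Delta>. of_nat (k \<gamma>) * \<gamma> t)" using b by (auto simp: positive_roots_def nonneg_comb_def)
        have "\<forall>t\<in>?h. b (mat_of t) = (\<Sum>\<gamma>\<in>\<Delta>. of_nat (k \<gamma>) * \<phi> \<gamma> t)" using k \<phi>h by simp
        thus "\<exists>k::_ => nat. \<forall>t\<in>?h. b (mat_of t) = (\<Sum>\<gamma>\<in>\<Delta>. of_nat (k \<gamma>) * \<phi> \<gamma> t)" by blast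
      qed
      ultimately show ?thesis by (auto simp: R.pos_vectors_def)
    qed
    \<comment> \<open>Each positive root is the restriction of the weight of a nonzero root vector,
      of which there are finitely many.\<close>
    have finP: "finite ?P"
    proof (rule finite_subset)
      show "finite (?r ` ?W)"
        by (rule finite_imageI[OF R.pos_weight_restrict_finite])
      show "?P \<subseteq> ?r ` ?W"
      proof
        fix b assume b: "b \<in> ?P"
        hence r: "b \<in> dual h" "root_space g h b \<noteq> {0}" by (auto simp: positive_roots_def roots_def)
        have "0 \<in> root_space g h b" using rs[of 0 b] cv.subspace_0[OF T.lie_subspace] by simp
        then obtain z where z: "z \<in> root_space g h b" "z \<noteq> 0" using r(2) by blast
        have "T.weight_vector (\<lambda>t. b (mat_of t)) (mx_of z)" using z(1) rs[of "mx_of z" b] unfolding T.weight_vector_def by simp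
        moreover have "mx_of z \<noteq> 0" using z(2) by (metis mat_of_mx_of mat_of_simps(1))
        ultimately have mem: "restrict (\<lambda>t. b (mat_of t)) ?h \<in> ?W" by blast
        have eq: "b = restrict (\<lambda>A. restrict (\<lambda>t. b (mat_of t)) ?h (mx_of A)) h"
        proof
          fix A show "b A = restrict (\<lambda>A. restrict (\<lambda>t. b (mat_of t)) ?h (mx_of A)) h A"
            using r(1) by (auto simp: dual_def extensional_def restrict_def)
        qed
        show "b \<in> ?r ` ?W"
          by (rule image_eqI[OF _ mem]) (rule eq)
      qed
    qed
    have Rsub: "cv.subspace {x. mat_of x \<in> root_space g h b}" for b
    proof -
      have "{x. mat_of x \<in> root_space g h b} = {y \<in> T.lie. \<forall>t\<in>?h. ad t y = b (mat_of t) *. y}" using rs by blast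
      also have "cv.subspace \<dots>"
        using cv.subspace_0[OF T.lie_subspace] cv.subspace_add[OF T.lie_subspace] cv.subspace_scale[OF T.lie_subspace]
        by (intro cv.subspaceI) (auto simp: ad_add ad_scale cscale_simps mult.commute)
      finally show ?thesis .
    qed
    have r0: "0 \<in> root_space g h b" and radd: "x \<in> root_space g h b ==> y \<in> root_space g h b ==> x + y \<in> root_space g h b"
      and rsc: "x \<in> root_space g h b ==> c *. x \<in> root_space g h b" for b x y c
      using cv.subspace_0[OF Rsub[of b]] cv.subspace_add[OF Rsub[of b], of "mx_of x" "mx_of y"] cv.subspace_scale[OF Rsub[of b], of "mx_of x" c] by simp_all
    have mat_sum: "mat_of (\<Sum>b\<in>?P. x b) = (\<Sum>b\<in>?P. mat_of (x b))" for x :: "_ => 'n mx"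
      using finP by induction auto
    show ?thesis
    proof
      show "nilradical g h \<Delta> \<subseteq> mat_of ` R.npos"
      proof
        fix z assume "z \<in> nilradical g h \<Delta>"
        then obtain x where x: "z = (\<Sum>b\<in>?P. x b)" "\<forall>b\<in>?P. x b \<in> root_space g h b" by (auto simp: nilradical_def)
        have "(\<Sum>b\<in>?P. mx_of (x b)) \<in> R.npos" unfolding R.npos_def
          by (intro cv.span_sum cv.span_base Pw) (use x in auto)
        moreover have "z = mat_of (\<Sum>b\<in>?P. mx_of (x b))" unfolding mat_sum x(1) by simp
        ultimately show "z \<in> mat_of ` R.npos" by blast
      qed
      have "R.npos \<subseteq> {x. mat_of x \<in> nilradical g h \<Delta>}" unfolding R.npos_def
      proof (rule cv.span_minimal)
        show "cv.subspace {x. mat_of x \<in> nilradical g h \<Delta>}"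
        proof (rule subspace_vimage)
          show "0 \<in> nilradical g h \<Delta>" unfolding nilradical_def using r0 by (auto intro!: exI[of _ "\<lambda>_. 0"])
          fix u v assume "u \<in> nilradical g h \<Delta>" "v \<in> nilradical g h \<Delta>"
          then obtain x y where "u = (\<Sum>b\<in>?P. x b)" "\<forall>b\<in>?P. x b \<in> root_space g h b" "v = (\<Sum>b\<in>?P. y b)" "\<forall>b\<in>?P. y b \<in> root_space g h b"
            by (auto simp: nilradical_def)
          thus "u + v \<in> nilradical g h \<Delta>" unfolding nilradical_def
            using radd by (auto intro!: exI[of _ "\<lambda>b. x b + y b"] simp: sum.distrib)
        next
          fix c u assume "u \<in> nilradical g h \<Delta>"
          then obtain x where "u = (\<Sum>b\<in>?P. x b)" "\<forall>b\<in>?P. x b \<in> root_space g h b" by (auto simp: nilradical_def)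
          thus "mscale c u \<in> nilradical g h \<Delta>" unfolding nilradical_def mscale_eq_cscale
            using rsc by (auto intro!: exI[of _ "\<lambda>b. c *. x b"] simp: cv.scale_sum_right)
        qed
        show "R.pos_vectors \<subseteq> {x. mat_of x \<in> nilradical g h \<Delta>}"
        proof
          fix y assume "y \<in> R.pos_vectors"
          then obtain \<beta> where b: "R.pos_weight \<beta>" "T.weight_vector \<beta> y" by (auto simp: R.pos_vectors_def)
          let ?b = "?r \<beta>"
          show "y \<in> {x. mat_of x \<in> nilradical g h \<Delta>}"
          proof (cases "y = 0")
            case True
            thus ?thesis using r0 unfolding nilradical_def by (auto intro!: exI[of _ "\<lambda>_. 0"])
          next
            case False
            have "?b \<in> roots g h" using dual[OF b(2) False] b(1) by (auto simp: R.pos_weight_def)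
            moreover have "nonneg_comb h \<Delta> ?b"
            proof -
              obtain k :: "_ => nat" where k: "\<forall>t\<in>?h. \<beta> t = (\<Sum>\<gamma>\<in>\<Delta>. of_nat (k \<gamma>) * \<phi> \<gamma> t)" using b(1) by (auto simp: R.pos_weight_def)
              have "\<forall>t\<in>h. ?b t = (\<Sum>\<gamma>\<in>\<Delta>. of_nat (k \<gamma>) * \<gamma> t)"
              proof
                fix t assume t: "t \<in> h"
                hence "?b t = \<beta> (mx_of t)" by simp
                also have "\<dots> = (\<Sum>\<gamma>\<in>\<Delta>. of_nat (k \<gamma>) * \<phi> \<gamma> (mx_of t))" using k hm[OF t] by blast
                also have "\<dots> = (\<Sum>\<gamma>\<in>\<Delta>. of_nat (k \<gamma>) * \<gamma> t)" by (rule sumh[OF t])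
                finally show "?b t = (\<Sum>\<gamma>\<in>\<Delta>. of_nat (k \<gamma>) * \<gamma> t)" .
              qed
              thus ?thesis unfolding nonneg_comb_def by blast
            qed
            ultimately have bP: "?b \<in> ?P" by (simp add: positive_roots_def)
            define x where "x = (\<lambda>c. if c = ?b then mat_of y else 0)"
            have "mat_of y = (\<Sum>c\<in>?P. x c)" using finP bP by (simp add: x_def)
            moreover have "\<forall>c\<in>?P. x c \<in> root_space g h c" using r0 b(2) unfolding wv by (simp add: x_def)
            ultimately show ?thesis unfolding nilradical_def by blast
          qed
        qed
      qed
      thus "mat_of ` R.npos \<subseteq> nilradical g h \<Delta>" by blast
    qed
  qed
  ultimately show ?thesis unfolding R.npos_eq by blast
qed

section \<open>Operators on a free complex vector space\<close>

instantiation poly_mapping :: (type, cvec) cvec begin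
lift_definition cscale_poly_mapping :: "complex => ('a \<Rightarrow>\<^sub>0 'b) => ('a \<Rightarrow>\<^sub>0 'b)" is "\<lambda>c f k. c *. f k"
  by (erule rev_finite_subset) auto
instance by (standard; transfer) (auto simp: cscale_simps)
end

lemma lookup_cscale [simp]: "Poly_Mapping.lookup (c *. f) k = c *. Poly_Mapping.lookup f k"
  by transfer simp

text \<open>Formal combinations of elements of \<open>'b\<close>. Every module with elements in
  \<open>'b\<close> is a linear quotient of this space; a linear section makes it the range of an
  idempotent.\<close>

type_synonym 'b free = "'b \<Rightarrow>\<^sub>0 complex"

typedef 'b endo = "{f :: 'b free => 'b free. clin f}" morphisms eapp Endo
  by (rule exI[of _ id]) (simp add: clin_def)

notation eapp (infixr "$$" 68)

lemma clin_eapp: "clin (eapp x)" using eapp[of x] by simp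

lemma endo_eqI: "(\<And>v. x $$ v = y $$ v) ==> x = y" by (metis eapp_inject ext)

lemmas eapp_linear = clin_add[OF clin_eapp] clin_scale[OF clin_eapp] clin_0[OF clin_eapp] clin_minus[OF clin_eapp] clin_diff[OF clin_eapp]

lemma Endo_app: "clin f ==> Endo f $$ v = f v" by (simp add: Endo_inverse)

instantiation endo :: (type) calg begin
definition "0 = Endo (\<lambda>v. 0)"
definition "1 = Endo (\<lambda>v. v)"
definition "x + y = Endo (\<lambda>v. x $$ v + y $$ v)"
definition "- x = Endo (\<lambda>v. - (x $$ v))"
definition "x - y = Endo (\<lambda>v. x $$ v - y $$ v)"
definition "x * y = Endo (\<lambda>v. x $$ y $$ v)"
definition "c *. x = Endo (\<lambda>v. c *. (x $$ v))"

lemma endo_simps: "0 $$ v = 0" "1 $$ v = v" "(x + y) $$ v = x $$ v + y $$ v" "(- x) $$ v = - (x $$ v)"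
  "(x - y) $$ v = x $$ v - y $$ v" "(x * y) $$ v = x $$ y $$ v" "(c *. x) $$ v = c *. (x $$ v)"
  unfolding zero_endo_def one_endo_def plus_endo_def uminus_endo_def minus_endo_def times_endo_def cscale_endo_def
  by (subst Endo_app, auto simp: clin_def eapp_linear cscale_simps mult.commute)+

instance
proof
  have "1 $$ Poly_Mapping.single undefined 1 \<noteq> (0::'a endo) $$ Poly_Mapping.single undefined 1"
    by (simp add: endo_simps poly_mapping_eq_iff fun_eq_iff) (metis lookup_single_eq zero_neq_one)
  thus "(0::'a endo) \<noteq> 1" by metis
qed (auto intro!: endo_eqI simp: endo_simps eapp_linear cscale_simps)
end

declare endo_simps [simp]

lemma eapp_power: "(x ^ k) $$ v = (eapp x ^^ k) v" by (induction k arbitrary: v) auto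

section \<open>Modules over enveloping algebras as representations\<close>

definition fsingle :: "complex => 'l list => 'l list => complex" where
  "fsingle c u = (\<lambda>w. if w = u then c else 0)"

lemma word_fsingle: "word_const c = fsingle c []" "word_gen x = fsingle 1 [x]"
  by (simp_all add: word_const_def word_gen_def fsingle_def)

lemma fsingle_carrier: "set u \<subseteq> X ==> fsingle c u \<in> carrier (free_algebra X)"
  unfolding free_algebra_def fsingle_def by (auto split: if_splits)

lemma free_add: "p \<oplus>\<^bsub>free_algebra X\<^esub> q = (\<lambda>w. p w + q w)" and free_zero: "\<zero>\<^bsub>free_algebra X\<^esub> = (\<lambda>w. 0)"
  and free_one: "\<one>\<^bsub>free_algebra X\<^esub> = fsingle 1 []"
  by (simp_all add: free_algebra_def fsingle_def)

lemma fsingle_mult: "fsingle c u \<otimes>\<^bsub>free_algebra X\<^esub> fsingle d v = fsingle (c * d) (u @ v)"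
proof
  fix w
  have "(\<Sum>i\<le>length w. fsingle c u (take i w) * fsingle d v (drop i w)) = fsingle (c * d) (u @ v) w"
  proof (cases "w = u @ v")
    case True
    have "i = length u" if "take i w = u" "i \<le> length w" for i using that by force
    hence "(\<Sum>i\<le>length w. fsingle c u (take i w) * fsingle d v (drop i w)) = (\<Sum>i\<le>length w. if i = length u then c * d else 0)"
      by (intro sum.cong) (auto simp: True fsingle_def)
    thus ?thesis by (simp add: True fsingle_def)
  next
    case False
    have "fsingle c u (take i w) * fsingle d v (drop i w) = 0" for i
      using False append_take_drop_id[of i w] by (auto simp: fsingle_def)
    hence "(\<Sum>i\<le>length w. fsingle c u (take i w) * fsingle d v (drop i w)) = 0" by (intro sum.neutral) blast
    thus ?thesis using False by (simp add: fsingle_def)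
  qed
  thus "(fsingle c u \<otimes>\<^bsub>free_algebra X\<^esub> fsingle d v) w = fsingle (c * d) (u @ v) w"
    by (simp add: free_algebra_def)
qed

lemma free_algebra_induct [consumes 1, case_names single add]:
  assumes q: "q \<in> carrier (free_algebra X)" and s: "\<And>c u. set u \<subseteq> X ==> P (fsingle c u)"
    and a: "\<And>p r. p \<in> carrier (free_algebra X) ==> r \<in> carrier (free_algebra X) ==> P p ==> P r ==> P (p \<oplus>\<^bsub>free_algebra X\<^esub> r)"
  shows "P q"
proof -
  have "finite {w. q w \<noteq> 0}" using q by (simp add: free_algebra_def)
  moreover have "finite A ==> \<forall>p \<in> carrier (free_algebra X). {w. p w \<noteq> 0} = A --> P p" for A
  proof (induction A rule: finite_induct)
    case empty
    have "p = fsingle 0 []" if "{w. p w \<noteq> 0} = {}" for p :: "'a list => complex"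
      using that by (auto simp: fsingle_def)
    thus ?case using s[of "[]" 0] by auto
  next
    case (insert w A)
    show ?case
    proof (intro ballI impI)
      fix p assume p: "p \<in> carrier (free_algebra X)" "{w. p w \<noteq> 0} = insert w A"
      have f: "fsingle (p w) w \<in> carrier (free_algebra X)"
        using p by (intro fsingle_carrier) (auto simp: free_algebra_def)
      let ?r = "p(w := 0)"
      have A: "{v. ?r v \<noteq> 0} = A" using p(2) insert.hyps by (auto split: if_splits)
      hence r: "?r \<in> carrier (free_algebra X)" using p insert.hyps by (auto simp: free_algebra_def)
      have "P ?r" using insert.IH r A by blast
      moreover have "P (fsingle (p w) w)" using p by (intro s) (auto simp: free_algebra_def)
      ultimately have "P (fsingle (p w) w \<oplus>\<^bsub>free_algebra X\<^esub> ?r)" using a f r by blast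
      moreover have "fsingle (p w) w \<oplus>\<^bsub>free_algebra X\<^esub> ?r = p" unfolding free_add by (auto simp: fsingle_def)
      ultimately show "P p" by simp
    qed
  qed
  ultimately show ?thesis using q by blast
qed

text \<open>The empty word goes to 1 and not to the corner unit; on vectors fixed by the idempotent
  the two agree.\<close>

definition frho :: "('l => 'a::calg) => ('l list => complex) => 'a" where
  "frho Y q = (\<Sum>w | q w \<noteq> 0. q w *. prod_list (map Y w))"

lemma frho_fsingle: "frho Y (fsingle c u) = c *. prod_list (map Y u)"
proof -
  have "{w. fsingle c u w \<noteq> 0} = (if c = 0 then {} else {u})" by (auto simp: fsingle_def)
  thus ?thesis by (simp add: frho_def) (simp add: fsingle_def)
qed

lemma frho_superset: assumes "finite A" "{w. q w \<noteq> 0} \<subseteq> A" shows "frho Y q = (\<Sum>w\<in>A. q w *. prod_list (map Y w))"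
  unfolding frho_def by (rule sum.mono_neutral_left) (use assms in auto)

lemma frho_add: assumes "p \<in> carrier (free_algebra X)" "q \<in> carrier (free_algebra X)"
  shows "frho Y (p \<oplus>\<^bsub>free_algebra X\<^esub> q) = frho Y p + frho Y q"
proof -
  let ?A = "{w. p w \<noteq> 0} \<union> {w. q w \<noteq> 0}"
  have A: "finite ?A" using assms by (simp add: free_algebra_def)
  have "frho Y (\<lambda>w. p w + q w) = (\<Sum>w\<in>?A. (p w + q w) *. prod_list (map Y w))" by (rule frho_superset[OF A]) auto
  also have "\<dots> = frho Y p + frho Y q"
    using frho_superset[OF A, of p Y] frho_superset[OF A, of q Y] by (simp add: cscale_add_left sum.distrib)
  finally show ?thesis by (simp add: free_add)
qed

lemma frho_mult: assumes p: "p \<in> carrier (free_algebra X)" and q: "q \<in> carrier (free_algebra X)"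
  shows "frho Y (p \<otimes>\<^bsub>free_algebra X\<^esub> q) = frho Y p * frho Y q"
proof -
  interpret T: ring "free_algebra X" by (rule ring_free_algebra)
  have 1: "frho Y (fsingle c u \<otimes>\<^bsub>free_algebra X\<^esub> q) = frho Y (fsingle c u) * frho Y q" if u: "set u \<subseteq> X" for c u
    using q
  proof (induction rule: free_algebra_induct)
    case (single d v)
    show ?case by (simp add: fsingle_mult frho_fsingle cv.scale_left_commute)
  next
    case (add p r)
    have f: "fsingle c u \<in> carrier (free_algebra X)" by (rule fsingle_carrier[OF u])
    show ?case by (simp add: T.r_distr f add frho_add[where X = X] distrib_left)
  qed
  show ?thesis using p
  proof (induction rule: free_algebra_induct)
    case (add a b)
    thus ?case by (simp add: T.l_distr q frho_add[where X = X] distrib_right)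
  qed (rule 1)
qed

definition lrep :: "('l::plus) lie_alg => 'a::calg => ('l => 'a) => bool" where
  "lrep L p X \<longleftrightarrow> (\<forall>x\<in>lset L. p * X x = X x \<and> X x * p = X x)
    \<and> (\<forall>x\<in>lset L. \<forall>y\<in>lset L. X (x + y) = X x + X y \<and> X (lbracket L x y) = ad (X x) (X y))
    \<and> (\<forall>c. \<forall>x\<in>lset L. X (lscale L c x) = c *. X x)"

locale lie_closed =
  fixes L :: "('l::plus) lie_alg"
  assumes closed: "\<And>x y. x \<in> lset L ==> y \<in> lset L ==> x + y \<in> lset L" "\<And>c x. x \<in> lset L ==> lscale L c x \<in> lset L"
    "\<And>x y. x \<in> lset L ==> y \<in> lset L ==> lbracket L x y \<in> lset L"
begin

abbreviation "T \<equiv> free_algebra (lset L)"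
abbreviation "I \<equiv> enveloping_ideal L"

sublocale T: ring T by (rule ring_free_algebra)

lemma word_carrier [simp]: "word_const c \<in> carrier T" "x \<in> lset L ==> word_gen x \<in> carrier T"
  by (auto simp: word_fsingle intro!: fsingle_carrier)

lemma relations_carrier: "enveloping_relations L \<subseteq> carrier T"
  unfolding enveloping_relations_def Let_def by (auto simp: closed intro!: T.minus_closed)

sublocale I: ideal I T
  unfolding enveloping_ideal_def by (rule T.genideal_ideal[OF relations_carrier])

sublocale U: ring "U L" unfolding U_def by (rule I.quotient_is_ring)

abbreviation cls ("\<kappa>") where "\<kappa> q \<equiv> I +>\<^bsub>T\<^esub> q"

lemma cls_hom: "\<kappa> \<in> ring_hom T (U L)" unfolding U_def by (rule I.rcos_ring_hom)

lemmas cls_add = ring_hom_add[OF cls_hom] and cls_mult = ring_hom_mult[OF cls_hom]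
  and cls_one = ring_hom_one[OF cls_hom] and cls_closed = ring_hom_closed[OF cls_hom]

lemma U_carrier: "u \<in> carrier (U L) \<longleftrightarrow> (\<exists>q\<in>carrier T. u = \<kappa> q)"
  unfolding U_def FactRing_def by (auto simp: A_RCOSETS_def' )

lemma cls_eq: "q \<in> carrier T ==> r \<in> carrier T ==> \<kappa> q = \<kappa> r \<longleftrightarrow> q \<ominus>\<^bsub>T\<^esub> r \<in> I"
  using T.quotient_eq_iff_same_a_r_cos[OF I.is_ideal] by simp

lemma cls_relations:
  assumes "x \<in> lset L" "y \<in> lset L"
  shows "\<kappa> (word_gen (x + y)) = \<kappa> (word_gen x \<oplus>\<^bsub>T\<^esub> word_gen y)"
    "\<kappa> (word_gen (lscale L c x)) = \<kappa> (word_const c \<otimes>\<^bsub>T\<^esub> word_gen x)"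
    "\<kappa> (word_gen x \<otimes>\<^bsub>T\<^esub> word_gen y \<ominus>\<^bsub>T\<^esub> word_gen y \<otimes>\<^bsub>T\<^esub> word_gen x) = \<kappa> (word_gen (lbracket L x y))"
proof -
  have "r \<in> I" if "r \<in> enveloping_relations L" for r
    using T.genideal_self[OF relations_carrier] that unfolding enveloping_ideal_def by blast
  thus "\<kappa> (word_gen (x + y)) = \<kappa> (word_gen x \<oplus>\<^bsub>T\<^esub> word_gen y)"
    "\<kappa> (word_gen (lscale L c x)) = \<kappa> (word_const c \<otimes>\<^bsub>T\<^esub> word_gen x)"
    "\<kappa> (word_gen x \<otimes>\<^bsub>T\<^esub> word_gen y \<ominus>\<^bsub>T\<^esub> word_gen y \<otimes>\<^bsub>T\<^esub> word_gen x) = \<kappa> (word_gen (lbracket L x y))"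
    using assms by (subst cls_eq; force simp: closed enveloping_relations_def Let_def)+
qed

text \<open>The kernel is an ideal of the free algebra containing the enveloping relations, which
  makes \<open>urho\<close> well defined on classes.\<close>

lemma frho_ideal:
  fixes Y :: "'l => 'a::calg"
  assumes "lrep L p Y" "q \<in> I" shows "frho Y q = 0"
proof -
  let ?K = "{q \<in> carrier T. frho Y q = 0}"
  have zero: "frho Y \<zero>\<^bsub>T\<^esub> = 0" by (simp add: free_zero frho_def)
  have minus: "frho Y (\<ominus>\<^bsub>T\<^esub> a) = - frho Y a" if "a \<in> carrier T" for a
  proof -
    have "frho Y (\<ominus>\<^bsub>T\<^esub> a \<oplus>\<^bsub>T\<^esub> a) = 0" using that by (simp add: T.l_neg zero)
    thus ?thesis using that by (simp add: frho_add[where X = "lset L"] eq_neg_iff_add_eq_0)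
  qed
  have diff: "frho Y (a \<ominus>\<^bsub>T\<^esub> b) = frho Y a - frho Y b" if "a \<in> carrier T" "b \<in> carrier T" for a b
    using that by (simp add: a_minus_def frho_add[where X = "lset L"] minus)
  have "ideal ?K T"
  proof (rule idealI[OF ring_free_algebra])
    show "subgroup ?K (add_monoid T)"
    proof (rule T.add.subgroupI)
      show "?K \<noteq> {}" using zero by blast
    qed (auto simp: frho_add[where X = "lset L"] minus zero simp flip: a_inv_def)
  qed (auto simp: frho_mult[where X = "lset L"])
  moreover have "enveloping_relations L \<subseteq> ?K"
    using assms(1) unfolding enveloping_relations_def Let_def lrep_def
    by (auto simp: closed diff frho_add[where X = "lset L"] frho_mult[where X = "lset L"] ad_def)
      (auto simp: word_fsingle frho_fsingle)
  ultimately show ?thesis using T.genideal_minimal assms(2) unfolding enveloping_ideal_def by blast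
qed

definition urho :: "('l => 'a::calg) => ('l list => complex) set => 'a" where
  "urho Y u = frho Y (SOME q. q \<in> carrier T \<and> u = \<kappa> q)"

lemma urho_cls: assumes "lrep L p Y" "q \<in> carrier T" shows "urho Y (\<kappa> q) = frho Y q"
proof -
  let ?r = "SOME r. r \<in> carrier T \<and> \<kappa> q = \<kappa> r"
  have r: "?r \<in> carrier T \<and> \<kappa> q = \<kappa> ?r" by (rule someI[of _ q]) (use assms in simp)
  hence "?r \<ominus>\<^bsub>T\<^esub> q \<in> I" using cls_eq assms(2) by auto
  moreover have "?r = (?r \<ominus>\<^bsub>T\<^esub> q) \<oplus>\<^bsub>T\<^esub> q" using r assms(2) by (simp add: a_minus_def T.add.m_assoc T.l_neg)
  ultimately have "frho Y ?r = frho Y q"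
    using r assms(2) frho_ideal[OF assms(1)] frho_add[of "?r \<ominus>\<^bsub>T\<^esub> q" "lset L" q Y] by simp
  thus ?thesis by (simp add: urho_def)
qed

end

locale umod = lie_closed L + M: left_module "U L" M for L :: "('l::plus) lie_alg" and M :: "('l, 'b) U_module"
begin

abbreviation "sc \<equiv> scal L M"
abbreviation "ac \<equiv> act L M"

lemma scal_cls: "sc c v = \<kappa> (fsingle c []) \<odot>\<^bsub>M\<^esub> v" and act_cls: "ac x v = \<kappa> (fsingle 1 [x]) \<odot>\<^bsub>M\<^esub> v"
  by (simp_all add: scal_def act_def U_const_def U_gen_def word_fsingle)

lemma fs [simp]: "set u \<subseteq> lset L ==> fsingle c u \<in> carrier T" by (rule fsingle_carrier)

lemma cls_smult_add: "p \<in> carrier T ==> q \<in> carrier T ==> m \<in> carrier M ==> \<kappa> (p \<oplus>\<^bsub>T\<^esub> q) \<odot>\<^bsub>M\<^esub> m = \<kappa> p \<odot>\<^bsub>M\<^esub> m \<oplus>\<^bsub>M\<^esub> \<kappa> q \<odot>\<^bsub>M\<^esub> m"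
  and cls_smult_mult: "p \<in> carrier T ==> q \<in> carrier T ==> m \<in> carrier M ==> \<kappa> (p \<otimes>\<^bsub>T\<^esub> q) \<odot>\<^bsub>M\<^esub> m = \<kappa> p \<odot>\<^bsub>M\<^esub> (\<kappa> q \<odot>\<^bsub>M\<^esub> m)"
  by (simp_all add: cls_add cls_mult cls_closed M.smult_l_distr M.smult_assoc1)

lemma fsingle_add: "fsingle (c + d) u = fsingle c u \<oplus>\<^bsub>T\<^esub> fsingle d u" by (auto simp: free_add fsingle_def)

lemma scal_closed [simp]: "m \<in> carrier M ==> sc c m \<in> carrier M"
  and act_closed [simp]: "x \<in> lset L ==> m \<in> carrier M ==> ac x m \<in> carrier M"
  by (simp_all add: scal_cls act_cls cls_closed)

lemma scal_add: "m \<in> carrier M ==> sc (c + d) m = sc c m \<oplus>\<^bsub>M\<^esub> sc d m"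
  by (simp add: scal_cls fsingle_add cls_smult_add)

lemma scal_add_right: "m \<in> carrier M ==> n \<in> carrier M ==> sc c (m \<oplus>\<^bsub>M\<^esub> n) = sc c m \<oplus>\<^bsub>M\<^esub> sc c n"
  by (simp add: scal_cls cls_closed M.smult_r_distr)

lemma act_add_right: "x \<in> lset L ==> m \<in> carrier M ==> n \<in> carrier M ==> ac x (m \<oplus>\<^bsub>M\<^esub> n) = ac x m \<oplus>\<^bsub>M\<^esub> ac x n"
  by (simp add: act_cls cls_closed M.smult_r_distr)

lemma scal_scal: "m \<in> carrier M ==> sc c (sc d m) = sc (c * d) m"
  using fsingle_mult[of "lset L" c "[]" d "[]"] by (simp add: scal_cls flip: cls_smult_mult)

lemma act_scal: "x \<in> lset L ==> m \<in> carrier M ==> ac x (sc c m) = sc c (ac x m)"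
  using fsingle_mult[of "lset L" c "[]" 1 "[x]"] fsingle_mult[of "lset L" 1 "[x]" c "[]"]
  by (simp add: scal_cls act_cls flip: cls_smult_mult)

lemma scal_one: "m \<in> carrier M ==> sc 1 m = m"
  using cls_one by (simp add: scal_cls free_one)

lemma scal_zero: "m \<in> carrier M ==> sc 0 m = \<zero>\<^bsub>M\<^esub>"
  using scal_add[of m 0 0] by simp

lemma scal_r_zero: "sc c \<zero>\<^bsub>M\<^esub> = \<zero>\<^bsub>M\<^esub>"
  using scal_add_right[of "\<zero>\<^bsub>M\<^esub>" "\<zero>\<^bsub>M\<^esub>" c] by simp

lemma scal_minus: "m \<in> carrier M ==> \<ominus>\<^bsub>M\<^esub> m = sc (- 1) m"
  using scal_add[of m "-1" 1] by (intro M.minus_equality) (simp_all add: scal_zero scal_one)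

lemma act_relations:
  assumes "x \<in> lset L" "y \<in> lset L" "m \<in> carrier M"
  shows "ac (x + y) m = ac x m \<oplus>\<^bsub>M\<^esub> ac y m" "ac (lscale L c x) m = sc c (ac x m)"
    "ac x (ac y m) = ac (lbracket L x y) m \<oplus>\<^bsub>M\<^esub> ac y (ac x m)"
proof -
  note r = cls_relations[OF assms(1,2), unfolded word_fsingle]
  show "ac (x + y) m = ac x m \<oplus>\<^bsub>M\<^esub> ac y m" "ac (lscale L c x) m = sc c (ac x m)"
    using assms unfolding act_cls scal_cls r by (simp_all add: cls_smult_add cls_smult_mult)
  let ?a = "fsingle 1 [x]" and ?b = "fsingle 1 [y]"
  have c: "?a \<in> carrier T" "?b \<in> carrier T" using assms by simp_all
  have "ac (lbracket L x y) m \<oplus>\<^bsub>M\<^esub> ac y (ac x m) = \<kappa> ((?a \<otimes>\<^bsub>T\<^esub> ?b \<ominus>\<^bsub>T\<^esub> ?b \<otimes>\<^bsub>T\<^esub> ?a) \<oplus>\<^bsub>T\<^esub> ?b \<otimes>\<^bsub>T\<^esub> ?a) \<odot>\<^bsub>M\<^esub> m"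
    using assms c unfolding act_cls r(3)[symmetric] by (simp add: cls_smult_add cls_smult_mult)
  also have "(?a \<otimes>\<^bsub>T\<^esub> ?b \<ominus>\<^bsub>T\<^esub> ?b \<otimes>\<^bsub>T\<^esub> ?a) \<oplus>\<^bsub>T\<^esub> ?b \<otimes>\<^bsub>T\<^esub> ?a = ?a \<otimes>\<^bsub>T\<^esub> ?b"
    using c by (simp add: a_minus_def T.add.m_assoc T.l_neg)
  finally show "ac x (ac y m) = ac (lbracket L x y) m \<oplus>\<^bsub>M\<^esub> ac y (ac x m)"
    using assms c by (simp add: cls_smult_mult act_cls)
qed

end

text \<open>Every module becomes the range of an idempotent on one fixed vector space, so that all of them, and
  the maps between them, live in a single algebra. The choice depends on the vector space structure only.\<close>

definition emb_spec :: "('l::plus) lie_alg => ('l, 'b) U_module => 'b endo \<times> ('b => 'b free) \<times> ('b free => 'b) => bool" where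
  "emb_spec L M = (\<lambda>(p, \<sigma>, \<pi>). (\<forall>m\<in>carrier M. \<pi> (\<sigma> m) = m) \<and> (\<forall>v. \<pi> v \<in> carrier M \<and> \<sigma> (\<pi> v) = p $$ v)
    \<and> (\<forall>m\<in>carrier M. \<forall>n\<in>carrier M. \<sigma> (m \<oplus>\<^bsub>M\<^esub> n) = \<sigma> m + \<sigma> n) \<and> (\<forall>c. \<forall>m\<in>carrier M. \<sigma> (scal L M c m) = c *. \<sigma> m))"

definition "emb L M = (SOME z. emb_spec L M z)"
definition "mproj L M = fst (emb L M)"
definition "msec L M = fst (snd (emb L M))"
definition "mpi L M = snd (snd (emb L M))"

definition xrep :: "('l::plus) lie_alg => ('l, 'b) U_module => 'l => 'b endo" where
  "xrep L M x = Endo (\<lambda>v. msec L M (act L M x (mpi L M v)))"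

context umod begin

text \<open>\<pi> evaluates formal combinations of elements of the module. With \<open>P\<close> a
  projection onto its kernel, p = 1 - P is idempotent with the same evaluation, and \<sigma> sends m
  to the image under p of the basis vector m.\<close>

lemma emb_exists: "\<exists>z. emb_spec L M z"
proof -
  define \<pi> where "\<pi> f = (\<Oplus>\<^bsub>M\<^esub>m\<in>Poly_Mapping.keys f \<inter> carrier M. sc (Poly_Mapping.lookup f m) m)" for f :: "'b free"
  have sup: "\<pi> f = (\<Oplus>\<^bsub>M\<^esub>m\<in>A. sc (Poly_Mapping.lookup f m) m)"
    if "finite A" "A \<subseteq> carrier M" "Poly_Mapping.keys f \<inter> carrier M \<subseteq> A" for f A
    unfolding \<pi>_def using that
    by (intro M.add.finprod_mono_neutral_cong_left) (auto simp: in_keys_iff scal_zero)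
  have cl: "\<pi> f \<in> carrier M" for f unfolding \<pi>_def by (rule M.finsum_closed) auto
  have add: "\<pi> (f + g) = \<pi> f \<oplus>\<^bsub>M\<^esub> \<pi> g" for f g
  proof -
    let ?A = "(Poly_Mapping.keys f \<union> Poly_Mapping.keys g) \<inter> carrier M"
    have s: "\<pi> f = (\<Oplus>\<^bsub>M\<^esub>m\<in>?A. sc (Poly_Mapping.lookup f m) m)" "\<pi> g = (\<Oplus>\<^bsub>M\<^esub>m\<in>?A. sc (Poly_Mapping.lookup g m) m)"
      "\<pi> (f + g) = (\<Oplus>\<^bsub>M\<^esub>m\<in>?A. sc (Poly_Mapping.lookup (f + g) m) m)"
      by (rule sup; use Poly_Mapping.keys_add[of f g] in auto)+
    have "\<pi> (f + g) = (\<Oplus>\<^bsub>M\<^esub>m\<in>?A. sc (Poly_Mapping.lookup f m) m \<oplus>\<^bsub>M\<^esub> sc (Poly_Mapping.lookup g m) m)"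
      unfolding s(3) by (rule M.finsum_cong') (auto simp: lookup_add scal_add)
    also have "\<dots> = \<pi> f \<oplus>\<^bsub>M\<^esub> \<pi> g" unfolding s(1,2) by (rule M.finsum_addf) auto
    finally show ?thesis .
  qed
  have scsum: "sc c (\<Oplus>\<^bsub>M\<^esub>m\<in>A. h m) = (\<Oplus>\<^bsub>M\<^esub>m\<in>A. sc c (h m))" if "finite A" "h \<in> A \<rightarrow> carrier M" for A h c
    using that
  proof induction
    case (insert a A)
    have cA: "(\<Oplus>\<^bsub>M\<^esub>m\<in>A. h m) \<in> carrier M" "(\<lambda>m. sc c (h m)) \<in> A \<rightarrow> carrier M" "h \<in> A \<rightarrow> carrier M" "h a \<in> carrier M"
      using insert.prems by (auto intro!: M.finsum_closed scal_closed)
    thus ?case using insert by (simp add: scal_add_right)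
  qed (simp add: scal_r_zero)
  have scale: "\<pi> (c *. f) = sc c (\<pi> f)" for c f
  proof -
    let ?A = "Poly_Mapping.keys f \<inter> carrier M"
    have "\<pi> (c *. f) = (\<Oplus>\<^bsub>M\<^esub>m\<in>?A. sc (Poly_Mapping.lookup (c *. f) m) m)"
      by (rule sup) (auto simp: in_keys_iff cscale_complex_def)
    also have "\<dots> = (\<Oplus>\<^bsub>M\<^esub>m\<in>?A. sc c (sc (Poly_Mapping.lookup f m) m))"
      by (rule M.finsum_cong') (auto simp: scal_scal cscale_complex_def)
    also have "\<dots> = sc c (\<pi> f)" unfolding \<pi>_def by (rule scsum[symmetric]) auto
    finally show ?thesis .
  qed
  have single: "\<pi> (Poly_Mapping.single m 1) = m" if "m \<in> carrier M" for m
  proof -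
    have "\<pi> (Poly_Mapping.single m 1) = (\<Oplus>\<^bsub>M\<^esub>k\<in>{m}. sc (Poly_Mapping.lookup (Poly_Mapping.single m 1) k) k)"
      by (rule sup) (use that in auto)
    thus ?thesis using that by (simp add: scal_one)
  qed
  have z: "\<pi> 0 = \<zero>\<^bsub>M\<^esub>" by (simp add: \<pi>_def)
  have "cv.subspace {f. \<pi> f = \<zero>\<^bsub>M\<^esub>}" by (auto simp: cv.subspace_def add scale z scal_r_zero)
  then obtain P where P: "clin P" "\<And>f. \<pi> (P f) = \<zero>\<^bsub>M\<^esub>" "\<And>f. \<pi> f = \<zero>\<^bsub>M\<^esub> ==> P f = f"
    by (rule cv_projection) blast
  define p where "p = Endo (\<lambda>v. v - P v)"
  have p: "p $$ v = v - P v" for v unfolding p_def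
    by (subst Endo_app) (auto simp: clin_def clin_add[OF P(1)] clin_scale[OF P(1)] cscale_simps)
  have \<pi>p: "\<pi> (p $$ v) = \<pi> v" for v
  proof -
    have "\<pi> ((p $$ v) + P v) = \<pi> (p $$ v)" unfolding add P(2) using cl by simp
    thus ?thesis by (simp add: p)
  qed
  have pe: "p $$ v = p $$ w" if "\<pi> v = \<pi> w" for v w
  proof -
    have "\<pi> (v - w) = \<pi> v \<oplus>\<^bsub>M\<^esub> sc (- 1) (\<pi> w)" using add[of v "(-1) *. w"] scale[of "-1" w] by simp
    also have "\<dots> = \<zero>\<^bsub>M\<^esub>" unfolding that using scal_minus[OF cl[of w]] M.r_neg[OF cl[of w]] by simp
    finally have "P (v - w) = v - w" by (rule P(3))
    thus ?thesis by (simp add: p clin_diff[OF P(1)] algebra_simps)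
  qed
  have "emb_spec L M (p, \<lambda>m. p $$ Poly_Mapping.single m 1, \<pi>)" unfolding emb_spec_def split
  proof (intro conjI allI ballI)
    show "\<pi> (p $$ Poly_Mapping.single m 1) = m" if "m \<in> carrier M" for m using that by (simp add: \<pi>p single)
    show "p $$ Poly_Mapping.single (\<pi> v) 1 = p $$ v" for v by (rule pe) (simp add: single cl)
    show "p $$ Poly_Mapping.single (m \<oplus>\<^bsub>M\<^esub> n) 1 = p $$ Poly_Mapping.single m 1 + p $$ Poly_Mapping.single n 1"
      if "m \<in> carrier M" "n \<in> carrier M" for m n
      unfolding eapp_linear(1)[symmetric] by (rule pe) (simp add: single add that)
    show "p $$ Poly_Mapping.single (sc c m) 1 = c *. (p $$ Poly_Mapping.single m 1)" if "m \<in> carrier M" for c m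
      unfolding eapp_linear(2)[symmetric] by (rule pe) (simp add: single scale that)
  qed (rule cl)
  thus ?thesis by blast
qed

abbreviation "\<pi> \<equiv> mpi L M"
abbreviation "\<sigma> \<equiv> msec L M"
abbreviation "p \<equiv> mproj L M"
abbreviation "X \<equiv> xrep L M"

lemma emb: "m \<in> carrier M ==> \<pi> (\<sigma> m) = m" "\<pi> v \<in> carrier M" "\<sigma> (\<pi> v) = p $$ v"
  "m \<in> carrier M ==> n \<in> carrier M ==> \<sigma> (m \<oplus>\<^bsub>M\<^esub> n) = \<sigma> m + \<sigma> n"
  "m \<in> carrier M ==> \<sigma> (sc c m) = c *. \<sigma> m"
proof -
  have "emb_spec L M (p, \<sigma>, \<pi>)"
    using someI_ex[OF emb_exists] by (simp add: mproj_def msec_def mpi_def flip: emb_def)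
  thus "m \<in> carrier M ==> \<pi> (\<sigma> m) = m" "\<pi> v \<in> carrier M" "\<sigma> (\<pi> v) = p $$ v"
    "m \<in> carrier M ==> n \<in> carrier M ==> \<sigma> (m \<oplus>\<^bsub>M\<^esub> n) = \<sigma> m + \<sigma> n" "m \<in> carrier M ==> \<sigma> (sc c m) = c *. \<sigma> m"
    unfolding emb_spec_def by simp_all
qed

lemma \<pi>_p: "\<pi> (p $$ v) = \<pi> v" unfolding emb(3)[symmetric] by (simp add: emb(1,2))

lemma p_\<sigma>: "m \<in> carrier M ==> p $$ \<sigma> m = \<sigma> m" unfolding emb(3)[symmetric] by (simp add: emb(1))

lemma p_idem: "p * p = p" by (rule endo_eqI) (simp add: emb(1,2) flip: emb(3))

lemma \<sigma>_inj: "m \<in> carrier M ==> n \<in> carrier M ==> \<sigma> m = \<sigma> n ==> m = n" using emb(1) by metis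

lemma \<pi>_linear: "\<pi> (v + w) = \<pi> v \<oplus>\<^bsub>M\<^esub> \<pi> w" "\<pi> (c *. v) = sc c (\<pi> v)"
proof -
  have "\<sigma> (\<pi> (v + w)) = \<sigma> (\<pi> v \<oplus>\<^bsub>M\<^esub> \<pi> w)" "\<sigma> (\<pi> (c *. v)) = \<sigma> (sc c (\<pi> v))"
    using emb(2)[of v] emb(2)[of w] by (simp_all add: emb(4,5)) (simp_all add: emb(3) eapp_linear)
  thus "\<pi> (v + w) = \<pi> v \<oplus>\<^bsub>M\<^esub> \<pi> w" "\<pi> (c *. v) = sc c (\<pi> v)" using \<sigma>_inj emb(2) by simp_all
qed

lemma X_app: "x \<in> lset L ==> X x $$ v = \<sigma> (ac x (\<pi> v))"
  unfolding xrep_def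
  by (subst Endo_app) (auto simp: clin_def \<pi>_linear emb(2) act_add_right act_scal emb(4,5))

lemma X_\<sigma>: "x \<in> lset L ==> m \<in> carrier M ==> X x $$ \<sigma> m = \<sigma> (ac x m)"
  by (simp add: X_app emb(1))

lemma \<sigma>_zero: "\<sigma> \<zero>\<^bsub>M\<^esub> = 0" using emb(5)[of "\<zero>\<^bsub>M\<^esub>" 0] by (simp add: scal_r_zero)

lemma \<pi>_zero: "\<pi> 0 = \<zero>\<^bsub>M\<^esub>" using emb(1)[of "\<zero>\<^bsub>M\<^esub>"] by (simp add: \<sigma>_zero)

lemma lrep_X: "lrep L p X"
  unfolding lrep_def
proof (intro conjI ballI allI)
  fix x assume x: "x \<in> lset L"
  show "p * X x = X x" "X x * p = X x" by (rule endo_eqI; simp add: X_app x p_\<sigma> emb(2) \<pi>_p)+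
  show "X (lscale L c x) = c *. X x" for c
    by (rule endo_eqI) (simp add: X_app x closed emb(2,5) act_relations(2)[OF x x])
  fix y assume y: "y \<in> lset L"
  show "X (x + y) = X x + X y" by (rule endo_eqI) (simp add: X_app x y closed emb(2,4) act_relations(1))
  show "X (lbracket L x y) = ad (X x) (X y)"
  proof (rule endo_eqI)
    fix v
    have "\<sigma> (ac x (ac y (\<pi> v))) = \<sigma> (ac (lbracket L x y) (\<pi> v)) + \<sigma> (ac y (ac x (\<pi> v)))"
      using act_relations(3)[OF x y, of "\<pi> v"] by (simp add: emb(2,4) x y closed)
    thus "X (lbracket L x y) $$ v = ad (X x) (X y) $$ v"
      by (simp add: ad_def X_app x y closed emb(1,2))
  qed
qed

end

section \<open>Functors that twist the action on a fixed vector space\<close>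

definition mcat :: "('l::plus) lie_alg => ('b endo => ('l => 'b endo) => bool) => (('l, 'b) U_module, 'b => 'b) category" where
  "mcat L Q = \<lparr>obj = {M. left_module (U L) M \<and> Q (mproj L M) (xrep L M)},
     hom = module_hom (U L), ident = (\<lambda>M. \<lambda>v\<in>carrier M. v), cmp = (\<lambda>M N P g f. compose (carrier M) g f)\<rparr>"

context lie_closed begin

lemma umodI: "left_module (U L) M ==> umod L M"
  by (simp add: umod_def lie_closed_axioms)

definition remod :: "('l, 'b) U_module => ('l => 'b endo) => ('l, 'b) U_module" where
  "remod M Y = M\<lparr>smult := \<lambda>u m. mpi L M (urho Y u $$ msec L M m)\<rparr>"

lemma remod_simps [simp]: "carrier (remod M Y) = carrier M" "add (remod M Y) = add M" "zero (remod M Y) = zero M"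
  by (simp_all add: remod_def)

text \<open>Linearity over the enveloping algebra is tested on scalars and generators: words follow
  by induction on their length, and sums by additivity.\<close>

lemma hom_iff:
  assumes "left_module (U L) M" "left_module (U L) N"
  shows "f \<in> module_hom (U L) M N \<longleftrightarrow> f \<in> carrier M \<rightarrow>\<^sub>E carrier N \<and> (\<forall>x\<in>carrier M. \<forall>y\<in>carrier M. f (x \<oplus>\<^bsub>M\<^esub> y) = f x \<oplus>\<^bsub>N\<^esub> f y)
    \<and> (\<forall>c. \<forall>m\<in>carrier M. f (scal L M c m) = scal L N c (f m)) \<and> (\<forall>x\<in>lset L. \<forall>m\<in>carrier M. f (act L M x m) = act L N x (f m))"
    (is "?l \<longleftrightarrow> ?r")
proof
  interpret M: umod L M by (rule umodI[OF assms(1)])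
  show ?r if ?l using that unfolding module_hom_def scal_def act_def U_const_def U_gen_def by (simp add: cls_closed)
  interpret N: umod L N by (rule umodI[OF assms(2)])
  assume r: ?r
  have fc: "f m \<in> carrier N" if "m \<in> carrier M" for m using r that by blast
  have "f (\<kappa> q \<odot>\<^bsub>M\<^esub> m) = \<kappa> q \<odot>\<^bsub>N\<^esub> f m" if "q \<in> carrier T" "m \<in> carrier M" for q m using that
  proof (induction arbitrary: m rule: free_algebra_induct)
    case (single c u)
    thus ?case
    proof (induction u arbitrary: m)
      case Nil
      thus ?case using r by (simp add: M.scal_cls N.scal_cls)
    next
      case (Cons x u)
      have "fsingle c u \<otimes>\<^bsub>T\<^esub> fsingle 1 [x] = fsingle c (u @ [x])" by (simp add: fsingle_mult)
      have e: "fsingle c (x # u) = fsingle 1 [x] \<otimes>\<^bsub>T\<^esub> fsingle c u" by (simp add: fsingle_mult)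
      have x: "x \<in> lset L" "set u \<subseteq> lset L" using Cons.prems by auto
      have "f (\<kappa> (fsingle c (x # u)) \<odot>\<^bsub>M\<^esub> m) = f (act L M x (\<kappa> (fsingle c u) \<odot>\<^bsub>M\<^esub> m))"
        unfolding e M.act_cls using x Cons.prems by (simp add: M.cls_smult_mult)
      also have "\<dots> = act L N x (\<kappa> (fsingle c u) \<odot>\<^bsub>N\<^esub> f m)"
        using r x Cons by (simp add: cls_closed)
      also have "\<dots> = \<kappa> (fsingle c (x # u)) \<odot>\<^bsub>N\<^esub> f m"
        unfolding e N.act_cls using x fc Cons.prems by (simp add: N.cls_smult_mult)
      finally show ?case .
    qed
  next
    case (add a b)
    thus ?case using r fc by (simp add: M.cls_smult_add N.cls_smult_add cls_closed)
  qed
  thus ?l using r unfolding module_hom_def by (auto simp: U_carrier)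
qed

lemma remod:
  assumes M: "left_module (U L) M" and Y: "lrep L (mproj L M) Y"
  shows remod_module: "left_module (U L) (remod M Y)"
    and remod_scal: "m \<in> carrier M ==> scal L (remod M Y) c m = scal L M c m"
    and remod_act: "x \<in> lset L ==> act L (remod M Y) x m = mpi L M (Y x $$ msec L M m)"
    and remod_emb: "emb L (remod M Y) = emb L M"
    and remod_xrep: "x \<in> lset L ==> xrep L (remod M Y) x = Y x"
proof -
  interpret M: umod L M by (rule umodI[OF M])
  let ?N = "remod M Y"
  have sm: "\<kappa> q \<odot>\<^bsub>?N\<^esub> m = M.\<pi> (frho Y q $$ M.\<sigma> m)" if "q \<in> carrier T" for q m
    using that by (simp add: remod_def urho_cls[OF Y])
  have Yp: "M.p $$ Y x $$ v = Y x $$ v" if "x \<in> lset L" for x v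
  proof -
    have "M.p * Y x = Y x" using Y that by (simp add: lrep_def)
    from arg_cong[OF this, of "\<lambda>z. z $$ v"] show ?thesis by simp
  qed
  have pl: "M.p $$ prod_list (map Y u) $$ v = prod_list (map Y u) $$ v" if "set u \<subseteq> lset L" "M.p $$ v = v" for u v
    using that by (induction u) (auto simp: Yp)
  have pf: "M.p $$ frho Y q $$ v = frho Y q $$ v" if "q \<in> carrier T" "M.p $$ v = v" for q v
    using that
  proof (induction rule: free_algebra_induct)
    case (single c u) thus ?case by (simp add: frho_fsingle eapp_linear pl)
  next
    case (add a b) thus ?case by (simp add: frho_add[where X = "lset L"] eapp_linear)
  qed
  have ab: "abelian_group ?N" using M.M.abelian_group_axioms
    by (simp add: remod_def abelian_group_def abelian_monoid_def abelian_group_axioms_def)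
  have N: "left_module (U L) ?N"
  proof (rule left_module.intro[OF U.ring_axioms ab], unfold_locales, simp_all)
    show "u \<odot>\<^bsub>?N\<^esub> x \<in> carrier M" for u x by (simp add: remod_def M.emb(2))
    show "\<one>\<^bsub>U L\<^esub> \<odot>\<^bsub>?N\<^esub> x = x" if "x \<in> carrier M" for x
      unfolding cls_one[symmetric] using that sm[of "\<one>\<^bsub>T\<^esub>" x] by (simp add: M.emb(1)) (simp add: free_one frho_fsingle M.emb(1))
    fix u x assume u: "u \<in> carrier (U L)" and x: "x \<in> carrier M"
    obtain q where q: "q \<in> carrier T" "u = \<kappa> q" using u U_carrier by blast
    show "u \<odot>\<^bsub>?N\<^esub> (x \<oplus>\<^bsub>M\<^esub> y) = u \<odot>\<^bsub>?N\<^esub> x \<oplus>\<^bsub>M\<^esub> u \<odot>\<^bsub>?N\<^esub> y" if "y \<in> carrier M" for y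
      using that x by (simp add: remod_def M.emb(4) eapp_linear M.\<pi>_linear)
    fix w assume w: "w \<in> carrier (U L)"
    obtain r where r: "r \<in> carrier T" "w = \<kappa> r" using w U_carrier by blast
    show "(u \<oplus>\<^bsub>U L\<^esub> w) \<odot>\<^bsub>?N\<^esub> x = u \<odot>\<^bsub>?N\<^esub> x \<oplus>\<^bsub>M\<^esub> w \<odot>\<^bsub>?N\<^esub> x"
      using q(1) r(1) unfolding q(2) r(2) by (simp add: sm frho_add[where X = "lset L"] M.\<pi>_linear flip: cls_add)
    show "(u \<otimes>\<^bsub>U L\<^esub> w) \<odot>\<^bsub>?N\<^esub> x = u \<odot>\<^bsub>?N\<^esub> (w \<odot>\<^bsub>?N\<^esub> x)"
      using q(1) r(1) x unfolding q(2) r(2)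
      by (simp add: sm frho_mult[where X = "lset L"] M.emb(3) pf M.p_\<sigma> flip: cls_mult)
  qed
  thus "left_module (U L) ?N" .
  have sc: "scal L ?N c m = scal L M c m" if "m \<in> carrier M" for c m
  proof -
    have "scal L ?N c m = M.\<pi> (c *. M.\<sigma> m)" using sm[of "fsingle c []" m]
      by (simp add: scal_def U_const_def word_fsingle frho_fsingle)
    thus ?thesis using that by (simp add: M.\<pi>_linear M.emb(1))
  qed
  thus "m \<in> carrier M ==> scal L ?N c m = scal L M c m" .
  have ac: "act L ?N x m = M.\<pi> (Y x $$ M.\<sigma> m)" if "x \<in> lset L" for x m
    using that sm[of "fsingle 1 [x]" m] by (simp add: act_def U_gen_def word_fsingle frho_fsingle)
  thus "x \<in> lset L ==> act L ?N x m = M.\<pi> (Y x $$ M.\<sigma> m)" .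
  \<comment> \<open>The specifications are equal as predicates, so the same choice is made and the
    twisted module sits in the free space in the same way.\<close>
  have "emb_spec L ?N = emb_spec L M"
    unfolding emb_spec_def by (intro ext) (auto simp: sc split: prod.splits)
  thus e: "emb L ?N = emb L M" by (simp add: emb_def)
  hence e': "mpi L ?N = mpi L M" "msec L ?N = msec L M" by (simp_all add: mpi_def msec_def)
  show "xrep L ?N x = Y x" if x: "x \<in> lset L"
  proof (rule endo_eqI)
    fix v
    interpret N: umod L ?N by (rule umodI[OF N])
    have "xrep L ?N x $$ v = M.p $$ Y x $$ M.p $$ v" using x by (simp add: N.X_app e' ac M.emb(3))
    also have "\<dots> = Y x $$ M.p $$ v" by (rule Yp[OF x])
    also have "\<dots> = Y x $$ v"
    proof -
      have "Y x * M.p = Y x" using Y x by (simp add: lrep_def)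
      from arg_cong[OF this, of "\<lambda>z. z $$ v"] show ?thesis by simp
    qed
    finally show "xrep L ?N x $$ v = Y x $$ v" .
  qed
qed

lemma is_category_mcat: "is_category (mcat L Q)"
proof -
  have cl: "compose (carrier M) g f \<in> module_hom (U L) M P"
    if "M \<in> obj (mcat L Q)" "N \<in> obj (mcat L Q)" "P \<in> obj (mcat L Q)" "f \<in> module_hom (U L) M N" "g \<in> module_hom (U L) N P" for M N P f g
  proof -
    have lm: "left_module (U L) M" "left_module (U L) N" "left_module (U L) P" using that(1-3) by (auto simp: mcat_def)
    interpret M: umod L M by (rule umodI[OF lm(1)])
    have f: "f m \<in> carrier N" if "m \<in> carrier M" for m using \<open>f \<in> _\<close> that by (auto simp: module_hom_def)
    have g: "g m \<in> carrier P" if "m \<in> carrier N" for m using \<open>g \<in> _\<close> that by (auto simp: module_hom_def)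
    show ?thesis using \<open>f \<in> _\<close> \<open>g \<in> _\<close> unfolding module_hom_def
      by (auto simp: compose_def f g)
  qed
  have id: "(\<lambda>v\<in>carrier M. v) \<in> module_hom (U L) M M" if "left_module (U L) M" for M
  proof -
    interpret M: umod L M by (rule umodI[OF that])
    show ?thesis unfolding module_hom_def by auto
  qed
  have fm: "f \<in> carrier M \<rightarrow>\<^sub>E carrier N" if "f \<in> module_hom (U L) M N" for f M N using that by (simp add: module_hom_def)
  show ?thesis unfolding is_category_def
  proof (intro conjI ballI)
    fix M N f assume "f \<in> hom (mcat L Q) M N"
    hence f: "f \<in> carrier M \<rightarrow>\<^sub>E carrier N" by (simp add: mcat_def fm)
    show "cmp (mcat L Q) M M N f (ident (mcat L Q) M) = f"
      using f by (auto simp: mcat_def compose_def fun_eq_iff PiE_def extensional_def)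
    show "cmp (mcat L Q) M N N (ident (mcat L Q) N) f = f"
      using f by (auto simp: mcat_def compose_def fun_eq_iff PiE_def extensional_def Pi_def)
  next
    fix W X Y Z f g k assume "f \<in> hom (mcat L Q) W X"
    hence f: "f \<in> carrier W \<rightarrow>\<^sub>E carrier X" by (simp add: mcat_def fm)
    show "cmp (mcat L Q) W X Z (cmp (mcat L Q) X Y Z k g) f = cmp (mcat L Q) W Y Z k (cmp (mcat L Q) W X Y g f)"
      using f by (auto simp: mcat_def compose_def fun_eq_iff PiE_def Pi_def)
  qed (use cl id in \<open>auto simp: mcat_def\<close>)
qed

text \<open>Twisting the action by \<^term>\<open>\<Theta>\<close> leaves the underlying vector space, and hence all maps, unchanged.\<close>

definition twist_functor :: "('b endo => ('l => 'b endo) => bool) => ('b endo => ('l => 'b endo) => bool)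
    => ('b endo => ('l => 'b endo) => 'l => 'b endo) => bool" where
  "twist_functor Q Q' \<Theta> \<longleftrightarrow>
    (\<forall>p X Y. Q' p X --> (\<forall>x\<in>lset L. X x = Y x) --> Q' p Y)
  \<and> (\<forall>p X Y. (\<forall>x\<in>lset L. X x = Y x) --> (\<forall>x\<in>lset L. \<Theta> p X x = \<Theta> p Y x))
  \<and> (\<forall>p X. p * p = p --> lrep L p X --> Q p X --> lrep L p (\<Theta> p X) \<and> Q' p (\<Theta> p X))
  \<and> (\<forall>p X p' X' F. p * p = p --> lrep L p X --> Q p X --> p' * p' = p' --> lrep L p' X' --> Q p' X' --> p' * F = F --> F * p = F -->
       (\<forall>x\<in>lset L. F * X x = X' x * F) --> (\<forall>x\<in>lset L. F * \<Theta> p X x = \<Theta> p' X' x * F))"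

lemma twist_functorD:
  assumes t: "twist_functor Q Q' \<Theta>"
  shows "Q' p X ==> (\<And>x. x \<in> lset L ==> X x = Y x) ==> Q' p Y"
    and "(\<And>x. x \<in> lset L ==> X x = Y x) ==> x \<in> lset L ==> \<Theta> p X x = \<Theta> p Y x"
    and "p * p = p ==> lrep L p X ==> Q p X ==> lrep L p (\<Theta> p X) \<and> Q' p (\<Theta> p X)"
    and "p * p = p ==> lrep L p X ==> Q p X ==> p' * p' = p' ==> lrep L p' X' ==> Q p' X' ==> p' * F = F ==> F * p = F ==>
       (\<And>x. x \<in> lset L ==> F * X x = X' x * F) ==> x \<in> lset L ==> F * \<Theta> p X x = \<Theta> p' X' x * F"
  using t[unfolded twist_functor_def, THEN conjunct1, rule_format, of p X Y]
    t[unfolded twist_functor_def, THEN conjunct2, THEN conjunct1, rule_format, of X Y x p]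
    t[unfolded twist_functor_def, THEN conjunct2, THEN conjunct2, THEN conjunct1, rule_format, of p X]
    t[unfolded twist_functor_def, THEN conjunct2, THEN conjunct2, THEN conjunct2, rule_format, of p X p' X' F x]
  by auto

definition tw :: "('b endo => ('l => 'b endo) => 'l => 'b endo) => ('l, 'b) U_module => ('l, 'b) U_module" where
  "tw \<Theta> M = remod M (\<Theta> (mproj L M) (xrep L M))"

lemma tw:
  assumes t: "twist_functor Q Q' \<Theta>" and M: "M \<in> obj (mcat L Q)"
  shows tw_obj: "tw \<Theta> M \<in> obj (mcat L Q')" and tw_mproj: "mproj L (tw \<Theta> M) = mproj L M"
    and tw_xrep: "x \<in> lset L ==> xrep L (tw \<Theta> M) x = \<Theta> (mproj L M) (xrep L M) x"
    and tw_lrep: "lrep L (mproj L M) (\<Theta> (mproj L M) (xrep L M))"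
proof -
  have m: "left_module (U L) M" "Q (mproj L M) (xrep L M)" using M by (auto simp: mcat_def)
  interpret M: umod L M by (rule umodI[OF m(1)])
  have r: "lrep L M.p (\<Theta> M.p M.X)" "Q' M.p (\<Theta> M.p M.X)"
    using twist_functorD(3)[OF t M.p_idem M.lrep_X m(2)] by simp_all
  show "lrep L M.p (\<Theta> M.p M.X)" by (rule r)
  note R = remod[OF m(1) r(1), folded tw_def]
  show e: "mproj L (tw \<Theta> M) = M.p" by (simp add: mproj_def R(4))
  show x: "xrep L (tw \<Theta> M) x = \<Theta> M.p M.X x" if "x \<in> lset L" for x by (rule R(5)[OF that])
  have "Q' M.p (xrep L (tw \<Theta> M))"
    by (rule twist_functorD(1)[OF t r(2)]) (simp add: x)
  thus "tw \<Theta> M \<in> obj (mcat L Q')" using R(1) by (simp add: mcat_def e)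
qed

lemma tw_carrier [simp]: "carrier (tw \<Theta> M) = carrier M" "add (tw \<Theta> M) = add M" by (simp_all add: tw_def)

lemma tw_functor:
  assumes t: "twist_functor Q Q' \<Theta>"
  shows "is_functor (mcat L Q) (mcat L Q') (tw \<Theta>) (\<lambda>_ _ f. f)"
proof -
  have "f \<in> module_hom (U L) (tw \<Theta> M) (tw \<Theta> N)"
    if M: "M \<in> obj (mcat L Q)" and N: "N \<in> obj (mcat L Q)" and f: "f \<in> module_hom (U L) M N" for M N f
  proof -
    have m: "left_module (U L) M" "Q (mproj L M) (xrep L M)" using M by (auto simp: mcat_def)
    have n: "left_module (U L) N" "Q (mproj L N) (xrep L N)" using N by (auto simp: mcat_def)
    interpret M: umod L M by (rule umodI[OF m(1)])
    interpret N: umod L N by (rule umodI[OF n(1)])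
    note RM = remod[OF m(1) tw_lrep[OF t M], folded tw_def] and RN = remod[OF n(1) tw_lrep[OF t N], folded tw_def]
    note f' = f[unfolded hom_iff[OF m(1) n(1)]]
    have fc: "f m \<in> carrier N" if "m \<in> carrier M" for m using f' that by blast
    \<comment> \<open>A module map becomes an element of the common operator algebra that
      intertwines the two families of operators.\<close>
    define F where "F = Endo (\<lambda>v. N.\<sigma> (f (M.\<pi> v)))"
    have F: "F $$ v = N.\<sigma> (f (M.\<pi> v))" for v unfolding F_def
      by (subst Endo_app) (use f' in \<open>auto simp: clin_def M.\<pi>_linear M.emb(2) fc N.emb(4,5)\<close>)
    have "N.p * F = F" "F * M.p = F" by (rule endo_eqI; simp add: F N.p_\<sigma> fc M.emb(2) M.\<pi>_p)+
    moreover have "\<forall>x\<in>lset L. F * M.X x = N.X x * F"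
      using f' by (auto intro!: endo_eqI simp: F M.X_app N.X_app M.emb(1,2) N.emb(1) fc)
    ultimately have c: "F * \<Theta> M.p M.X x = \<Theta> N.p N.X x * F" if "x \<in> lset L" for x
      using twist_functorD(4)[OF t M.p_idem M.lrep_X m(2) N.p_idem N.lrep_X n(2), of F x] that by blast
    have "f (act L (tw \<Theta> M) x k) = act L (tw \<Theta> N) x (f k)" if x: "x \<in> lset L" and k: "k \<in> carrier M" for x k
    proof -
      have "F $$ \<Theta> M.p M.X x $$ M.\<sigma> k = \<Theta> N.p N.X x $$ F $$ M.\<sigma> k"
        using arg_cong[OF c[OF x], of "\<lambda>z. z $$ M.\<sigma> k"] by simp
      hence "N.\<pi> (N.\<sigma> (f (M.\<pi> (\<Theta> M.p M.X x $$ M.\<sigma> k)))) = N.\<pi> (\<Theta> N.p N.X x $$ N.\<sigma> (f k))"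
        by (simp add: F M.emb(1) k)
      thus ?thesis by (simp add: RM(3)[OF x] RN(3)[OF x] N.emb(1) fc M.emb(2))
    qed
    thus ?thesis unfolding hom_iff[OF RM(1) RN(1)] using f' fc by (simp add: RM(2) RN(2))
  qed
  thus ?thesis unfolding is_functor_def using tw_obj[OF t] by (auto simp: mcat_def)
qed

text \<open>The double twist agrees with \<open>M\<close> on the carrier, but its scalar
  multiplication may differ elsewhere. Hence an isomorphism given by the identity map and not an
  equality of records.\<close>

lemma tw_tw_iso:
  assumes t: "twist_functor Q Q' \<Theta>" and t': "twist_functor Q' Q \<Theta>'" and M: "M \<in> obj (mcat L Q)"
    and i: "\<And>p X x. p * p = p ==> lrep L p X ==> Q p X ==> x \<in> lset L ==> \<Theta>' p (\<Theta> p X) x = X x"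
  shows "(\<lambda>v\<in>carrier M. v) \<in> module_hom (U L) M (tw \<Theta>' (tw \<Theta> M))" "(\<lambda>v\<in>carrier M. v) \<in> module_hom (U L) (tw \<Theta>' (tw \<Theta> M)) M"
proof -
  let ?N = "tw \<Theta> M" and ?P = "tw \<Theta>' (tw \<Theta> M)"
  have m: "left_module (U L) M" "Q (mproj L M) (xrep L M)" using M by (auto simp: mcat_def)
  have N: "?N \<in> obj (mcat L Q')" by (rule tw_obj[OF t M])
  hence n: "left_module (U L) ?N" by (simp add: mcat_def)
  interpret M: umod L M by (rule umodI[OF m(1)])
  interpret N: umod L ?N by (rule umodI[OF n])
  note RM = remod[OF m(1) tw_lrep[OF t M], folded tw_def] and RN = remod[OF n tw_lrep[OF t' N], folded tw_def]
  have e: "mpi L ?N = M.\<pi>" "msec L ?N = M.\<sigma>" "mproj L ?N = M.p" by (simp_all add: RM(4) mpi_def msec_def mproj_def)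
  have a: "act L ?P x k = act L M x k" if x: "x \<in> lset L" and k: "k \<in> carrier M" for x k
  proof -
    have "\<Theta>' M.p (xrep L ?N) x = \<Theta>' M.p (\<Theta> M.p M.X) x"
      by (rule twist_functorD(2)[OF t']) (simp_all add: tw_xrep[OF t M] x)
    also have "\<dots> = M.X x" by (rule i[OF M.p_idem M.lrep_X m(2) x])
    finally have "act L ?P x k = M.\<pi> (M.X x $$ M.\<sigma> k)" by (simp add: RN(3)[OF x] e)
    thus ?thesis by (simp add: M.X_\<sigma> x k M.emb(1))
  qed
  have s: "scal L ?P c k = scal L M c k" if "k \<in> carrier M" for c k using that by (simp add: RM(2) RN(2))
  show "(\<lambda>v\<in>carrier M. v) \<in> module_hom (U L) M ?P" "(\<lambda>v\<in>carrier M. v) \<in> module_hom (U L) ?P M"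
    unfolding hom_iff[OF m(1) RN(1)] hom_iff[OF RN(1) m(1)] by (auto simp: a s)
qed

theorem equivalent_mcat:
  assumes t: "twist_functor Q Q' \<Theta>" and t': "twist_functor Q' Q \<Theta>'"
    and i: "\<And>p X x. p * p = p ==> lrep L p X ==> Q p X ==> x \<in> lset L ==> \<Theta>' p (\<Theta> p X) x = X x"
    and i': "\<And>p X x. p * p = p ==> lrep L p X ==> Q' p X ==> x \<in> lset L ==> \<Theta> p (\<Theta>' p X) x = X x"
  shows "equivalent_categories (mcat L Q) (mcat L Q')"
proof -
  have ext: "compose (carrier M) (\<lambda>v\<in>carrier N. v) f = compose (carrier M) f (\<lambda>v\<in>carrier M. v)" if "f \<in> module_hom (U L) M N" for M N f
  proof -
    have "f v \<in> carrier N" if "v \<in> carrier M" for v using \<open>f \<in> _\<close> that by (auto simp: module_hom_def)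
    thus ?thesis by (auto simp: compose_def fun_eq_iff)
  qed
  have idid: "compose A (\<lambda>v\<in>A. v) (\<lambda>v\<in>A. v) = (\<lambda>v\<in>A. v)" for A :: "'c set" by (auto simp: compose_def)
  have eta: "natural_iso (mcat L R) (mcat L R) (\<lambda>X. X) (\<lambda>X Y f. f) F (\<lambda>X Y f. f) (\<lambda>M. \<lambda>v\<in>carrier M. v)
      \<and> natural_iso (mcat L R) (mcat L R) F (\<lambda>X Y f. f) (\<lambda>X. X) (\<lambda>X Y f. f) (\<lambda>M. \<lambda>v\<in>carrier M. v)"
    if h: "\<And>M. M \<in> obj (mcat L R) ==> (\<lambda>v\<in>carrier M. v) \<in> module_hom (U L) M (F M) \<and> (\<lambda>v\<in>carrier M. v) \<in> module_hom (U L) (F M) M"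
      and c: "\<And>M. carrier (F M) = carrier M" for F R
  proof -
    have "iso_arrow (mcat L R) M (F M) (\<lambda>v\<in>carrier M. v) \<and> iso_arrow (mcat L R) (F M) M (\<lambda>v\<in>carrier M. v)" if "M \<in> obj (mcat L R)" for M
      using h[OF that] by (auto simp: iso_arrow_def mcat_def idid c intro!: bexI[of _ "\<lambda>v\<in>carrier M. v"])
    thus ?thesis using ext by (auto simp: natural_iso_def mcat_def c)
  qed
  have 1: "(\<lambda>v\<in>carrier M. v) \<in> module_hom (U L) M (tw \<Theta>' (tw \<Theta> M)) \<and> (\<lambda>v\<in>carrier M. v) \<in> module_hom (U L) (tw \<Theta>' (tw \<Theta> M)) M"
    if "M \<in> obj (mcat L Q)" for M by (intro conjI; rule tw_tw_iso[OF t t' that]; rule i; assumption)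
  have 2: "(\<lambda>v\<in>carrier M. v) \<in> module_hom (U L) M (tw \<Theta> (tw \<Theta>' M)) \<and> (\<lambda>v\<in>carrier M. v) \<in> module_hom (U L) (tw \<Theta> (tw \<Theta>' M)) M"
    if "M \<in> obj (mcat L Q')" for M by (intro conjI; rule tw_tw_iso[OF t' t that]; rule i'; assumption)
  show ?thesis unfolding equivalent_categories_def
    using is_category_mcat tw_functor[OF t] tw_functor[OF t'] eta[OF 1] eta[OF 2] by (auto; blast)
qed

end

section \<open>The quadratic equation defining the Weyl pair\<close>

definition nilS :: "'b endo => 'b endo => bool" where
  "nilS p A \<longleftrightarrow> (\<forall>v. \<exists>k. (A ^ k) $$ p $$ v = 0)"

lemma nilS_lnil: "nilS p A ==> lnil (eapp A) (p $$ v)"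
  by (simp add: nilS_def lnil_def eapp_power)

lemma clin_apps: "(x * y) $$ v = x $$ y $$ v" by simp

lemma app_eq: "x = y ==> x $$ v = y $$ v" by simp

lemma nilS_mult: assumes "nilS p A" "A * C = C * A" shows "nilS p (C * A)"
  unfolding nilS_def
proof
  fix v
  obtain k where k: "(A ^ k) $$ p $$ v = 0" using assms(1) unfolding nilS_def by blast
  have "(C * A) ^ k = C ^ k * A ^ k" by (rule power_mult_commute) (rule assms(2)[symmetric])
  hence "((C * A) ^ k) $$ p $$ v = 0" by (simp add: k eapp_linear)
  thus "\<exists>k. ((C * A) ^ k) $$ p $$ v = 0" by blast
qed

text \<open>(A + C)^l is C^l plus a multiple of A. With l chosen so that C^l kills the vector,
  applying (A + C)^l lowers the order of A by one, and induction on this order finishes.\<close>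

lemma nilS_add:
  assumes A: "nilS p A" and C: "nilS p C" and c: "A * C = C * A"
    and p: "p * A = A" "A * p = A" "p * C = C" "C * p = C"
  shows "nilS p (A + C)"
proof -
  have Q: "\<exists>Q. (A + C) ^ l = A * Q + C ^ l \<and> A * Q = Q * A \<and> C * Q = Q * C" for l
  proof (induction l)
    case 0
    show ?case by (rule exI[of _ 0]) simp
  next
    case (Suc l)
    then obtain Q where Q: "(A + C) ^ l = A * Q + C ^ l" "A * Q = Q * A" "C * Q = Q * C" by blast
    have cl: "A * C ^ n = C ^ n * A" for n by (induction n) (simp_all, metis mult.assoc c)
    have Cp: "C * C ^ n = C ^ n * C" for n by (simp add: power_commutes)
    let ?Q = "A * Q + C * Q + C ^ l"
    have "(A + C) ^ Suc l = A * A * Q + A * C ^ l + C * A * Q + C ^ Suc l"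
      by (simp add: Q(1) distrib_left distrib_right mult.assoc add.assoc)
    also have "\<dots> = A * ?Q + C ^ Suc l" by (simp add: c distrib_left mult.assoc add_ac flip: mult.assoc)
    finally have 1: "(A + C) ^ Suc l = A * ?Q + C ^ Suc l" .
    have "A * (C * Q) = C * Q * A" unfolding mult.assoc[symmetric] c unfolding mult.assoc Q(2) ..
    moreover have "A * (A * Q) = A * Q * A" unfolding mult.assoc Q(2)[symmetric] ..
    ultimately have 2: "A * ?Q = ?Q * A" by (simp add: distrib_left distrib_right cl)
    have "C * (A * Q) = A * Q * C" unfolding mult.assoc Q(3)[symmetric] unfolding mult.assoc[symmetric] c ..
    moreover have "C * (C * Q) = C * Q * C" unfolding mult.assoc Q(3)[symmetric] ..
    ultimately have "C * ?Q = ?Q * C" by (simp add: distrib_left distrib_right Cp)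
    thus ?case using 1 2 by blast
  qed
  have "\<forall>v. (A ^ k) $$ p $$ v = 0 --> (\<exists>n. ((A + C) ^ n) $$ p $$ v = 0)" for k
  proof (induction k)
    case 0
    show ?case by (intro allI impI exI[of _ 0]) simp
  next
    case (Suc k)
    show ?case
    proof (intro allI impI)
      fix v assume v: "(A ^ Suc k) $$ p $$ v = 0"
      obtain l where l: "(C ^ l) $$ p $$ v = 0" using C unfolding nilS_def by blast
      obtain Q where Q: "(A + C) ^ l = A * Q + C ^ l" "A * Q = Q * A" using Q by blast
      have AQ: "A ^ n * Q = Q * A ^ n" for n by (induction n) (simp_all, metis mult.assoc Q(2))
      have 1: "((A + C) ^ l) $$ p $$ v = p $$ A $$ Q $$ p $$ v"
        using l app_eq[OF p(1), of "Q $$ p $$ v"] by (simp add: Q(1))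
      have "(A ^ k) $$ p $$ A $$ Q $$ p $$ v = (A ^ k) $$ A $$ Q $$ p $$ v"
        using app_eq[OF p(1)] by simp
      also have "\<dots> = (A ^ Suc k * Q) $$ p $$ v" by (simp add: power_Suc2 del: power_Suc)
      also have "\<dots> = 0" unfolding AQ using v by (simp add: eapp_linear)
      finally obtain n where n: "((A + C) ^ n) $$ p $$ A $$ Q $$ p $$ v = 0" using Suc by blast
      have "((A + C) ^ (n + l)) $$ p $$ v = 0" unfolding power_add clin_apps 1 by (rule n)
      thus "\<exists>n. ((A + C) ^ n) $$ p $$ v = 0" by blast
    qed
  qed
  thus ?thesis using A unfolding nilS_def by blast
qed

definition pev :: "complex fps => 'b endo => 'b endo => 'b endo" where
  "pev F p A = Endo (\<lambda>v. fev F (eapp A) (p $$ v))"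

locale nilc =
  fixes p A :: "'b endo"
  assumes p: "p * p = p" "p * A = A" "A * p = A" and nil: "nilS p A"
begin

lemma pev_app: "pev F p A $$ v = fev F (eapp A) (p $$ v)"
  unfolding pev_def
  by (subst Endo_app)
    (auto simp: clin_def eapp_linear fev_vadd[OF clin_eapp nilS_lnil[OF nil] nilS_lnil[OF nil]] fev_vscale[OF clin_eapp nilS_lnil[OF nil]])

lemma pev_stable: assumes "cv.subspace W" "\<And>w. w \<in> W ==> A $$ w \<in> W" "\<And>w. w \<in> W ==> p $$ w \<in> W" "v \<in> W"
  shows "pev F p A $$ v \<in> W"
  unfolding pev_app by (rule fev_stable) (use assms in auto)

lemma pev_corner: "p * pev F p A = pev F p A" "pev F p A * p = pev F p A"
proof -
  have "pev F p A $$ v \<in> {w. p $$ w = w}" for v unfolding pev_app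
    by (rule fev_stable) (auto simp: cv.subspace_def eapp_linear simp flip: clin_apps simp: p)
  thus "p * pev F p A = pev F p A" by (auto intro!: endo_eqI)
  show "pev F p A * p = pev F p A" by (rule endo_eqI) (use app_eq[OF p(1)] in \<open>simp add: pev_app\<close>)
qed

lemma pev_commute: assumes "Z * p = p * Z" "Z * A = A * Z" shows "Z * pev F p A = pev F p A * Z"
proof (rule endo_eqI)
  fix v
  have "fev F (eapp A) (Z $$ p $$ v) = Z $$ fev F (eapp A) (p $$ v)"
    by (rule fev_intertwine[OF clin_eapp clin_eapp clin_eapp _ nilS_lnil[OF nil]]) (use app_eq[OF assms(2)] in simp)
  thus "(Z * pev F p A) $$ v = (pev F p A * Z) $$ v" using app_eq[OF assms(1), of v] by (simp add: pev_app)
qed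

lemma pev_mult: "pev F p A * pev G p A = pev (F * G) p A"
proof (rule endo_eqI)
  fix v
  have "(pev F p A * pev G p A) $$ v = fev F (eapp A) (p $$ pev G p A $$ v)" by (simp add: pev_app)
  also have "p $$ pev G p A $$ v = fev G (eapp A) (p $$ v)" using app_eq[OF pev_corner(1), of G v] by (simp add: pev_app)
  also have "fev F (eapp A) \<dots> = fev (F * G) (eapp A) (p $$ v)" by (rule fev_fmult[OF clin_eapp nilS_lnil[OF nil]])
  finally show "(pev F p A * pev G p A) $$ v = pev (F * G) p A $$ v" by (simp add: pev_app)
qed

lemma pev_add: "pev (F + G) p A = pev F p A + pev G p A"
  by (rule endo_eqI) (simp add: pev_app fev_fadd[OF clin_eapp nilS_lnil[OF nil]])

lemma pev_const: "pev (fps_const c) p A = c *. p"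
  by (rule endo_eqI) (simp add: pev_app fev_const[OF clin_eapp nilS_lnil[OF nil]])

lemma pev_1: "pev 1 p A = p" using pev_const[of 1] by simp

lemma pev_X: "pev fps_X p A = A"
  by (rule endo_eqI) (use app_eq[OF p(3)] in \<open>simp add: pev_app fev_X[OF clin_eapp nilS_lnil[OF nil]]\<close>)

end

text \<open>The generating function of the Catalan numbers with alternating signs.\<close>

lemma catalan_fps: "\<exists>D :: complex fps. fps_X * D * D + D = 1"
proof -
  \<comment> \<open>The square root of 1 + 4X as a binomial series; the solution is (S - 1) /
    (2X).\<close>
  define S where "S = fps_compose (fps_binomial (1/2)) (fps_const 4 * fps_X :: complex fps)"
  have "S * S = fps_compose (fps_binomial (1/2) * fps_binomial (1/2)) (fps_const 4 * fps_X)"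
    unfolding S_def by (rule fps_compose_mult_distrib[symmetric]) simp
  also have "fps_binomial (1/2) * fps_binomial (1/2) = (fps_binomial 1 :: complex fps)"
    by (simp flip: fps_binomial_add_mult)
  also have "fps_binomial 1 = (1 + fps_X :: complex fps)" by (rule fps_binomial_1)
  also have "fps_compose (1 + fps_X) (fps_const 4 * fps_X) = 1 + fps_const 4 * (fps_X :: complex fps)"
    by (simp add: fps_compose_add_distrib)
  finally have S: "S * S = 1 + fps_const 4 * fps_X" .
  have S0: "fps_nth S 0 = 1" by (simp add: S_def)
  define D where "D = fps_const (1/2) * fps_shift 1 (S - 1)"
  have "fps_X * fps_shift 1 (S - 1) = S - 1"
    by (rule fps_ext) (auto simp: fps_X_mult_nth S0)
  moreover have "fps_const 2 * D = fps_shift 1 (S - 1)" unfolding D_def by (simp add: mult.assoc[symmetric])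
  ultimately have SD: "S = 1 + fps_const 2 * fps_X * D" by (metis (no_types, lifting) add_diff_cancel_left' diff_add_cancel add.commute mult.assoc mult.commute)
  have ring: "(1 + a * x * d) * (1 + a * x * d) - 1 = (a * a) * x * (x * d * d) + (a + a) * x * d" for a x d :: "complex fps"
    by (simp add: algebra_simps)
  have "S * S - 1 = (fps_const 2 * fps_const 2) * fps_X * (fps_X * D * D) + (fps_const 2 + fps_const 2) * fps_X * D"
    unfolding SD by (rule ring)
  also have "\<dots> = fps_const 4 * fps_X * (fps_X * D * D + D)"
    unfolding fps_const_mult fps_const_add by (simp add: distrib_left mult.assoc)
  finally have "fps_const 4 * fps_X * (fps_X * D * D + D) = S * S - 1" ..
  also have "\<dots> = fps_const 4 * fps_X * 1" unfolding S by simp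
  finally have "fps_X * D * D + D = 1"
    by (subst (asm) mult_cancel_left) auto
  thus ?thesis by blast
qed

definition quad :: "'b endo => 'b endo => 'b endo => 'b endo => 'b endo => bool" where
  "quad p E H F t \<longleftrightarrow> p * t = t \<and> t * p = t \<and> t * E = E * t \<and> t * H = H * t \<and> t * F = F * t \<and> E * t * t + H * t = F"

text \<open>\<open>c\<close> is the only generalised eigenvalue of \<open>H\<close> on the range of
  \<open>p\<close>; being nonzero it makes \<open>H\<close> invertible there.\<close>

locale wdata =
  fixes p E H F :: "'b endo" and c :: complex
  assumes p: "p * p = p" and corner: "p * E = E" "E * p = E" "p * H = H" "H * p = H" "p * F = F" "F * p = F"
    and comm: "E * H = H * E" "E * F = F * E" "H * F = F * H"
    and c0: "c \<noteq> 0" and nilE: "nilS p E" and nilH: "nilS p (H - c *. p)"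
begin

lemma H_inj: assumes "p $$ w = w" "H $$ w = 0" shows "w = 0"
proof -
  have "(H - c *. p) ^ k $$ w = ((- c) ^ k) *. w" for k
    by (induction k) (simp_all add: eapp_linear assms cscale_simps)
  moreover obtain k where "(H - c *. p) ^ k $$ p $$ w = 0" using nilH unfolding nilS_def by blast
  ultimately have "((- c) ^ k) *. w = 0" by (simp add: assms)
  thus ?thesis using c0 by simp
qed

text \<open>Putting t = F K V with K the inverse of H turns the equation into A E V^2 + V = p for A
  = F K^2. The Catalan series in A E solves it, as A E is locally nilpotent along with E. Built from
  series, \<open>t\<close> preserves every subspace that \<open>p\<close>, E, H and F
  preserve.\<close>

lemma quad_exists:
  "\<exists>t. quad p E H F t \<and> (\<forall>W. cv.subspace W --> (\<forall>w\<in>W. p $$ w \<in> W \<and> E $$ w \<in> W \<and> H $$ w \<in> W \<and> F $$ w \<in> W) --> (\<forall>w\<in>W. t $$ w \<in> W))"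
proof -
  interpret N: nilc p "H - c *. p"
    by unfold_locales (simp_all add: p corner nilH right_diff_distrib left_diff_distrib)
  let ?G = "inverse (fps_const c + fps_X)"
  \<comment> \<open>The series of 1 / (c + X) evaluated at the locally nilpotent operator H - c p,
    hence the inverse of \<open>H\<close> in the corner.\<close>
  define K where "K = pev ?G p (H - c *. p)"
  have "pev (fps_const c + fps_X) p (H - c *. p) = H"
    by (simp add: N.pev_add N.pev_const N.pev_X)
  hence HK: "H * K = p"
    unfolding K_def using N.pev_mult[of "fps_const c + fps_X" ?G] c0 by (simp add: inverse_mult_eq_1' N.pev_1)
  have Kc: "Z * K = K * Z" if "Z * p = p * Z" "Z * H = H * Z" for Z
    unfolding K_def by (rule N.pev_commute) (use that in \<open>simp_all add: right_diff_distrib left_diff_distrib\<close>)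
  have Kp: "p * K = K" "K * p = K" unfolding K_def by (rule N.pev_corner)+
  have cK: "E * K = K * E" "F * K = K * F" "H * K = K * H" by (rule Kc; simp add: corner comm)+
  define A where "A = F * K * K"
  have EA: "E * A = A * E" unfolding A_def by (metis (no_types, lifting) cK(1) comm(2) mult.assoc)
  have pA: "p * A = A" "A * p = A" unfolding A_def
    by (simp_all add: mult.assoc[symmetric] corner) (simp add: mult.assoc Kp)
  interpret M: nilc p "A * E"
  proof
    show "nilS p (A * E)" by (rule nilS_mult[OF nilE EA])
  qed (simp_all add: p mult.assoc[symmetric] pA, simp add: mult.assoc corner)
  obtain D :: "complex fps" where D: "fps_X * D * D + D = 1" using catalan_fps by blast
  define V where "V = pev D p (A * E)"
  have "pev (fps_X * D * D + D) p (A * E) = A * E * V * V + V"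
    unfolding V_def M.pev_add M.pev_mult[symmetric] M.pev_X ..
  hence V: "A * E * V * V + V = p" unfolding D M.pev_1 by simp
  have Vp: "p * V = V" "V * p = V" unfolding V_def by (rule M.pev_corner)+
  have Vc: "Z * V = V * Z" if "Z * p = p * Z" "Z * A = A * Z" "Z * E = E * Z" for Z
    unfolding V_def by (rule M.pev_commute[OF that(1)]) (metis mult.assoc that(2,3))
  have HA: "H * A = A * H" unfolding A_def by (metis (no_types, lifting) cK(3) comm(3) mult.assoc)
  have FA: "F * A = A * F" unfolding A_def by (metis (no_types, lifting) cK(2) mult.assoc)
  have KA: "K * A = A * K" unfolding A_def by (metis (no_types, lifting) cK(2) mult.assoc)
  have cV: "E * V = V * E" "F * V = V * F" "H * V = V * H" "K * V = V * K"
    by (rule Vc; simp add: corner comm Kp EA HA FA KA cK)+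
  define t where "t = F * K * V"
  have tE: "t * Z = Z * t" if "Z * F = F * Z" "Z * K = K * Z" "Z * V = V * Z" for Z
    unfolding t_def mult.assoc that(3)[symmetric] unfolding mult.assoc[symmetric]
    unfolding mult.assoc[of F K Z] that(2)[symmetric] mult.assoc[symmetric] that(1) ..
  have q: "quad p E H F t" unfolding quad_def
  proof (intro conjI)
    show "p * t = t" unfolding t_def by (simp add: mult.assoc[symmetric] corner)
    show "t * p = t" unfolding t_def by (simp add: mult.assoc Vp)
    show "t * E = E * t" "t * H = H * t" "t * F = F * t"
      by (rule tE; simp add: comm cK cV)+
    have "H * t = F * V"
    proof -
      have "H * t = F * (H * K) * V" unfolding t_def by (simp only: mult.assoc[symmetric] comm(3))
      thus ?thesis by (simp add: HK corner)
    qed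
    moreover have "E * t * t = F * (A * E * V * V)"
    proof -
      have "E * t * t = E * (F * (K * V)) * (F * (K * V))" unfolding t_def by (simp only: mult.assoc)
      also have "\<dots> = E * F * ((K * V) * F) * (K * V)" by (simp only: mult.assoc)
      also have "(K * V) * F = F * (K * V)" by (metis mult.assoc cK(2) cV(2))
      also have "E * F * (F * (K * V)) * (K * V) = F * (E * F * (K * (V * K)) * V)"
        by (metis comm(2) mult.assoc)
      also have "V * K = K * V" by (rule cV(4)[symmetric])
      also have "F * (E * F * (K * (K * V)) * V) = F * (E * A * V * V)" unfolding A_def by (simp only: mult.assoc)
      finally show ?thesis unfolding EA .
    qed
    ultimately have "E * t * t + H * t = F * (A * E * V * V + V)" by (simp add: distrib_left)
    thus "E * t * t + H * t = F" unfolding V by (simp add: corner)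
  qed
  have "t $$ w \<in> W" if W: "cv.subspace W" "\<And>w. w \<in> W ==> p $$ w \<in> W \<and> E $$ w \<in> W \<and> H $$ w \<in> W \<and> F $$ w \<in> W" "w \<in> W" for W w
  proof -
    have d: "(H - c *. p) $$ w \<in> W" if "w \<in> W" for w
      using W(2)[OF that] by (simp add: cv.subspace_diff cv.subspace_scale W(1))
    have K: "K $$ w \<in> W" if "w \<in> W" for w unfolding K_def
      by (rule N.pev_stable[OF W(1) d]) (use W(2) that in auto)
    have A: "A $$ w \<in> W" if "w \<in> W" for w unfolding A_def using K W(2) that by simp
    have V: "V $$ w \<in> W" if "w \<in> W" for w unfolding V_def
      by (rule M.pev_stable[OF W(1)]) (use W(2) A that in auto)
    show ?thesis unfolding t_def using W(2) K V \<open>w \<in> W\<close> by simp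
  qed
  with q show ?thesis by blast
qed

end

text \<open>Uniqueness (for Z = p) and naturality at once. The defect D = Z t - t' Z satisfies a
  linear relation. On a vector v with E^(k+1) v = 0, induction gives D E v = 0 and D t E v = 0, so
  the relation reduces to H' D v = 0, and H' is injective.\<close>

lemma quad_intertwine:
  assumes "wdata p E H F c" "wdata p' E' H' F' c'" "quad p E H F t" "quad p' E' H' F' t'"
    and Z: "p' * Z = Z" "Z * p = Z" "Z * E = E' * Z" "Z * H = H' * Z" "Z * F = F' * Z"
  shows "Z * t = t' * Z"
proof -
  interpret A: wdata p E H F c by fact
  interpret B: wdata p' E' H' F' c' by fact
  have t: "p * t = t" "t * p = t" "t * E = E * t" "t * H = H * t" "E * t * t + H * t = F"
    and t': "p' * t' = t'" "t' * p' = t'" "t' * E' = E' * t'" "t' * H' = H' * t'" "E' * t' * t' + H' * t' = F'"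
    using assms(3,4) by (simp_all add: quad_def)
  define D where "D = Z * t - t' * Z"
  have DE: "D * E = E' * D"
  proof -
    have "Z * t * E = E' * (Z * t)" unfolding mult.assoc t(3) unfolding mult.assoc[symmetric] Z(3) ..
    moreover have "t' * Z * E = E' * (t' * Z)" unfolding mult.assoc Z(3) unfolding mult.assoc[symmetric] t'(3) ..
    ultimately show ?thesis by (simp add: D_def left_diff_distrib right_diff_distrib)
  qed
  have pD: "p' * D = D" "D * p = D" unfolding D_def right_diff_distrib left_diff_distrib
    by (simp_all add: mult.assoc[symmetric] Z t') (simp add: mult.assoc Z t)
  have eq: "E' * (D * t + t' * D) + H' * D = 0"
  proof -
    have "E' * (Z * t * t) + H' * (Z * t) = Z * (E * t * t + H * t)"
      unfolding distrib_left mult.assoc[symmetric] Z(3,4) ..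
    also have "\<dots> = (E' * t' * t' + H' * t') * Z" unfolding t(5) t'(5) Z(5) ..
    finally have e0: "E' * (Z * t * t) + H' * (Z * t) = (E' * t' * t' + H' * t') * Z" .
    have "E' * (Z * t * t - t' * t' * Z) + H' * D = 0"
    proof -
      have r: "a - b + (c - d) = 0" if "a + c = b + d" for a b c d :: "'a endo"
        using that by (simp add: algebra_simps)
      show ?thesis unfolding D_def right_diff_distrib
        by (rule r) (use e0 in \<open>simp add: distrib_right mult.assoc\<close>)
    qed
    moreover have "Z * t * t - t' * t' * Z = D * t + t' * D" unfolding D_def by (simp add: left_diff_distrib right_diff_distrib mult.assoc)
    ultimately show ?thesis by simp
  qed
  have "\<forall>v. p $$ v = v --> (E ^ k) $$ v = 0 --> D $$ v = 0" for k
  proof (induction k)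
    case (Suc k)
    show ?case
    proof (intro allI impI)
      fix v assume v: "p $$ v = v" "(E ^ Suc k) $$ v = 0"
      have Ev: "p $$ E $$ v = E $$ v" using app_eq[OF A.corner(1), of v] by simp
      have EkE: "(E ^ k) $$ E $$ v = 0" using v(2) by (simp add: power_Suc2 del: power_Suc)
      hence 1: "D $$ E $$ v = 0" using Suc Ev by blast
      have tEk: "(E ^ k) * t = t * E ^ k" by (induction k) (simp_all, metis mult.assoc t(3))
      have "p $$ t $$ E $$ v = t $$ E $$ v" using app_eq[OF t(1)] by simp
      moreover have "(E ^ k) $$ t $$ E $$ v = 0" using app_eq[OF tEk, of "E $$ v"] EkE by (simp add: eapp_linear)
      ultimately have 2: "D $$ t $$ E $$ v = 0" using Suc by blast
      have "(E' * (D * t)) $$ v = D $$ t $$ E $$ v"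
        using app_eq[OF DE, of "t $$ v"] app_eq[OF t(3), of v] by simp
      moreover have "(E' * (t' * D)) $$ v = t' $$ D $$ E $$ v"
        using app_eq[OF DE, of v] app_eq[OF t'(3), of "D $$ v"] by simp
      ultimately have "H' $$ D $$ v = 0" using app_eq[OF eq, of v] 1 2 by (simp add: distrib_left eapp_linear)
      thus "D $$ v = 0" using B.H_inj app_eq[OF pD(1), of v] by simp
    qed
  qed (simp add: eapp_linear)
  moreover have "\<exists>k. (E ^ k) $$ p $$ v = 0" for v using A.nilE by (simp add: nilS_def)
  moreover have "p $$ p $$ v = p $$ v" for v using app_eq[OF A.p, of v] by simp
  ultimately have "D $$ p $$ v = 0" for v by blast
  hence "D = 0" using app_eq[OF pD(2)] by (intro endo_eqI) simp
  thus ?thesis by (simp add: D_def)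
qed

definition qroot :: "'b endo => 'b endo => 'b endo => 'b endo => 'b endo" where
  "qroot p E H F = (SOME t. quad p E H F t \<and> (\<forall>W. cv.subspace W --> (\<forall>w\<in>W. p $$ w \<in> W \<and> E $$ w \<in> W \<and> H $$ w \<in> W \<and> F $$ w \<in> W) --> (\<forall>w\<in>W. t $$ w \<in> W)))"

context wdata begin

lemma qroot: "quad p E H F (qroot p E H F)"
  and qroot_stable: "cv.subspace W ==> (\<And>w. w \<in> W ==> p $$ w \<in> W \<and> E $$ w \<in> W \<and> H $$ w \<in> W \<and> F $$ w \<in> W) ==> w \<in> W ==> qroot p E H F $$ w \<in> W"
  using someI_ex[OF quad_exists, folded qroot_def] by blast+

text \<open>On vectors killed by E the operator is H, which is injective. Since E commutes with the
  operator, induction on the order of nilpotency of E reduces to this case.\<close>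

lemma EH_inj:
  assumes A: "A * E = E * A" "p * A = A" and w: "p $$ w = w" "(H + A * E) $$ w = 0" shows "w = 0"
proof -
  have "\<forall>w. p $$ w = w --> (H + A * E) $$ w = 0 --> (E ^ k) $$ w = 0 --> w = 0" for k
  proof (induction k)
    case (Suc k)
    show ?case
    proof (intro allI impI)
      fix w assume w: "p $$ w = w" "(H + A * E) $$ w = 0" "(E ^ Suc k) $$ w = 0"
      have "(H + A * E) $$ E $$ w = E $$ (H + A * E) $$ w"
        using app_eq[OF comm(1), of w] app_eq[OF A(1), of "E $$ w"] by (simp add: eapp_linear)
      hence "(H + A * E) $$ E $$ w = 0" unfolding w(2) by (simp only: eapp_linear)
      moreover have "p $$ E $$ w = E $$ w" using app_eq[OF corner(1), of w] by simp
      moreover have "(E ^ k) $$ E $$ w = 0" using w(3) by (simp add: power_Suc2 del: power_Suc)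
      ultimately have "E $$ w = 0" using Suc by blast
      hence "H $$ w = 0" using w(2) by (simp add: eapp_linear)
      thus "w = 0" using H_inj w(1) by blast
    qed
  qed (simp add: eapp_linear)
  moreover obtain k where "(E ^ k) $$ p $$ w = 0" using nilE by (auto simp: nilS_def)
  ultimately show ?thesis using w by simp
qed

lemma EH_cancel:
  assumes "A * E = E * A" "p * A = A" and D: "p * D = D" "(H + A * E) * D = 0" shows "D = 0"
proof (rule endo_eqI)
  fix v
  have "D $$ v = 0" by (rule EH_inj[OF assms(1,2)]) (use app_eq[OF D(1), of v] app_eq[OF D(2), of v] in simp_all)
  thus "D $$ v = 0 $$ v" by simp
qed

end

section \<open>Fourier transforms of representations of the Takiff algebra\<close>

lemma ad_eq_0: "ad x y = 0 \<longleftrightarrow> x * y = y * (x::'a::calg)" by (simp add: ad_def)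

lemma ad_1: "ad x (p::'a::calg) = 0" if "x * p = x" "p * x = x" using that by (simp add: ad_def)

text \<open>Applied below to the operators preserving a subspace and to those lowering a filtration;
  like \<open>fev_stable\<close> it rests on infinite sums being 0.\<close>

lemma fourier_stable:
  assumes J: "cv.subspace J" "\<And>y. y \<in> J ==> ad (e * e) y \<in> J" "\<And>y. y \<in> J ==> ad (t * t) y \<in> J" and "y \<in> J"
  shows "fourier s e t y \<in> J"
proof -
  have E: "EXP (c *. z) w \<in> J" if "w \<in> J" "\<And>y. y \<in> J ==> ad z y \<in> J" for c z w unfolding EXP_def
    by (rule fev_stable[OF J(1)]) (use that in \<open>auto simp: ad_cscale intro: cv.subspace_scale[OF J(1)]\<close>)
  show ?thesis unfolding fourier_def by (intro E J assms(4))
qed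

lemma endo_stable_subspace: "cv.subspace W ==> cv.subspace {y. \<forall>w\<in>W. y $$ w \<in> W}"
  by (intro cv.subspaceI) (auto intro: cv.subspace_add cv.subspace_scale cv.subspace_0)

lemma fourier_endo_stable:
  assumes W: "cv.subspace W" "\<And>w. w \<in> W ==> e $$ w \<in> W" "\<And>w. w \<in> W ==> t $$ w \<in> W" "\<And>w. w \<in> W ==> y $$ w \<in> W" and w: "w \<in> W"
  shows "fourier s e t y $$ w \<in> W"
proof -
  have "fourier s e t y \<in> {y. \<forall>w\<in>W. y $$ w \<in> W}"
    by (rule fourier_stable[OF endo_stable_subspace[OF W(1)]]) (use W in \<open>auto simp: ad_def intro!: cv.subspace_diff\<close>)
  thus ?thesis using w by blast
qed

lemma endo_span: assumes "cv.subspace W" "\<And>s. s \<in> T ==> x $$ s \<in> W" "w \<in> cv.span T" shows "x $$ w \<in> W"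
proof -
  have "cv.subspace {w. x $$ w \<in> W}"
    by (rule cv.subspaceI) (auto simp: eapp_linear cv.subspace_0[OF assms(1)] cv.subspace_add[OF assms(1)] cv.subspace_scale[OF assms(1)])
  hence "cv.span T \<subseteq> {w. x $$ w \<in> W}" by (rule cv.span_minimal[rotated]) (use assms(2) in blast)
  thus ?thesis using assms(3) by blast
qed

lemma image_subspace: "cv.subspace ((\<lambda>v. x $$ v) ` cv.span S)"
proof (rule cv.subspaceI)
  show "0 \<in> (\<lambda>v. x $$ v) ` cv.span S" by (intro image_eqI[of _ _ 0]) (simp_all add: eapp_linear cv.span_zero)
  show "u + w \<in> (\<lambda>v. x $$ v) ` cv.span S" if "u \<in> (\<lambda>v. x $$ v) ` cv.span S" "w \<in> (\<lambda>v. x $$ v) ` cv.span S" for u w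
    using that by (auto simp: cv.span_add simp flip: eapp_linear(1))
  show "c *. u \<in> (\<lambda>v. x $$ v) ` cv.span S" if "u \<in> (\<lambda>v. x $$ v) ` cv.span S" for c u
    using that by (auto simp: cv.span_scale simp flip: eapp_linear(2))
qed

text \<open>The Fock representation: where a is locally nilpotent, b a is diagonalisable with
  natural numbers as eigenvalues. As a and b have opposite weights, b a commutes with
  \<open>h\<close>, and the decomposition stays within one weight.\<close>

lemma weyl_eigen:
  fixes a b p :: "'b endo"
  assumes ab: "a * b - b * a = p" and corner: "p * a = a" "a * p = a" "p * b = b" "b * p = b"
    and Ua: "\<And>x. x \<in> h ==> ad (A x) a = \<beta> x *. a" and Ub: "\<And>x. x \<in> h ==> ad (A x) b = - (\<beta> x *. b)"
  shows "p $$ v = v ==> (\<And>x. x \<in> h ==> A x $$ v = l x *. v) ==> (a ^ k) $$ v = 0 ==>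
    v \<in> cv.span {w. p $$ w = w \<and> (\<forall>x\<in>h. A x $$ w = l x *. w) \<and> (\<exists>n::nat. (b * a) $$ w = of_nat n *. w)}"
proof (induction k arbitrary: v l)
  case 0
  thus ?case by (simp add: cv.span_zero)
next
  case (Suc k)
  let ?E = "\<lambda>l. {w. p $$ w = w \<and> (\<forall>x\<in>h. A x $$ w = l x *. w) \<and> (\<exists>n::nat. (b * a) $$ w = of_nat n *. w)}"
  have ua: "A x $$ a $$ w = a $$ A x $$ w + \<beta> x *. (a $$ w)" and ub: "A x $$ b $$ w = b $$ A x $$ w - \<beta> x *. (b $$ w)"
    if "x \<in> h" for x w
    using app_eq[OF Ua[OF that], of w] app_eq[OF Ub[OF that], of w] by (simp_all add: ad_def algebra_simps)
  have ab': "a $$ b $$ w = b $$ a $$ w + p $$ w" for w using app_eq[OF ab, of w] by (simp add: algebra_simps)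
  let ?l = "\<lambda>x. l x + \<beta> x"
  have "p $$ a $$ v = a $$ v" using app_eq[OF corner(1)] by simp
  moreover have "A x $$ a $$ v = ?l x *. (a $$ v)" if "x \<in> h" for x
    by (simp add: ua that Suc.prems(2) eapp_linear cscale_simps)
  moreover have "(a ^ k) $$ a $$ v = 0" using Suc.prems(3) by (simp add: power_Suc2 del: power_Suc)
  ultimately have av: "a $$ v \<in> cv.span (?E ?l)" by (rule Suc.IH)
  have im: "cv.subspace ((\<lambda>v. (b * a) $$ v) ` cv.span (?E l))" by (rule image_subspace)
  have "b $$ a $$ v \<in> (\<lambda>v. (b * a) $$ v) ` cv.span (?E l)"
  proof (rule endo_span[OF im _ av])
    fix w assume "w \<in> ?E ?l"
    then obtain n :: nat where w: "p $$ w = w" "\<And>x. x \<in> h ==> A x $$ w = ?l x *. w" "b $$ a $$ w = of_nat n *. w" by auto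
    \<comment> \<open>Applying \<open>b\<close> raises the eigenvalue to n + 1, which is invertible;
      so b w lies in the image of b a on the span.\<close>
    have e: "(b * a) $$ b $$ w = of_nat (Suc n) *. (b $$ w)"
      using w(1,3) by (simp add: ab' eapp_linear cscale_simps add.commute)
    have "b $$ w \<in> ?E l"
    proof (intro CollectI conjI ballI)
      show "p $$ b $$ w = b $$ w" using app_eq[OF corner(3)] by simp
      show "A x $$ b $$ w = l x *. (b $$ w)" if "x \<in> h" for x
        by (simp add: ub that w(2) eapp_linear cscale_simps)
      show "\<exists>n::nat. (b * a) $$ b $$ w = of_nat n *. (b $$ w)" using e by blast
    qed
    thus "b $$ w \<in> (\<lambda>v. (b * a) $$ v) ` cv.span (?E l)"
      using e by (intro image_eqI[of _ _ "(1 / of_nat (Suc n)) *. (b $$ w)"])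
        (simp_all add: eapp_linear cscale_simps cv.span_scale cv.span_base field_simps del: of_nat_Suc)
  qed
  then obtain v' where v': "v' \<in> cv.span (?E l)" "(b * a) $$ v' = b $$ a $$ v" by force
  let ?D = "{w. p $$ w = w \<and> (\<forall>x\<in>h. A x $$ w = l x *. w)}"
  have sub: "cv.subspace ?D"
    by (rule cv.subspaceI) (auto simp: eapp_linear cscale_simps mult.commute)
  have "cv.span (?E l) \<subseteq> ?D"
    by (rule cv.span_minimal[OF _ sub]) auto
  hence "v' \<in> ?D" using v'(1) by blast
  moreover have "v \<in> ?D" using Suc.prems by blast
  ultimately have "v - v' \<in> ?D" using cv.subspace_diff[OF sub] by blast
  \<comment> \<open>The remaining difference is an eigenvector for 0.\<close>
  moreover have "(b * a) $$ (v - v') = of_nat 0 *. (v - v')" using v'(2) by (simp add: eapp_linear)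
  ultimately have "v - v' \<in> ?E l" by blast
  hence "(v - v') + v' \<in> cv.span (?E l)" by (intro cv.span_add v'(1) cv.span_base)
  thus ?case by simp
qed

type_synonym ('n, 'b) ops = "'n mx => 'b endo"

section \<open>Representations of the Takiff algebra as pairs of operator families\<close>

context root_setup begin

text \<open>\<open>A a\<close> and \<open>B a\<close> are the actions of \<open>a \<otimes> 1\<close> and \<open>a \<otimes> \<epsilon>\<close>. The conditions collected in \<open>base\<close> below
  survive the Fourier transform; for category \<open>O\<close> one adds that \<open>A e\<close> is locally nilpotent.\<close>

definition irep :: "'b endo => ('n, 'b) ops => ('n, 'b) ops => bool" where
  "irep p A B \<longleftrightarrow> p * p = p \<and> (\<forall>a\<in>g. p * A a = A a \<and> A a * p = A a \<and> p * B a = B a \<and> B a * p = B a)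
    \<and> (\<forall>a\<in>g. \<forall>b\<in>g. A (a + b) = A a + A b \<and> B (a + b) = B a + B b
        \<and> A (ad a b) = ad (A a) (A b) \<and> B (ad a b) = ad (A a) (B b) \<and> ad (B a) (B b) = 0)
    \<and> (\<forall>c. \<forall>a\<in>g. A (c *. a) = c *. A a \<and> B (c *. a) = c *. B a)"

lemma irepD:
  assumes "irep p A B"
  shows "p * p = p" "a \<in> g ==> p * A a = A a" "a \<in> g ==> A a * p = A a" "a \<in> g ==> p * B a = B a" "a \<in> g ==> B a * p = B a"
    "a \<in> g ==> b \<in> g ==> A (a + b) = A a + A b" "a \<in> g ==> b \<in> g ==> B (a + b) = B a + B b"
    "a \<in> g ==> A (d *. a) = d *. A a" "a \<in> g ==> B (d *. a) = d *. B a"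
    "a \<in> g ==> b \<in> g ==> A (ad a b) = ad (A a) (A b)" "a \<in> g ==> b \<in> g ==> B (ad a b) = ad (A a) (B b)"
    "a \<in> g ==> b \<in> g ==> ad (B a) (B b) = 0" "a \<in> g ==> b \<in> g ==> ad (B a) (A b) = B (ad a b)" "A 0 = 0" "B 0 = 0"
proof -
  note i = assms[unfolded irep_def]
  show 1: "p * p = p" "a \<in> g ==> p * A a = A a" "a \<in> g ==> A a * p = A a" "a \<in> g ==> p * B a = B a" "a \<in> g ==> B a * p = B a"
    "a \<in> g ==> b \<in> g ==> A (a + b) = A a + A b" "a \<in> g ==> b \<in> g ==> B (a + b) = B a + B b"
    "a \<in> g ==> b \<in> g ==> A (ad a b) = ad (A a) (A b)" "a \<in> g ==> b \<in> g ==> ad (B a) (B b) = 0" using i by simp_all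
  have s: "a \<in> g ==> A (d *. a) = d *. A a" "a \<in> g ==> B (d *. a) = d *. B a" for a d using i by simp_all
  thus "a \<in> g ==> A (d *. a) = d *. A a" "a \<in> g ==> B (d *. a) = d *. B a" by simp_all
  show "A 0 = 0" "B 0 = 0" using s[OF e_g, of 0] by simp_all
  have b: "a \<in> g ==> b \<in> g ==> B (ad a b) = ad (A a) (B b)" for a b using i by simp
  thus "a \<in> g ==> b \<in> g ==> B (ad a b) = ad (A a) (B b)" by simp
  show "ad (B a) (A b) = B (ad a b)" if "a \<in> g" "b \<in> g"
  proof -
    have "B (ad a b) = B ((-1) *. ad b a)" using ad_skew[of a b] by simp
    also have "\<dots> = - ad (A b) (B a)" using s(2)[OF g_ad[OF that(2,1)], of "-1"] b[OF that(2,1)] by simp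
    finally show ?thesis unfolding ad_skew[of "B a" "A b"] by simp
  qed
qed

definition wspan :: "'b endo => ('n, 'b) ops => 'b free set" where
  "wspan p A = cv.span {v. p $$ v = v \<and> (\<exists>l. \<forall>x\<in>h. A x $$ v = l x *. v)}"

definition fgen :: "'b endo => ('n, 'b) ops => ('n, 'b) ops => bool" where
  "fgen p A B \<longleftrightarrow> (\<exists>S. finite S \<and> (\<forall>s\<in>S. p $$ s = s) \<and> (\<forall>W. cv.subspace W --> S \<subseteq> W --> (\<forall>w\<in>W. p $$ w = w) -->
      (\<forall>a\<in>g. \<forall>w\<in>W. A a $$ w \<in> W \<and> B a $$ w \<in> W) --> (\<forall>v. p $$ v \<in> W)))"

text \<open>Local finiteness over the nilradical appears as nilpotency over \<open>n'\<close>
  together with local nilpotency of \<open>B e\<close>. Once \<open>A e\<close> is locally nilpotent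
  too, \<open>lfin_nil\<close> and \<open>nil_lfin\<close> show the equivalence.\<close>

definition base :: "('n mx => complex) => 'b endo => ('n, 'b) ops => ('n, 'b) ops => bool" where
  "base \<nu> p A B \<longleftrightarrow> irep p A B \<and> (\<forall>v. p $$ v \<in> wspan p A) \<and> fgen p A B
    \<and> (\<forall>v. \<exists>k. p $$ v \<in> wk eapp (A ` n' \<union> B ` n') k) \<and> nilS p (B e) \<and> (\<forall>x\<in>h. nilS p (B x - \<nu> x *. p))"

definition wroot :: "'b endo => ('n, 'b) ops => 'b endo" where
  "wroot p B = qroot p (B e) (B (ad e f)) (B f)"

end

section \<open>The Weyl pair inside a representation\<close>

locale takiff_rep = root_setup g h n' \<alpha> e f \<rho>
  for g h n' :: "'n::finite mx set" and \<alpha> :: "'n mx => complex" and e f \<rho> :: "'n mx" +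
  fixes \<nu> :: "'n mx => complex" and p :: "'b endo" and A B :: "('n, 'b) ops"
  assumes base: "base \<nu> p A B" and \<nu>H: "\<nu> (ad e f) \<noteq> 0"
begin

abbreviation "H \<equiv> ad e f"
abbreviation "t \<equiv> wroot p B"

lemma mem_g: "e \<in> g" "f \<in> g" "H \<in> g" "x \<in> h ==> x \<in> g" "y \<in> n' ==> y \<in> g"
  using e_g f_g g_ad h_g n'_g by auto

lemma irep: "irep p A B" using base by (simp add: base_def)

lemmas pp = irepD(1)[OF irep] and corner = irepD(2-5)[OF irep] and U_add = irepD(6)[OF irep] and B_add = irepD(7)[OF irep]
  and U_scale = irepD(8)[OF irep] and B_scale = irepD(9)[OF irep] and U_ad = irepD(10)[OF irep] and B_ad = irepD(11)[OF irep]
  and BB = irepD(12)[OF irep] and BU = irepD(13)[OF irep] and U_0 = irepD(14,15)[OF irep]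

lemma nilBe: "nilS p (B e)" and nilBh: "x \<in> h ==> nilS p (B x - \<nu> x *. p)" using base by (simp_all add: base_def)

sublocale W: wdata p "B e" "B H" "B f" "\<nu> H"
  by unfold_locales (use nilBe nilBh[OF H_h] \<nu>H BB mem_g in \<open>auto simp: pp corner ad_eq_0[symmetric]\<close>)

lemma quad: "quad p (B e) (B H) (B f) t" unfolding wroot_def by (rule W.qroot)

lemma t_corner: "p * t = t" "t * p = t" and t_eq: "B e * t * t + B H * t = B f" using quad by (simp_all add: quad_def)

lemma t_commute:
  assumes "p * Z = Z" "Z * p = Z" "ad (B e) Z = 0" "ad (B H) Z = 0" "ad (B f) Z = 0" shows "ad t Z = 0"
  using quad_intertwine[OF W.wdata_axioms W.wdata_axioms quad quad, of Z] assms by (simp add: ad_eq_0)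

lemma t_B: "a \<in> g ==> ad t (B a) = 0"
  by (rule t_commute) (auto simp: corner BB mem_g)

lemma B_t: "a \<in> g ==> ad (B a) t = 0" using t_B ad_skew[of "B a" t] by simp

lemma der:
  assumes a: "a \<in> g"
  shows der_B: "b \<in> g ==> ad (B b) (ad (A a) t) = 0" and der_t: "ad t (ad (A a) t) = 0"
    and der_corner: "p * ad (A a) t = ad (A a) t" "ad (A a) t * p = ad (A a) t"
proof -
  have B: "ad (B b) (ad (A a) t) = 0" if b: "b \<in> g" for b
  proof -
    show ?thesis unfolding ad_jacobi[of "B b"] BU[OF b a] B_t[OF b] B_t[OF g_ad[OF b a]] by simp
  qed
  thus "b \<in> g ==> ad (B b) (ad (A a) t) = 0" .
  show c: "p * ad (A a) t = ad (A a) t" "ad (A a) t * p = ad (A a) t"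
    unfolding ad_def right_diff_distrib left_diff_distrib
    by (simp_all add: mult.assoc[symmetric] t_corner corner a) (simp add: mult.assoc t_corner corner a)
  show "ad t (ad (A a) t) = 0" by (rule t_commute[OF c]) (simp_all add: B mem_g)
qed

text \<open>The quadratic equation differentiated along \<open>ad (A a)\<close>. The unknown
  derivative of \<open>t\<close> appears linearly, multiplied by the derivative H + 2 t E of the
  quadratic polynomial.\<close>

lemma quad_der:
  assumes a: "a \<in> g"
  shows "(B H + (2 *. t) * B e) * ad (A a) t = B (ad a f) - B (ad a H) * t - B (ad a e) * t * t"
proof -
  let ?d = "ad (A a) t"
  have c: "t * ?d = ?d * t" "B e * t = t * B e" using der_t[OF a] t_B[OF e_g] by (simp_all add: ad_eq_0)
  have d: "z + z = 2 *. z" for z :: "'b endo" using cscale_add_left[of 1 1 z] by simp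
  have "B (ad a f) = ad (A a) (B e * t * t + B H * t)" unfolding t_eq by (rule B_ad[OF a f_g])
  also have "\<dots> = B (ad a e) * t * t + (B e * ?d * t + B e * t * ?d) + (B (ad a H) * t + B H * ?d)"
    by (simp add: ad_add ad_mult B_ad a mem_g distrib_right distrib_left mult.assoc add.assoc)
  also have "B e * ?d * t + B e * t * ?d = (2 *. t) * B e * ?d"
  proof -
    have "B e * ?d * t = B e * t * ?d" by (simp only: mult.assoc c(1))
    thus ?thesis by (simp add: d c(2))
  qed
  finally show ?thesis by (simp add: distrib_right algebra_simps)
qed

lemma cancel: assumes "p * D = D" "(B H + (2 *. t) * B e) * D = 0" shows "D = 0"
  by (rule W.EH_cancel[OF _ _ assms]) (use t_B[OF e_g] in \<open>simp_all add: ad_eq_0 t_corner\<close>)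

text \<open>For a = e the right-hand side of the differentiated equation is again H + 2 t E, which
  cancels by injectivity.\<close>

lemma ad_Ue_t: "ad (A e) t = p"
proof -
  have "ad e H = - (2 *. e)" unfolding ad_skew[of e H] using h_e[OF H_h] \<alpha>_H by simp
  hence "B (ad e H) = - (2 *. B e)" using B_scale[OF e_g, of "-2"] by simp
  hence "(B H + (2 *. t) * B e) * ad (A e) t = B H + 2 *. (B e * t)" unfolding quad_der[OF e_g] by (simp add: U_0)
  also have "\<dots> = (B H + (2 *. t) * B e) * p" using t_B[OF e_g] by (simp add: distrib_right mult.assoc corner t_corner mem_g ad_eq_0)
  finally have "(B H + (2 *. t) * B e) * (ad (A e) t - p) = 0" by (simp add: right_diff_distrib)
  hence "ad (A e) t - p = 0" by (rule cancel[rotated]) (simp add: right_diff_distrib der_corner e_g pp)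
  thus ?thesis by simp
qed

lemma ad_Uh_t: assumes x: "x \<in> h" shows "ad (A x) t = - (\<alpha> x *. t)"
proof -
  have "B (ad x H) = 0" using h_ad[OF x H_h] U_0 by simp
  moreover have "B (ad x e) = \<alpha> x *. B e" "B (ad x f) = - (\<alpha> x *. B f)"
    using h_e[OF x] h_f[OF x] B_scale[OF e_g] B_scale[OF f_g, of "- \<alpha> x"] by simp_all
  ultimately have "(B H + (2 *. t) * B e) * ad (A x) t = - (\<alpha> x *. B f) - \<alpha> x *. (B e * t * t)"
    unfolding quad_der[OF mem_g(4)[OF x]] by simp
  also have "\<dots> = - (\<alpha> x *. (B H * t + 2 *. (B e * t * t)))"
    unfolding t_eq[symmetric] 
    using cscale_add_left[of 1 1 "B e * t * t"] by (simp add: cscale_add_right)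
  also have "B H * t + 2 *. (B e * t * t) = (B H + (2 *. t) * B e) * t"
    using t_B[OF e_g] by (simp add: distrib_right ad_eq_0)
  finally have "(B H + (2 *. t) * B e) * (ad (A x) t + \<alpha> x *. t) = 0" by (simp add: distrib_left del: distrib_right)
  hence "ad (A x) t + \<alpha> x *. t = 0" by (rule cancel[rotated]) (simp add: distrib_left der_corner mem_g x t_corner)
  thus ?thesis by (simp add: eq_neg_iff_add_eq_0)
qed

sublocale P: weyl_pair "A e" t p
  by unfold_locales (use ad_Ue_t in \<open>simp_all add: ad_def corner t_corner mem_g\<close>)

text \<open>\<open>ad (A e)\<close> is nilpotent on these operators because e is a nilpotent matrix.
  \<open>ad t\<close> kills every B a and kills A a after two applications, since the derivative of
  t under A a commutes with t.\<close>

lemma nilp: assumes a: "a \<in> g" shows U_nilp: "A a \<in> nilp_alg (A e) t" and B_nilp: "B a \<in> nilp_alg (A e) t"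
proof -
  have g: "(ad e ^^ k) a \<in> g" for k by (induction k) (auto simp: a g_ad e_g)
  have p: "(ad (A e) ^^ k) (A a) = A ((ad e ^^ k) a)" "(ad (A e) ^^ k) (B a) = B ((ad e ^^ k) a)" for k
    by (induction k) (simp_all add: U_ad B_ad e_g g)
  obtain m where "e ^ m = 0" using e_nilp by blast
  hence z: "(ad e ^^ (2 * m)) a = 0" by (rule ad_nilpotent)
  have 1: "adn (A e) (A a)" "adn (A e) (B a)"
    by (rule adnI[where n = "2 * m"]; simp only: p z U_0)+
  have "(ad t ^^ 2) (A a) = 0" using der_t[OF a] ad_skew[of t "A a"] by (simp add: numeral_2_eq_2 ad_minus)
  moreover have "(ad t ^^ 1) (B a) = 0" using t_B[OF a] by simp
  ultimately have 2: "adn t (A a)" "adn t (B a)" by (blast intro: adnI)+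
  show "A a \<in> nilp_alg (A e) t" "B a \<in> nilp_alg (A e) t" using 1 2 by (simp_all add: nilp_alg_def)
qed

end

lemma nilS_scale: "nilS p Z ==> nilS p (c *. Z)"
  using nilS_mult[of p Z "c *. 1"] by simp

lemma fourier_intertwine:
  assumes "weyl_pair e t p" "weyl_pair e' t' p'" "Z * e = e' * Z" "Z * t = t' * Z" "Z * y = y' * Z"
    "y \<in> nilp_alg e t" "y' \<in> nilp_alg e' t'"
  shows "Z * fourier s e t y = fourier s e' t' y' * Z"
proof -
  interpret P: weyl_pair e t p by fact
  interpret Q: weyl_pair e' t' p' by fact
  have sq: "Z * (c *. (u * u)) = (c *. (u' * u')) * Z" if "Z * u = u' * Z" for c u u'
  proof -
    have "Z * (u * u) = u' * u' * Z" unfolding mult.assoc[symmetric] that unfolding mult.assoc that ..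
    thus ?thesis by simp
  qed
  have E: "Z * EXP (c *. (u * u)) w = EXP (c *. (u' * u')) w' * Z"
    if "u = e \<and> u' = e' \<or> u = t \<and> u' = t'" "Z * w = w' * Z" "w \<in> nilp_alg e t" "w' \<in> nilp_alg e' t'" for c u u' w w'
    by (rule EXP_intertwine[OF sq that(2)]) (use that assms(3,4) P.sq_adn[OF that(3)] Q.sq_adn[OF that(4)] in auto)
  show ?thesis unfolding fourier_def
    by (intro E P.nilp_alg_fev Q.nilp_alg_fev P.sq_mem Q.sq_mem assms) simp_all
qed

lemma wk_ad:
  assumes "\<And>z. z \<in> N ==> ad z Z \<in> N" "v \<in> wk eapp N k" shows "Z $$ v \<in> wk eapp N k"
proof (rule wk_normal[of N eapp "eapp Z", OF clin_eapp clin_eapp _ assms(2)])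
  fix x assume "x \<in> N"
  thus "\<exists>x'\<in>N. \<forall>v. x $$ Z $$ v = Z $$ x $$ v + x' $$ v"
    by (intro bexI[of _ "ad x Z"] assms(1)) (simp_all add: ad_def)
qed

context root_setup begin

lemma irep_wk:
  assumes i: "irep p A B" and z: "z \<in> insert e (insert f h)" and v: "v \<in> wk eapp (A ` n' \<union> B ` n') k"
  shows "A z $$ v \<in> wk eapp (A ` n' \<union> B ` n') k" "B z $$ v \<in> wk eapp (A ` n' \<union> B ` n') k"
proof -
  let ?N = "A ` n' \<union> B ` n'"
  have zg: "z \<in> g" using z e_g f_g h_g by auto
  have 2: "ad x (A z) \<in> ?N \<and> ad x (B z) \<in> ?N" if x: "x \<in> ?N" for x
  proof -
    obtain y where y: "y \<in> n'" "x = A y \<or> x = B y" using x by blast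
    have yg: "y \<in> g" using y n'_g by blast
    have n: "ad y z \<in> n'" "0 \<in> n'"
      using n'_ad[OF z y(1)] cv.subspace_neg[OF n'_subspace] cv.subspace_0[OF n'_subspace] ad_skew[of y z] by simp_all
    \<comment> \<open>The vanishing commutator is written \<open>A 0\<close> because it has to be a
      member of the generating set.\<close>
    have "ad (A y) (A z) = A (ad y z)" "ad (A y) (B z) = B (ad y z)" "ad (B y) (A z) = B (ad y z)" "ad (B y) (B z) = A 0"
      using irepD[OF i] yg zg by simp_all
    thus ?thesis using y(2) n by blast
  qed
  show "A z $$ v \<in> wk eapp ?N k" "B z $$ v \<in> wk eapp ?N k" by (rule wk_ad[OF _ v], use 2 in simp)+
qed

definition fourA :: "complex => 'b endo => ('n, 'b) ops => ('n, 'b) ops => ('n, 'b) ops" where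
  "fourA s p A B a = fourier s (A e) (wroot p B) (A a)"

definition fourB :: "complex => 'b endo => ('n, 'b) ops => ('n, 'b) ops => ('n, 'b) ops" where
  "fourB s p A B a = fourier s (A e) (wroot p B) (B a)"

end

section \<open>Effect of the Fourier transform on a representation\<close>

context takiff_rep begin

abbreviation "fA s \<equiv> fourA s p A B"
abbreviation "fB s \<equiv> fourB s p A B"

lemma fo_p: "fourier s (A e) t p = p" by (rule P.fourier_fix) (rule P.ad_p)+

lemma four_irep: "irep p (fA s) (fB s)"
proof -
  have c: "p * fourier s (A e) t y = fourier s (A e) t y" "fourier s (A e) t y * p = fourier s (A e) t y"
    if "y \<in> nilp_alg (A e) t" "p * y = y" "y * p = y" for y
    using P.fourier_mult[OF P.nilp_alg_p that(1), of s] P.fourier_mult[OF that(1) P.nilp_alg_p, of s] that by (simp_all add: fo_p)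
  show ?thesis unfolding irep_def fourA_def fourB_def
    by (auto simp: pp c nilp corner U_add B_add U_scale B_scale U_ad B_ad P.fourier_add P.fourier_scale simp flip: P.fourier_ad)
      (simp add: BB P.fourier_fix)
qed

lemma Aet: "A e * t = t * A e + p" using ad_Ue_t by (simp add: ad_def algebra_simps)

lemma ad_eh: assumes x: "x \<in> h" shows "ad e x = - (\<alpha> x *. e)"
  unfolding ad_skew[of e x] h_e[OF x] ..

context
  fixes s :: complex
  assumes s: "s * s = 1"
begin

lemma fA_e: "fA s e = - s *. t" unfolding fourA_def by (rule P.fourier_e[OF s])

lemma fo_t: "fourier s (A e) t t = s *. A e" by (rule P.fourier_t[OF s])

lemma fB_e: "fB s e = B e"
proof -
  have "ad (A e) (B e) = 0" using B_ad[OF e_g e_g] U_0 by simp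
  thus ?thesis unfolding fourB_def by (rule P.fourier_fix[OF _ t_B[OF e_g]])
qed

text \<open>A x + \<alpha>(x) t e commutes with both e and t, so the transform fixes it; what
  remains is the transform of the product t e, namely -e t.\<close>

lemma fA_h: assumes x: "x \<in> h" shows "fA s x = A x + \<alpha> x *. (t * A e + A e * t)"
proof -
  let ?y = "A x + \<alpha> x *. (t * A e)"
  have xg: "x \<in> g" using x by (rule mem_g)
  have "ad (A e) (A x) = - (\<alpha> x *. A e)" using U_ad[OF e_g xg] U_scale[OF e_g, of "- \<alpha> x"] by (simp add: ad_eh[OF x])
  hence 1: "ad (A e) ?y = 0" by (simp add: ad_add ad_scale ad_mult ad_Ue_t corner mem_g)
  have "ad t (A x) = \<alpha> x *. t" unfolding ad_skew[of t] ad_Uh_t[OF x] by simp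
  moreover have "ad t (A e) = - p" by (rule P.ad_te)
  ultimately have 2: "ad t ?y = 0" by (simp add: ad_add ad_scale ad_mult t_corner)
  have n: "t * A e \<in> nilp_alg (A e) t" by (intro P.nilp_alg_mult P.nilp_alg_t P.nilp_alg_e)
  have ny: "?y \<in> nilp_alg (A e) t" by (intro P.nilp_alg_add P.nilp_alg_scale n U_nilp xg)
  have "fA s x = fourier s (A e) t (?y - \<alpha> x *. (t * A e))" by (simp add: fourA_def)
  also have "\<dots> = ?y - \<alpha> x *. (fourier s (A e) t t * fourier s (A e) t (A e))"
    unfolding P.fourier_diff[OF ny P.nilp_alg_scale[OF n]] P.fourier_scale[OF n] P.fourier_mult[OF P.nilp_alg_t P.nilp_alg_e]
      P.fourier_fix[OF 1 2] ..
  also have "fourier s (A e) t t * fourier s (A e) t (A e) = - (A e * t)"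
    unfolding fo_t P.fourier_e[OF s] by (simp add: cscale_cscale s)
  finally show ?thesis by (simp add: cscale_simps)
qed

lemma fB_h: assumes x: "x \<in> h"
  shows "fB s x = (B x + \<alpha> x *. (t * B e)) - (\<alpha> x * s) *. (A e * B e)" "ad (A e) (B x + \<alpha> x *. (t * B e)) = 0"
proof -
  let ?y = "B x + \<alpha> x *. (t * B e)"
  have xg: "x \<in> g" using x by (rule mem_g)
  have "ad (A e) (B x) = - (\<alpha> x *. B e)" using B_ad[OF e_g xg] B_scale[OF e_g, of "- \<alpha> x"] by (simp add: ad_eh[OF x])
  moreover have "ad (A e) (B e) = 0" using B_ad[OF e_g e_g] U_0 by simp
  ultimately show 1: "ad (A e) ?y = 0" by (simp add: ad_add ad_scale ad_mult ad_Ue_t corner mem_g)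
  have 2: "ad t ?y = 0" by (simp add: ad_add ad_scale ad_mult t_B mem_g xg)
  have n: "t * B e \<in> nilp_alg (A e) t" by (intro P.nilp_alg_mult P.nilp_alg_t B_nilp e_g)
  have ny: "?y \<in> nilp_alg (A e) t" by (intro P.nilp_alg_add P.nilp_alg_scale n B_nilp xg)
  have "fB s x = fourier s (A e) t (?y - \<alpha> x *. (t * B e))" by (simp add: fourB_def)
  also have "\<dots> = ?y - \<alpha> x *. (fourier s (A e) t t * fB s e)"
    unfolding P.fourier_diff[OF ny P.nilp_alg_scale[OF n]] P.fourier_scale[OF n] P.fourier_mult[OF P.nilp_alg_t B_nilp[OF e_g]]
      P.fourier_fix[OF 1 2] fourB_def ..
  finally show "fB s x = ?y - (\<alpha> x * s) *. (A e * B e)" unfolding fo_t fB_e by (simp add: cscale_cscale)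
qed

text \<open>The difference is a sum of three locally nilpotent operators: B x - \<nu>(x), a multiple
  of t E and a multiple of (A e) E. The latter two inherit nilpotency from E, which commutes with
  their other factor. The first two commute, and their sum commutes with the third.\<close>

lemma nil_fBh: assumes x: "x \<in> h" shows "nilS p (fB s x - \<nu> x *. p)"
proof -
  have xg: "x \<in> g" using x by (rule mem_g)
  have ee: "ad (A e) (B e) = 0" using B_ad[OF e_g e_g] U_0 by simp
  have te: "t * B e = B e * t" using t_B[OF e_g] by (simp add: ad_eq_0)
  have bx: "B x * B e = B e * B x" using BB[OF xg e_g] by (simp add: ad_eq_0)
  have bt: "B x * t = t * B x" using t_B[OF xg] by (simp add: ad_eq_0)
  have 1: "nilS p (\<alpha> x *. (t * B e))" by (intro nilS_scale nilS_mult nilBe te[symmetric])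
  let ?Y = "(B x - \<nu> x *. p) + \<alpha> x *. (t * B e)" and ?Z = "(- (\<alpha> x * s)) *. (A e * B e)"
  have c1: "B x * (t * B e) = t * B e * B x" unfolding mult.assoc[symmetric] bt unfolding mult.assoc bx ..
  have 2: "nilS p ?Y"
  proof (rule nilS_add[OF nilBh[OF x] 1])
    have pt: "p * (t * B e) = t * B e" "t * B e * p = t * B e"
      by (simp add: t_corner flip: mult.assoc) (simp add: mult.assoc corner e_g)
    show "(B x - \<nu> x *. p) * \<alpha> x *. (t * B e) = \<alpha> x *. (t * B e) * (B x - \<nu> x *. p)"
      by (simp add: left_diff_distrib right_diff_distrib c1 pt cscale_simps mult.commute)
  qed (simp_all add: left_diff_distrib right_diff_distrib corner xg pp mult.assoc[symmetric] t_corner, simp_all add: mult.assoc corner e_g)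
  have 3: "nilS p ?Z" by (intro nilS_scale nilS_mult nilBe) (use ee in \<open>simp add: ad_eq_0\<close>)
  have Ye: "ad (A e) ?Y = 0" using fB_h(2)[OF x] P.ad_p(1) by (simp add: ad_add ad_diff ad_scale)
  have "ad (B e) ?Y = 0" using BB[OF e_g xg] B_t[OF e_g] ad_1[of "B e" p] by (simp add: ad_add ad_diff ad_scale ad_mult corner e_g)
  hence YB: "?Y * B e = B e * ?Y" by (simp only: ad_eq_0)
  have YA: "?Y * A e = A e * ?Y" using Ye by (simp only: ad_eq_0)
  have "?Y * (A e * B e) = A e * B e * ?Y" unfolding mult.assoc[symmetric] YA unfolding mult.assoc YB ..
  hence c2: "?Y * ?Z = ?Z * ?Y" by simp
  have "nilS p (?Y + ?Z)"
    by (rule nilS_add[OF 2 3 c2])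
      (simp_all add: left_diff_distrib right_diff_distrib distrib_left distrib_right corner xg pp mult.assoc[symmetric] t_corner e_g, simp_all add: mult.assoc corner e_g)
  moreover have "?Y + ?Z = fB s x - \<nu> x *. p" unfolding fB_h(1)[OF x] by simp
  ultimately show ?thesis by (simp only:)
qed

lemma wdata_N: "wdata p (fB s e) (fB s H) (fB s f) (\<nu> H)"
proof -
  have c: "p * fB s a = fB s a" "fB s a * p = fB s a" "b \<in> g ==> fB s a * fB s b = fB s b * fB s a" if "a \<in> g" for a b
    using four_irep[of s] that by (simp_all add: irep_def ad_eq_0)
  show ?thesis
    by unfold_locales (use nil_fBh[OF H_h] nilBe \<nu>H in \<open>simp_all add: pp c mem_g\<close>, simp add: fB_e)
qed

text \<open>The transform is multiplicative, so the image of t solves the transformed quadratic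
  equation; uniqueness identifies it with the root.\<close>

lemma wroot_N: "wroot p (fB s) = s *. A e"
proof -
  interpret N: wdata p "fB s e" "fB s H" "fB s f" "\<nu> H" by (rule wdata_N)
  let ?f = "fourier s (A e) t"
  have m: "?f (y * z) = ?f y * ?f z" if "y \<in> nilp_alg (A e) t" "z \<in> nilp_alg (A e) t" for y z by (rule P.fourier_mult[OF that])
  have com: "?f t * ?f (B a) = ?f (B a) * ?f t" if "a \<in> g" for a
    using t_B[OF that] m[OF P.nilp_alg_t B_nilp[OF that]] m[OF B_nilp[OF that] P.nilp_alg_t] by (simp add: ad_eq_0)
  have tt: "B e * t \<in> nilp_alg (A e) t" "B e * t * t \<in> nilp_alg (A e) t" "B H * t \<in> nilp_alg (A e) t"
    by (intro P.nilp_alg_mult B_nilp P.nilp_alg_t mem_g)+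
  have "?f (B e * t * t + B H * t) = ?f (B e) * ?f t * ?f t + ?f (B H) * ?f t"
    by (simp only: P.fourier_add[OF tt(2,3)] m[OF tt(1) P.nilp_alg_t] m[OF B_nilp P.nilp_alg_t] mem_g)
  hence eq: "?f (B e) * ?f t * ?f t + ?f (B H) * ?f t = ?f (B f)" unfolding t_eq ..
  have "p * ?f t = ?f t" "?f t * p = ?f t"
    using m[OF P.nilp_alg_p P.nilp_alg_t] m[OF P.nilp_alg_t P.nilp_alg_p] by (simp_all add: fo_p t_corner)
  hence "quad p (fB s e) (fB s H) (fB s f) (?f t)" unfolding quad_def fourB_def
    by (intro conjI eq com mem_g)
  hence "p * ?f t = wroot p (fB s) * p" unfolding wroot_def
    by (rule quad_intertwine[OF wdata_N wdata_N _ N.qroot]) (simp_all add: pp N.corner)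
  moreover have "wroot p (fB s) * p = wroot p (fB s)" using N.qroot unfolding wroot_def quad_def by blast
  ultimately show ?thesis by (simp add: fo_t corner e_g)
qed

lemma fo_inverse: "a \<in> g ==> fourier (- s) (A e) t (fA s a) = A a" "a \<in> g ==> fourier (- s) (A e) t (fB s a) = B a"
  unfolding fourA_def fourB_def by (rule P.fourier_fourier; rule nilp; assumption)+

text \<open>The Weyl pair of the new representation is the transform of the old one. By
  \<open>fourier_transformed\<close> the second transform is therefore the conjugate of the inverse
  transform by the first.\<close>

lemma four_four: assumes a: "a \<in> g"
  shows "fourA (- s) p (fA s) (fB s) a = A a" "fourB (- s) p (fA s) (fB s) a = B a"
proof -
  have w: "wroot p (fB s) = fourier s (A e) t t" by (simp add: wroot_N fo_t)
  have i: "fourier s (A e) t (fourier (- s) (A e) t y) = y" if "y \<in> nilp_alg (A e) t" for y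
    using P.fourier_fourier[OF that, of "- s"] by simp
  have "fourier (- s) (fA s e) (wroot p (fB s)) (fourier s (A e) t y) = y" if "y \<in> nilp_alg (A e) t" for y
    unfolding w fourA_def using P.fourier_transformed[OF s that, of "- s"] i[OF that] by simp
  from this[OF U_nilp[OF a]] this[OF B_nilp[OF a]]
  show "fourA (- s) p (fA s) (fB s) a = A a" "fourB (- s) p (fA s) (fB s) a = B a"
    unfolding fourA_def[of "- s"] fourB_def[of "- s"] by (simp_all only: fourA_def[symmetric] fourB_def[symmetric])
qed

text \<open>The same generators work. A subspace stable under the transformed operators is stable
  under their root, a multiple of \<open>A e\<close>, and under t, a multiple of the transformed e;
  then the inverse transform makes it stable under the original operators.\<close>

lemma four_fgen: "fgen p (fA s) (fB s)"
proof -
  interpret N: wdata p "fB s e" "fB s H" "fB s f" "\<nu> H" by (rule wdata_N)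
  have "fgen p A B" using base by (simp add: base_def)
  then obtain S where S: "finite S" "\<forall>v\<in>S. p $$ v = v" "\<And>W. cv.subspace W ==> S \<subseteq> W ==> \<forall>w\<in>W. p $$ w = w ==>
      \<forall>a\<in>g. \<forall>w\<in>W. A a $$ w \<in> W \<and> B a $$ w \<in> W ==> \<forall>v. p $$ v \<in> W" unfolding fgen_def by blast
  have "\<forall>v. p $$ v \<in> W" if W: "cv.subspace W" "S \<subseteq> W" "\<forall>w\<in>W. p $$ w = w" "\<forall>a\<in>g. \<forall>w\<in>W. fA s a $$ w \<in> W \<and> fB s a $$ w \<in> W" for W
  proof (rule S(3)[OF W(1-3)], intro ballI)
    have e': "A e = s *. wroot p (fB s)" and t': "t = (- s) *. fA s e" by (simp_all add: wroot_N fA_e cscale_cscale s)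
    have "wroot p (fB s) $$ w \<in> W" if "w \<in> W" for w unfolding wroot_def
      by (rule N.qroot_stable[OF W(1) _ that]) (use W(3,4) mem_g in auto)
    hence We: "A e $$ w \<in> W" if "w \<in> W" for w unfolding e' using cv.subspace_scale[OF W(1)] that by simp
    have Wt: "t $$ w \<in> W" if "w \<in> W" for w using W(4) e_g cv.subspace_scale[OF W(1), of "fA s e $$ w" "- s"] that
      by (subst t') (simp only: endo_simps)
    fix a w assume a: "a \<in> g" and w: "w \<in> W"
    have "fourier (- s) (A e) t (fA s a) $$ w \<in> W" "fourier (- s) (A e) t (fB s a) $$ w \<in> W"
      by (rule fourier_endo_stable[OF W(1) We Wt _ w]; use W(4) a in blast)+
    thus "A a $$ w \<in> W \<and> B a $$ w \<in> W" unfolding fo_inverse[OF a] by simp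
  qed
  with S(1,2) show ?thesis unfolding fgen_def by blast
qed

text \<open>\<open>A e\<close> and t preserve the filtration by \<open>n'\<close>, so commutators
  with their squares keep operators that lower it. The transformed \<open>n'\<close> thus lowers the
  same filtration.\<close>

lemma four_nil_n': "\<exists>k. p $$ v \<in> wk eapp (fA s ` n' \<union> fB s ` n') k"
proof -
  let ?N = "A ` n' \<union> B ` n'"
  let ?F = "wk eapp ?N"
  have sub: "cv.subspace (?F k)" for k by (rule wk_subspace) (rule clin_eapp)
  have n0: "0 \<in> ?N" using U_0 cv.subspace_0[OF n'_subspace] by (metis UnI1 imageI)
  note FA = irep_wk(1)[OF irep] and FB = irep_wk(2)[OF irep]
  have Fp: "p $$ v \<in> ?F k" if "v \<in> ?F k" for v k
  proof (rule wk_ad[OF _ that])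
    have "ad z p = 0" if "z \<in> ?N" for z using that mem_g by (auto intro!: ad_1 simp: corner)
    thus "ad z p \<in> ?N" if "z \<in> ?N" for z using that n0 by simp
  qed
  have Ft: "t $$ v \<in> ?F k" if "v \<in> ?F k" for v k unfolding wroot_def
    by (rule W.qroot_stable[OF sub _ that]) (use FB Fp H_h in auto)
  let ?J = "{y. \<forall>k. \<forall>v\<in>?F (Suc k). y $$ v \<in> ?F k}"
  have J: "cv.subspace ?J" using sub by (intro cv.subspaceI) (auto intro: cv.subspace_0 cv.subspace_add cv.subspace_scale simp del: wk.simps)
  have Jz: "ad (z * z) y \<in> ?J" if y: "y \<in> ?J" and z: "\<And>v k. v \<in> ?F k ==> z $$ v \<in> ?F k" for y z
  proof (intro CollectI allI ballI)
    fix k v assume v: "v \<in> ?F (Suc k)"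
    have "z $$ z $$ y $$ v \<in> ?F k" using y z v by blast
    moreover have "y $$ z $$ z $$ v \<in> ?F k" using y z[of _ "Suc k"] v by blast
    ultimately show "ad (z * z) y $$ v \<in> ?F k" using cv.subspace_diff[OF sub] by (simp add: ad_def)
  qed
  have fo: "fourier s (A e) t y \<in> ?J" if "y \<in> ?N" for y
    by (rule fourier_stable[OF J]) (use Jz FA Ft that in auto)
  have "?F k \<subseteq> wk eapp (fA s ` n' \<union> fB s ` n') k" for k
  proof (induction k)
    case (Suc k)
    have "x $$ v \<in> ?F k" if "x \<in> fA s ` n' \<union> fB s ` n'" "v \<in> ?F (Suc k)" for x v
      using that fo unfolding fourA_def fourB_def by blast
    thus ?case using Suc by (simp del: Un_iff) blast
  qed simp
  moreover have "\<exists>k. p $$ v \<in> ?F k" using base by (simp add: base_def)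
  ultimately show ?thesis by blast
qed

text \<open>On a weight vector with t e acting by c, the transformed x acts by l(x) + \<alpha>(x)
  (2c + 1). Weight vectors split into such vectors by \<open>weyl_eigen\<close>, used for the pair
  (e, t) or, when t is the locally nilpotent one, for (t, -e).\<close>

lemma four_wspan: assumes nil: "nilS p (A e) \<or> nilS p t" shows "p $$ v \<in> wspan p (fA s)"
proof -
  have key: "v \<in> wspan p (fA s)" if v: "p $$ v = v" "\<And>x. x \<in> h ==> A x $$ v = l x *. v" for v l
  proof -
    let ?E = "\<lambda>y. {w. p $$ w = w \<and> (\<forall>x\<in>h. A x $$ w = l x *. w) \<and> (\<exists>n::nat. y $$ w = of_nat n *. w)}"
    have w: "w \<in> wspan p (fA s)" if "p $$ w = w" "\<forall>x\<in>h. A x $$ w = l x *. w" "t $$ A e $$ w = c *. w" for w c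
    proof -
      have "fA s x $$ w = (l x + \<alpha> x * (c + c + 1)) *. w" if "x \<in> h" for x
      proof -
        have "fA s x $$ w = l x *. w + \<alpha> x *. (c *. w + (c *. w + w))"
          using that \<open>\<forall>x\<in>h. _\<close> \<open>p $$ w = w\<close> \<open>t $$ _ = _\<close> by (simp add: fA_h Aet)
        also have "\<dots> = (l x + \<alpha> x * (c + c + 1)) *. w"
          unfolding cscale_add_left distrib_left cscale_cscale[symmetric] cscale_add_right by (simp add: add.assoc)
        finally show ?thesis .
      qed
      thus ?thesis unfolding wspan_def
        by (intro cv.span_base CollectI conjI that(1) exI[of _ "\<lambda>x. l x + \<alpha> x * (c + c + 1)"] ballI)
    qed
    have sp: "cv.subspace (wspan p (fA s))" unfolding wspan_def by (rule cv.subspace_span)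
    from nil show ?thesis
    proof
      assume "nilS p (A e)"
      then obtain k where "(A e ^ k) $$ p $$ v = 0" unfolding nilS_def by blast
      hence k: "(A e ^ k) $$ v = 0" by (simp add: v(1))
      have "v \<in> cv.span (?E (t * A e))"
        by (rule weyl_eigen[OF P.comm P.corner, where h = h and A = A and \<beta> = \<alpha>, OF _ _ v k])
          (use U_ad[OF mem_g(4) e_g] h_e U_scale[OF e_g] ad_Uh_t in auto)
      moreover have "cv.span (?E (t * A e)) \<subseteq> wspan p (fA s)" by (rule cv.span_minimal[OF _ sp]) (use w in auto)
      ultimately show ?thesis by blast
    next
      assume "nilS p t"
      then obtain k where "(t ^ k) $$ p $$ v = 0" unfolding nilS_def by blast
      hence k: "(t ^ k) $$ v = 0" by (simp add: v(1))
      have c: "t * (- A e) - (- A e) * t = p" using Aet by simp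
      have "v \<in> cv.span (?E ((- A e) * t))"
      proof (rule weyl_eigen[OF c t_corner, where h = h and A = A and \<beta> = "\<lambda>x. - \<alpha> x", OF _ _ _ _ v k])
        show "ad (A x) t = - \<alpha> x *. t" if "x \<in> h" for x using ad_Uh_t[OF that] by simp
        show "ad (A x) (- A e) = - (- \<alpha> x *. - A e)" if "x \<in> h" for x
          using U_ad[OF mem_g(4) e_g, OF that] h_e[OF that] U_scale[OF e_g] by (simp add: ad_minus)
      qed (simp_all add: corner e_g)
      moreover have "cv.span (?E ((- A e) * t)) \<subseteq> wspan p (fA s)"
      proof (rule cv.span_minimal[OF _ sp], safe)
        fix w and n :: nat assume a: "p $$ w = w" "\<forall>x\<in>h. A x $$ w = l x *. w" "(- A e * t) $$ w = of_nat n *. w"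
        have "A e $$ t $$ w = - (of_nat n *. w)" using a(3) by (simp add: equation_minus_iff) 
        moreover have "A e $$ t $$ w = t $$ A e $$ w + w" using app_eq[OF Aet, of w] a(1) by simp
        ultimately have "t $$ A e $$ w = (- of_nat n - 1) *. w" by (simp add: cscale_simps algebra_simps)
        thus "w \<in> wspan p (fA s)" by (rule w[OF a(1,2)])
      qed
      ultimately show ?thesis by blast
    qed
  qed
  have "p $$ v \<in> wspan p A" using base by (simp add: base_def)
  moreover have "wspan p A \<subseteq> wspan p (fA s)"
    unfolding wspan_def[of p A] by (rule cv.span_minimal) (use key in \<open>auto simp: wspan_def cv.subspace_span\<close>)
  ultimately show ?thesis by blast
qed

theorem four_base: "nilS p (A e) \<or> nilS p t ==> base \<nu> p (fA s) (fB s)"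
  unfolding base_def
  by (auto simp: four_irep four_wspan four_fgen four_nil_n' nil_fBh fB_e nilBe)

end

text \<open>In the transformed representation the root is \<open>A e\<close>, so the quadratic
  equation writes \<open>fB 1 f\<close> as a multiple of \<open>A e\<close>. The cofactor commutes
  with \<open>A e\<close>, because \<open>B e\<close> and the corrected operator of
  \<open>fB_h\<close> do.\<close>

lemma four_Bf: assumes "nilS p (A e)" shows "nilS p (fB 1 f)"
proof -
  have s: "1 * 1 = (1::complex)" by simp
  let ?y = "B H + 2 *. (t * B e)"
  interpret N: wdata p "fB 1 e" "fB 1 H" "fB 1 f" "\<nu> H" by (rule wdata_N[OF s])
  have q: "quad p (fB 1 e) (fB 1 H) (fB 1 f) (A e)"
    using N.qroot wroot_N[OF s] unfolding wroot_def by simp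
  have y: "ad (A e) ?y = 0" "fB 1 H = ?y - 2 *. (A e * B e)" using fB_h[OF s H_h] by (simp_all add: \<alpha>_H)
  have ee: "ad (A e) (B e) = 0" using B_ad[OF e_g e_g] U_0 by simp
  have "fB 1 f = B e * A e * A e + fB 1 H * A e" using q by (simp add: quad_def fB_e[OF s])
  also have "\<dots> = (B e * A e + (?y - 2 *. (A e * B e))) * A e" unfolding y(2) by (simp only: distrib_right)
  finally have f: "fB 1 f = (B e * A e + (?y - 2 *. (A e * B e))) * A e" .
  have "ad (A e) (B e * A e + (?y - 2 *. (A e * B e))) = 0"
    using y(1) by (simp only: ad_add ad_diff ad_scale ad_mult ee ad_self) simp
  thus ?thesis unfolding f by (intro nilS_mult[OF assms]) (simp only: ad_eq_0)
qed

text \<open>B f factors as (H + t E) t with commuting factors, and H + t E is injective on the range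
  of \<open>p\<close>; so a power of B f kills a vector only if the same power of t does.\<close>

lemma nil_t: assumes "nilS p (B f)" shows "nilS p t"
  unfolding nilS_def
proof
  fix v
  let ?m = "B H + t * B e"
  have te: "t * B e = B e * t" "t * B H = B H * t" using t_B mem_g by (simp_all add: ad_eq_0)
  have f: "B f = ?m * t" unfolding t_eq[symmetric] by (simp add: te distrib_right add.commute)
  have c: "?m * t = t * ?m" by (simp add: distrib_left distrib_right te) (simp add: te mult.assoc[symmetric])
  obtain k where k: "(B f ^ k) $$ p $$ v = 0" using assms unfolding nilS_def by blast
  have inj: "(?m ^ n) $$ w = 0 ==> p $$ w = w ==> w = 0" for n w
  proof (induction n)
    case (Suc n)
    have "p $$ (?m ^ n) $$ w = (?m ^ n) $$ w"
    proof (cases n)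
      case (Suc j)
      have "p * ?m = ?m" by (simp add: distrib_left corner mem_g t_corner flip: mult.assoc)
      from app_eq[OF this] show ?thesis by (simp add: Suc)
    qed (simp add: Suc.prems)
    hence "(?m ^ n) $$ w = 0"
      by (rule W.EH_inj[of t, rotated 2]) (use Suc.prems te t_corner in simp_all)
    thus ?case using Suc by blast
  qed simp
  have "(?m ^ k) $$ (t ^ k) $$ p $$ v = 0" using k unfolding f power_mult_commute[OF c] by simp
  moreover have "p $$ (t ^ k) $$ p $$ v = (t ^ k) $$ p $$ v"
    using app_eq[OF pp] app_eq[OF t_corner(1)] by (cases k) simp_all
  ultimately have "(t ^ k) $$ p $$ v = 0" by (rule inj)
  thus "\<exists>k. (t ^ k) $$ p $$ v = 0" by blast
qed

end

section \<open>The simple reflection and the combined twist\<close>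

lemma EXP_two: "ad x (ad x (ad x y)) = 0 ==> EXP x y = y + ad x y + (1/2) *. ad x (ad x y)"
  using EXP_bound[where x = x and K = 3 and y = y] by (simp add: dpow_def eval_nat_numeral)

lemma ad_uminus: "ad (- x) y = - ad x y" by (simp add: ad_def)

context root_setup begin

text \<open>Defined on all matrices, since e and f are nilpotent. For c = 1 and c = -1 these are two
  lifts of the simple reflection, inverse to each other.\<close>

definition sref :: "complex => 'n mx => 'n mx" where
  "sref c x = EXP (c *. e) (EXP ((- c) *. f) (EXP (c *. e) x))"

lemma adn_ef: "adn (c *. e) y" "adn (c *. f) y"
  using e_nilp f_nilp ad_nilpotent by (blast intro: adn_cscale adnI)+

lemma sref_linear: "sref c (x + y) = sref c x + sref c y" "sref c (d *. x) = d *. sref c x"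
  by (simp_all add: sref_def EXP_add EXP_scale adn_ef del: cv.scale_minus_left)

lemma sref_mult: "sref c (x * y) = sref c x * sref c y"
  by (simp add: sref_def EXP_mult adn_ef del: cv.scale_minus_left)

lemma sref_diff: "sref c (x - y) = sref c x - sref c y"
  using sref_linear(1)[of c x "(-1) *. y"] sref_linear(2)[of c "-1" y] by simp

lemma sref_ad: "sref c (ad x y) = ad (sref c x) (sref c y)"
  by (simp add: ad_def sref_diff sref_mult)

lemma sref_sref: "sref (- c) (sref c x) = x"
proof -
  have e: "EXP ((- c) *. e) (EXP (c *. e) y) = y" and f: "EXP (c *. f) (EXP ((- c) *. f) y) = y" for y
    using EXP_inverse[of e y "- c" c] EXP_inverse[of f y c "- c"] adn_ef[of 1 y] by (simp_all add: EXP_0 del: cv.scale_minus_left)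
  show ?thesis unfolding sref_def minus_minus e f ..
qed

lemma sref_stable: assumes "cv.subspace W" "\<And>y. y \<in> W ==> ad e y \<in> W" "\<And>y. y \<in> W ==> ad f y \<in> W" "x \<in> W"
  shows "sref c x \<in> W"
proof -
  have E: "EXP (d *. z) w \<in> W" if "w \<in> W" "\<And>y. y \<in> W ==> ad z y \<in> W" for d z w unfolding EXP_def
    by (rule fev_stable[OF assms(1)]) (use that in \<open>auto simp: ad_cscale intro: cv.subspace_scale[OF assms(1)]\<close>)
  show ?thesis unfolding sref_def by ((rule E assms(2-4) | assumption)+)
qed

lemma sref_g: "x \<in> g ==> sref c x \<in> g" and sref_n': "x \<in> n' ==> sref c x \<in> n'"
  by (rule sref_stable; simp add: g_subspace g_ad e_g f_g n'_subspace n'_ad)+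

context
  fixes c :: complex assumes c: "c * c = 1"
begin

lemma ad_H: "ad e (ad e f) = - (2 *. e)" "ad f e = - ad e f" "ad f (ad e f) = 2 *. f"
  unfolding ad_skew[of e "ad e f"] ad_skew[of f "ad e f"] ad_skew[of f e] h_e[OF H_h] h_f[OF H_h] \<alpha>_H by simp_all

text \<open>On the span of e, h and f the series stop at second order, and \<open>c * c = 1\<close>
  removes c from the quadratic term.\<close>

lemma EXP_ce: "EXP (c *. e) e = e" "EXP (c *. e) (ad e f) = ad e f - (2 * c) *. e"
    "EXP (c *. e) f = f + c *. ad e f - e"
  by (simp add: EXP_fix ad_cscale, subst EXP_one, simp_all add: ad_cscale ad_H ad_scale ad_minus mult.commute,
      subst EXP_two, simp_all add: ad_cscale ad_H ad_scale ad_minus c cscale_cscale)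

lemma EXP_cf: "EXP ((- c) *. f) f = f" "EXP ((- c) *. f) (ad e f) = ad e f - (2 * c) *. f"
    "EXP ((- c) *. f) e = e + c *. ad e f - f"
proof -
  show "EXP ((- c) *. f) f = f" by (rule EXP_fix) (simp add: ad_cscale ad_uminus)
  show "EXP ((- c) *. f) (ad e f) = ad e f - (2 * c) *. f"
    by (subst EXP_one) (simp_all add: ad_cscale ad_uminus ad_H ad_scale ad_minus mult.commute)
  show "EXP ((- c) *. f) e = e + c *. ad e f - f"
    by (subst EXP_two) (simp_all add: ad_cscale ad_uminus ad_H ad_scale ad_minus c cscale_cscale)
qed

lemma EXP_lc: "EXP (d *. e) (x + b *. y) = EXP (d *. e) x + b *. EXP (d *. e) y"
  "EXP (d *. f) (x + b *. y) = EXP (d *. f) x + b *. EXP (d *. f) y"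
  by (simp_all add: EXP_add EXP_scale adn_ef)

lemma EXP_d: "EXP (d *. e) (x - y) = EXP (d *. e) x - EXP (d *. e) y"
  "EXP (d *. f) (x - y) = EXP (d *. f) x - EXP (d *. f) y"
  using EXP_lc[of d x "-1" y] by simp_all

lemma sref_e: "sref c e = - f"
proof -
  have "sref c e = EXP (c *. e) (e + c *. ad e f - f)" unfolding sref_def EXP_ce(1) EXP_cf(3) ..
  also have "\<dots> = e + c *. (ad e f - (2 * c) *. e) - (f + c *. ad e f - e)"
    unfolding EXP_d EXP_lc EXP_ce ..
  also have "\<dots> = (e + e) - ((2 * (c * c)) *. e) - f" by (simp add: cscale_simps algebra_simps)
  also have "\<dots> = - f" using cscale_add_left[of 1 1 e] by (simp add: c)
  finally show ?thesis .
qed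

lemma sref_h: assumes x: "x \<in> h" shows "sref c x = x - \<alpha> x *. ad e f"
proof -
  have ex: "ad e x = - (\<alpha> x *. e)" and fx: "ad f x = \<alpha> x *. f"
    unfolding ad_skew[of e x] ad_skew[of f x] h_e[OF x] h_f[OF x] by simp_all
  have 1: "EXP (c *. e) x = x + (- (c * \<alpha> x)) *. e"
    by (subst EXP_one) (simp_all add: ad_cscale ex ad_scale ad_minus cscale_cscale)
  have 2: "EXP ((- c) *. f) x = x + (- (c * \<alpha> x)) *. f"
    by (subst EXP_one) (simp_all add: ad_cscale ad_uminus fx ad_scale ad_minus cscale_cscale)
  have "EXP ((- c) *. f) (EXP (c *. e) x) = x + (- (c * \<alpha> x)) *. f + (- (c * \<alpha> x)) *. (e + c *. ad e f - f)"
    unfolding 1 EXP_lc 2 EXP_cf ..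
  also have "\<dots> = x + (- (c * \<alpha> x)) *. e + (- (c * c) * \<alpha> x) *. ad e f"
    by (simp add: cscale_simps algebra_simps)
  also have "\<dots> = x + (- (c * \<alpha> x)) *. e + (- \<alpha> x) *. ad e f" unfolding c by simp
  finally have "sref c x = EXP (c *. e) (x + (- (c * \<alpha> x)) *. e + (- \<alpha> x) *. ad e f)"
    unfolding sref_def by simp
  also have "\<dots> = x + (- (c * \<alpha> x)) *. e + (- (c * \<alpha> x)) *. e + (- \<alpha> x) *. (ad e f - (2 * c) *. e)"
    unfolding EXP_lc 1 EXP_ce ..
  also have "\<dots> = x - \<alpha> x *. ad e f + ((2 * (c * \<alpha> x)) *. e - ((c * \<alpha> x) *. e + (c * \<alpha> x) *. e))"
    by (simp add: cscale_simps algebra_simps)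
  also have "\<dots> = x - \<alpha> x *. ad e f" using cscale_add_left[of "c * \<alpha> x" "c * \<alpha> x" e] by simp
  finally show ?thesis .
qed

lemma sref_f: "sref c f = - e"
proof -
  have "sref c f = EXP (c *. e) (EXP ((- c) *. f) (f + c *. ad e f - e))" unfolding sref_def EXP_ce(3) ..
  also have "EXP ((- c) *. f) (f + c *. ad e f - e) = f + c *. (ad e f - (2 * c) *. f) - (e + c *. ad e f - f)"
    unfolding EXP_d EXP_lc EXP_cf ..
  also have "\<dots> = (f + f) - ((2 * (c * c)) *. f) - e" by (simp add: cscale_simps algebra_simps)
  also have "\<dots> = (-1) *. e" using cscale_add_left[of 1 1 f] by (simp add: c)
  also have "EXP (c *. e) ((-1) *. e) = - e" by (simp only: EXP_scale[OF adn_ef(1)] EXP_ce(1)) simp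
  finally show ?thesis .
qed

text \<open>The lift exchanges e and f up to sign, maps \<open>h\<close> to itself by the reflection
  and preserves \<open>n'\<close>. So the nilpotency of B e and B f is exchanged, and everything
  else persists with \<nu> reflected.\<close>

lemma sref_base:
  assumes b: "base \<nu> p A B" and f: "nilS p (B f)" and \<nu>: "\<And>x. x \<in> h ==> \<nu>' x = \<nu> (x - \<alpha> x *. ad e f)"
  shows "base \<nu>' p (\<lambda>x. A (sref c x)) (\<lambda>x. B (sref c x)) \<and> nilS p (B (sref c f))"
proof -
  have i: "irep p A B" and w: "\<And>v. p $$ v \<in> wspan p A" and fg: "fgen p A B" and n: "\<And>v. \<exists>k. p $$ v \<in> wk eapp (A ` n' \<union> B ` n') k"
    and e: "nilS p (B e)" and hn: "\<And>x. x \<in> h ==> nilS p (B x - \<nu> x *. p)" using b by (simp_all add: base_def)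
  have hs: "sref c x \<in> h" if "x \<in> h" for x
    unfolding sref_h[OF that] using that H_h h_subspace by (simp add: cv.subspace_diff cv.subspace_scale)
  have 1: "irep p (\<lambda>x. A (sref c x)) (\<lambda>x. B (sref c x))"
    using i by (simp add: irep_def sref_g sref_linear sref_ad)
  have "wspan p A \<subseteq> wspan p (\<lambda>x. A (sref c x))" unfolding wspan_def
  proof (rule cv.span_mono, rule subsetI)
    fix v assume "v \<in> {v. p $$ v = v \<and> (\<exists>l. \<forall>x\<in>h. A x $$ v = l x *. v)}"
    then obtain l where l: "p $$ v = v" "\<forall>x\<in>h. A x $$ v = l x *. v" by blast
    have "\<forall>x\<in>h. A (sref c x) $$ v = l (sref c x) *. v" using l(2) hs by simp
    thus "v \<in> {v. p $$ v = v \<and> (\<exists>l. \<forall>x\<in>h. A (sref c x) $$ v = l x *. v)}"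
      using l(1) by (intro CollectI conjI exI[of _ "\<lambda>x. l (sref c x)"])
  qed
  hence 2: "p $$ v \<in> wspan p (\<lambda>x. A (sref c x))" for v using w by blast
  have ss: "sref c (sref (- c) a) = a" for a using sref_sref[of "- c" a] by simp
  have 3: "fgen p (\<lambda>x. A (sref c x)) (\<lambda>x. B (sref c x))"
  proof -
    obtain S where S: "finite S" "\<forall>v\<in>S. p $$ v = v" "\<And>W. cv.subspace W ==> S \<subseteq> W ==> \<forall>w\<in>W. p $$ w = w ==>
      \<forall>a\<in>g. \<forall>w\<in>W. A a $$ w \<in> W \<and> B a $$ w \<in> W ==> \<forall>v. p $$ v \<in> W" using fg unfolding fgen_def by blast
    have "\<forall>v. p $$ v \<in> W" if W: "cv.subspace W" "S \<subseteq> W" "\<forall>w\<in>W. p $$ w = w"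
        "\<forall>a\<in>g. \<forall>w\<in>W. A (sref c a) $$ w \<in> W \<and> B (sref c a) $$ w \<in> W" for W
    proof (rule S(3)[OF W(1-3)], intro ballI)
      fix a w assume "a \<in> g" "w \<in> W"
      thus "A a $$ w \<in> W \<and> B a $$ w \<in> W" using W(4)[rule_format, of "sref (- c) a" w] by (simp add: sref_g ss)
    qed
    with S(1,2) show ?thesis unfolding fgen_def by blast
  qed
  have "(\<lambda>x. A (sref c x)) ` n' \<union> (\<lambda>x. B (sref c x)) ` n' \<subseteq> A ` n' \<union> B ` n'" using sref_n' by blast
  from wk_antimono[OF this, of eapp] have 4: "\<exists>k. p $$ v \<in> wk eapp ((\<lambda>x. A (sref c x)) ` n' \<union> (\<lambda>x. B (sref c x)) ` n') k" for v
    using n[of v] by blast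
  have m: "B (- x) = - B x" if "x \<in> g" for x using i that unfolding irep_def by (metis cv.scale_minus_left cscale_one)
  have 5: "nilS p (B (sref c e))" "nilS p (B (sref c f))" unfolding sref_e sref_f m[OF e_g] m[OF f_g]
    using nilS_scale[OF f, of "-1"] nilS_scale[OF e, of "-1"] by simp_all
  have 6: "nilS p (B (sref c x) - \<nu>' x *. p)" if "x \<in> h" for x
    using hn[OF hs[OF that]] \<nu>[OF that] sref_h[OF that] by simp
  show ?thesis unfolding base_def using 1 2 3 4 5 6 by blast
qed

end

section \<open>The composite twist, its inverse and its naturality\<close>

definition twA :: "complex => 'b endo => ('n, 'b) ops => ('n, 'b) ops => ('n, 'b) ops" where
  "twA c p A B = fourA (- 1) p (\<lambda>x. fourA 1 p A B (sref c x)) (\<lambda>x. fourB 1 p A B (sref c x))"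

definition twB :: "complex => 'b endo => ('n, 'b) ops => ('n, 'b) ops => ('n, 'b) ops" where
  "twB c p A B = fourB (- 1) p (\<lambda>x. fourA 1 p A B (sref c x)) (\<lambda>x. fourB 1 p A B (sref c x))"

lemma H_g: "ad e f \<in> g" by (rule g_ad[OF e_g f_g])

text \<open>A module determines its operators on \<open>g\<close> only, so the twist must not see
  values outside \<open>g\<close>.\<close>

lemma four_cong:
  assumes "\<And>a. a \<in> g ==> A a = A' a" "\<And>a. a \<in> g ==> B a = B' a" "a \<in> g"
  shows "fourA s p A B a = fourA s p A' B' a" "fourB s p A B a = fourB s p A' B' a"
  using assms e_g f_g H_g by (simp_all add: fourA_def fourB_def wroot_def)

lemma tw_cong:
  assumes AB: "\<And>a. a \<in> g ==> A a = A' a" "\<And>a. a \<in> g ==> B a = B' a" and "a \<in> g"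
  shows "twA c p A B a = twA c p A' B' a" "twB c p A B a = twB c p A' B' a"
proof -
  have 1: "fourA 1 p A B (sref c x) = fourA 1 p A' B' (sref c x)" "fourB 1 p A B (sref c x) = fourB 1 p A' B' (sref c x)" if "x \<in> g" for x
    by (rule four_cong[OF AB sref_g[OF that]]; assumption)+
  show "twA c p A B a = twA c p A' B' a" "twB c p A B a = twB c p A' B' a"
    unfolding twA_def twB_def
    using four_cong[of "\<lambda>x. fourA 1 p A B (sref c x)" "\<lambda>x. fourA 1 p A' B' (sref c x)"
      "\<lambda>x. fourB 1 p A B (sref c x)" "\<lambda>x. fourB 1 p A' B' (sref c x)", OF 1 assms(3)] by simp_all
qed

definition objO :: "('n mx => complex) => 'b endo => ('n, 'b) ops => ('n, 'b) ops => bool" where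
  "objO \<nu> p A B \<longleftrightarrow> base \<nu> p A B \<and> nilS p (A e)"

text \<open>Local nilpotency of e gives that of \<open>fB 1 f\<close>, which the reflection turns
  into the condition on the new B e; the new B f is nilpotent because \<open>B e\<close> was. Hence
  the root t is nilpotent by \<open>nil_t\<close>, and the inverse transform makes this t the new
  action of e.\<close>

lemma tw_steps:
  assumes O: "objO \<nu> p A B" and c: "c * c = 1" and \<nu>: "\<nu> (ad e f) \<noteq> 0" "\<nu>' (ad e f) \<noteq> 0" "\<And>x. x \<in> h ==> \<nu>' x = \<nu> (x - \<alpha> x *. ad e f)"
  shows "takiff_rep g h n' \<alpha> e f \<rho> \<nu> p A B"
    "takiff_rep g h n' \<alpha> e f \<rho> \<nu> p (fourA 1 p A B) (fourB 1 p A B)"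
    "takiff_rep g h n' \<alpha> e f \<rho> \<nu>' p (\<lambda>x. fourA 1 p A B (sref c x)) (\<lambda>x. fourB 1 p A B (sref c x))"
    "objO \<nu>' p (twA c p A B) (twB c p A B)"
proof -
  have tr: "takiff_rep g h n' \<alpha> e f \<rho> \<kappa> p C D" if "base \<kappa> p C D" "\<kappa> (ad e f) \<noteq> 0" for \<kappa> C D
    using that by unfold_locales
  show M: "takiff_rep g h n' \<alpha> e f \<rho> \<nu> p A B" using O \<nu>(1) by (intro tr) (simp_all add: objO_def)
  interpret M: takiff_rep g h n' \<alpha> e f \<rho> \<nu> p A B by (rule M)
  have ne: "nilS p (A e)" using O by (simp add: objO_def)
  have b1: "base \<nu> p (fourA 1 p A B) (fourB 1 p A B)" by (rule M.four_base) (simp_all add: ne)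
  show "takiff_rep g h n' \<alpha> e f \<rho> \<nu> p (fourA 1 p A B) (fourB 1 p A B)" using b1 \<nu>(1) by (rule tr)
  have b2: "base \<nu>' p (\<lambda>x. fourA 1 p A B (sref c x)) (\<lambda>x. fourB 1 p A B (sref c x)) \<and> nilS p (fourB 1 p A B (sref c f))"
    by (rule sref_base[OF c b1 M.four_Bf[OF ne] \<nu>(3)])
  thus N: "takiff_rep g h n' \<alpha> e f \<rho> \<nu>' p (\<lambda>x. fourA 1 p A B (sref c x)) (\<lambda>x. fourB 1 p A B (sref c x))" by (intro tr \<nu>(2)) simp
  interpret N: takiff_rep g h n' \<alpha> e f \<rho> \<nu>' p "\<lambda>x. fourA 1 p A B (sref c x)" "\<lambda>x. fourB 1 p A B (sref c x)" by (rule N)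
  have nt: "nilS p N.t" by (rule N.nil_t) (use b2 in simp)
  have s: "(-1) * (-1) = (1::complex)" by simp
  have "base \<nu>' p (twA c p A B) (twB c p A B)" unfolding twA_def twB_def by (rule N.four_base[OF s]) (simp add: nt)
  moreover have "twA c p A B e = N.t" unfolding twA_def N.fA_e[OF s] by simp
  ultimately show "objO \<nu>' p (twA c p A B) (twB c p A B)" by (simp add: objO_def nt)
qed

text \<open>The transform of the second twist undoes the last transform of the first,
  \<open>sref (- c)\<close> then cancels \<open>sref c\<close>, and the remaining two transforms
  cancel.\<close>

lemma tw_tw:
  assumes "objO \<nu> p A B" "c * c = 1" "\<nu> (ad e f) \<noteq> 0" "\<nu>' (ad e f) \<noteq> 0" "\<And>x. x \<in> h ==> \<nu>' x = \<nu> (x - \<alpha> x *. ad e f)" and a: "a \<in> g"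
  shows "twA (- c) p (twA c p A B) (twB c p A B) a = A a" "twB (- c) p (twA c p A B) (twB c p A B) a = B a"
proof -
  note T = tw_steps[OF assms(1-5)]
  interpret M: takiff_rep g h n' \<alpha> e f \<rho> \<nu> p A B by (rule T(1))
  interpret N: takiff_rep g h n' \<alpha> e f \<rho> \<nu>' p "\<lambda>x. fourA 1 p A B (sref c x)" "\<lambda>x. fourB 1 p A B (sref c x)" by (rule T(3))
  have s: "(-1) * (-1) = (1::complex)" "1 * 1 = (1::complex)" by simp_all
  have ss: "sref c (sref (- c) x) = x" for x using sref_sref[of "- c" x] by simp
  have 1: "fourA 1 p (twA c p A B) (twB c p A B) (sref (- c) x) = fourA 1 p A B x"
    "fourB 1 p (twA c p A B) (twB c p A B) (sref (- c) x) = fourB 1 p A B x" if "x \<in> g" for x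
    using N.four_four[OF s(1) sref_g[OF that, of "- c"]] by (simp_all add: twA_def twB_def ss)
  show "twA (- c) p (twA c p A B) (twB c p A B) a = A a" "twB (- c) p (twA c p A B) (twB c p A B) a = B a"
    unfolding twA_def[of "- c"] twB_def[of "- c"]
    using four_cong[of "\<lambda>x. fourA 1 p (twA c p A B) (twB c p A B) (sref (- c) x)" "fourA 1 p A B"
      "\<lambda>x. fourB 1 p (twA c p A B) (twB c p A B) (sref (- c) x)" "fourB 1 p A B", OF 1 a] M.four_four[OF s(2) a] by simp_all
qed

lemma four_natural:
  assumes "takiff_rep g h n' \<alpha> e f \<rho> \<nu> p A B" "takiff_rep g h n' \<alpha> e f \<rho> \<nu> p' A' B'"
    and Z: "p' * Z = Z" "Z * p = Z" "\<And>a. a \<in> g ==> Z * A a = A' a * Z" "\<And>a. a \<in> g ==> Z * B a = B' a * Z" and a: "a \<in> g"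
  shows "Z * fourA s p A B a = fourA s p' A' B' a * Z" "Z * fourB s p A B a = fourB s p' A' B' a * Z"
proof -
  interpret M: takiff_rep g h n' \<alpha> e f \<rho> \<nu> p A B by fact
  interpret N: takiff_rep g h n' \<alpha> e f \<rho> \<nu> p' A' B' by fact
  have t: "Z * M.t = N.t * Z"
    by (rule quad_intertwine[OF M.W.wdata_axioms N.W.wdata_axioms M.quad N.quad]) (simp_all add: Z e_g f_g H_g)
  show "Z * fourA s p A B a = fourA s p' A' B' a * Z" "Z * fourB s p A B a = fourB s p' A' B' a * Z"
    unfolding fourA_def fourB_def
    by (rule fourier_intertwine[OF M.P.weyl_pair_axioms N.P.weyl_pair_axioms _ t];
        simp add: Z a e_g M.nilp N.nilp)+
qed

lemma tw_natural:
  assumes O: "objO \<nu> p A B" "objO \<nu> p' A' B'" and c: "c * c = 1" "\<nu> (ad e f) \<noteq> 0" "\<nu>' (ad e f) \<noteq> 0" "\<And>x. x \<in> h ==> \<nu>' x = \<nu> (x - \<alpha> x *. ad e f)"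
    and Z: "p' * Z = Z" "Z * p = Z" "\<And>a. a \<in> g ==> Z * A a = A' a * Z" "\<And>a. a \<in> g ==> Z * B a = B' a * Z" and a: "a \<in> g"
  shows "Z * twA c p A B a = twA c p' A' B' a * Z" "Z * twB c p A B a = twB c p' A' B' a * Z"
proof -
  note T = tw_steps[OF O(1) c] and T' = tw_steps[OF O(2) c]
  have 1: "Z * fourA 1 p A B (sref c a) = fourA 1 p' A' B' (sref c a) * Z" "Z * fourB 1 p A B (sref c a) = fourB 1 p' A' B' (sref c a) * Z" if "a \<in> g" for a
    by (rule four_natural[OF T(1) T'(1) Z sref_g[OF that]]; assumption)+
  show "Z * twA c p A B a = twA c p' A' B' a * Z" "Z * twB c p A B a = twB c p' A' B' a * Z"
    unfolding twA_def twB_def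
    by (rule four_natural[OF T(3) T'(3) Z(1,2) 1 a]; assumption)+
qed

lemma base_cong:
  assumes AB: "\<And>a. a \<in> g ==> A a = A' a" "\<And>a. a \<in> g ==> B a = B' a" and b: "base \<nu> p A B"
  shows "base \<nu> p A' B'"
proof -
  have g: "a + b \<in> g" "ad a b \<in> g" "d *. a \<in> g" if "a \<in> g" "b \<in> g" for a b d
    using that g_subspace g_ad by (auto intro: cv.subspace_add cv.subspace_scale)
  have "irep p A B ==> irep p A' B'" unfolding irep_def by (simp add: AB g flip: AB)
  moreover have "wspan p A = wspan p A'" unfolding wspan_def using AB h_g by (simp add: subset_iff cong: conj_cong)
  moreover have "fgen p A B = fgen p A' B'" unfolding fgen_def by (simp add: AB)
  moreover have "A ` n' = A' ` n'" "B ` n' = B' ` n'" using AB n'_g by (auto simp: subset_iff intro!: image_cong)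
  moreover have "B x = B' x" if "x \<in> h" for x using AB h_g that by blast
  ultimately show ?thesis using b AB(2)[OF e_g] unfolding base_def by simp
qed

end

section \<open>Passage between the Takiff algebra and pairs of operators\<close>

lemma takiff_simps: "lset (takiff gc) = gc \<times> gc" "lscale (takiff gc) d (x, y) = (mscale d x, mscale d y)"
  "lbracket (takiff gc) (x, y) (x', y') = (mbracket x x', mbracket x y' + mbracket y x')"
  by (simp_all add: takiff_def)

lemma mx_of_simps: "mx_of (a + b) = mx_of a + mx_of b" "mx_of (mscale c a) = c *. mx_of a" "mx_of 0 = 0"
  "mx_of (mbracket a b) = ad (mx_of a) (mx_of b)"
  by (simp_all add: mat_of_inject[symmetric] mscale_eq_cscale flip: mbracket_mx)

locale takiff_setup = root_setup "mxs gc" "mxs hc" n' \<alpha> e f \<rho>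
  for gc hc :: "'n::finite cmat set" and n' \<alpha> e f \<rho>
begin

abbreviation "gg \<equiv> mxs gc"
abbreviation "L \<equiv> takiff gc"

lemma gc_closed: "x \<in> gc ==> y \<in> gc ==> x + y \<in> gc" "x \<in> gc ==> mscale c x \<in> gc" "x \<in> gc ==> y \<in> gc ==> mbracket x y \<in> gc" "0 \<in> gc"
  using cv.subspace_add[OF g_subspace, of "mx_of x" "mx_of y"] cv.subspace_scale[OF g_subspace, of "mx_of x" c]
    g_ad[of "mx_of x" "mx_of y"] cv.subspace_0[OF g_subspace] mbracket_mx[of "mx_of x" "mx_of y"]
  by (simp_all add: mscale_eq_cscale)

sublocale lie_closed L
  by unfold_locales (auto simp: takiff_simps gc_closed)

definition AX :: "('n cmat \<times> 'n cmat => 'b endo) => ('n, 'b) ops" where "AX X a = X (mat_of a, 0)"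
definition BX :: "('n cmat \<times> 'n cmat => 'b endo) => ('n, 'b) ops" where "BX X a = X (0, mat_of a)"

lemma lrep_irep: assumes "p * p = p" "lrep L p X" shows "irep p (AX X) (BX X)"
proof -
  have l: "x \<in> lset L ==> p * X x = X x \<and> X x * p = X x" "x \<in> lset L ==> y \<in> lset L ==> X (x + y) = X x + X y"
    "x \<in> lset L ==> y \<in> lset L ==> X (lbracket L x y) = ad (X x) (X y)" "x \<in> lset L ==> X (lscale L c x) = c *. X x" for x y c
    using assms(2) by (simp_all add: lrep_def)
  have z: "X (0, 0) = 0" using l(4)[of "(0, 0)" 0] gc_closed(4) by (simp add: takiff_simps mscale_eq_cscale)
  have m: "mbracket x 0 = 0" "mbracket 0 x = 0" "mscale c 0 = 0" for x :: "'n cmat" and c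
    by (simp_all add: mbracket_def mscale_eq_cscale)
  show ?thesis unfolding irep_def
  proof (intro conjI ballI allI)
    fix a assume a: "a \<in> gg"
    show "p * AX X a = AX X a" "AX X a * p = AX X a" "p * BX X a = BX X a" "BX X a * p = BX X a"
      using l(1)[of "(mat_of a, 0)"] l(1)[of "(0, mat_of a)"] a gc_closed(4) by (simp_all add: AX_def BX_def takiff_simps)
    show "AX X (c *. a) = c *. AX X a" "BX X (c *. a) = c *. BX X a" for c
      using l(4)[of "(mat_of a, 0)" c] l(4)[of "(0, mat_of a)" c] a gc_closed(4)
      by (simp_all add: AX_def BX_def takiff_simps m mscale_eq_cscale)
    fix b assume b: "b \<in> gg"
    show "AX X (a + b) = AX X a + AX X b" "BX X (a + b) = BX X a + BX X b"
      using l(2)[of "(mat_of a, 0)" "(mat_of b, 0)"] l(2)[of "(0, mat_of a)" "(0, mat_of b)"] a b gc_closed(4)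
      by (simp_all add: AX_def BX_def takiff_simps)
    show "AX X (ad a b) = ad (AX X a) (AX X b)" "BX X (ad a b) = ad (AX X a) (BX X b)" "ad (BX X a) (BX X b) = 0"
      using l(3)[of "(mat_of a, 0)" "(mat_of b, 0)"] l(3)[of "(mat_of a, 0)" "(0, mat_of b)"] l(3)[of "(0, mat_of a)" "(0, mat_of b)"] a b gc_closed(4)
      by (simp_all add: AX_def BX_def takiff_simps m mbracket_mx z)
  qed (rule assms(1))
qed

definition XAB :: "('n, 'b) ops => ('n, 'b) ops => 'n cmat \<times> 'n cmat => 'b endo" where
  "XAB A B = (\<lambda>(x, y). A (mx_of x) + B (mx_of y))"

lemma irep_lrep: assumes i: "irep p A B" shows "lrep L p (XAB A B)"
proof -
  have m: "mx_of x \<in> gg" if "x \<in> gc" for x using that by simp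
  note i' = irepD[OF i]
  have br: "ad (A a) (A a') + B (ad a b' + ad b a') = ad (A a + B b) (A a' + B b')"
    if "a \<in> gg" "b \<in> gg" "a' \<in> gg" "b' \<in> gg" for a b a' b'
  proof -
    have "ad (A a + B b) (A a' + B b') = ad (A a) (A a') + ad (A a) (B b') + (ad (B b) (A a') + ad (B b) (B b'))"
      by (simp add: ad_def algebra_simps)
    thus ?thesis
      by (simp only: i'(7)[OF g_ad[OF that(1,4)] g_ad[OF that(2,3)]] i'(11)[OF that(1,4)] i'(12)[OF that(2,4)] i'(13)[OF that(2,3)] add.assoc add_0_right)
  qed
  show ?thesis unfolding lrep_def
    by (auto simp: takiff_simps XAB_def mx_of_simps distrib_left distrib_right i'(2-10) br cscale_simps add_ac)
qed

lemma XAB_X: assumes "lrep L p X" "x \<in> lset L" shows "XAB (AX X) (BX X) x = X x"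
proof -
  obtain a b where x: "x = (a, b)" "a \<in> gc" "b \<in> gc" using assms(2) by (auto simp: takiff_simps)
  hence "X ((a, 0) + (0, b)) = X (a, 0) + X (0, b)"
    using assms(1) gc_closed(4) by (simp only: lrep_def takiff_simps) blast
  thus ?thesis by (simp add: x(1) XAB_def AX_def BX_def)
qed

lemma AX_XAB: assumes "irep p A B" shows "AX (XAB A B) a = A a" "BX (XAB A B) a = B a"
proof -
  have "A (0 *. e) = 0 *. A e" "B (0 *. e) = 0 *. B e" using assms e_g by (simp_all only: irep_def)
  hence "A 0 = 0" "B 0 = 0" by simp_all
  thus "AX (XAB A B) a = A a" "BX (XAB A B) a = B a"
    by (simp_all add: AX_def BX_def XAB_def mx_of_simps mat_of_inverse)
qed

definition Q :: "('n mx => complex) => 'b endo => ('n cmat \<times> 'n cmat => 'b endo) => bool" where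
  "Q \<nu> p X \<longleftrightarrow> objO \<nu> p (AX X) (BX X)"

definition tX :: "complex => 'b endo => ('n cmat \<times> 'n cmat => 'b endo) => 'n cmat \<times> 'n cmat => 'b endo" where
  "tX c p X = XAB (twA c p (AX X) (BX X)) (twB c p (AX X) (BX X))"

lemma X_cong: assumes "\<And>x. x \<in> lset L ==> X x = Y x" "a \<in> gg" shows "AX X a = AX Y a" "BX X a = BX Y a"
  using assms gc_closed(4) by (simp_all add: AX_def BX_def takiff_simps)

lemma twist_functor_tX:
  fixes \<nu> \<nu>' :: "'n mx => complex"
  assumes c: "c * c = 1" "\<nu> (ad e f) \<noteq> 0" "\<nu>' (ad e f) \<noteq> 0" "\<And>x. x \<in> mxs hc ==> \<nu>' x = \<nu> (x - \<alpha> x *. ad e f)"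
  shows "twist_functor (Q \<nu>) (Q \<nu>' :: 'b endo => _) (tX c)"
  unfolding twist_functor_def
proof (intro conjI allI impI ballI)
  fix p :: "'b endo" and X Y :: "'n cmat \<times> 'n cmat => 'b endo"
  assume XY: "\<forall>x\<in>lset L. X x = Y x"
  have XY': "X x = Y x" if "x \<in> lset L" for x using XY that by blast
  have AB: "AX X a = AX Y a" "BX X a = BX Y a" if "a \<in> gg" for a by (rule X_cong[OF XY' that]; assumption)+
  { assume q: "Q \<nu>' p X"
    have "base \<nu>' p (AX Y) (BX Y)" by (rule base_cong[OF AB]) (use q in \<open>simp_all add: Q_def objO_def\<close>)
    thus "Q \<nu>' p Y" using q AB(1)[OF e_g] by (simp add: Q_def objO_def) }
  show "tX c p X x = tX c p Y x" if xL: "x \<in> lset L" for x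
  proof -
    obtain a b where x: "x = (a, b)" "a \<in> gc" "b \<in> gc" using xL by (auto simp: takiff_simps)
    hence "mx_of a \<in> gg" "mx_of b \<in> gg" by simp_all
    thus ?thesis unfolding tX_def XAB_def x(1)
      using tw_cong[OF AB] by simp
  qed
next
  fix p :: "'b endo" and X :: "'n cmat \<times> 'n cmat => 'b endo"
  assume "p * p = p" "lrep L p X" "Q \<nu> p X"
  hence o: "objO \<nu>' p (twA c p (AX X) (BX X)) (twB c p (AX X) (BX X))"
    unfolding Q_def by (intro tw_steps(4)[OF _ c])
  hence i: "irep p (twA c p (AX X) (BX X)) (twB c p (AX X) (BX X))" by (simp add: objO_def base_def)
  have eq: "AX (tX c p X) = twA c p (AX X) (BX X)" "BX (tX c p X) = twB c p (AX X) (BX X)"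
    unfolding tX_def by (rule ext, rule AX_XAB[OF i])+
  show "lrep L p (tX c p X)" unfolding tX_def by (rule irep_lrep[OF i])
  show "Q \<nu>' p (tX c p X)" unfolding Q_def eq by (rule o)
next
  fix p p' Z :: "'b endo" and X X' :: "'n cmat \<times> 'n cmat => 'b endo" and x
  assume q: "Q \<nu> p X" "Q \<nu> p' X'" and Z: "p' * Z = Z" "Z * p = Z" "\<forall>x\<in>lset L. Z * X x = X' x * Z" and x: "x \<in> lset L"
  have Z': "Z * AX X a = AX X' a * Z" "Z * BX X a = BX X' a * Z" if "a \<in> gg" for a
    using Z(3) that gc_closed(4) by (simp_all add: AX_def BX_def takiff_simps)
  obtain a b where x: "x = (a, b)" "a \<in> gc" "b \<in> gc" using x by (auto simp: takiff_simps)
  hence ab: "mx_of a \<in> gg" "mx_of b \<in> gg" by simp_all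
  have N: "Z * twA c p (AX X) (BX X) a = twA c p' (AX X') (BX X') a * Z" "Z * twB c p (AX X) (BX X) a = twB c p' (AX X') (BX X') a * Z"
    if "a \<in> gg" for a
    by (rule tw_natural[OF q[unfolded Q_def] c Z(1,2) Z' that]; assumption)+
  show "Z * tX c p X x = tX c p' X' x * Z"
    unfolding tX_def XAB_def x(1) by (simp add: distrib_left distrib_right N(1)[OF ab(1)] N(2)[OF ab(2)])
qed

lemma tX_tX:
  assumes c: "c * c = 1" "\<nu> (ad e f) \<noteq> 0" "\<nu>' (ad e f) \<noteq> 0" "\<And>x. x \<in> mxs hc ==> \<nu>' x = \<nu> (x - \<alpha> x *. ad e f)"
    and l: "lrep L p X" and q: "Q \<nu> p X" and x: "x \<in> lset L"
  shows "tX (- c) p (tX c p X) x = X x"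
proof -
  have o: "objO \<nu> p (AX X) (BX X)" using q by (simp add: Q_def)
  have "objO \<nu>' p (twA c p (AX X) (BX X)) (twB c p (AX X) (BX X))" by (rule tw_steps(4)[OF o c])
  hence i: "irep p (twA c p (AX X) (BX X)) (twB c p (AX X) (BX X))" by (simp add: objO_def base_def)
  have eq: "AX (tX c p X) = twA c p (AX X) (BX X)" "BX (tX c p X) = twB c p (AX X) (BX X)"
    unfolding tX_def by (rule ext, rule AX_XAB[OF i])+
  obtain a b where ab: "x = (a, b)" "a \<in> gc" "b \<in> gc" using x by (auto simp: takiff_simps)
  hence m: "mx_of a \<in> gg" "mx_of b \<in> gg" by simp_all
  have tt: "twA (- c) p (twA c p (AX X) (BX X)) (twB c p (AX X) (BX X)) a = AX X a"
    "twB (- c) p (twA c p (AX X) (BX X)) (twB c p (AX X) (BX X)) a = BX X a" if "a \<in> gg" for a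
    by (rule tw_tw[OF o c that]; assumption)+
  have "tX (- c) p (tX c p X) x = XAB (AX X) (BX X) x"
    unfolding tX_def[of "- c"] eq XAB_def ab(1) using tt(1)[OF m(1)] tt(2)[OF m(2)] by simp
  thus ?thesis unfolding XAB_X[OF l x] .
qed

theorem equivalent_mcat_Q:
  fixes \<nu> \<nu>' :: "'n mx => complex"
  assumes "\<nu> (ad e f) \<noteq> 0" "\<nu>' (ad e f) \<noteq> 0" "\<And>x. x \<in> mxs hc ==> \<nu>' x = \<nu> (x - \<alpha> x *. ad e f)"
    "\<And>x. x \<in> mxs hc ==> \<nu> x = \<nu>' (x - \<alpha> x *. ad e f)"
  shows "equivalent_categories (mcat L (Q \<nu> :: 'b endo => _)) (mcat L (Q \<nu>' :: 'b endo => _))"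
proof (rule equivalent_mcat)
  show "twist_functor (Q \<nu>) (Q \<nu>') (tX 1)" by (rule twist_functor_tX[OF _ assms(1,2,3)]) simp_all
  show "twist_functor (Q \<nu>') (Q \<nu>) (tX (- 1))" by (rule twist_functor_tX[OF _ assms(2,1,4)]) simp_all
  show "tX (- 1) p (tX 1 p X) x = X x" if "lrep L p X" "Q \<nu> p X" "x \<in> lset L" for p X x
    by (rule tX_tX[OF _ assms(1,2,3) that]) simp_all
  show "tX 1 p (tX (- 1) p X) x = X x" if "lrep L p X" "Q \<nu>' p X" "x \<in> lset L" for p X x
    using tX_tX[OF _ assms(2,1,4) that, of "- 1"] by simp
qed

end

section \<open>Local finiteness\<close>

definition lfin :: "'b endo => 'b endo set => bool" where
  "lfin p N \<longleftrightarrow> (\<forall>v. \<exists>T. finite T \<and> (\<forall>s\<in>T. p $$ s = s) \<and> p $$ v \<in> cv.span T \<and> (\<forall>x\<in>N. \<forall>w\<in>cv.span T. x $$ w \<in> cv.span T))"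

lemma p_span: "(\<And>s. s \<in> T ==> p $$ s = s) ==> w \<in> cv.span T ==> p $$ w = w"
proof -
  assume "\<And>s. s \<in> T ==> p $$ s = s" "w \<in> cv.span T"
  moreover have "cv.subspace {w. p $$ w = w}" by (rule cv.subspaceI) (auto simp: eapp_linear)
  ultimately have "cv.span T \<subseteq> {w. p $$ w = w}" by (intro cv.span_minimal) auto
  thus ?thesis using \<open>w \<in> _\<close> by blast
qed

text \<open>The vectors x^i s with i below a common order of nilpotency are added for one operator
  at a time; commutativity keeps stability under the earlier ones. The last clause confines the new
  vectors to any stable subspace that contains \<open>S\<close>, such as a step of a
  filtration.\<close>

lemma comm_closure:
  assumes "finite N" "\<And>x. x \<in> N ==> p * x = x" "\<And>x y. x \<in> N ==> y \<in> N ==> x * y = y * x" "\<And>x. x \<in> N ==> nilS p x"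
    and S: "finite S" "\<And>s. s \<in> S ==> p $$ s = s"
  shows "\<exists>T. finite T \<and> S \<subseteq> cv.span T \<and> (\<forall>s\<in>T. p $$ s = s) \<and> (\<forall>x\<in>N. \<forall>w\<in>cv.span T. x $$ w \<in> cv.span T)
    \<and> (\<forall>F. cv.subspace F --> (\<forall>x\<in>N. \<forall>w\<in>F. x $$ w \<in> F) --> S \<subseteq> F --> T \<subseteq> F)"
  using assms(1-4)
proof (induction N)
  case empty
  show ?case by (intro exI[of _ S]) (use S in \<open>auto intro: cv.span_base\<close>)
next
  case (insert x N)
  obtain T where T: "finite T" "S \<subseteq> cv.span T" "\<forall>s\<in>T. p $$ s = s" "\<forall>y\<in>N. \<forall>w\<in>cv.span T. y $$ w \<in> cv.span T"
    "\<And>F. cv.subspace F ==> (\<forall>y\<in>N. \<forall>w\<in>F. y $$ w \<in> F) ==> S \<subseteq> F ==> T \<subseteq> F"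
    using insert.IH insert.prems by blast
  have px: "p * x = x" and nx: "nilS p x" using insert.prems by simp_all
  have "\<forall>s\<in>T. \<exists>k. (x ^ k) $$ s = 0" using nx T(3) unfolding nilS_def by metis
  then obtain k where k: "\<forall>s\<in>T. (x ^ k s) $$ s = 0" by metis
  define m where "m = Max (insert 0 (k ` T))"
  have xm: "(x ^ m) $$ s = 0" if s: "s \<in> T" for s
  proof -
    have "k s \<le> m" unfolding m_def using T(1) s by (intro Max_ge) auto
    hence "x ^ m = x ^ (m - k s) * x ^ k s" by (simp flip: power_add)
    thus ?thesis using k s by (simp add: eapp_linear)
  qed
  let ?T = "(\<lambda>(i, s). (x ^ i) $$ s) ` ({..m} \<times> T)"
  have gen: "(x ^ i) $$ s \<in> cv.span ?T" if "s \<in> T" for i s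
  proof (cases "i \<le> m")
    case True
    thus ?thesis using that by (intro cv.span_base) (auto intro!: image_eqI[of _ _ "(i, s)"])
  next
    case False
    hence "x ^ i = x ^ (i - m) * x ^ m" by (simp flip: power_add)
    thus ?thesis using xm[OF that] by (simp add: eapp_linear cv.span_zero)
  qed
  have genw: "(x ^ i) $$ w \<in> cv.span ?T" if "w \<in> cv.span T" for i w
    by (rule endo_span[OF cv.subspace_span gen that])
  have "finite ?T" using T(1) by simp
  moreover have "S \<subseteq> cv.span ?T" using T(2) genw[of _ 0] by auto
  moreover have "\<forall>s\<in>?T. p $$ s = s"
  proof
    fix u assume "u \<in> ?T"
    then obtain i s where u: "u = (x ^ i) $$ s" "s \<in> T" by auto
    show "p $$ u = u" unfolding u(1) using T(3) u(2) app_eq[OF px] by (cases i) simp_all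
  qed
  moreover have "\<forall>y\<in>insert x N. \<forall>w\<in>cv.span ?T. y $$ w \<in> cv.span ?T"
  proof (intro ballI)
    fix y w assume y: "y \<in> insert x N" and w: "w \<in> cv.span ?T"
    show "y $$ w \<in> cv.span ?T"
    proof (rule endo_span[OF cv.subspace_span _ w])
      fix u assume "u \<in> ?T"
      then obtain i s where u: "u = (x ^ i) $$ s" "s \<in> T" by auto
      show "y $$ u \<in> cv.span ?T"
      proof (cases "y = x")
        case True
        thus ?thesis using gen[OF u(2), of "Suc i"] by (simp add: u(1))
      next
        case False
        have xy: "y * x = x * y" using insert.prems(2)[OF y] by simp
        have "y * x ^ i = x ^ i * y" by (induction i) (simp_all, metis mult.assoc xy)
        from app_eq[OF this, of s] have "y $$ u = (x ^ i) $$ y $$ s" by (simp add: u(1))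
        moreover have "y $$ s \<in> cv.span T" using T(4) False y u(2) by (auto intro: cv.span_base)
        ultimately show ?thesis using genw by simp
      qed
    qed
  qed
  moreover have "\<forall>F. cv.subspace F --> (\<forall>x\<in>insert x N. \<forall>w\<in>F. x $$ w \<in> F) --> S \<subseteq> F --> ?T \<subseteq> F"
  proof (intro allI impI subsetI)
    fix F u assume F: "cv.subspace F" "\<forall>x\<in>insert x N. \<forall>w\<in>F. x $$ w \<in> F" "S \<subseteq> F" and "u \<in> ?T"
    then obtain i s where u: "u = (x ^ i) $$ s" "s \<in> T" by auto
    have "s \<in> F" using T(5)[OF F(1)] F(2,3) u(2) by blast
    thus "u \<in> F" unfolding u(1) using F(2) by (induction i) auto
  qed
  ultimately show ?case by blast
qed

definition espace :: "'b endo => 'b endo => (complex => bool) => 'b free set" where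
  "espace p R P = cv.span {v. p $$ v = v \<and> (\<exists>c. P c \<and> R $$ v = c *. v)}"

lemma espace_subspace: "cv.subspace (espace p R P)" unfolding espace_def by (rule cv.subspace_span)

lemma espace_mono: "(\<And>c. P c ==> P' c) ==> espace p R P \<subseteq> espace p R P'"
  unfolding espace_def by (rule cv.span_mono) blast

text \<open>Indexing by eigenvalues and extending by 0 lets two expansions be added or compared over
  the union of their index sets.\<close>

lemma espace_sum: assumes "v \<in> espace p R P"
  shows "\<exists>C u. finite C \<and> (\<forall>c\<in>C. P c) \<and> (\<forall>c. R $$ u c = c *. u c) \<and> v = (\<Sum>c\<in>C. u c) \<and> (\<forall>c. c \<notin> C --> u c = 0)"
  using assms unfolding espace_def
proof (induction rule: cv.span_induct)
  case base
  let ?S = "{v. \<exists>C u. finite C \<and> (\<forall>c\<in>C. P c) \<and> (\<forall>c. R $$ u c = c *. u c) \<and> v = (\<Sum>c\<in>C. u c) \<and> (\<forall>c. c \<notin> C --> u c = 0)}"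
  show ?case
  proof (rule cv.subspaceI)
    show "0 \<in> ?S"
      by (auto intro!: exI[of _ "{}"] exI[of _ "\<lambda>_. 0"] simp: eapp_linear)
  next
    fix x y assume "x \<in> ?S"
      "y \<in> ?S"
    then obtain C u D w where C: "finite C" "\<forall>c\<in>C. P c" "\<forall>c. R $$ u c = c *. u c" "x = (\<Sum>c\<in>C. u c)" "\<forall>c. c \<notin> C --> u c = 0"
      and D: "finite D" "\<forall>c\<in>D. P c" "\<forall>c. R $$ w c = c *. w c" "y = (\<Sum>c\<in>D. w c)" "\<forall>c. c \<notin> D --> w c = 0" by blast
    have s: "x = (\<Sum>c\<in>C \<union> D. u c)" "y = (\<Sum>c\<in>C \<union> D. w c)" unfolding C(4) D(4)
      by (rule sum.mono_neutral_left; use C D in auto)+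
    show "x + y \<in> ?S"
      by (intro CollectI exI[of _ "C \<union> D"] exI[of _ "\<lambda>c. u c + w c"])
        (use C(1-3,5) D(1-3,5) s in \<open>auto simp: sum.distrib eapp_linear cscale_add_right\<close>)
  next
    fix d x assume "x \<in> ?S"
    then obtain C u where C: "finite C" "\<forall>c\<in>C. P c" "\<forall>c. R $$ u c = c *. u c" "x = (\<Sum>c\<in>C. u c)" "\<forall>c. c \<notin> C --> u c = 0" by blast
    thus "d *. x \<in> ?S"
      by (intro CollectI exI[of _ C] exI[of _ "\<lambda>c. d *. u c"]) (auto simp: cv.scale_sum_right eapp_linear cscale_cscale mult.commute)
  qed
next
  case (step v)
  then obtain c where c: "P c" "R $$ v = c *. v" by blast
  thus ?case by (intro exI[of _ "{c}"] exI[of _ "\<lambda>d. if d = c then v else 0"]) (auto simp: eapp_linear)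
qed

lemma espace_disjoint: assumes "v \<in> espace p R P" "v \<in> espace p R P'" "\<And>c. P c ==> P' c ==> False" shows "v = 0"
proof -
  obtain C u where C: "finite C" "\<forall>c\<in>C. P c" "\<forall>c. R $$ u c = c *. u c" "v = (\<Sum>c\<in>C. u c)" "\<forall>c. c \<notin> C --> u c = 0"
    using espace_sum[OF assms(1)] by blast
  obtain D w where D: "finite D" "\<forall>c\<in>D. P' c" "\<forall>c. R $$ w c = c *. w c" "v = (\<Sum>c\<in>D. w c)" "\<forall>c. c \<notin> D --> w c = 0"
    using espace_sum[OF assms(2)] by blast
  have "(\<Sum>c\<in>C. u c) = (\<Sum>c\<in>C \<union> D. u c)" "(\<Sum>c\<in>D. w c) = (\<Sum>c\<in>C \<union> D. w c)"
    by (rule sum.mono_neutral_left; use C(1,5) D(1,5) in auto)+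
  hence s: "v = (\<Sum>c\<in>C \<union> D. u c)" "v = (\<Sum>c\<in>C \<union> D. w c)" using C(4) D(4) by simp_all
  have z: "(\<Sum>c\<in>C \<union> D. u c - w c) \<in> {0}" using s by (simp add: sum_subtractf)
  have "\<forall>c\<in>C \<union> D. u c - w c \<in> {0}"
    by (rule eigen_component_mem[OF clin_eapp[of R] _ _ _ _ z])
      (use C(1,3) D(1,3) in \<open>auto simp: eapp_linear cscale_simps cv.subspace_def\<close>)
  moreover have "w c = 0" if "c \<in> C" for c using that C(2) D(2,5) assms(3) by blast
  ultimately have "u c = 0" if "c \<in> C" for c using that by auto
  thus ?thesis unfolding C(4) by simp
qed

context root_setup begin

definition npos :: "'n mx set" where "npos = {c *. e + y | c y. y \<in> n'}"

abbreviation "eig_ge p A r \<equiv> espace p (A \<rho>) (\<lambda>c. Re c \<ge> r)"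
abbreviation "eig_lt p A r \<equiv> espace p (A \<rho>) (\<lambda>c. Re c < r)"

lemma npos_mem: "0 \<in> npos" "e \<in> npos" "n' \<subseteq> npos"
proof -
  have "0 \<in> n'" by (rule cv.subspace_0[OF n'_subspace])
  moreover have "c *. e + y \<in> npos" if "y \<in> n'" for c y using that unfolding npos_def by blast
  from this[of _ 0] this[of 0 0] this[of 0 1] show "0 \<in> npos" "e \<in> npos" "n' \<subseteq> npos" using calculation by auto
qed

lemma npos_g: "npos \<subseteq> g"
  unfolding npos_def using cv.subspace_add[OF g_subspace] cv.subspace_scale[OF g_subspace] e_g n'_g by blast

lemma irep_subspace:
  assumes i: "irep p A B" and W: "cv.subspace W" shows "cv.subspace {y \<in> g. A y $$ w \<in> W \<and> B y $$ w \<in> W}"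
  using irepD[OF i] cv_sub[OF g_subspace]
    cv_sub[OF W]
  by (intro cv.subspaceI) auto

text \<open>\<open>npos\<close> is spanned by eigenvectors of \<open>ad \<rho>\<close> with
  eigenvalues at least 1. Weights are complex, so they are compared by their real parts.\<close>

lemma npos_raise:
  assumes i: "irep p A B" and z: "z \<in> npos" and v: "v \<in> eig_ge p A r"
  shows "A z $$ v \<in> eig_ge p A (r + 1)" "B z $$ v \<in> eig_ge p A (r + 1)"
proof -
  let ?E = "eig_ge p A (r + 1)"
  note E = espace_subspace[of p "A \<rho>" "\<lambda>c. Re c \<ge> r + 1"]
  have \<rho>g: "\<rho> \<in> g" using \<rho>_h h_g by blast
  let ?Y = "{y. y \<in> npos \<and> (\<exists>j::nat. j \<ge> 1 \<and> ad \<rho> y = of_nat j *. y)}"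
  have gen: "A y $$ v \<in> ?E \<and> B y $$ v \<in> ?E" if y: "y \<in> ?Y" for y
  proof -
    obtain j :: nat where j: "j \<ge> 1" "ad \<rho> y = of_nat j *. y" using y by blast
    have yg: "y \<in> g" using y npos_g by blast
    have Z: "Z $$ v \<in> ?E" if Z: "ad (A \<rho>) Z = of_nat j *. Z" "p * Z = Z" for Z
    proof (rule endo_span[OF E _ v[unfolded espace_def]])
      fix w assume "w \<in> {v. p $$ v = v \<and> (\<exists>c. Re c \<ge> r \<and> A \<rho> $$ v = c *. v)}"
      then obtain c where c: "p $$ w = w" "Re c \<ge> r" "A \<rho> $$ w = c *. w" by blast
      have "A \<rho> $$ Z $$ w = Z $$ A \<rho> $$ w + of_nat j *. (Z $$ w)" using app_eq[OF Z(1), of w] by (simp add: ad_def algebra_simps)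
      hence "A \<rho> $$ Z $$ w = (c + of_nat j) *. (Z $$ w)" by (simp add: c eapp_linear cscale_simps)
      moreover have "p $$ Z $$ w = Z $$ w" using app_eq[OF Z(2)] by simp
      moreover have "Re (c + of_nat j) \<ge> r + 1" using c(2) j(1) by simp
      ultimately show "Z $$ w \<in> ?E" unfolding espace_def by (intro cv.span_base) blast
    qed
    have "ad (A \<rho>) (A y) = of_nat j *. A y" "ad (A \<rho>) (B y) = of_nat j *. B y"
      using irepD(10,11)[OF i \<rho>g yg] irepD(8,9)[OF i yg, of "of_nat j"] j(2) by simp_all
    thus ?thesis using Z irepD(2,4)[OF i yg] by blast
  qed
  have "cv.subspace {y \<in> g. A y $$ v \<in> ?E \<and> B y $$ v \<in> ?E}"
    by (rule irep_subspace[OF i E])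
  moreover have "?Y \<subseteq> {y \<in> g. A y $$ v \<in> ?E \<and> B y $$ v \<in> ?E}" using gen npos_g by blast
  ultimately have "cv.span ?Y \<subseteq> {y \<in> g. A y $$ v \<in> ?E \<and> B y $$ v \<in> ?E}" by (intro cv.span_minimal)
  thus "A z $$ v \<in> ?E" "B z $$ v \<in> ?E" using z \<rho>_n[folded npos_def] by blast+
qed

lemma wspan_bounds:
  assumes "v \<in> wspan p A"
  shows "\<exists>r R. v \<in> eig_ge p A r \<and> v \<in> eig_lt p A R"
  using assms unfolding wspan_def
proof (induction rule: cv.span_induct)
  case base
  let ?S = "{v. \<exists>r R. v \<in> eig_ge p A r \<and> v \<in> eig_lt p A R}"
  show ?case
  proof (rule cv.subspaceI)
    show "0 \<in> ?S" using cv.subspace_0[OF espace_subspace] by blast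
    fix c x assume "x \<in> ?S"
    thus "c *. x \<in> ?S" using cv.subspace_scale[OF espace_subspace] by blast
  next
    fix x y assume "x \<in> ?S" "y \<in> ?S"
    then obtain r R r' R' where x: "x \<in> eig_ge p A r" "x \<in> eig_lt p A R"
      and y: "y \<in> eig_ge p A r'" "y \<in> eig_lt p A R'" by blast
    have "x + y \<in> eig_ge p A (min r r')" "x + y \<in> eig_lt p A (max R R')"
      by (rule cv.subspace_add[OF espace_subspace];
          (rule subsetD[OF espace_mono x(1)] subsetD[OF espace_mono y(1)] subsetD[OF espace_mono x(2)] subsetD[OF espace_mono y(2)]; simp))+
    thus "x + y \<in> ?S" by blast
  qed
next
  case (step v)
  then obtain l where l: "p $$ v = v" "A \<rho> $$ v = l *. v" using \<rho>_h by blast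
  have "v \<in> eig_ge p A (Re l)" "v \<in> eig_lt p A (Re l + 1)"
    unfolding espace_def by (rule cv.span_base, use l in force)+
  thus ?case by blast
qed

lemma wk_power: "x \<in> N ==> v \<in> wk eapp N k ==> (x ^ k) $$ v = 0"
  by (induction k arbitrary: v) (auto simp: power_Suc2 simp del: power_Suc)

text \<open>A finite-dimensional stable space has \<rho>-eigenvalues with real parts below some R.
  Each operator raises the real part by at least 1, so a vector starting above r is killed by any
  product of at least R - r of them.\<close>

lemma lfin_nil:
  assumes i: "irep p A B" and w: "\<And>v. p $$ v \<in> wspan p A" and l: "lfin p {A x + B y | x y. x \<in> npos \<and> y \<in> npos}"
  shows "\<exists>k. p $$ v \<in> wk eapp (A ` n' \<union> B ` n') k" "nilS p (A e)" "nilS p (B e)"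
proof -
  let ?N = "A ` npos \<union> B ` npos"
  note z = npos_mem(1)
  have key: "\<exists>k. p $$ v \<in> wk eapp ?N k" for v
  proof -
    obtain T where T: "finite T" "\<forall>s\<in>T. p $$ s = s" "p $$ v \<in> cv.span T"
      "\<forall>x\<in>{A x + B y | x y. x \<in> npos \<and> y \<in> npos}. \<forall>w\<in>cv.span T. x $$ w \<in> cv.span T"
      using spec[OF l[unfolded lfin_def], of v] by (elim exE conjE) (rule that)
    have st: "x $$ w \<in> cv.span T" if "x \<in> ?N" "w \<in> cv.span T" for x w
    proof -
      from that(1) obtain y where y: "y \<in> npos" "x = A y \<or> x = B y" by (elim UnE imageE) auto
      have "A y = A y + B 0" "B y = A 0 + B y" using irepD(14,15)[OF i] by simp_all
      hence "x \<in> {A x + B y | x y. x \<in> npos \<and> y \<in> npos}" using y z by blast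
      thus ?thesis using T(4) that(2) by blast
    qed
    have "\<exists>R. T \<subseteq> eig_lt p A R" using T(1,2)
    proof (induction T)
      case (insert s T)
      then obtain R where R: "T \<subseteq> eig_lt p A R" by auto
      have "s \<in> wspan p A" using w[of s] insert.prems by simp
      then obtain R' where R': "s \<in> eig_lt p A R'" using wspan_bounds by blast
      have "eig_lt p A R \<subseteq> eig_lt p A (max R R')"
        "eig_lt p A R' \<subseteq> eig_lt p A (max R R')" by (rule espace_mono; simp)+
      thus ?case using R R' by blast
    qed simp
    then obtain R where "T \<subseteq> eig_lt p A R" by blast
    hence R: "cv.span T \<subseteq> eig_lt p A R" by (rule cv.span_minimal[OF _ espace_subspace])
    have wk: "u \<in> cv.span T ==> u \<in> eig_ge p A (R - real k) ==> u \<in> wk eapp ?N k" for u k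
    proof (induction k arbitrary: u)
      case 0
      hence "u = 0" using R espace_disjoint[of u p "A \<rho>" "\<lambda>c. Re c \<ge> R" "\<lambda>c. Re c < R"] by force
      thus ?case by simp
    next
      case (Suc k)
      have "x $$ u \<in> wk eapp ?N k" if x: "x \<in> ?N" for x
      proof (rule Suc.IH[OF st[OF x Suc.prems(1)]])
        have "A y $$ u \<in> eig_ge p A (R - real k) \<and> B y $$ u \<in> eig_ge p A (R - real k)" if "y \<in> npos" for y
          using npos_raise[OF i that Suc.prems(2)] by (simp add: algebra_simps)
        thus "x $$ u \<in> eig_ge p A (R - real k)" using x by blast
      qed
      thus ?case by simp
    qed
    obtain r where r: "p $$ v \<in> eig_ge p A r" using wspan_bounds[OF w] by blast
    obtain k :: nat where "real k \<ge> R - r" using real_arch_simple by blast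
    hence "eig_ge p A r \<subseteq> eig_ge p A (R - real k)" by (intro espace_mono) linarith
    thus ?thesis using wk[OF T(3)] r by blast
  qed
  have "A ` n' \<union> B ` n' \<subseteq> ?N" using npos_mem(3) by blast
  from wk_antimono[OF this, of eapp] show "\<exists>k. p $$ v \<in> wk eapp (A ` n' \<union> B ` n') k" using key[of v] by blast
  have "A e \<in> ?N" "B e \<in> ?N" using npos_mem(2) by blast+
  moreover have "nilS p x" if x: "x \<in> ?N" for x unfolding nilS_def
  proof
    fix v
    obtain k where "p $$ v \<in> wk eapp ?N k" using key by blast
    hence "(x ^ k) $$ p $$ v = 0" by (rule wk_power[OF x])
    thus "\<exists>k. (x ^ k) $$ p $$ v = 0" by (rule exI)
  qed
  ultimately show "nilS p (A e)" "nilS p (B e)" by simp_all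
qed

text \<open>Induction along the filtration. A finite set is first closed under the commuting,
  locally nilpotent \<open>A e\<close> and \<open>B e\<close>, which preserve the step because e
  normalises \<open>n'\<close>. Generators of \<open>n'\<close> then carry it into the step below,
  where the induction hypothesis closes it up.\<close>

lemma nil_lfin:
  assumes i: "irep p A B" and n: "\<And>v. \<exists>k. p $$ v \<in> wk eapp (A ` n' \<union> B ` n') k" and e: "nilS p (A e)" "nilS p (B e)"
  shows "lfin p {A x + B y | x y. x \<in> npos \<and> y \<in> npos}"
proof -
  let ?N = "A ` n' \<union> B ` n'"
  obtain Y where Y: "finite Y" "Y \<subseteq> n'" "n' \<subseteq> cv.span Y" by (rule mx_finite_span[OF n'_subspace])
  let ?st = "\<lambda>T. \<forall>w\<in>cv.span T. A e $$ w \<in> cv.span T \<and> B e $$ w \<in> cv.span T \<and> (\<forall>y\<in>n'. A y $$ w \<in> cv.span T \<and> B y $$ w \<in> cv.span T)"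
  have ee: "A e * B e = B e * A e" using irepD(11)[OF i e_g e_g] irepD(15)[OF i] by (simp add: ad_eq_0)
  have lin: "A y $$ w \<in> W \<and> B y $$ w \<in> W" if W: "cv.subspace W" and "\<And>x. x \<in> A ` Y \<union> B ` Y ==> x $$ w \<in> W" and y: "y \<in> n'" for W w y
  proof -
    have "cv.subspace {y \<in> g. A y $$ w \<in> W \<and> B y $$ w \<in> W}"
      by (rule irep_subspace[OF i W])
    moreover have "Y \<subseteq> {y \<in> g. A y $$ w \<in> W \<and> B y $$ w \<in> W}" using Y(2) n'_g that(2) by blast
    ultimately have "cv.span Y \<subseteq> {y \<in> g. A y $$ w \<in> W \<and> B y $$ w \<in> W}" by (intro cv.span_minimal)
    thus ?thesis using y Y(3) by blast
  qed
  have main: "\<exists>T. finite T \<and> (\<forall>s\<in>T. p $$ s = s) \<and> S \<subseteq> cv.span T \<and> ?st T"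
    if "finite S" "\<forall>s\<in>S. p $$ s = s" "S \<subseteq> wk eapp ?N k" for S k
    using that
  proof (induction k arbitrary: S)
    case 0
    hence "S \<subseteq> {0}" by simp
    thus ?case by (intro exI[of _ "{}"]) (simp add: eapp_linear)
  next
    case (Suc k)
    have "\<exists>T. finite T \<and> S \<subseteq> cv.span T \<and> (\<forall>s\<in>T. p $$ s = s) \<and> (\<forall>x\<in>{A e, B e}. \<forall>w\<in>cv.span T. x $$ w \<in> cv.span T)
        \<and> (\<forall>F. cv.subspace F --> (\<forall>x\<in>{A e, B e}. \<forall>w\<in>F. x $$ w \<in> F) --> S \<subseteq> F --> T \<subseteq> F)"
      by (rule comm_closure) (use Suc.prems irepD(2,4)[OF i e_g] e ee in auto)
    then obtain T1 where T1: "finite T1" "S \<subseteq> cv.span T1" "\<forall>s\<in>T1. p $$ s = s" "\<forall>x\<in>{A e, B e}. \<forall>w\<in>cv.span T1. x $$ w \<in> cv.span T1"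
      "\<And>F. cv.subspace F ==> (\<forall>x\<in>{A e, B e}. \<forall>w\<in>F. x $$ w \<in> F) ==> S \<subseteq> F ==> T1 \<subseteq> F" by blast
    have T1F: "T1 \<subseteq> wk eapp ?N (Suc k)"
      by (rule T1(5)[OF wk_subspace _ Suc.prems(3)]) (use irep_wk[OF i] clin_eapp in blast)+
    let ?R = "(\<lambda>(x, s). x $$ s) ` ((A ` Y \<union> B ` Y) \<times> T1)"
    have R: "finite ?R" "\<forall>s\<in>?R. p $$ s = s" "?R \<subseteq> wk eapp ?N k"
    proof -
      show "finite ?R" using Y(1) T1(1) by simp
      have "p * x = x" if "x \<in> A ` Y \<union> B ` Y" for x using that irepD(2,4)[OF i] Y(2) n'_g by auto
      from app_eq[OF this] show "\<forall>s\<in>?R. p $$ s = s" by auto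
      show "?R \<subseteq> wk eapp ?N k"
      proof
        fix u assume "u \<in> ?R"
        then obtain z where z: "u = (\<lambda>(x, s). x $$ s) z" "z \<in> (A ` Y \<union> B ` Y) \<times> T1" by (rule imageE)
        hence u: "fst z \<in> A ` Y \<union> B ` Y" "snd z \<in> T1" "u = fst z $$ snd z"
          by (simp_all only: mem_Times_iff case_prod_beta)
        have "fst z \<in> ?N" using u(1) Y(2) by blast
        moreover have "snd z \<in> wk eapp ?N (Suc k)" using T1F u(2) by blast
        ultimately show "u \<in> wk eapp ?N k" unfolding u(3) by (intro wk_lower)
      qed
    qed
    obtain T2 where T2: "finite T2" "\<forall>s\<in>T2. p $$ s = s" "?R \<subseteq> cv.span T2" "?st T2" using Suc.IH[OF R] by blast
    let ?T = "T1 \<union> T2"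
    have m: "cv.span T1 \<subseteq> cv.span ?T" "cv.span T2 \<subseteq> cv.span ?T" by (rule cv.span_mono; blast)+
    have "A e $$ w \<in> cv.span ?T \<and> B e $$ w \<in> cv.span ?T \<and> (\<forall>y\<in>n'. A y $$ w \<in> cv.span ?T \<and> B y $$ w \<in> cv.span ?T)"
      if w: "w \<in> cv.span ?T" for w
    proof (intro conjI ballI)
      have g: "x $$ w \<in> cv.span ?T" if "\<And>s. s \<in> T1 ==> x $$ s \<in> cv.span ?T" "\<And>s. s \<in> T2 ==> x $$ s \<in> cv.span ?T" for x
        by (rule endo_span[OF cv.subspace_span _ w]) (use that in blast)
      have b: "s \<in> cv.span T1" if "s \<in> T1" for s using that by (rule cv.span_base)
      have b2: "s \<in> cv.span T2" if "s \<in> T2" for s using that by (rule cv.span_base)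
      show "A e $$ w \<in> cv.span ?T" "B e $$ w \<in> cv.span ?T"
        by (rule g; use T1(4) T2(4) m b b2 in blast)+
      fix y assume y: "y \<in> n'"
      have "A y $$ s \<in> cv.span T2 \<and> B y $$ s \<in> cv.span T2" if s: "s \<in> T1" for s
      proof (rule lin[OF cv.subspace_span _ y])
        fix x assume "x \<in> A ` Y \<union> B ` Y"
        hence "x $$ s \<in> ?R" using s by (auto intro!: image_eqI[of _ _ "(x, s)"])
        thus "x $$ s \<in> cv.span T2" using T2(3) by blast
      qed
      thus "A y $$ w \<in> cv.span ?T" "B y $$ w \<in> cv.span ?T"
        by - (rule g; use T2(4) m b2 y in blast)+
    qed
    thus ?case using T1(1-3) T2(1,2) m by (intro exI[of _ ?T]) auto
  qed
  show ?thesis unfolding lfin_def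
  proof
    fix v
    obtain k where k: "p $$ v \<in> wk eapp ?N k" using n by blast
    have "\<exists>T. finite T \<and> (\<forall>s\<in>T. p $$ s = s) \<and> {p $$ v} \<subseteq> cv.span T \<and> ?st T"
      by (rule main[of _ k]) (use k app_eq[OF irepD(1)[OF i], of v] in auto)
    then obtain T where T: "finite T" "\<forall>s\<in>T. p $$ s = s" "p $$ v \<in> cv.span T" "?st T" by blast
    have one: "A z $$ w \<in> cv.span T \<and> B z $$ w \<in> cv.span T" if z: "z \<in> npos" and w: "w \<in> cv.span T" for z w
    proof -
      obtain c y where y: "z = c *. e + y" "y \<in> n'" using z unfolding npos_def by blast
      have yg: "y \<in> g" "c *. e \<in> g" using y n'_g cv.subspace_scale[OF g_subspace e_g] by auto
      have "A z $$ w = c *. (A e $$ w) + A y $$ w" "B z $$ w = c *. (B e $$ w) + B y $$ w"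
        unfolding y(1) irepD(6,7)[OF i yg(2,1)] irepD(8,9)[OF i e_g] by simp_all
      thus ?thesis using T(4) w y(2) by (simp add: cv.span_add cv.span_scale)
    qed
    have "\<forall>x\<in>{A x + B y | x y. x \<in> npos \<and> y \<in> npos}. \<forall>w\<in>cv.span T. x $$ w \<in> cv.span T"
    proof (intro ballI, elim CollectE exE conjE)
      fix u w x y assume "w \<in> cv.span T" "u = A x + B y" "x \<in> npos" "y \<in> npos"
      thus "u $$ w \<in> cv.span T" using one by (simp add: cv.span_add)
    qed
    with T(1-3) show "\<exists>T. finite T \<and> (\<forall>s\<in>T. p $$ s = s) \<and> p $$ v \<in> cv.span T
      \<and> (\<forall>x\<in>{A x + B y | x y. x \<in> npos \<and> y \<in> npos}. \<forall>w\<in>cv.span T. x $$ w \<in> cv.span T)" by blast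
  qed
qed

text \<open>The shifted operators B x - \<nu>(x) commute and are locally nilpotent, so
  \<open>comm_closure\<close> applies to a finite spanning set of \<open>h\<close>.\<close>

lemma lfin_h:
  assumes i: "irep p A B" and n: "\<And>x. x \<in> h ==> nilS p (B x - \<nu> x *. p)"
  shows "lfin p (B ` h)"
  unfolding lfin_def
proof
  fix v
  obtain Y where Y: "finite Y" "Y \<subseteq> h" "h \<subseteq> cv.span Y" by (rule mx_finite_span[OF h_subspace])
  have Yg: "y \<in> g" if "y \<in> Y" for y using that Y(2) h_g by blast
  let ?N = "(\<lambda>y. B y - \<nu> y *. p) ` Y"
  have c: "B x * B y = B y * B x" if "x \<in> Y" "y \<in> Y" for x y
    using irepD(12)[OF i Yg Yg, OF that] by (simp add: ad_eq_0)
  have "\<exists>T. finite T \<and> {p $$ v} \<subseteq> cv.span T \<and> (\<forall>s\<in>T. p $$ s = s) \<and> (\<forall>x\<in>?N. \<forall>w\<in>cv.span T. x $$ w \<in> cv.span T)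
     \<and> (\<forall>F. cv.subspace F --> (\<forall>x\<in>?N. \<forall>w\<in>F. x $$ w \<in> F) --> {p $$ v} \<subseteq> F --> T \<subseteq> F)"
  proof (rule comm_closure)
    show "p * x = x" if "x \<in> ?N" for x using that irepD(1,4)[OF i] Yg by (auto simp: right_diff_distrib)
    show "x * y = y * x" if "x \<in> ?N" "y \<in> ?N" for x y
      using that irepD(1,4,5)[OF i] Yg c by (auto simp: right_diff_distrib left_diff_distrib mult.commute cv.scale_right_diff_distrib cscale_cscale)
    show "nilS p x" if "x \<in> ?N" for x using that n Y(2) by auto
  qed (use Y(1) app_eq[OF irepD(1)[OF i], of v] in auto)
  then obtain T where T: "finite T" "p $$ v \<in> cv.span T" "\<forall>s\<in>T. p $$ s = s" "\<forall>x\<in>?N. \<forall>w\<in>cv.span T. x $$ w \<in> cv.span T" by blast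
  have "B x $$ w \<in> cv.span T" if x: "x \<in> h" and w: "w \<in> cv.span T" for x w
  proof -
    have "cv.subspace {y \<in> g. B y $$ w \<in> cv.span T}"
      using irepD[OF i] cv_sub[OF g_subspace]
      by (intro cv.subspaceI) (auto intro: cv.span_add cv.span_scale cv.span_zero)
    moreover have "Y \<subseteq> {y \<in> g. B y $$ w \<in> cv.span T}"
    proof
      fix y assume y: "y \<in> Y"
      have "(B y - \<nu> y *. p) $$ w \<in> cv.span T" using T(4) y w by blast
      hence "(B y - \<nu> y *. p) $$ w + \<nu> y *. w \<in> cv.span T" using w by (intro cv.span_add cv.span_scale)
      thus "y \<in> {y \<in> g. B y $$ w \<in> cv.span T}" using Yg[OF y] p_span[of T p w] T(3) w by simp
    qed
    ultimately have "cv.span Y \<subseteq> {y \<in> g. B y $$ w \<in> cv.span T}" by (intro cv.span_minimal)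
    thus ?thesis using x Y(3) by blast
  qed
  thus "\<exists>T. finite T \<and> (\<forall>s\<in>T. p $$ s = s) \<and> p $$ v \<in> cv.span T \<and> (\<forall>x\<in>B ` h. \<forall>w\<in>cv.span T. x $$ w \<in> cv.span T)"
    using T(1-3) by blast
qed

end

section \<open>The category of modules in terms of operators\<close>

context umod begin

lemma cspan_csubspace: assumes "S \<subseteq> carrier M" shows "csubspace L M (cspan L M S)"
proof -
  have c: "csubspace L M (carrier M)" by (auto simp: csubspace_def)
  show ?thesis unfolding csubspace_def[of L M "cspan L M S"]
  proof (intro conjI ballI allI)
    show "cspan L M S \<subseteq> carrier M" unfolding cspan_def using c assms by blast
  qed (auto simp: cspan_def csubspace_def)
qed

lemma cspan_base: "s \<in> S ==> s \<in> cspan L M S" by (auto simp: cspan_def)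

lemma cspan_minimal: "csubspace L M V ==> S \<subseteq> V ==> cspan L M S \<subseteq> V" by (auto simp: cspan_def)

lemma csubspace_vimage: assumes "csubspace L M V" shows "cv.subspace {v. \<pi> v \<in> V}"
  by (rule cv.subspaceI) (use assms in \<open>auto simp: csubspace_def \<pi>_linear \<pi>_zero\<close>)

lemma subspace_csubspace: assumes "cv.subspace W" shows "csubspace L M {m \<in> carrier M. \<sigma> m \<in> W}"
  unfolding csubspace_def
  by (auto simp: \<sigma>_zero emb(4,5) cv_sub[OF assms])

lemma cspan_iff: assumes S: "S \<subseteq> carrier M" and m: "m \<in> carrier M"
  shows "m \<in> cspan L M S \<longleftrightarrow> \<sigma> m \<in> cv.span (\<sigma> ` S)"
proof
  assume "m \<in> cspan L M S"
  moreover have "S \<subseteq> {m \<in> carrier M. \<sigma> m \<in> cv.span (\<sigma> ` S)}" using S by (auto intro: cv.span_base)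
  ultimately show "\<sigma> m \<in> cv.span (\<sigma> ` S)"
    using cspan_minimal[OF subspace_csubspace[OF cv.subspace_span]] by blast
next
  have "cv.span (\<sigma> ` S) \<subseteq> {v. \<pi> v \<in> cspan L M S}"
    by (rule cv.span_minimal[OF _ csubspace_vimage[OF cspan_csubspace[OF S]]]) (use S cspan_base in \<open>auto simp: emb(1)\<close>)
  moreover assume "\<sigma> m \<in> cv.span (\<sigma> ` S)"
  ultimately have "\<pi> (\<sigma> m) \<in> cspan L M S" by blast
  thus "m \<in> cspan L M S" by (simp add: emb(1)[OF m])
qed

lemma submodule_iff: "submodule N (U L) M \<longleftrightarrow> csubspace L M N \<and> (\<forall>x\<in>lset L. \<forall>m\<in>N. ac x m \<in> N)"
proof
  assume N: "submodule N (U L) M"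
  have "subgroup N (add_monoid M)" using N by (simp add: submodule_def)
  hence "N \<subseteq> carrier M" "\<zero>\<^bsub>M\<^esub> \<in> N" "\<And>v w. v \<in> N ==> w \<in> N ==> v \<oplus>\<^bsub>M\<^esub> w \<in> N"
    by (auto simp: subgroup_def)
  moreover have "\<kappa> q \<odot>\<^bsub>M\<^esub> m \<in> N" if "q \<in> carrier T" "m \<in> N" for q m
    by (rule submodule.smult_closed[OF N cls_closed that(2)]) (rule that(1))
  ultimately show "csubspace L M N \<and> (\<forall>x\<in>lset L. \<forall>m\<in>N. ac x m \<in> N)"
    by (auto simp: csubspace_def scal_cls act_cls)
next
  assume N: "csubspace L M N \<and> (\<forall>x\<in>lset L. \<forall>m\<in>N. ac x m \<in> N)"
  hence n: "N \<subseteq> carrier M" "\<zero>\<^bsub>M\<^esub> \<in> N" "\<And>v w. v \<in> N ==> w \<in> N ==> v \<oplus>\<^bsub>M\<^esub> w \<in> N" "\<And>c v. v \<in> N ==> sc c v \<in> N" "\<And>x v. x \<in> lset L ==> v \<in> N ==> ac x v \<in> N"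
    by (auto simp: csubspace_def)
  have c: "m \<in> carrier M" if "m \<in> N" for m using that n(1) by blast
  have "\<kappa> q \<odot>\<^bsub>M\<^esub> m \<in> N" if "q \<in> carrier T" "m \<in> N" for q m using that
  proof (induction arbitrary: m rule: free_algebra_induct)
    case (single d u)
    thus ?case
    proof (induction u arbitrary: m)
      case Nil
      thus ?case using n(4) by (simp add: scal_cls)
    next
      case (Cons x u)
      have e: "fsingle d (x # u) = fsingle 1 [x] \<otimes>\<^bsub>T\<^esub> fsingle d u" by (simp add: fsingle_mult)
      have "\<kappa> (fsingle d (x # u)) \<odot>\<^bsub>M\<^esub> m = ac x (\<kappa> (fsingle d u) \<odot>\<^bsub>M\<^esub> m)"
        unfolding e act_cls using Cons.prems c by (simp add: cls_smult_mult)
      thus ?case using Cons n(5) by simp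
    qed
  next
    case (add a b)
    thus ?case using n(3) c by (simp add: cls_smult_add)
  qed
  moreover have "subgroup N (add_monoid M)"
  proof (rule group.subgroupI[OF abelian_group.a_group[OF M.M.abelian_group_axioms]])
    show "inv\<^bsub>add_monoid M\<^esub> a \<in> N" if "a \<in> N" for a
      using scal_minus[OF c[OF that]] n(4)[OF that] by (simp flip: a_inv_def)
  qed (use n in auto)
  ultimately show "submodule N (U L) M"
    by (auto simp: submodule_def submodule_axioms_def U_carrier)
qed

lemma finitely_generated_iff:
  "finitely_generated (U L) M \<longleftrightarrow> (\<exists>S. finite S \<and> (\<forall>s\<in>S. p $$ s = s) \<and> (\<forall>W. cv.subspace W --> S \<subseteq> W --> (\<forall>w\<in>W. p $$ w = w) -->
      (\<forall>x\<in>lset L. \<forall>w\<in>W. X x $$ w \<in> W) --> (\<forall>v. p $$ v \<in> W)))" (is "_ \<longleftrightarrow> ?r")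
proof
  assume "finitely_generated (U L) M"
  then obtain S where S: "finite S" "S \<subseteq> carrier M" "\<And>N. submodule N (U L) M ==> S \<subseteq> N ==> N = carrier M"
    unfolding finitely_generated_def by blast
  have "p $$ v \<in> W" if W: "cv.subspace W" "\<sigma> ` S \<subseteq> W" "\<forall>x\<in>lset L. \<forall>w\<in>W. X x $$ w \<in> W" for W v
  proof -
    have "{m \<in> carrier M. \<sigma> m \<in> W} = carrier M"
    proof (rule S(3))
      show "submodule {m \<in> carrier M. \<sigma> m \<in> W} (U L) M" unfolding submodule_iff
        using subspace_csubspace[OF W(1)] W(3) by (auto simp flip: X_\<sigma>)
      show "S \<subseteq> {m \<in> carrier M. \<sigma> m \<in> W}" using W(2) S(2) by blast
    qed
    hence "\<sigma> (\<pi> v) \<in> W" using emb(2) by blast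
    thus ?thesis by (simp add: emb(3))
  qed
  thus ?r using S(1,2) by (intro exI[of _ "\<sigma> ` S"]) (auto simp: p_\<sigma>)
next
  assume ?r
  then obtain S where S: "finite S" "\<forall>s\<in>S. p $$ s = s" "\<And>W. cv.subspace W ==> S \<subseteq> W ==> \<forall>w\<in>W. p $$ w = w ==>
      \<forall>x\<in>lset L. \<forall>w\<in>W. X x $$ w \<in> W ==> \<forall>v. p $$ v \<in> W" by blast
  have "N = carrier M" if N: "submodule N (U L) M" "\<pi> ` S \<subseteq> N" for N
  proof -
    have n: "csubspace L M N" "\<And>x m. x \<in> lset L ==> m \<in> N ==> ac x m \<in> N" using N(1) unfolding submodule_iff by auto
    have nc: "N \<subseteq> carrier M" using n(1) by (simp add: csubspace_def)
    let ?W = "{v. p $$ v = v} \<inter> {v. \<pi> v \<in> N}"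
    have "cv.subspace {v. p $$ v = v}" by (rule cv.subspaceI) (auto simp: eapp_linear)
    hence "cv.subspace ?W" using csubspace_vimage[OF n(1)] by (rule cv.subspace_inter)
    moreover have "S \<subseteq> ?W" using S(2) N(2) by blast
    moreover have "\<forall>w\<in>?W. p $$ w = w" by blast
    moreover have "\<forall>x\<in>lset L. \<forall>w\<in>?W. X x $$ w \<in> ?W"
      using n(2) by (auto simp: X_app p_\<sigma> emb(1,2))
    ultimately have "\<forall>v. p $$ v \<in> ?W" by (rule S(3))
    hence "\<pi> (p $$ \<sigma> m) \<in> N" for m by blast
    thus ?thesis using nc by (auto simp: \<pi>_p emb(1)) (metis emb(1))
  qed
  moreover have "\<pi> ` S \<subseteq> carrier M" using emb(2) by blast
  ultimately show "finitely_generated (U L) M" unfolding finitely_generated_def using S(1) by blast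
qed

lemma locally_finite_iff:
  assumes a: "a \<subseteq> lset L" shows "locally_finite_on L M a \<longleftrightarrow> lfin p (X ` a)"
proof
  assume l: "locally_finite_on L M a"
  show "lfin p (X ` a)" unfolding lfin_def
  proof
    fix v
    obtain V S where V: "csubspace L M V" "\<pi> v \<in> V" "finite S" "S \<subseteq> V" "V = cspan L M S" "\<forall>x\<in>a. \<forall>w\<in>V. ac x w \<in> V"
      using l emb(2)[of v] unfolding locally_finite_on_def by blast
    have Vc: "V \<subseteq> carrier M" using V(1) by (simp add: csubspace_def)
    have S: "S \<subseteq> carrier M" using V(4) Vc by blast
    have ps: "\<forall>s\<in>\<sigma> ` S. p $$ s = s" using S by (auto simp: p_\<sigma>)
    have iff: "\<sigma> m \<in> cv.span (\<sigma> ` S) \<longleftrightarrow> m \<in> V" if "m \<in> carrier M" for m unfolding V(5) cspan_iff[OF S that] ..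
    have "p $$ v \<in> cv.span (\<sigma> ` S)" using V(2) by (simp add: iff emb(2) flip: emb(3))
    moreover have "y $$ w \<in> cv.span (\<sigma> ` S)" if y: "y \<in> X ` a" and w: "w \<in> cv.span (\<sigma> ` S)" for y w
    proof -
      obtain x where x: "y = X x" "x \<in> a" using y by blast
      have "\<sigma> (\<pi> w) = w" unfolding emb(3) by (rule p_span[OF _ w]) (use ps in blast)
      hence "\<pi> w \<in> V" using w iff[OF emb(2), of w] by simp
      hence "ac x (\<pi> w) \<in> V" using V(6) x(2) by blast
      hence "\<sigma> (ac x (\<pi> w)) \<in> cv.span (\<sigma> ` S)" using Vc iff by blast
      thus ?thesis using x a by (simp add: X_app subsetD)
    qed
    ultimately show "\<exists>T. finite T \<and> (\<forall>s\<in>T. p $$ s = s) \<and> p $$ v \<in> cv.span T \<and> (\<forall>x\<in>X ` a. \<forall>w\<in>cv.span T. x $$ w \<in> cv.span T)"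
      using ps V(3) by (intro exI[of _ "\<sigma> ` S"]) auto
  qed
next
  assume l: "lfin p (X ` a)"
  show "locally_finite_on L M a" unfolding locally_finite_on_def
  proof
    fix m assume m: "m \<in> carrier M"
    obtain T where T: "finite T" "\<forall>s\<in>T. p $$ s = s" "p $$ \<sigma> m \<in> cv.span T" "\<forall>x\<in>X ` a. \<forall>w\<in>cv.span T. x $$ w \<in> cv.span T"
      using spec[OF l[unfolded lfin_def], of "\<sigma> m"] by (elim exE conjE) (rule that)
    have S: "\<pi> ` T \<subseteq> carrier M" using emb(2) by blast
    have "\<sigma> ` \<pi> ` T = T" using T(2) by (force simp: emb(3) image_image)
    hence iff: "k \<in> cspan L M (\<pi> ` T) \<longleftrightarrow> \<sigma> k \<in> cv.span T" if "k \<in> carrier M" for k using cspan_iff[OF S that] by simp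
    have cs: "csubspace L M (cspan L M (\<pi> ` T))" by (rule cspan_csubspace[OF S])
    have "ac x w \<in> cspan L M (\<pi> ` T)" if x: "x \<in> a" and w: "w \<in> cspan L M (\<pi> ` T)" for x w
    proof -
      have wc: "w \<in> carrier M" using cs w by (auto simp: csubspace_def)
      have xl: "x \<in> lset L" using x a by blast
      have "X x $$ \<sigma> w \<in> cv.span T" using T(4) x w iff[OF wc] by blast
      thus ?thesis using iff[OF act_closed[OF xl wc]] by (simp add: X_\<sigma> xl wc)
    qed
    moreover have "m \<in> cspan L M (\<pi> ` T)" using T(3) iff[OF m] by (simp add: p_\<sigma> m)
    moreover have "\<pi> ` T \<subseteq> cspan L M (\<pi> ` T)" using cspan_base by blast
    ultimately show "\<exists>V. csubspace L M V \<and> m \<in> V \<and> (\<exists>S. finite S \<and> S \<subseteq> V \<and> V = cspan L M S) \<and> (\<forall>x\<in>a. \<forall>w\<in>V. ac x w \<in> V)"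
      using cs T(1) by (intro exI[of _ "cspan L M (\<pi> ` T)"]) blast
  qed
qed

end

locale takiff_mod = takiff_setup gc hc n' \<alpha> e f \<rho> + umod "takiff gc" M
  for gc hc :: "'n::finite cmat set" and n' \<alpha> e f \<rho> and M :: "('n, 'b) takiff_module"
begin

abbreviation "hh \<equiv> mxs hc"

lemma ball_hh: "(\<forall>t\<in>hc. P (mx_of t) t) \<longleftrightarrow> (\<forall>x\<in>hh. P x (mat_of x))"
proof (intro iffI ballI)
  fix x assume "\<forall>t\<in>hc. P (mx_of t) t" "x \<in> hh"
  hence "P (mx_of (mat_of x)) (mat_of x)" by blast
  thus "P x (mat_of x)" by (simp add: mat_of_inverse)
next
  fix t assume a: "\<forall>x\<in>hh. P x (mat_of x)" and "t \<in> hc"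
  hence "mx_of t \<in> hh" by simp
  from bspec[OF a this] have "P (mx_of t) (mat_of (mx_of t))" .
  thus "P (mx_of t) t" by simp
qed

lemma A_\<sigma>: "a \<in> gg ==> m \<in> carrier M ==> AX X a $$ \<sigma> m = \<sigma> (ac (mat_of a, 0) m)"
  and B_\<sigma>: "a \<in> gg ==> m \<in> carrier M ==> BX X a $$ \<sigma> m = \<sigma> (ac (0, mat_of a) m)"
  unfolding AX_def BX_def by (rule X_\<sigma>; simp add: takiff_simps gc_closed(4))+

lemma irepX: "irep p (AX X) (BX X)" by (rule lrep_irep[OF p_idem lrep_X])

lemma X_pair: "a \<in> gg ==> b \<in> gg ==> X (mat_of a, mat_of b) = AX X a + BX X b"
  using XAB_X[OF lrep_X, of "(mat_of a, mat_of b)"] by (simp add: takiff_simps XAB_def mat_of_inverse)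

lemma nil_iff: assumes t: "t \<in> hc"
  shows "(\<forall>v\<in>carrier M. \<exists>k. ((\<lambda>w. ac (0, t) w \<ominus>\<^bsub>M\<^esub> sc c w) ^^ k) v = \<zero>\<^bsub>M\<^esub>) \<longleftrightarrow> nilS p (BX X (mx_of t) - c *. p)"
proof -
  let ?f = "\<lambda>w. ac (0, t) w \<ominus>\<^bsub>M\<^esub> sc c w" and ?Y = "BX X (mx_of t) - c *. p"
  have tg: "mx_of t \<in> gg" using subsetD[OF h_g, of "mx_of t"] t by simp
  have tl: "(0, t) \<in> lset (takiff gc)" using tg gc_closed(4) by (simp add: takiff_simps)
  have m: "\<sigma> (u \<ominus>\<^bsub>M\<^esub> w) = \<sigma> u - \<sigma> w" if "u \<in> carrier M" "w \<in> carrier M" for u w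
    using that by (simp add: a_minus_def scal_minus emb(4,5))
  have k: "(?f ^^ k) v \<in> carrier M \<and> \<sigma> ((?f ^^ k) v) = (?Y ^ k) $$ \<sigma> v" if v: "v \<in> carrier M" for k v
  proof (induction k)
    case (Suc k)
    hence u: "(?f ^^ k) v \<in> carrier M" by simp
    have "\<sigma> ((?f ^^ Suc k) v) = ?Y $$ \<sigma> ((?f ^^ k) v)"
      using B_\<sigma>[OF tg u] by (simp add: m u tl emb(5) p_\<sigma>)
    thus ?case using Suc u tl by simp
  qed (simp add: v)
  have z: "(?f ^^ k) v = \<zero>\<^bsub>M\<^esub> \<longleftrightarrow> (?Y ^ k) $$ \<sigma> v = 0" if "v \<in> carrier M" for k v
    using k[OF that, of k] \<sigma>_zero \<sigma>_inj[of "(?f ^^ k) v" "\<zero>\<^bsub>M\<^esub>"] by auto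
  show ?thesis
  proof
    assume "\<forall>v\<in>carrier M. \<exists>k. (?f ^^ k) v = \<zero>\<^bsub>M\<^esub>"
    hence "\<exists>k. (?Y ^ k) $$ \<sigma> (\<pi> v) = 0" for v using z[OF emb(2)] emb(2) by blast
    thus "nilS p ?Y" by (simp add: nilS_def emb(3))
  next
    assume "nilS p ?Y"
    show "\<forall>v\<in>carrier M. \<exists>k. (?f ^^ k) v = \<zero>\<^bsub>M\<^esub>"
    proof
      fix v assume v: "v \<in> carrier M"
      obtain k where "(?Y ^ k) $$ p $$ \<sigma> v = 0" using \<open>nilS p ?Y\<close> unfolding nilS_def by blast
      hence "(?f ^^ k) v = \<zero>\<^bsub>M\<^esub>" unfolding z[OF v] p_\<sigma>[OF v] .
      thus "\<exists>k. (?f ^^ k) v = \<zero>\<^bsub>M\<^esub>" by (rule exI)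
    qed
  qed
qed

lemma weights_iff: "cspan (takiff gc) M (\<Union>\<nu>\<in>dual hc. weight_space gc hc M \<nu>) = carrier M \<longleftrightarrow> (\<forall>v. p $$ v \<in> wspan p (AX X))"
proof -
  let ?S = "\<Union>\<nu>\<in>dual hc. weight_space gc hc M \<nu>" and ?V = "{v. p $$ v = v \<and> (\<exists>l. \<forall>x\<in>hh. AX X x $$ v = l x *. v)}"
  have hg: "mx_of t \<in> gg" if "t \<in> hc" for t using subsetD[OF h_g, of "mx_of t"] that by simp
  have tl: "(t, 0) \<in> lset (takiff gc)" if "t \<in> hc" for t using hg[OF that] gc_closed(4) by (simp add: takiff_simps)
  have S: "?S \<subseteq> carrier M" by (auto simp: weight_space_def)
  have ws: "m \<in> weight_space gc hc M \<nu> \<longleftrightarrow> m \<in> carrier M \<and> (\<forall>x\<in>hh. AX X x $$ \<sigma> m = \<nu> (mat_of x) *. \<sigma> m)" for m \<nu>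
  proof -
    have "ac (t, 0) m = sc (\<nu> t) m \<longleftrightarrow> AX X (mx_of t) $$ \<sigma> m = \<nu> t *. \<sigma> m" if m: "m \<in> carrier M" and t: "t \<in> hc" for t
    proof -
      have A: "AX X (mx_of t) $$ \<sigma> m = \<sigma> (ac (t, 0) m)" using A_\<sigma>[OF hg[OF t] m] by simp
      have "ac (t, 0) m = sc (\<nu> t) m \<longleftrightarrow> \<sigma> (ac (t, 0) m) = \<sigma> (sc (\<nu> t) m)"
        by (rule iffI, simp, rule \<sigma>_inj[OF act_closed[OF tl[OF t] m] scal_closed[OF m]])
      thus ?thesis unfolding A emb(5)[OF m] .
    qed
    moreover
    have "(\<forall>t\<in>hc. AX X (mx_of t) $$ \<sigma> m = \<nu> t *. \<sigma> m) \<longleftrightarrow> (\<forall>x\<in>hh. AX X x $$ \<sigma> m = \<nu> (mat_of x) *. \<sigma> m)"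
      by (rule ball_hh)
    ultimately show ?thesis unfolding weight_space_def mem_Collect_eq by (simp cong: conj_cong)
  qed
  have "cv.span (\<sigma> ` ?S) = wspan p (AX X)"
  proof (rule antisym)
    have "\<sigma> ` ?S \<subseteq> ?V"
    proof
      fix v assume "v \<in> \<sigma> ` ?S"
      then obtain m \<nu> where m: "v = \<sigma> m" "m \<in> weight_space gc hc M \<nu>" by blast
      hence "p $$ v = v" "\<forall>x\<in>hh. AX X x $$ v = \<nu> (mat_of x) *. v" unfolding ws by (simp_all add: p_\<sigma>)
      thus "v \<in> ?V"
        by (intro CollectI conjI exI[of _ "\<lambda>x. \<nu> (mat_of x)"])
    qed
    thus "cv.span (\<sigma> ` ?S) \<subseteq> wspan p (AX X)" unfolding wspan_def by (rule cv.span_mono)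
    have "?V \<subseteq> cv.span (\<sigma> ` ?S)"
    proof
      fix v assume "v \<in> ?V"
      then obtain l where v: "p $$ v = v" "\<And>x. x \<in> hh ==> AX X x $$ v = l x *. v" by blast
      show "v \<in> cv.span (\<sigma> ` ?S)"
      proof (cases "v = 0")
        case False
        \<comment> \<open>The eigenvalue function of a nonzero joint eigenvector is automatically
          linear on \<open>h\<close>; restricting it yields the representative required by
          \<open>dual\<close>.\<close>
        define \<nu> where "\<nu> = restrict (\<lambda>t. l (mx_of t)) hc"
        have sp: "\<sigma> (\<pi> v) = v" using v(1) by (simp add: emb(3))
        have lin: "l (x + y) = l x + l y" "l (c *. x) = c * l x" if "x \<in> hh" "y \<in> hh" for x y c
        proof -
          have g: "x \<in> gg" "y \<in> gg" using that h_g by blast+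
          have "x + y \<in> hh" "c *. x \<in> hh" using that cv.subspace_add[OF h_subspace] cv.subspace_scale[OF h_subspace] by blast+
          from v(2)[OF this(1)] v(2)[OF this(2)] v(2)[OF that(1)] v(2)[OF that(2)]
          have "(l (x + y) - (l x + l y)) *. v = 0" "(l (c *. x) - c * l x) *. v = 0"
            using irepD(6)[OF irepX g] irepD(8)[OF irepX g(1), of c] by (auto simp: cscale_simps)
          thus "l (x + y) = l x + l y" "l (c *. x) = c * l x" using False by simp_all
        qed
        have hm: "mx_of t \<in> hh" if "t \<in> hc" for t using that by simp
        have "x + y \<in> hc" "mscale c x \<in> hc" if "x \<in> hc" "y \<in> hc" for x y c
          using cv.subspace_add[OF h_subspace hm[OF that(1)] hm[OF that(2)]] cv.subspace_scale[OF h_subspace hm[OF that(1)], of c]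
          by (simp_all add: mscale_eq_cscale)
        hence "\<nu> \<in> dual hc" unfolding dual_def \<nu>_def using lin[OF hm hm] by (auto simp: mx_of_simps)
        moreover have "\<pi> v \<in> weight_space gc hc M \<nu>" unfolding ws sp using v(2) emb(2) by (simp add: \<nu>_def mat_of_inverse)
        ultimately have "\<pi> v \<in> ?S" by blast
        hence "\<sigma> (\<pi> v) \<in> cv.span (\<sigma> ` ?S)" by (intro cv.span_base imageI)
        thus ?thesis by (simp only: sp)
      qed (simp add: cv.span_zero)
    qed
    thus "wspan p (AX X) \<subseteq> cv.span (\<sigma> ` ?S)" unfolding wspan_def by (rule cv.span_minimal[OF _ cv.subspace_span])
  qed
  hence iff: "m \<in> cspan (takiff gc) M ?S \<longleftrightarrow> \<sigma> m \<in> wspan p (AX X)" if "m \<in> carrier M" for m using cspan_iff[OF S that] by simp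
  have sub: "cspan (takiff gc) M ?S \<subseteq> carrier M" using cspan_csubspace[OF S] by (simp add: csubspace_def)
  show ?thesis
  proof
    assume "cspan (takiff gc) M ?S = carrier M"
    thus "\<forall>v. p $$ v \<in> wspan p (AX X)" using iff emb(2) by (simp flip: emb(3))
  next
    assume a: "\<forall>v. p $$ v \<in> wspan p (AX X)"
    have "m \<in> cspan (takiff gc) M ?S" if "m \<in> carrier M" for m using a[rule_format, of "\<sigma> m"] iff[OF that] p_\<sigma>[OF that] by simp
    thus "cspan (takiff gc) M ?S = carrier M" using sub by blast
  qed
qed

text \<open>Local finiteness over the nilradical becomes nilpotency by \<open>lfin_nil\<close> and
  \<open>nil_lfin\<close>. For h \<otimes> \<epsilon> it follows from the generalised eigenvalue
  condition by \<open>lfin_h\<close>.\<close>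

theorem in_O_mu_iff:
  assumes n: "nilradical gc hc \<Delta> = mat_of ` npos"
  shows "in_O_mu gc hc \<Delta> \<mu> M \<longleftrightarrow> Q (\<lambda>x. \<mu> (mat_of x)) p X"
proof -
  let ?A = "AX X" and ?B = "BX X"
  have fg: "finitely_generated (U (takiff gc)) M \<longleftrightarrow> fgen p ?A ?B"
  proof -
    have "(\<forall>x\<in>lset (takiff gc). \<forall>w\<in>W. X x $$ w \<in> W) \<longleftrightarrow> (\<forall>a\<in>gg. \<forall>w\<in>W. ?A a $$ w \<in> W \<and> ?B a $$ w \<in> W)" if W: "cv.subspace W" for W
    proof
      assume a: "\<forall>x\<in>lset (takiff gc). \<forall>w\<in>W. X x $$ w \<in> W"
      show "\<forall>a\<in>gg. \<forall>w\<in>W. ?A a $$ w \<in> W \<and> ?B a $$ w \<in> W"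
        using a gc_closed(4) by (simp add: AX_def BX_def takiff_simps)
    next
      assume a: "\<forall>a\<in>gg. \<forall>w\<in>W. ?A a $$ w \<in> W \<and> ?B a $$ w \<in> W"
      show "\<forall>x\<in>lset (takiff gc). \<forall>w\<in>W. X x $$ w \<in> W"
      proof (intro ballI)
        fix x w assume x: "x \<in> lset (takiff gc)" and w: "w \<in> W"
        obtain a b where ab: "x = (mat_of a, mat_of b)" "a \<in> gg" "b \<in> gg"
        proof (cases x)
          case (Pair c d)
          thus ?thesis using x by (intro that[of "mx_of c" "mx_of d"]) (simp_all add: takiff_simps)
        qed
        show "X x $$ w \<in> W" unfolding ab(1) X_pair[OF ab(2,3)] using a ab(2,3) w by (simp add: cv.subspace_add[OF W])
      qed
    qed
    thus ?thesis unfolding finitely_generated_iff fgen_def by (simp cong: imp_cong)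
  qed
  have ng: "mat_of ` npos \<times> mat_of ` npos \<subseteq> lset (takiff gc)" using npos_g by (auto simp: takiff_simps)
  have n_im: "X ` (mat_of ` npos \<times> mat_of ` npos) = {?A x + ?B y | x y. x \<in> npos \<and> y \<in> npos}"
  proof -
    have "X ` (mat_of ` npos \<times> mat_of ` npos) = {X (mat_of x, mat_of y) | x y. x \<in> npos \<and> y \<in> npos}" by blast
    moreover have "X (mat_of x, mat_of y) = ?A x + ?B y" if "x \<in> npos" "y \<in> npos" for x y
      using X_pair that npos_g by blast
    hence "{X (mat_of x, mat_of y) | x y. x \<in> npos \<and> y \<in> npos} = {?A x + ?B y | x y. x \<in> npos \<and> y \<in> npos}"
      by (intro Collect_cong ex_cong1) auto
    ultimately show ?thesis by simp
  qed
  have hl: "{0} \<times> hc \<subseteq> lset (takiff gc)"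
  proof -
    have "t \<in> gc" if "t \<in> hc" for t using subsetD[OF h_g, of "mx_of t"] that by simp
    thus ?thesis using gc_closed(4) by (auto simp: takiff_simps)
  qed
  have h_im: "X ` ({0} \<times> hc) = ?B ` hh"
  proof -
    have "A \<in> mat_of ` hh" if "A \<in> hc" for A using that by (intro image_eqI[of _ _ "mx_of A"]) simp_all
    hence "hc = mat_of ` hh" by blast
    hence "X ` ({0} \<times> hc) = X ` ({0} \<times> mat_of ` hh)" by simp
    thus ?thesis by (auto simp: BX_def)
  qed
  have nil: "(\<forall>t\<in>hc. \<forall>v\<in>carrier M. \<exists>k. ((\<lambda>w. ac (0, t) w \<ominus>\<^bsub>M\<^esub> sc (\<mu> t) w) ^^ k) v = \<zero>\<^bsub>M\<^esub>)
      \<longleftrightarrow> (\<forall>x\<in>hh. nilS p (?B x - \<mu> (mat_of x) *. p))"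
  proof -
    from ball_hh[of "\<lambda>x t. nilS p (?B x - \<mu> t *. p)"] show ?thesis using nil_iff by simp
  qed
  note lf = locally_finite_iff[OF ng, unfolded n_im] locally_finite_iff[OF hl, unfolded h_im]
  have lm: "left_module (U (takiff gc)) M" by (rule M.left_module_axioms)
  show ?thesis
  proof
    assume "in_O_mu gc hc \<Delta> \<mu> M"
    hence o: "fgen p ?A ?B" "\<And>v. p $$ v \<in> wspan p ?A" "lfin p {?A x + ?B y | x y. x \<in> npos \<and> y \<in> npos}"
      "\<And>x. x \<in> hh ==> nilS p (?B x - \<mu> (mat_of x) *. p)"
      unfolding in_O_mu_def in_O_def n fg weights_iff lf nil by simp_all
    show "Q (\<lambda>x. \<mu> (mat_of x)) p X" unfolding Q_def objO_def base_def
      using irepX o(1,2,4) lfin_nil[OF irepX o(2,3)] by simp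
  next
    assume "Q (\<lambda>x. \<mu> (mat_of x)) p X"
    hence o: "fgen p ?A ?B" "\<And>v. p $$ v \<in> wspan p ?A" "\<And>v. \<exists>k. p $$ v \<in> wk eapp (?A ` n' \<union> ?B ` n') k"
      "nilS p (?A e)" "nilS p (?B e)" "\<And>x. x \<in> hh ==> nilS p (?B x - \<mu> (mat_of x) *. p)"
      unfolding Q_def objO_def base_def by simp_all
    show "in_O_mu gc hc \<Delta> \<mu> M"
      unfolding in_O_mu_def in_O_def n fg weights_iff lf nil
      using lm o nil_lfin[OF irepX o(3-5)] lfin_h[OF irepX o(6)] by simp
  qed
qed

end

lemma (in takiff_setup) cat_O_mu_mcat:
  fixes \<mu> :: "'n cmat => complex"
  assumes "nilradical gc hc \<Delta> = mat_of ` npos"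
  shows "(cat_O_mu gc hc \<Delta> \<mu> :: (('n, 'b) takiff_module, 'b => 'b) category) = mcat L (Q (\<lambda>x. \<mu> (mat_of x)))"
proof -
  have "in_O_mu gc hc \<Delta> \<mu> M \<longleftrightarrow> left_module (U L) M \<and> Q (\<lambda>x. \<mu> (mat_of x)) (mproj L M) (xrep L M)" for M :: "('n, 'b) takiff_module"
  proof (cases "left_module (U L) M")
    case True
    interpret umod L M by (rule umodI[OF True])
    interpret takiff_mod gc hc n' \<alpha> e f \<rho> M ..
    show ?thesis using in_O_mu_iff[OF assms] True by simp
  qed (simp add: in_O_mu_def in_O_def)
  thus ?thesis by (simp add: cat_O_mu_def mcat_def)
qed

theorem theorem1p2:
  fixes G g h :: "'n::finite cmat set"
    and \<Delta> :: "('n cmat \<Rightarrow> complex) set"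
    and \<alpha> \<mu> :: "'n cmat \<Rightarrow> complex"
    and e\<^sub>\<alpha> f\<^sub>\<alpha> h\<^sub>\<alpha> :: "'n cmat"
  assumes "reductive_group G"
    and "connectedin zariski G"
    and "g = lie_algebra_of G"
    and "maximal_toral h g"
    and "simple_system g h \<Delta>"
    and "\<alpha> \<in> \<Delta>"
    and "e\<^sub>\<alpha> \<in> root_space g h \<alpha>"
    and "f\<^sub>\<alpha> \<in> root_space g h (\<lambda>t. - \<alpha> t)"
    and "h\<^sub>\<alpha> = mbracket e\<^sub>\<alpha> f\<^sub>\<alpha>"
    and "h\<^sub>\<alpha> \<in> h"
    and "\<alpha> h\<^sub>\<alpha> = 2"
    and "\<mu> \<in> dual h"
    and "\<mu> h\<^sub>\<alpha> \<noteq> 0"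
  shows "equivalent_categories
           (cat_O_mu g h \<Delta> \<mu> :: (('n, 'b) takiff_module, 'b \<Rightarrow> 'b) category)
           (cat_O_mu g h \<Delta> (reflection h \<alpha> h\<^sub>\<alpha> \<mu>) :: (('n, 'b) takiff_module, 'b \<Rightarrow> 'b) category)"
proof -
  let ?e = "mx_of e\<^sub>\<alpha>" and ?f = "mx_of f\<^sub>\<alpha>"
  have "\<exists>n' \<rho>. root_setup (mxs g) (mxs h) n' (\<lambda>x. \<alpha> (mat_of x)) ?e ?f \<rho>
    \<and> nilradical g h \<Delta> = mat_of ` {c *. ?e + y | c y. y \<in> n'}"
    by (rule root_setup_exists[OF assms(1,3-8)]) (use assms(9-11) in simp_all)
  then obtain n' \<rho> where r: "root_setup (mxs g) (mxs h) n' (\<lambda>x. \<alpha> (mat_of x)) ?e ?f \<rho>"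
    "nilradical g h \<Delta> = mat_of ` {c *. ?e + y | c y. y \<in> n'}" by blast
  interpret S: takiff_setup g h n' "\<lambda>x. \<alpha> (mat_of x)" ?e ?f \<rho> using r(1) by (rule takiff_setup.intro)
  have H: "mat_of (ad ?e ?f) = h\<^sub>\<alpha>" unfolding assms(9) mx_of_simps(4)[symmetric] by simp
  let ?\<mu>' = "reflection h \<alpha> h\<^sub>\<alpha> \<mu>"
  have d: "\<beta> (x - c *. h\<^sub>\<alpha>) = \<beta> x - c * \<beta> h\<^sub>\<alpha> \<and> x - c *. h\<^sub>\<alpha> \<in> h" if b: "\<beta> \<in> dual h" and x: "x \<in> h" for \<beta> x c
  proof -
    have 1: "mscale (- c) h\<^sub>\<alpha> \<in> h"
      using cv.subspace_scale[OF S.h_subspace S.H_h, of "- c"] by (simp add: H mscale_eq_cscale)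
    have "x - c *. h\<^sub>\<alpha> \<in> h"
      using cv.subspace_diff[OF S.h_subspace _ cv.subspace_scale[OF S.h_subspace S.H_h, of c], of "mx_of x"] x by (simp add: H)
    moreover have "\<beta> (x + mscale (- c) h\<^sub>\<alpha>) = \<beta> x + (- c) * \<beta> h\<^sub>\<alpha>" using b x 1 assms(10) by (simp add: dual_def)
    ultimately show ?thesis by (simp add: mscale_eq_cscale)
  qed
  have \<alpha>: "\<alpha> \<in> dual h" using assms(5,6) by (auto simp: simple_system_def roots_def)
  have "equivalent_categories (mcat S.L (S.Q (\<lambda>x. \<mu> (mat_of x)) :: 'b endo => _)) (mcat S.L (S.Q (\<lambda>x. ?\<mu>' (mat_of x)) :: 'b endo => _))"
  proof (rule S.equivalent_mcat_Q)
    \<comment> \<open>At the coroot the reflected functional takes the value -\<mu>(h_\<alpha>),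
      again nonzero, so both directions of the twist are available.\<close>
    show "\<mu> (mat_of (ad ?e ?f)) \<noteq> 0" "?\<mu>' (mat_of (ad ?e ?f)) \<noteq> 0"
      using assms(10,11,13) by (simp_all add: H reflection_def)
    fix x assume "x \<in> mxs h"
    hence x: "mat_of x \<in> h" by simp
    have m: "mat_of (x - \<alpha> (mat_of x) *. ad ?e ?f) = mat_of x - \<alpha> (mat_of x) *. h\<^sub>\<alpha>" by (simp add: H)
    show "?\<mu>' (mat_of x) = \<mu> (mat_of (x - \<alpha> (mat_of x) *. ad ?e ?f))"
      unfolding m using d[OF assms(12) x] x by (simp add: reflection_def mult.commute)
    show "\<mu> (mat_of x) = ?\<mu>' (mat_of (x - \<alpha> (mat_of x) *. ad ?e ?f))"
    proof -
      let ?y = "mat_of x - \<alpha> (mat_of x) *. h\<^sub>\<alpha>"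
      have "\<alpha> ?y = - \<alpha> (mat_of x)" "\<mu> ?y = \<mu> (mat_of x) - \<alpha> (mat_of x) * \<mu> h\<^sub>\<alpha>" "?y \<in> h"
        using d[OF assms(12) x, of "\<alpha> (mat_of x)"] d[OF \<alpha> x, of "\<alpha> (mat_of x)"] by (simp_all add: assms(11))
      thus ?thesis unfolding m by (simp add: reflection_def)
    qed
  qed
  thus ?thesis unfolding S.cat_O_mu_mcat[OF r(2)[folded S.npos_def]] .
qed

end
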